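(* Let $m>n\ge 1$ be integers, let $\Sigma$ be an $m\times m$ real positive definite matrix, and let $W\sim\mathcal{W}_m(n,\Sigma)$ be a singular real Wishart matrix. Then for $x>0$ the distribution function of the largest eigenvalue $\ell_1$ of $W$ is $$\Pr(\ell_1<x)=\frac{\Gamma_n\{(n+1)/2\}\left(\frac{x}{2}\right)^{nm/2}}{\Gamma_n\{(n+m+1)/2\}\,|\Sigma|^{n/2}}\;{}_1F_1^{(m,n)}\left(\frac m2;\frac{n+m+1}{2};-\frac12x\Sigma^{-1},I_n\right).$$
   Context: $W\sim\mathcal{W}_m(n,\Sigma)$ means $W=XX^\top$ where $X$ is an $m\times n$ real random matrix whose $n$ columns are i.i.d. $\mathcal{N}_m(0,\Sigma)$. $|\cdot|$ is the determinant. The multivariate gamma function is $\Gamma_n(c)=\pi^{n(n-1)/4}\prod_{i=1}^n\Gamma\left(c-\frac{i-1}{2}\right)$ for $\mathrm{Re}(c)>(n-1)/2$. Zonal polynomials: for a partition $\kappa$ of $k$ and a symmetric $m\times m$ matrix $X$ with eigenvalues $x_1,\dots,x_m$, $C_\kappa(X)$ is the homogeneous symmetric polynomial of degree $k$ in $x_1,\dots,x_m$ determined by: (i) its lexicographically leading monomial is $x_1^{\kappa_1}\cdots x_m^{\kappa_m}$ up to a constant; (ii) it is an eigenfunction of $\sum_i x_i^2\partial_i^2+\sum_{i\ne j}\frac{x_i^2}{x_i-x_j}\partial_i$; (iii) $\sum_{\kappa}C_\kappa(X)=(\operatorname{tr}X)^k$, the sum being over partitions of $k$ with at most $m$ parts.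 $P^k_n$ is the set of partitions of $k$ with at most $n$ nonzero parts; $(\alpha)_\kappa=\prod_i(\alpha-(i-1)/2)_{\kappa_i}$ with $(\alpha)_k=\alpha(\alpha+1)\cdots(\alpha+k-1)$, $(\alpha)_0=1$. For an $m\times m$ symmetric $A$ and an $n\times n$ symmetric $B$, $${}_1F_1^{(m,n)}(a;c;A,B)=\sum_{k=0}^\infty\sum_{\kappa\in P^k_n}\frac{(a)_\kappa}{(c)_\kappa}\frac{C_\kappa(A)C_\kappa(B)}{k!\,C_\kappa(I_m)}.$$
   Formalization: Conditions (i)–(iii) do not determine C_κ: (4,1,1) and (3,3) share an eigenvalue, so multiples of C_(3,3) can be added to C_(4,1,1). It is also required that every monomial of C_κ be dominated by κ in partial sums, which gives the standard zonal polynomials. *)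

theory Defs
  imports "HOL-Probability.Probability" "HOL-Library.Poly_Mapping"
begin

section \<open>Wishart matrices\<close>

definition positive_definite :: "real ^ 'm ^ 'm \<Rightarrow> bool" where
  "positive_definite A \<longleftrightarrow> transpose A = A \<and> (\<forall>v. v \<noteq> 0 \<longrightarrow> v \<bullet> (A *v v) > 0)"

definition mvn_density :: "real ^ 'm \<Rightarrow> real ^ 'm ^ 'm \<Rightarrow> real ^ 'm \<Rightarrow> real" where
  "mvn_density \<mu> \<Sigma> v =
     exp (- ((v - \<mu>) \<bullet> (matrix_inv \<Sigma> *v (v - \<mu>))) / 2) / sqrt ((2 * pi) ^ CARD('m) * det \<Sigma>)"

text \<open>
  The number of degrees of freedom is the cardinality of the index type \<open>'n\<close> of the columns
  of \<open>X\<close>, which does not occur in the type of \<open>W\<close> and is therefore passed explicitly.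
\<close>

definition wishart ::
    "'a measure \<Rightarrow> 'n::finite itself \<Rightarrow> real ^ 'm ^ 'm \<Rightarrow> ('a \<Rightarrow> real ^ 'm ^ 'm) \<Rightarrow> bool" where
  "wishart M (_ :: 'n itself) \<Sigma> W \<longleftrightarrow>
     (\<exists>X :: 'a \<Rightarrow> real ^ 'n ^ 'm.
        prob_space.indep_vars M (\<lambda>_. borel) (\<lambda>j \<omega>. column j (X \<omega>)) UNIV \<and>
        (\<forall>j. distributed M lborel (\<lambda>\<omega>. column j (X \<omega>)) (\<lambda>v. ennreal (mvn_density 0 \<Sigma> v))) \<and>
        (\<forall>\<omega>\<in>space M. W \<omega> = X \<omega> ** transpose (X \<omega>)))"

definition largest_eigenvalue :: "real ^ 'm ^ 'm \<Rightarrow> real" where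
  "largest_eigenvalue A = Max {l. \<exists>v. v \<noteq> 0 \<and> A *v v = l *\<^sub>R v}"

text \<open>
  The eigenvalues with multiplicity, in decreasing order; well defined if all complex
  eigenvalues of \<open>A\<close> are real, in particular for symmetric \<open>A\<close>.
\<close>

definition eigenvalues :: "real ^ 'm ^ 'm \<Rightarrow> real list" where
  "eigenvalues A = (THE xs. sorted_wrt (\<ge>) xs \<and> length xs = CARD('m) \<and>
     (\<forall>t. det (mat t - A) = (\<Prod>x\<leftarrow>xs. t - x)))"


section \<open>Zonal polynomials\<close>

text \<open>
  Partitions and exponents of monomials are finitely supported functions; the \<open>i\<close>-th part
  (counted from \<open>1\<close>) of a partition \<open>\<kappa>\<close> is \<open>lookup \<kappa> (i - 1)\<close>, and the variables
  \<open>x\<^sub>1, \<dots>, x\<^sub>m\<close> have the indices \<open>0, \<dots>, m - 1\<close>.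
\<close>

type_synonym monomial = "nat \<Rightarrow>\<^sub>0 nat"
type_synonym mpolynomial = "monomial \<Rightarrow>\<^sub>0 real"

abbreviation "lookup \<equiv> Poly_Mapping.lookup"
abbreviation "keys \<equiv> Poly_Mapping.keys"

definition partitions :: "nat \<Rightarrow> nat \<Rightarrow> monomial set" where
  "partitions n k =
     {\<kappa>. antimono (lookup \<kappa>) \<and> card (keys \<kappa>) \<le> n \<and> (\<Sum>i\<in>keys \<kappa>. lookup \<kappa> i) = k}"

definition eval_poly :: "mpolynomial \<Rightarrow> (nat \<Rightarrow> real) \<Rightarrow> real" where
  "eval_poly p x = (\<Sum>\<alpha>\<in>keys p. lookup p \<alpha> * (\<Prod>i\<in>keys \<alpha>. x i ^ lookup \<alpha> i))"

definition homogeneous_symmetric :: "nat \<Rightarrow> nat \<Rightarrow> mpolynomial \<Rightarrow> bool" where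
  "homogeneous_symmetric m k p \<longleftrightarrow>
     (\<forall>\<alpha>\<in>keys p. keys \<alpha> \<subseteq> {..<m} \<and> (\<Sum>i\<in>keys \<alpha>. lookup \<alpha> i) = k) \<and>
     (\<forall>\<pi> x. \<pi> permutes {..<m} \<longrightarrow> eval_poly p (x \<circ> \<pi>) = eval_poly p x)"

definition zonal_operator :: "nat \<Rightarrow> ((nat \<Rightarrow> real) \<Rightarrow> real) \<Rightarrow> (nat \<Rightarrow> real) \<Rightarrow> real" where
  "zonal_operator m f x =
     (\<Sum>i<m. (x i)\<^sup>2 * (deriv ^^ 2) (\<lambda>t. f (x(i := t))) (x i)) +
     (\<Sum>i<m. \<Sum>j\<in>{..<m} - {i}. (x i)\<^sup>2 / (x i - x j) * deriv (\<lambda>t. f (x(i := t))) (x i))"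

text \<open>
  The order on monomials is the lexicographic one: it is the \<open>linorder\<close> instance of
  \<open>poly_mapping\<close>, for which the lowest index is the most significant.

  Having a lexicographic leading monomial \<open>\<kappa>\<close> and being an eigenfunction of the operator do not
  determine a polynomial up to a constant, since eigenvalues can coincide for different
  partitions (\<open>(4,1,1)\<close> and \<open>(3,3)\<close> give the same eigenvalue), and the normalisation of the sum
  does not remove this freedom either. The zonal polynomials are the eigenfunctions in which
  every monomial is dominated by \<open>\<kappa>\<close>, which is the condition on partial sums.
\<close>

definition zonal_shape :: "nat \<Rightarrow> monomial \<Rightarrow> mpolynomial \<Rightarrow> bool" where
  "zonal_shape m \<kappa> p \<longleftrightarrow>
     \<kappa> \<in> keys p \<and> (\<forall>\<alpha>\<in>keys p. \<alpha> \<le> \<kappa>) \<and>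
     (\<forall>\<alpha>\<in>keys p. \<forall>r. (\<Sum>i<r. lookup \<alpha> i) \<le> (\<Sum>i<r. lookup \<kappa> i)) \<and>
     (\<exists>\<rho>. \<forall>x. inj_on x {..<m} \<longrightarrow> zonal_operator m (eval_poly p) x = \<rho> * eval_poly p x)"

definition zonal_family :: "nat \<Rightarrow> (monomial \<Rightarrow> mpolynomial) \<Rightarrow> bool" where
  "zonal_family m C \<longleftrightarrow>
     (\<forall>k. \<forall>\<kappa>\<in>partitions m k. homogeneous_symmetric m k (C \<kappa>) \<and> zonal_shape m \<kappa> (C \<kappa>)) \<and>
     (\<forall>k x. (\<Sum>\<kappa>\<in>partitions m k. eval_poly (C \<kappa>) x) = (\<Sum>i<m. x i) ^ k)"

definition zonal_poly :: "nat \<Rightarrow> monomial \<Rightarrow> mpolynomial" where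
  "zonal_poly m \<kappa> = (THE p. \<exists>C. zonal_family m C \<and> p = C \<kappa>)"

definition zonal :: "monomial \<Rightarrow> real ^ 'm ^ 'm \<Rightarrow> real" where
  "zonal \<kappa> A = eval_poly (zonal_poly CARD('m) \<kappa>) (\<lambda>i. eigenvalues A ! i)"


section \<open>Multivariate gamma and hypergeometric functions\<close>

definition multivariate_Gamma :: "nat \<Rightarrow> 'a::Gamma \<Rightarrow> 'a" where
  "multivariate_Gamma n c =
     of_real (pi powr (real n * (real n - 1) / 4)) * (\<Prod>i=1..n. Gamma (c - (of_nat i - 1) / 2))"

text \<open>The index \<open>i\<close> starts at \<open>0\<close> here, and vanishing parts contribute the factor \<open>1\<close>.\<close>

definition gen_pochhammer :: "real \<Rightarrow> monomial \<Rightarrow> real" where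
  "gen_pochhammer a \<kappa> = (\<Prod>i\<in>keys \<kappa>. pochhammer (a - real i / 2) (lookup \<kappa> i))"

definition hypergeom_1F1 ::
    "real \<Rightarrow> real \<Rightarrow> real ^ 'm ^ 'm \<Rightarrow> real ^ 'n ^ 'n \<Rightarrow> real" where
  "hypergeom_1F1 a c A B =
     suminf (\<lambda>k. \<Sum>\<kappa>\<in>partitions CARD('n) k.
        gen_pochhammer a \<kappa> / gen_pochhammer c \<kappa> *
        (zonal \<kappa> A * zonal \<kappa> B / (fact k * zonal \<kappa> (mat 1 :: real ^ 'm ^ 'm))))"

end

theory Submission
  imports Defs
begin

text \<open>
  For a partition \<open>\<kappa>\<close> let \<open>\<Delta>\<^sub>\<kappa>(Z)\<close> be the product of the leading principal minors of \<open>Z\<close>, the \<open>r\<close>-th one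
  raised to the power \<open>\<kappa>\<^sub>r - \<kappa>\<^sub>r\<^sub>+\<^sub>1\<close>. Its mean over \<open>Y C Y\<^sup>T\<close> with Gaussian \<open>Y\<close> is an orthogonally invariant
  polynomial in \<open>C\<close> with monomials dominated by \<open>\<kappa>\<close>, and since \<open>\<Delta>\<^sub>\<kappa>(T Z T\<^sup>T) = \<Delta>\<^sub>\<kappa>(T T\<^sup>T) \<Delta>\<^sub>\<kappa>(Z)\<close> for lower
  triangular \<open>T\<close>, it obeys a mean value formula for orthogonally invariant laws. Hence the kernel
  \<open>E tr(A Y B Y\<^sup>T)\<^sup>k\<close> is diagonal in these polynomials. Infinitesimal rotations of \<open>Y\<close> compute the differential
  operator on the kernel, so they are eigenfunctions, and dominance identifies them with the zonal
  polynomials up to constants.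

  The event \<open>\<ell>\<^sub>1 < x\<close> says that \<open>Z = X\<^sup>T / \<surd>x\<close> is a strict contraction. Expanding the Gaussian density of \<open>Z\<close>
  into powers of \<open>tr(Z A Z\<^sup>T)\<close>, and these into zonal polynomials, the mean value formula leaves the integrals of
  \<open>\<Delta>\<^sub>\<kappa>(Z Z\<^sup>T)\<close> over the contractions. There the rows of \<open>Z\<close> are integrated out from the last to the first by
  the substitution \<open>z\<^sub>r = (I - \<Sum>\<^sub>i\<^sub><\<^sub>r z\<^sub>i z\<^sub>i\<^sup>T)\<^sup>1\<^sup>/\<^sup>2 u\<close>, which produces one beta integral per row.
\<close>

section \<open>Symmetric matrices\<close>

text \<open>The definition singles out zonal polynomials only as members of a whole family, so
  existence and uniqueness of that family must be proved; uniqueness rests on the eigenvalues being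
  strictly monotone in the dominance order. Gaussian matrices take the place of the invariant
  measure on the orthogonal group: their invariance suffices for the averages, and the averaged
  functions are polynomials in the entries. The price is a constant \<open>gam\<close> for each
  partition, the coefficient of the average in the power of the trace, which must be nonzero because
  the eigenvalue equation is obtained by dividing by it. The two matrix sizes enter through the
  two-sided invariance of the contractions: the left one is used with \<open>n\<close> variables and
  yields the value at \<open>I_n\<close>, the right one with \<open>m\<close> variables and yields
  the quotient of the values at the argument and at \<open>I_m\<close>. Row \<open>i\<close>,
  counted from 0, comes with the determinant to the power \<open>(n - 1 - i) / 2\<close> and with
  its distance to the span of the earlier rows, of codimension \<open>m - i\<close>; this is the
  origin of the shifts by \<open>i / 2\<close> in the gamma functions and factorials.\<close>

lemma inner_matrix_vector: "x \<bullet> (A *v y) = (transpose A *v x) \<bullet> y" for A :: "real ^ 'n ^ 'm"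
  by (metis dot_lmul_matrix transpose_matrix_vector)

text \<open>The quadratic form attains its maximum \<open>l\<close> on the unit sphere of the
  invariant subspace, and a maximizer is an eigenvector because the first variation vanishes
  there.\<close>

lemma symmetric_eigenvector_exists:
  fixes A :: "real ^ 'm ^ 'm"
  assumes sym: "transpose A = A" and S: "subspace S" and inv: "\<And>v. v \<in> S \<Longrightarrow> A *v v \<in> S"
    and ne: "\<exists>v\<in>S. v \<noteq> 0"
  obtains v l where "v \<in> S" "norm v = 1" "A *v v = l *\<^sub>R v"
proof -
  let ?K = "S \<inter> sphere 0 1" and ?q = "\<lambda>v. v \<bullet> (A *v v)"
  have K: "compact ?K"
    using closed_subspace[OF S] by (simp add: closed_Int_compact)
  have N: "?K \<noteq> {}"
  proof -
    obtain v where v: "v \<in> S" "v \<noteq> 0" using ne by auto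
    then have "(1 / norm v) *\<^sub>R v \<in> ?K" using S by (auto simp: subspace_scale)
    then show ?thesis by auto
  qed
  have Q: "continuous_on ?K ?q"
  proof -
    have "continuous_on ?K ((*v) A)" by (rule linear_continuous_on) (rule matrix_vector_mul_bounded_linear)
    then show ?thesis by (rule continuous_on_inner[OF continuous_on_id])
  qed
  from continuous_attains_sup[OF K N Q]
  obtain v where v: "v \<in> ?K" and vmax: "\<And>w. w \<in> ?K \<Longrightarrow> ?q w \<le> ?q v" by blast
  define l where "l = ?q v"
  have nv: "norm v = 1" "v \<in> S" using v by auto
  have le: "?q w \<le> l * (w \<bullet> w)" if "w \<in> S" for w
  proof (cases "w = 0")
    case False
    have "(1 / norm w) *\<^sub>R w \<in> ?K" using that False S by (auto simp: subspace_scale)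
    from vmax[OF this] have "?q w / (norm w)\<^sup>2 \<le> l"
      by (simp add: matrix_vector_mult_scaleR l_def power2_eq_square field_simps)
    then show ?thesis using False by (simp add: field_simps power2_norm_eq_inner)
  qed simp
  \<comment> \<open>The form \<open>l * (w \<bullet> w) - w \<bullet> (A *v w)\<close> is
    nonnegative on \<open>S\<close> and vanishes at \<open>v\<close>. Along the line from
    \<open>v\<close> in direction \<open>u\<close> its linear coefficient is
    \<open>2 * (u \<bullet> u)\<close>, so it would become negative for small negative
    \<open>t\<close> unless \<open>u = 0\<close>.\<close>
  define u where "u = l *\<^sub>R v - A *v v"
  have uS: "u \<in> S" using inv nv S by (simp add: u_def subspace_diff subspace_scale)
  have Bsym: "w \<bullet> (A *v v) = v \<bullet> (A *v w)" for w
    by (metis sym inner_matrix_vector inner_commute)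
  have quad: "0 \<le> 2 * t * (u \<bullet> u) + t\<^sup>2 * (l * (u \<bullet> u) - ?q u)" for t
  proof -
    have "v + t *\<^sub>R u \<in> S" using nv uS S by (simp add: subspace_add subspace_scale)
    from le[OF this] have "0 \<le> l * ((v + t *\<^sub>R u) \<bullet> (v + t *\<^sub>R u)) - ?q (v + t *\<^sub>R u)" by simp
    also have "\<dots> = (l * (v \<bullet> v) - ?q v) + 2 * t * (l * (u \<bullet> v) - u \<bullet> (A *v v)) + t\<^sup>2 * (l * (u \<bullet> u) - ?q u)"
      using Bsym[of u] by (simp add: matrix_vector_right_distrib matrix_vector_mult_scaleR inner_add_left inner_add_right
          algebra_simps power2_eq_square inner_commute)
    also have "l * (v \<bullet> v) - ?q v = 0" using nv by (simp add: l_def norm_eq_1)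
    also have "l * (u \<bullet> v) - u \<bullet> (A *v v) = u \<bullet> u" by (simp add: u_def inner_diff_right)
    finally show ?thesis by simp
  qed
  have "u \<bullet> u = 0"
  proof (rule ccontr)
    define a where "a = u \<bullet> u"
    define c where "c = l * (u \<bullet> u) - ?q u"
    assume "u \<bullet> u \<noteq> 0"
    then have a: "a > 0" by (simp add: a_def)
    have c: "c \<ge> 0" using le[OF uS] by (simp add: c_def)
    \<comment> \<open>Adding \<open>1\<close> keeps the denominator positive also when
      \<open>c = 0\<close>.\<close>
    define t where "t = - a / (c + 1)"
    have "0 \<le> 2 * t * a + t\<^sup>2 * c" using quad[of t] by (simp add: a_def c_def)
    also have "t\<^sup>2 * c \<le> t\<^sup>2 * (c + 1)" by (simp add: mult_left_mono)
    also have "2 * t * a + t\<^sup>2 * (c + 1) = - a\<^sup>2 / (c + 1)"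
    proof -
      have "t * (c + 1) = - a" using c by (simp add: t_def)
      then have "t\<^sup>2 * (c + 1) = - a * t" by (simp add: power2_eq_square mult.assoc)
      then show ?thesis by (simp add: t_def power2_eq_square)
    qed
    also have "\<dots> < 0" using a c by (simp add: divide_neg_pos)
    finally show False by simp
  qed
  then have "A *v v = l *\<^sub>R v" by (simp add: u_def)
  with nv show ?thesis using that by blast
qed

lemma exists_orthogonal_vector:
  fixes u :: "'i \<Rightarrow> real ^ 'm"
  assumes "finite I" "card I < CARD('m)"
  shows "\<exists>x. x \<noteq> 0 \<and> (\<forall>i\<in>I. u i \<bullet> x = 0)"
proof -
  have "dim (u ` I) \<le> card (u ` I)" by (rule dim_le_card') (use assms in auto)
  also have "\<dots> \<le> card I" by (rule card_image_le[OF assms(1)])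
  finally have "dim (u ` I) < DIM(real ^ 'm)" using assms by simp
  from orthogonal_to_subspace_exists[OF this]
  obtain x where "x \<noteq> 0" "\<And>y. y \<in> span (u ` I) \<Longrightarrow> orthogonal x y" by blast
  then have "u i \<bullet> x = 0" if "i \<in> I" for i
    using that by (metis imageI inner_commute orthogonal_def span_base)
  with \<open>x \<noteq> 0\<close> show ?thesis by blast
qed

definition diagm :: "('m \<Rightarrow> real) \<Rightarrow> real ^ 'm ^ 'm" where
  "diagm d = (\<chi> i j. if i = j then d i else 0)"

lemma diagm_mult_vec: "(diagm d *v x) $ i = d i * x $ i"
proof -
  have "(diagm d *v x) $ i = (\<Sum>j\<in>UNIV. if j = i then d i * x $ j else 0)"
    unfolding matrix_vector_mult_def diagm_def vec_lambda_beta by (rule sum.cong) auto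
  then show ?thesis by simp
qed

lemma mat_eq_diagm: "mat c = diagm (\<lambda>_. c)"
  by (simp add: mat_def diagm_def)

lemma diagm_mult_left: "(diagm d ** A) $ i $ j = d i * A $ i $ j"
proof -
  have "(diagm d ** A) $ i $ j = (\<Sum>k\<in>UNIV. if k = i then d i * A $ k $ j else 0)"
    unfolding matrix_matrix_mult_def diagm_def vec_lambda_beta by (rule sum.cong) auto
  then show ?thesis by simp
qed

lemma diagm_mult_right: "(A ** diagm d) $ i $ j = A $ i $ j * d j"
proof -
  have "(A ** diagm d) $ i $ j = (\<Sum>k\<in>UNIV. if k = j then A $ i $ k * d k else 0)"
    unfolding matrix_matrix_mult_def diagm_def vec_lambda_beta by (rule sum.cong) auto
  then show ?thesis by simp
qed

lemma diagm_mult: "diagm c ** diagm d = diagm (\<lambda>i. c i * d i)"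
  by (auto simp: vec_eq_iff diagm_mult_left) (auto simp: diagm_def)

lemma transpose_diagm [simp]: "transpose (diagm d) = diagm d"
  by (auto simp: diagm_def transpose_def vec_eq_iff)

lemma det_diagm: "det (diagm d) = (\<Prod>i\<in>UNIV. d i)"
  by (subst det_diagonal) (auto simp: diagm_def)

lemma trace_diagm: "trace (diagm d) = (\<Sum>i\<in>UNIV. d i)"
  by (simp add: trace_def diagm_def)

lemma quadratic_form_diagm: "x \<bullet> (diagm d *v x) = (\<Sum>i\<in>UNIV. d i * (x $ i)\<^sup>2)"
  by (simp add: inner_vec_def diagm_mult_vec power2_eq_square mult_ac)

text \<open>Eigenvectors are collected one index at a time: the orthogonal complement of those
  already found is invariant under the symmetric \<open>A\<close> and nontrivial as long as an index
  is left. Inducting over subsets of the index type gives rows of \<open>U\<close> that are labelled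
  by that type.\<close>

theorem symmetric_diagonalization:
  fixes A :: "real ^ 'm ^ 'm"
  assumes sym: "transpose A = A"
  obtains U d where "orthogonal_matrix U" "A = transpose U ** diagm d ** U"
proof -
  have "\<exists>(u :: 'm \<Rightarrow> real ^ 'm) d. (\<forall>i\<in>I. \<forall>j\<in>I. u i \<bullet> u j = (if i = j then 1 else 0)) \<and> (\<forall>i\<in>I. A *v u i = d i *\<^sub>R u i)"
    if "finite I" for I :: "'m set"
    using that
  proof (induction I rule: finite_induct)
    case (insert k I)
    then obtain u d where u: "\<And>i j. i \<in> I \<Longrightarrow> j \<in> I \<Longrightarrow> u i \<bullet> u j = (if i = j then 1 else 0)"
      and d: "\<And>i. i \<in> I \<Longrightarrow> A *v u i = d i *\<^sub>R u i" by blast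
    define S where "S = {v. \<forall>i\<in>I. u i \<bullet> v = 0}"
    have "card (insert k I) \<le> CARD('m)" by (rule card_mono) auto
    then have "card I < CARD('m)" using insert by simp
    then have ne: "\<exists>v\<in>S. v \<noteq> 0"
      using exists_orthogonal_vector[of I u] insert(1) by (auto simp: S_def)
    have S: "subspace S" by (auto simp: S_def subspace_def inner_add_right)
    have inv: "A *v v \<in> S" if "v \<in> S" for v
      using that d by (auto simp: S_def inner_matrix_vector sym)
    obtain v l where v: "v \<in> S" "norm v = 1" "A *v v = l *\<^sub>R v"
      using symmetric_eigenvector_exists[OF sym S inv ne] by blast
    have "(u(k:=v)) i \<bullet> (u(k:=v)) j = (if i = j then 1 else 0)"
      if "i \<in> insert k I" "j \<in> insert k I" for i j
      using that v u insert(2) by (auto simp: S_def norm_eq_1 inner_commute)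
    moreover have "A *v (u(k:=v)) i = (d(k:=l)) i *\<^sub>R (u(k:=v)) i" if "i \<in> insert k I" for i
      using that v d insert(2) by auto
    ultimately show ?case by blast
  qed auto
  from this[of UNIV] obtain u :: "'m \<Rightarrow> real ^ 'm" and d where u: "\<And>i j. u i \<bullet> u j = (if i = j then 1 else 0)"
    and d: "\<And>i. A *v u i = d i *\<^sub>R u i" by auto
  define U :: "real ^ 'm ^ 'm" where "U = (\<chi> i. u i)"
  have row: "row i U = u i" for i by (simp add: U_def row_def vec_eq_iff)
  have U: "orthogonal_matrix U"
    unfolding orthogonal_matrix_orthonormal_rows by (auto simp: row u norm_eq_1 orthogonal_def)
  have "A ** transpose U = transpose U ** diagm d"
  proof (intro vec_eq_iff[THEN iffD2] allI)
    fix i j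
    have "(A ** transpose U) $ i $ j = (A *v u j) $ i"
      by (simp add: matrix_matrix_mult_def matrix_vector_mult_def U_def transpose_def)
    also have "\<dots> = (transpose U ** diagm d) $ i $ j"
      by (simp add: d diagm_mult_right) (simp add: U_def transpose_def)
    finally show "(A ** transpose U) $ i $ j = (transpose U ** diagm d) $ i $ j" .
  qed
  then have "A = transpose U ** diagm d ** U"
    using U by (metis orthogonal_matrix_def matrix_mul_assoc matrix_mul_rid)
  with U show ?thesis using that by blast
qed

section \<open>Diagonalization of semidefinite and definite matrices\<close>

definition psd :: "real ^ 'm ^ 'm \<Rightarrow> bool" where
  "psd A \<longleftrightarrow> transpose A = A \<and> (\<forall>v. v \<bullet> (A *v v) \<ge> 0)"

lemma quadratic_form_conj: "v \<bullet> ((transpose U ** A ** U) *v v) = (U *v v) \<bullet> (A *v (U *v v))"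
  for A :: "real ^ 'm ^ 'm"
proof -
  have "(transpose U ** A ** U) *v v = transpose U *v (A *v (U *v v))"
    by (simp only: matrix_vector_mul_assoc matrix_mul_assoc)
  then have "v \<bullet> ((transpose U ** A ** U) *v v) = v \<bullet> (transpose U *v (A *v (U *v v)))" by (rule arg_cong)
  also have "\<dots> = (transpose (transpose U) *v v) \<bullet> (A *v (U *v v))" by (rule inner_matrix_vector)
  finally show ?thesis by (subst (asm) transpose_transpose)
qed

lemma orthogonal_matrix_ex_vec:
  fixes U :: "real ^ 'm ^ 'm"
  assumes "orthogonal_matrix U"
  shows "U *v (transpose U *v x) = x" "transpose U *v (U *v x) = x"
  using assms by (simp_all only: orthogonal_matrix_def matrix_vector_mul_assoc matrix_vector_mul_lid)

text \<open>Each \<open>d i\<close> is the value of the quadratic form of \<open>A\<close> at a unit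
  vector, so sign conditions on \<open>A\<close> pass to the diagonal.\<close>

lemma diagonal_entry_eq:
  fixes A :: "real ^ 'm ^ 'm"
  assumes "orthogonal_matrix U" "A = transpose U ** diagm d ** U"
  shows "row i U \<bullet> (A *v row i U) = d i" "norm (row i U) = 1"
proof -
  have n: "norm (row i U) = 1" for i using assms(1) orthogonal_matrix_orthonormal_rows by blast
  then show "norm (row i U) = 1" .
  have "row i U = transpose U *v axis i 1"
    by (simp add: vec_eq_iff row_def matrix_vector_mult_def transpose_def axis_def if_distrib cong: if_cong)
  then have "U *v row i U = axis i 1" using orthogonal_matrix_ex_vec(1)[OF assms(1)] by simp
  then show "row i U \<bullet> (A *v row i U) = d i"
    unfolding assms(2) quadratic_form_conj quadratic_form_diagm
    by (simp add: axis_def if_distrib[of "\<lambda>x. x^2"] if_distrib[of "\<lambda>x. _ * x"] cong: if_cong)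
qed

lemma psd_diagonalization:
  fixes A :: "real ^ 'm ^ 'm"
  assumes "psd A"
  obtains U d where "orthogonal_matrix U" "A = transpose U ** diagm d ** U" "\<And>i. d i \<ge> 0"
proof -
  obtain U d where U: "orthogonal_matrix U" "A = transpose U ** diagm d ** U"
    using symmetric_diagonalization assms psd_def by blast
  have "d i \<ge> 0" for i
    unfolding diagonal_entry_eq(1)[OF U, symmetric] using assms unfolding psd_def by blast
  then show ?thesis using U that by blast
qed

lemma positive_definite_diagonalization:
  fixes A :: "real ^ 'm ^ 'm"
  assumes "positive_definite A"
  obtains U d where "orthogonal_matrix U" "A = transpose U ** diagm d ** U" "\<And>i. d i > 0"
proof -
  obtain U d where U: "orthogonal_matrix U" "A = transpose U ** diagm d ** U"
    using symmetric_diagonalization assms positive_definite_def by blast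
  have "d i > 0" for i
  proof -
    have "row i U \<noteq> 0" using diagonal_entry_eq(2)[OF U] by (metis norm_zero zero_neq_one)
    then have "row i U \<bullet> (A *v row i U) > 0" using assms unfolding positive_definite_def by blast
    then show ?thesis unfolding diagonal_entry_eq(1)[OF U] .
  qed
  then show ?thesis using U that by blast
qed

lemma psd_diagm: "psd (diagm d)" if "\<And>i. d i \<ge> 0"
  unfolding psd_def quadratic_form_diagm using that by (auto intro!: sum_nonneg)

section \<open>Ordering the index type\<close>

text \<open>Leading minors, triangular matrices and the numbered variables need an order on the
  index type, which is merely finite. Any fixed enumeration serves, because the functions that are
  compared in the end are symmetric in the eigenvalues.\<close>

definition ix :: "nat \<Rightarrow> 'm::finite" where "ix = from_nat_into UNIV"
definition rk :: "'m::finite \<Rightarrow> nat" where "rk = to_nat_on UNIV"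

lemma ix_rk [simp]: "ix (rk a) = a"
  unfolding ix_def rk_def by (rule from_nat_into_to_nat_on) auto

lemma rk_less [simp]: "rk (a :: 'm::finite) < CARD('m)"
  using to_nat_on_finite[of "UNIV :: 'm set"] by (auto simp: rk_def bij_betw_def)

lemma rk_ix [simp]:
  assumes "i < CARD('m)"
  shows "rk (ix i :: 'm::finite) = i"
proof -
  have "i \<in> rk ` (UNIV :: 'm set)"
    using to_nat_on_finite[of "UNIV :: 'm set"] assms by (simp add: rk_def bij_betw_def)
  then obtain a :: 'm where "i = rk a" by blast
  then show ?thesis by simp
qed

lemma rk_inj [simp]: "rk a = rk b \<longleftrightarrow> a = b"
  by (metis ix_rk)

lemma bij_ix: "bij_betw (ix :: nat \<Rightarrow> 'm::finite) {..<CARD('m)} UNIV"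
  by (rule bij_betwI[where g = rk]) auto

lemma sum_ix: "(\<Sum>i\<in>(UNIV::'m::finite set). f i) = (\<Sum>l<CARD('m). f (ix l))"
  by (rule sum.reindex_bij_betw[OF bij_ix, symmetric])

lemma prod_ix: "(\<Prod>i\<in>(UNIV::'m::finite set). f i) = (\<Prod>l<CARD('m). f (ix l))"
  by (rule prod.reindex_bij_betw[OF bij_ix, symmetric])

definition seg :: "nat \<Rightarrow> 'm::finite set" where "seg r = {a. rk a < r}"

lemma seg_0 [simp]: "seg 0 = {}" and seg_card: "seg CARD('m) = (UNIV :: 'm::finite set)"
  by (auto simp: seg_def)

lemma seg_Suc: "r < CARD('m) \<Longrightarrow> seg (Suc r) = insert (ix r :: 'm::finite) (seg r)"
  by (auto simp: seg_def less_Suc_eq)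

lemma ix_notin_seg: "r < CARD('m) \<Longrightarrow> (ix r :: 'm::finite) \<notin> seg r"
  by (auto simp: seg_def)

lemma card_seg: "r \<le> CARD('m) \<Longrightarrow> card (seg r :: 'm::finite set) = r"
  by (induction r) (auto simp: seg_Suc ix_notin_seg)

section \<open>Leading principal minors\<close>

definition lower_triangular :: "real ^ 'm ^ 'm \<Rightarrow> bool" where
  "lower_triangular T \<longleftrightarrow> (\<forall>i j. rk i < rk j \<longrightarrow> T $ i $ j = 0)"

text \<open>Gram-Schmidt for the rows in the order of \<open>rk\<close>. \<open>L\<close> may be
  singular; an orthonormal vector is added in every step, even if the row brings no new direction,
  so that \<open>H\<close> is a full orthogonal matrix.\<close>

theorem lower_orthogonal_decomposition:
  fixes L :: "real ^ 'm ^ 'm"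
  obtains T H where "lower_triangular T" "orthogonal_matrix H" "L = T ** H"
proof -
  have "\<exists>h :: nat \<Rightarrow> real ^ 'm. (\<forall>i<r. \<forall>j<r. h i \<bullet> h j = (if i = j then 1 else 0)) \<and>
      (\<forall>i<r. row (ix i) L \<in> span (h ` {..i}))" if "r \<le> CARD('m)" for r
    using that
  proof (induction r)
    case (Suc r)
    then obtain h :: "nat \<Rightarrow> real ^ 'm" where h: "\<And>i j. i < r \<Longrightarrow> j < r \<Longrightarrow> h i \<bullet> h j = (if i = j then 1 else 0)"
      and sp: "\<And>i. i < r \<Longrightarrow> row (ix i) L \<in> span (h ` {..i})" by auto
    obtain y z where yz: "y \<in> span (h ` {..<r})" "\<And>w. w \<in> span (h ` {..<r}) \<Longrightarrow> orthogonal z w"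
      "row (ix r) L = y + z" using orthogonal_subspace_decomp_exists by metis
    obtain x where x: "x \<noteq> 0" "\<And>i. i < r \<Longrightarrow> h i \<bullet> x = 0"
      using exists_orthogonal_vector[of "{..<r}" h] Suc by auto
    \<comment> \<open>If the row already lies in the span of the previous vectors, any vector
      orthogonal to them continues the system.\<close>
    define w where "w = (if z = 0 then x else z)"
    have "h i \<bullet> z = 0" if "i < r" for i
      using yz(2)[of "h i"] that by (simp add: orthogonal_def inner_commute span_base)
    then have w: "w \<noteq> 0" "\<And>i. i < r \<Longrightarrow> h i \<bullet> w = 0" "z \<in> span {w}"
      using x by (auto simp: w_def span_base span_zero)
    define v where "v = (1 / norm w) *\<^sub>R w"
    have v: "v \<bullet> v = 1" "\<And>i. i < r \<Longrightarrow> h i \<bullet> v = 0" using w by (auto simp: v_def power2_norm_eq_inner[symmetric] power2_eq_square)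
    have "w = norm w *\<^sub>R v" using w by (simp add: v_def)
    then have "w \<in> span {v}" by (metis insertI1 span_base span_scale)
    then have "span {w} \<subseteq> span {v}" by (intro span_minimal) auto
    then have z: "z \<in> span {v}" using w(3) by blast
    define g where "g = h(r := v)"
    have im: "g ` {..i} = h ` {..i}" if "i < r" for i using that by (auto simp: g_def image_def)
    have im2: "g ` {..r} = insert v (h ` {..<r})" by (auto simp: g_def image_def)
    have "g i \<bullet> g j = (if i = j then 1 else 0)" if "i < Suc r" "j < Suc r" for i j
      using that h v by (auto simp: g_def less_Suc_eq inner_commute)
    moreover have "row (ix i) L \<in> span (g ` {..i})" if "i < Suc r" for i
    proof (cases "i = r")
      case True
      have "y \<in> span (g ` {..r})" unfolding im2 by (rule subsetD[OF span_mono yz(1)]) auto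
      moreover have "z \<in> span (g ` {..r})" unfolding im2 by (rule subsetD[OF span_mono z]) auto
      ultimately show ?thesis using True yz(3) by (simp add: span_add)
    qed (use that sp im in auto)
    ultimately show ?case by blast
  qed auto
  from this[of "CARD('m)"] obtain h :: "nat \<Rightarrow> real ^ 'm" where
    h: "\<And>i j. i < CARD('m) \<Longrightarrow> j < CARD('m) \<Longrightarrow> h i \<bullet> h j = (if i = j then 1 else 0)"
    and sp: "\<And>i. i < CARD('m) \<Longrightarrow> row (ix i :: 'm) L \<in> span (h ` {..i})" by auto
  define H :: "real ^ 'm ^ 'm" where "H = (\<chi> i. h (rk i))"
  have rH: "row i H = h (rk i)" for i by (simp add: H_def row_def vec_eq_iff)
  have H: "orthogonal_matrix H"
    unfolding orthogonal_matrix_orthonormal_rows by (auto simp: rH h norm_eq_1 orthogonal_def)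
  define T where "T = L ** transpose H"
  have Tij: "T $ i $ j = row i L \<bullet> h (rk j)" for i j
    by (simp add: T_def matrix_matrix_mult_def transpose_def inner_vec_def row_def H_def)
  have "T $ i $ j = 0" if "rk i < rk j" for i j
  proof -
    have "row i L \<in> span (h ` {..rk i})" using sp[of "rk i"] by simp
    moreover have "orthogonal (h (rk j)) w" if "w \<in> span (h ` {..rk i})" for w
    proof (rule orthogonal_to_span[OF that])
      fix y assume "y \<in> h ` {..rk i}"
      then obtain k where "k \<le> rk i" "y = h k" by auto
      then show "orthogonal (h (rk j)) y"
        using \<open>rk i < rk j\<close> h[of "rk j" k] rk_less[of j] by (auto simp: orthogonal_def)
    qed
    ultimately show ?thesis by (simp add: Tij orthogonal_def inner_commute)
  qed
  then have "lower_triangular T" by (simp add: lower_triangular_def)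
  moreover have "L = T ** H"
    using H by (simp add: T_def orthogonal_matrix_def flip: matrix_mul_assoc)
  ultimately show ?thesis using H that by blast
qed

text \<open>The complementary block is filled with the identity, so that a minor of any size is a
  determinant over the same index type and \<open>det_mul\<close> applies to it.\<close>

definition trunc :: "'m set \<Rightarrow> real ^ 'm ^ 'm \<Rightarrow> real ^ 'm ^ 'm" where
  "trunc I Z = (\<chi> i j. if i \<in> I \<and> j \<in> I then Z $ i $ j else if i = j then 1 else 0)"

definition pm :: "'m::finite set \<Rightarrow> real ^ 'm ^ 'm \<Rightarrow> real" where
  "pm I Z = det (trunc I Z)"

lemma pm_empty [simp]: "pm {} Z = 1"
proof -
  have "trunc {} Z = mat 1" by (simp add: trunc_def mat_def)
  then show ?thesis by (simp add: pm_def)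
qed

lemma transpose_trunc: "transpose (trunc I Z) = trunc I (transpose Z)"
  by (auto simp: trunc_def transpose_def vec_eq_iff)

text \<open>A row of \<open>T\<close> with index in the leading segment has no entries outside the
  segment, so the leading block of the product sees only the leading blocks of the factors.\<close>

lemma trunc_lower_mult:
  fixes T Z :: "real ^ 'm ^ 'm"
  assumes "lower_triangular T"
  shows "trunc (seg r) (T ** Z) = trunc (seg r) T ** trunc (seg r) Z"
proof (intro vec_eq_iff[THEN iffD2] allI)
  fix i j :: 'm
  have eq: "(trunc (seg r) T ** trunc (seg r) Z) $ i $ j = (\<Sum>k\<in>UNIV. trunc (seg r) T $ i $ k * trunc (seg r) Z $ k $ j)"
    by (simp add: matrix_matrix_mult_def)
  show "trunc (seg r) (T ** Z) $ i $ j = (trunc (seg r) T ** trunc (seg r) Z) $ i $ j"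
  proof (cases "i \<in> seg r")
    case True
    show ?thesis
    proof (cases "j \<in> seg r")
      case j: True
      have "(trunc (seg r) T ** trunc (seg r) Z) $ i $ j = (\<Sum>k\<in>UNIV. T $ i $ k * Z $ k $ j)"
        unfolding eq
      proof (rule sum.cong)
        fix k
        show "trunc (seg r) T $ i $ k * trunc (seg r) Z $ k $ j = T $ i $ k * Z $ k $ j"
        proof (cases "k \<in> seg r")
          case False
          then have "rk i < rk k" using True by (auto simp: seg_def)
          then have "T $ i $ k = 0" using assms by (auto simp: lower_triangular_def)
          then show ?thesis using False True j by (auto simp: trunc_def)
        qed (use True j in \<open>auto simp: trunc_def\<close>)
      qed simp
      then show ?thesis using True j by (simp add: trunc_def matrix_matrix_mult_def)
    next
      case j: False
      have "(trunc (seg r) T ** trunc (seg r) Z) $ i $ j = (\<Sum>k\<in>(UNIV :: 'm set). 0)"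
        unfolding eq by (rule sum.cong[OF refl]) (use True j in \<open>auto simp: trunc_def\<close>)
      then show ?thesis using True j by (auto simp: trunc_def)
    qed
  next
    case False
    have "(trunc (seg r) T ** trunc (seg r) Z) $ i $ j = (\<Sum>k\<in>UNIV. if k = i then trunc (seg r) Z $ k $ j else 0)"
      unfolding eq by (rule sum.cong) (use False in \<open>auto simp: trunc_def\<close>)
    then show ?thesis using False by (simp add: trunc_def)
  qed
qed

lemma pm_lower_conj:
  fixes T Z :: "real ^ 'm ^ 'm"
  assumes "lower_triangular T"
  shows "pm (seg r) (T ** Z ** transpose T) = pm (seg r) (T ** transpose T) * pm (seg r) Z"
proof -
  have *: "trunc (seg r) (T ** (Y ** transpose T)) = trunc (seg r) T ** (trunc (seg r) Y ** transpose (trunc (seg r) T))"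
    for Y
  proof -
    have "transpose (trunc (seg r) (Y ** transpose T)) = transpose (trunc (seg r) Y ** transpose (trunc (seg r) T))"
      by (simp add: transpose_trunc matrix_transpose_mul trunc_lower_mult[OF assms])
    then have "trunc (seg r) (Y ** transpose T) = trunc (seg r) Y ** transpose (trunc (seg r) T)"
      by (metis transpose_transpose)
    then show ?thesis by (simp add: trunc_lower_mult[OF assms])
  qed
  \<comment> \<open>The case \<open>Z = mat 1\<close> identifies the squared determinant of the
    block of \<open>T\<close> with the minor of \<open>T ** transpose T\<close>.\<close>
  have "trunc (seg r) (mat 1 :: real ^ 'm ^ 'm) = mat 1" by (auto simp: trunc_def mat_def vec_eq_iff)
  then show ?thesis
    using *[of Z] *[of "mat 1"] by (simp add: pm_def det_mul matrix_mul_assoc[symmetric])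
qed

definition gramm :: "('m \<Rightarrow> 'v::real_inner) \<Rightarrow> real ^ 'm ^ 'm" where
  "gramm x = (\<chi> i j. x i \<bullet> x j)"

text \<open>Write \<open>x a = y + z\<close> with \<open>y\<close> in the span of the vectors over
  \<open>I\<close> and \<open>z\<close> orthogonal to it. Row \<open>a\<close> of the Gram block is
  then a combination of the other rows, which leaves the determinant unchanged, plus
  \<open>(norm z)\<^sup>2\<close> times a unit vector. The norm of \<open>z\<close> is the distance
  to the span.\<close>

lemma pm_gramm_insert:
  fixes x :: "'m::finite \<Rightarrow> 'v::euclidean_space"
  assumes "a \<notin> I"
  shows "pm (insert a I) (gramm x) = (infdist (x a) (span (x ` I)))\<^sup>2 * pm I (gramm x)"
proof -
  obtain y z where yz: "y \<in> span (x ` I)" "\<And>w. w \<in> span (x ` I) \<Longrightarrow> orthogonal z w" "x a = y + z"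
    using orthogonal_subspace_decomp_exists by metis
  have ne: "span (x ` I) \<noteq> {}" using span_zero by blast
  have inf: "infdist (x a) (span (x ` I)) = norm z"
  proof (rule antisym)
    have "infdist (x a) (span (x ` I)) \<le> dist (x a) y" using yz(1) by (rule infdist_le)
    then show "infdist (x a) (span (x ` I)) \<le> norm z" using yz(3) by (simp add: dist_norm)
    show "norm z \<le> infdist (x a) (span (x ` I))"
      unfolding infdist_notempty[OF ne]
    proof (rule cINF_greatest[OF ne])
      fix w assume w: "w \<in> span (x ` I)"
      have "orthogonal z (y - w)" using yz w by (simp add: span_diff)
      then have "(norm (z + (y - w)))\<^sup>2 = (norm z)\<^sup>2 + (norm (y - w))\<^sup>2" by (rule norm_add_Pythagorean)
      then have "(norm z)\<^sup>2 \<le> (norm (z + (y - w)))\<^sup>2" by simp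
      then have "norm z \<le> norm (z + (y - w))" by (rule power2_le_imp_le) simp
      then show "norm z \<le> dist (x a) w" using yz(3) by (simp add: dist_norm algebra_simps)
    qed
  qed
  define J where "J = insert a I"
  define R :: "'v \<Rightarrow> real ^ 'm" where "R v = (\<chi> j. if j \<in> J then v \<bullet> x j else 0)" for v
  define B :: "real ^ 'm ^ 'm" where "B = (\<chi> k. if k = a then R z else trunc J (gramm x) $ k)"
  have rowt: "trunc J (gramm x) $ i = R (x i)" if "i \<in> J" for i
    using that by (auto simp: trunc_def R_def gramm_def vec_eq_iff)
  have "R y \<in> span (R ` x ` I)"
  proof -
    have "linear R" by (auto simp: linear_iff R_def vec_eq_iff inner_add_left)
    then show ?thesis using yz(1) by (simp add: linear_span_image)
  qed
  moreover have "R ` x ` I \<subseteq> {row j B |j. j \<noteq> a}"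
  proof safe
    fix i assume i: "i \<in> I"
    then have "row i B = R (x i)" using assms rowt[of i]
      by (auto simp: B_def row_def vec_eq_iff J_def)
    then show "\<exists>j. R (x i) = row j B \<and> j \<noteq> a" using i assms by metis
  qed
  ultimately have "R y \<in> span {row j B |j. j \<noteq> a}" using span_mono by blast
  then have "R y \<in> vec.span {row j B |j. j \<noteq> a}" by (simp add: span_vec_eq)
  from det_row_span[OF this]
  have "det (\<chi> k. if k = a then row a B + R y else row k B) = det B" .
  moreover have "(\<chi> k. if k = a then row a B + R y else row k B) = trunc J (gramm x)"
  proof -
    have "R z + R y = R (x a)" by (simp add: R_def vec_eq_iff yz(3) inner_add_left)
    then show ?thesis using rowt[of a] by (auto simp: vec_eq_iff B_def row_def J_def)
  qed
  ultimately have 1: "pm J (gramm x) = det B" by (simp add: pm_def)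
  have za: "z \<bullet> x j = 0" if "j \<in> I" for j using yz(2)[of "x j"] that by (simp add: orthogonal_def span_base)
  have zx: "z \<bullet> x a = (norm z)\<^sup>2"
    using yz(2)[OF yz(1)] by (simp add: yz(3) inner_add_right orthogonal_def power2_norm_eq_inner)
  define E :: "real ^ 'm ^ 'm" where "E = (\<chi> k. if k = a then axis a 1 else trunc J (gramm x) $ k)"
  have "R z = (norm z)\<^sup>2 *s axis a 1"
    using za zx by (auto simp: R_def vec_eq_iff axis_def J_def)
  then have "det B = (norm z)\<^sup>2 * det E"
    unfolding B_def E_def using det_row_mul[of a "(norm z)\<^sup>2" "\<lambda>_. axis a 1" "\<lambda>k. trunc J (gramm x) $ k"]
    by (simp only:)
  \<comment> \<open>\<open>E\<close> and the block over \<open>I\<close> can differ only in column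
    \<open>a\<close>. A permutation that does not fix \<open>a\<close> picks a zero from row
    \<open>a\<close> of either matrix, so these entries never contribute.\<close>
  moreover have "det E = pm I (gramm x)"
  proof -
    define F :: "real ^ 'm ^ 'm" where "F = trunc I (gramm x)"
    have "det E = det F"
    proof -
      have "det E = (\<Sum>p | p permutes UNIV. of_int (sign p) * (\<Prod>i\<in>UNIV. E $ i $ p i))" by (simp add: det_def)
      also have "\<dots> = (\<Sum>p | p permutes UNIV. of_int (sign p) * (\<Prod>i\<in>UNIV. F $ i $ p i))"
      proof (rule sum.cong)
        fix p assume "p \<in> {p. p permutes (UNIV :: 'm set)}"
        then have p: "p permutes UNIV" by simp
        have "(\<Prod>i\<in>UNIV. E $ i $ p i) = (\<Prod>i\<in>UNIV. F $ i $ p i)"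
        proof (cases "p a = a")
          case True
          have "E $ i $ p i = F $ i $ p i" for i
          proof (cases "i = a")
            case False
            then have "p i \<noteq> a" using True p by (metis permutes_def)
            with False show ?thesis using assms by (auto simp: E_def F_def trunc_def J_def)
          qed (use True assms in \<open>auto simp: E_def F_def trunc_def axis_def\<close>)
          then show ?thesis by simp
        next
          case False
          then have "E $ a $ p a = 0" "F $ a $ p a = 0" using assms by (auto simp: E_def F_def trunc_def axis_def)
          then have "(\<Prod>i\<in>UNIV. E $ i $ p i) = 0" "(\<Prod>i\<in>UNIV. F $ i $ p i) = 0"
            by (intro prod_zero bexI[of _ a]; simp)+
          then show ?thesis by (simp only:)
        qed
        then show "of_int (sign p) * (\<Prod>i\<in>UNIV. E $ i $ p i) = of_int (sign p) * (\<Prod>i\<in>UNIV. F $ i $ p i)" by simp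
      qed simp
      finally show ?thesis by (simp add: det_def)
    qed
    then show ?thesis by (simp add: F_def pm_def)
  qed
  ultimately show ?thesis using 1 inf by (simp add: J_def)
qed

section \<open>Isometries and the Lebesgue measure\<close>

text \<open>The image measure \<open>\<mu>\<close> is translation invariant and gives unit balls the
  volume they have under \<open>lborel\<close>. For a Borel set \<open>A\<close>, integrating over
  the pairs of points at distance less than 1, one of them in \<open>A\<close>, in both orders shows
  that the two measures agree on \<open>A\<close>. The two spaces may have different types, as the
  transposition of matrices requires.\<close>

lemma lborel_isometry:
  fixes f :: "'a::euclidean_space \<Rightarrow> 'b::euclidean_space"
  assumes lin: "linear f" and iso: "\<And>x. norm (f x) = norm x" and dim: "DIM('a) = DIM('b)"
  shows "distr lborel borel f = lborel"
proof -
  have cont: "continuous_on UNIV f" using lin by (metis linear_continuous_on linear_conv_bounded_linear)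
  have fm [measurable]: "f \<in> borel_measurable borel" using cont by (rule borel_measurable_continuous_onI)
  have inj: "inj f"
    using lin iso by (metis linear_injective_0 norm_eq_zero)
  have surj: "surj f"
  proof -
    have "dim (range f) = DIM('b)" using dim_image_eq[OF lin, of UNIV] inj dim by simp
    then show ?thesis
      by (metis dim_eq_full lin linear_subspace_image span_eq_iff subspace_UNIV)
  qed
  define \<mu> where "\<mu> = distr lborel borel f"
  have sets: "sets \<mu> = sets borel" "space \<mu> = UNIV" by (simp_all add: \<mu>_def)
  have [measurable_cong]: "sets \<mu> = sets borel" by (rule sets)
  let ?B = "\<lambda>y::'b. ball y 1"
  have trans: "(\<integral>\<^sup>+x. g (x + y) \<partial>\<mu>) = (\<integral>\<^sup>+x. g x \<partial>\<mu>)" if [measurable]: "g \<in> borel_measurable borel" for g :: "'b \<Rightarrow> ennreal" and y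
  proof -
    obtain a where a: "f a = y" using surj by (metis surjD)
    have "(\<integral>\<^sup>+x. g (x + y) \<partial>\<mu>) = (\<integral>\<^sup>+x. g (f (a + x)) \<partial>lborel)"
      unfolding \<mu>_def by (simp add: nn_integral_distr linear_add[OF lin] a add.commute)
    also have "\<dots> = (\<integral>\<^sup>+x. g (f x) \<partial>distr lborel borel ((+) a))"
      by (rule nn_integral_distr[symmetric]) auto
    also have "\<dots> = (\<integral>\<^sup>+x. g x \<partial>\<mu>)" unfolding \<mu>_def lborel_distr_plus by (simp add: nn_integral_distr)
    finally show ?thesis .
  qed
  have ball: "emeasure \<mu> (?B y) = emeasure lborel (ball (0::'a) 1)" for y
  proof -
    obtain a where a: "f a = y" using surj by (metis surjD)
    have "f -` ball y 1 = ball a 1"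
      using iso by (auto simp: dist_norm a[symmetric] linear_diff[OF lin, symmetric])
    then show ?thesis by (simp add: \<mu>_def emeasure_distr emeasure_lborel_ball_finite emeasure_ball)
  qed
  have eqball: "emeasure lborel (ball (0::'a) 1) = emeasure lborel (ball (0::'b) 1)"
    by (simp add: emeasure_ball dim)
  have bpos: "emeasure lborel (ball (0::'b) 1) \<noteq> 0" "emeasure lborel (ball (0::'b) 1) \<noteq> \<infinity>"
    by (simp_all add: emeasure_ball unit_ball_vol_pos less_imp_neq[symmetric])
  have sf: "sigma_finite_measure \<mu>"
  proof
    show "\<exists>A. countable A \<and> A \<subseteq> sets \<mu> \<and> \<Union> A = space \<mu> \<and> (\<forall>a\<in>A. emeasure \<mu> a \<noteq> \<infinity>)"
    proof (intro exI[of _ "range (\<lambda>n::nat. f ` ball 0 (real n))"] conjI ballI)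
      have fb: "f ` ball 0 r = ball 0 r" for r
      proof safe
        fix x assume "x \<in> ball (0::'b) r"
        moreover obtain a where "f a = x" using surj by (metis surjD)
        ultimately show "x \<in> f ` ball 0 r" using iso[of a] by auto
      qed (simp add: iso)
      show "countable (range (\<lambda>n::nat. f ` ball 0 (real n)))" by simp
      show "range (\<lambda>n::nat. f ` ball 0 (real n)) \<subseteq> sets \<mu>" by (auto simp: fb sets)
      show "\<Union> (range (\<lambda>n::nat. f ` ball 0 (real n))) = space \<mu>"
        unfolding fb sets using reals_Archimedean2 by (auto simp: )
      fix A assume "A \<in> range (\<lambda>n::nat. f ` ball 0 (real n))"
      then obtain n where A: "A = ball 0 (real n)" using fb by auto
      have "f -` ball 0 (real n) = ball 0 (real n)" using iso by auto
      then show "emeasure \<mu> A \<noteq> \<infinity>"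
        using emeasure_lborel_ball_finite[of "0::'a" "real n"] by (simp add: A \<mu>_def emeasure_distr less_top)
    qed
  qed
  interpret pair_sigma_finite \<mu> "lborel :: 'b measure"
    by (simp add: pair_sigma_finite_def sf sigma_finite_lborel)
  have [measurable]: "ball y r \<in> sets borel" for y :: 'b and r by simp
  have main: "emeasure \<mu> A = emeasure lborel A" if [measurable]: "A \<in> sets borel" for A :: "'b set"
  proof -
    have "emeasure \<mu> A * emeasure lborel (?B 0) = (\<integral>\<^sup>+y. indicator (?B 0) y * (\<integral>\<^sup>+x. indicator A (x + y) \<partial>\<mu>) \<partial>lborel)"
      by (simp add: trans nn_integral_cmult mult.commute sets nn_integral_cmult_indicator del: nn_integral_indicator_singleton)
    also have "\<dots> = (\<integral>\<^sup>+y. (\<integral>\<^sup>+x. indicator (?B 0) y * indicator A (x + y) \<partial>\<mu>) \<partial>lborel)"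
      by (intro nn_integral_cong nn_integral_cmult[symmetric]) measurable
    also have "\<dots> = (\<integral>\<^sup>+x. (\<integral>\<^sup>+y. indicator (?B 0) y * indicator A (x + y) \<partial>lborel) \<partial>\<mu>)"
    proof (rule Fubini')
      have "(\<lambda>z::'b \<times> 'b. indicator (?B 0) (snd z) :: ennreal) \<in> borel_measurable (borel \<Otimes>\<^sub>M borel)"
        by (rule measurable_compose[OF measurable_snd borel_measurable_indicator]) simp
      moreover have "(\<lambda>z::'b \<times> 'b. indicator A (fst z + snd z) :: ennreal) \<in> borel_measurable (borel \<Otimes>\<^sub>M borel)"
        by (rule measurable_compose[OF _ borel_measurable_indicator[OF that]]) measurable
      ultimately show "(\<lambda>(x, y). indicator (?B 0) y * indicator A (x + y) :: ennreal)
          \<in> borel_measurable (\<mu> \<Otimes>\<^sub>M (lborel :: 'b measure))"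
        unfolding split_beta measurable_cong_sets[OF sets_pair_measure_cong[OF sets(1) sets_lborel] refl]
        by (rule borel_measurable_times_ennreal)
    qed
    also have "\<dots> = (\<integral>\<^sup>+x. (\<integral>\<^sup>+y. indicator (?B x) y * indicator A y \<partial>lborel) \<partial>\<mu>)"
    proof (rule nn_integral_cong)
      fix x :: 'b
      have "(\<integral>\<^sup>+y. indicator (?B 0) y * indicator A (x + y) \<partial>lborel)
          = (\<integral>\<^sup>+y. indicator (?B x) (x + y) * indicator A (x + y) \<partial>lborel)"
        by (intro nn_integral_cong) (auto simp: indicator_def dist_norm)
      also have "\<dots> = (\<integral>\<^sup>+y. indicator (?B x) y * indicator A y \<partial>distr lborel borel ((+) x))"
        by (rule nn_integral_distr[symmetric]) measurable
      finally show "(\<integral>\<^sup>+y. indicator (?B 0) y * indicator A (x + y) \<partial>lborel)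
          = (\<integral>\<^sup>+y. indicator (?B x) y * indicator A y \<partial>lborel)" by (simp only: lborel_distr_plus)
    qed
    also have "\<dots> = (\<integral>\<^sup>+y. (\<integral>\<^sup>+x. indicator {z. dist (fst z) (snd z) < 1} (x, y) * indicator A y \<partial>\<mu>) \<partial>lborel)"
      by (subst Fubini') (auto intro!: nn_integral_cong simp: indicator_def)
    also have "\<dots> = (\<integral>\<^sup>+y. indicator A y * emeasure \<mu> (?B y) \<partial>lborel)"
    proof (rule nn_integral_cong)
      fix y :: 'b
      have "(\<integral>\<^sup>+x. indicator {z. dist (fst z) (snd z) < 1} (x, y) * indicator A y \<partial>\<mu>)
          = (\<integral>\<^sup>+x. indicator (?B y) x * indicator A y \<partial>\<mu>)"
        by (intro nn_integral_cong) (auto simp: indicator_def dist_commute)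
      also have "\<dots> = emeasure \<mu> (?B y) * indicator A y"
        by (subst nn_integral_multc) (auto simp: sets intro!: borel_measurable_indicator)
      finally show "(\<integral>\<^sup>+x. indicator {z. dist (fst z) (snd z) < 1} (x, y) * indicator A y \<partial>\<mu>)
        = indicator A y * emeasure \<mu> (?B y)" by (simp add: mult.commute)
    qed
    also have "\<dots> = emeasure lborel A * emeasure lborel (ball (0::'b) 1)"
      by (simp add: ball eqball nn_integral_multc)
    finally have "emeasure lborel (ball (0::'b) 1) * emeasure \<mu> A = emeasure lborel (ball (0::'b) 1) * emeasure lborel A"
      by (simp only: mult.commute)
    then show ?thesis using bpos unfolding ennreal_mult_cancel_left by auto
  qed
  then show ?thesis by (intro measure_eqI) (auto simp: \<mu>_def)
qed

section \<open>Lebesgue measure on matrices as a product over the rows\<close>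

lemma vec_lambda_measurable:
  "(\<lambda>x. \<chi> i. x i) \<in> (\<Pi>\<^sub>M i\<in>(UNIV::'m::finite set). (lborel :: 'v::euclidean_space measure)) \<rightarrow>\<^sub>M borel"
proof (subst borel_measurable_euclidean_space, intro ballI)
  fix b :: "'v ^ 'm" assume "b \<in> Basis"
  have "(\<lambda>x. \<Sum>i\<in>UNIV. x i \<bullet> b $ i) \<in> borel_measurable (\<Pi>\<^sub>M i\<in>(UNIV::'m set). (lborel :: 'v measure))"
    by measurable
  then show "(\<lambda>x. (\<chi> i. x i) \<bullet> b) \<in> borel_measurable (\<Pi>\<^sub>M i\<in>(UNIV::'m set). (lborel :: 'v measure))"
    by (simp add: inner_vec_def)
qed

text \<open>Both measures give boxes the product of the side lengths. This lets the rows of a matrix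
  be integrated one after the other.\<close>

lemma nn_integral_lborel_vec:
  fixes f :: "'v::euclidean_space ^ 'm \<Rightarrow> ennreal"
  assumes [measurable]: "f \<in> borel_measurable borel"
  shows "(\<integral>\<^sup>+x. f x \<partial>lborel) = (\<integral>\<^sup>+x. f (\<chi> i. x i) \<partial>(\<Pi>\<^sub>M i\<in>UNIV. lborel))"
proof -
  interpret product_sigma_finite "\<lambda>_::'m. lborel :: 'v measure" by standard
  note vec_lambda_measurable [measurable]
  have "lborel = distr (\<Pi>\<^sub>M i\<in>(UNIV::'m set). (lborel :: 'v measure)) borel (\<lambda>x. \<chi> i. x i)"
  proof (rule lborel_eqI)
    fix l u :: "'v ^ 'm" assume le: "\<And>b. b \<in> Basis \<Longrightarrow> l \<bullet> b \<le> u \<bullet> b"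
    have le': "l $ i \<bullet> b \<le> u $ i \<bullet> b" if "b \<in> Basis" for i b
      using le[of "axis i b"] that by (simp add: Basis_vec_def inner_axis) blast
    have "(\<lambda>x. \<chi> i. x i) -` box l u \<inter> space (\<Pi>\<^sub>M i\<in>(UNIV::'m set). (lborel :: 'v measure))
        = (\<Pi>\<^sub>E i\<in>UNIV. box (l $ i) (u $ i))"
      by (auto simp: space_PiM box_def Basis_vec_def inner_axis PiE_iff)
    then have "emeasure (distr (\<Pi>\<^sub>M i\<in>(UNIV::'m set). (lborel :: 'v measure)) borel (\<lambda>x. \<chi> i. x i)) (box l u)
        = (\<Prod>i\<in>UNIV. emeasure lborel (box (l $ i) (u $ i)))"
      by (subst emeasure_distr) (auto simp: emeasure_PiM)
    also have "\<dots> = (\<Prod>i\<in>(UNIV::'m set). ennreal (\<Prod>b\<in>Basis. (u $ i - l $ i) \<bullet> b))"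
      using le' by (simp add: emeasure_lborel_box)
    also have "\<dots> = ennreal (\<Prod>i\<in>(UNIV::'m set). \<Prod>b\<in>Basis. (u $ i - l $ i) \<bullet> b)"
      using le' by (intro prod_ennreal) (auto intro!: prod_nonneg simp: inner_diff_left)
    also have "(\<Prod>i\<in>(UNIV::'m set). \<Prod>b\<in>Basis. (u $ i - l $ i) \<bullet> b) = (\<Prod>b\<in>Basis. (u - l) \<bullet> b)"
    proof -
      have "(\<Prod>i\<in>(UNIV::'m set). \<Prod>b\<in>Basis. (u $ i - l $ i) \<bullet> b)
          = (\<Prod>(i, b)\<in>UNIV \<times> Basis. (u $ i - l $ i) \<bullet> b)" by (simp add: prod.cartesian_product)
      also have "\<dots> = (\<Prod>x\<in>(UNIV::'m set) \<times> (Basis::'v set). (u - l) \<bullet> (case x of (i, b) \<Rightarrow> axis i b))"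
        by (intro prod.cong) (auto simp: inner_axis)
      also have "\<dots> = (\<Prod>b\<in>Basis. (u - l) \<bullet> b)"
        by (rule prod.reindex_bij_betw)
          (auto simp: bij_betw_def Basis_vec_def inj_on_def axis_eq_axis)
      finally show ?thesis .
    qed
    finally show "emeasure (distr (\<Pi>\<^sub>M i\<in>(UNIV::'m set). (lborel :: 'v measure)) borel (\<lambda>x. \<chi> i. x i)) (box l u)
      = (\<Prod>b\<in>Basis. (u - l) \<bullet> b)" .
  qed simp
  then have "(\<integral>\<^sup>+x. f x \<partial>lborel) = (\<integral>\<^sup>+x. f x \<partial>distr (\<Pi>\<^sub>M i\<in>(UNIV::'m set). (lborel :: 'v measure)) borel (\<lambda>x. \<chi> i. x i))"
    by simp
  then show ?thesis by (simp add: nn_integral_distr)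
qed

text \<open>Both sides are compared on boxes, where the integral of a product factorises.
  Sigma-finiteness of the densities is a separate hypothesis because it does not follow from that of
  \<open>N i\<close> when \<open>f i\<close> takes infinite values.\<close>

lemma PiM_density:
  fixes N :: "'i \<Rightarrow> 'a measure" and f :: "'i \<Rightarrow> 'a \<Rightarrow> ennreal"
  assumes fin: "finite I" and sf: "\<And>i. sigma_finite_measure (N i)"
    and f [measurable]: "\<And>i. f i \<in> borel_measurable (N i)"
    and sf': "\<And>i. sigma_finite_measure (density (N i) (f i))"
  shows "(\<Pi>\<^sub>M i\<in>I. density (N i) (f i)) = density (\<Pi>\<^sub>M i\<in>I. N i) (\<lambda>x. \<Prod>i\<in>I. f i (x i))"
proof -
  interpret A: product_sigma_finite N by (simp add: product_sigma_finite_def sf)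
  interpret B: product_sigma_finite "\<lambda>i. density (N i) (f i)" by (simp add: product_sigma_finite_def sf')
  have pm [measurable]: "(\<lambda>x. \<Prod>i\<in>I. f i (x i)) \<in> borel_measurable (\<Pi>\<^sub>M i\<in>I. N i)"
    by measurable
  show ?thesis
  proof (rule B.PiM_eqI[OF fin, symmetric])
    have "sets (\<Pi>\<^sub>M i\<in>I. density (N i) (f i)) = sets (\<Pi>\<^sub>M i\<in>I. N i)"
      by (rule sets_PiM_cong) auto
    then show "sets (density (Pi\<^sub>M I N) (\<lambda>x. \<Prod>i\<in>I. f i (x i))) = sets (\<Pi>\<^sub>M i\<in>I. density (N i) (f i))" by simp
    fix A assume A: "\<And>i. i \<in> I \<Longrightarrow> A i \<in> sets (density (N i) (f i))"
    then have [measurable]: "i \<in> I \<Longrightarrow> A i \<in> sets (N i)" for i by simp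
    have "Pi\<^sub>E I A \<in> sets (Pi\<^sub>M I N)" using fin by (intro sets_PiM_I_finite) auto
    then have "emeasure (density (Pi\<^sub>M I N) (\<lambda>x. \<Prod>i\<in>I. f i (x i))) (Pi\<^sub>E I A)
       = (\<integral>\<^sup>+x. (\<Prod>i\<in>I. f i (x i)) * indicator (Pi\<^sub>E I A) x \<partial>Pi\<^sub>M I N)"
      by (simp add: emeasure_density)
    also have "\<dots> = (\<integral>\<^sup>+x. (\<Prod>i\<in>I. f i (x i) * indicator (A i) (x i)) \<partial>Pi\<^sub>M I N)"
    proof (rule nn_integral_cong)
      fix x assume "x \<in> space (Pi\<^sub>M I N)"
      then have "indicator (Pi\<^sub>E I A) x = (\<Prod>i\<in>I. indicator (A i) (x i) :: ennreal)"
        using fin by (auto simp: space_PiM PiE_iff indicator_def prod_zero_iff split: if_splits)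
      then show "(\<Prod>i\<in>I. f i (x i)) * indicator (Pi\<^sub>E I A) x = (\<Prod>i\<in>I. f i (x i) * indicator (A i) (x i))"
        by (simp add: prod.distrib)
    qed
    also have "\<dots> = (\<Prod>i\<in>I. \<integral>\<^sup>+x. f i x * indicator (A i) x \<partial>N i)"
      by (rule A.product_nn_integral_prod[OF fin]) measurable
    also have "\<dots> = (\<Prod>i\<in>I. emeasure (density (N i) (f i)) (A i))"
      by (intro prod.cong) (auto simp: emeasure_density)
    finally show "emeasure (density (Pi\<^sub>M I N) (\<lambda>x. \<Prod>i\<in>I. f i (x i))) (Pi\<^sub>E I A)
      = (\<Prod>i\<in>I. emeasure (density (N i) (f i)) (A i))" .
  qed
qed

section \<open>The standard Gaussian measure\<close>

definition gw :: "'a::euclidean_space \<Rightarrow> real" where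
  "gw x = exp (- (norm x)\<^sup>2 / 2) / sqrt (2 * pi) ^ DIM('a)"

definition gaussM :: "'a::euclidean_space measure" where
  "gaussM = density lborel (\<lambda>x. ennreal (gw x))"

lemma gw_nonneg [simp]: "gw x \<ge> 0" by (simp add: gw_def)

lemma gw_measurable [measurable]: "gw \<in> borel_measurable borel"
  unfolding gw_def by measurable

lemma sets_gaussM [simp, measurable_cong]: "sets gaussM = sets borel"
  and space_gaussM [simp]: "space gaussM = UNIV"
  by (simp_all add: gaussM_def)

lemma norm_sq_Basis: "(norm x)\<^sup>2 = (\<Sum>b\<in>Basis. (x \<bullet> b)\<^sup>2)"
  unfolding power2_norm_eq_inner by (subst euclidean_inner) (simp add: power2_eq_square)

text \<open>The width is kept general: \<open>1\<close> normalises the Gaussian measure,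
  \<open>sqrt 2\<close> dominates its moments, and \<open>1 / sqrt 2\<close> starts the recursion
  for the integrals over balls.\<close>

lemma nn_integral_exp_norm:
  assumes "\<sigma> > 0"
  shows "(\<integral>\<^sup>+x. ennreal (exp (- (norm x)\<^sup>2 / (2 * \<sigma>\<^sup>2))) \<partial>(lborel :: 'a::euclidean_space measure)) = ennreal ((sqrt (2 * pi) * \<sigma>) ^ DIM('a))"
proof -
  have 1: "(\<integral>\<^sup>+x. ennreal (exp (- x\<^sup>2 / (2 * \<sigma>\<^sup>2))) \<partial>(lborel :: real measure)) = ennreal (sqrt (2 * pi) * \<sigma>)"
  proof -
    interpret prob_space "density lborel (normal_density 0 \<sigma>)" by (rule prob_space_normal_density[OF assms])
    have "ennreal (exp (- x\<^sup>2 / (2 * \<sigma>\<^sup>2))) = ennreal (sqrt (2 * pi) * \<sigma>) * ennreal (normal_density 0 \<sigma> x)" for x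
      using assms by (simp add: normal_density_def real_sqrt_mult ennreal_mult[symmetric] field_simps)
    then have "(\<integral>\<^sup>+x. ennreal (exp (- x\<^sup>2 / (2 * \<sigma>\<^sup>2))) \<partial>(lborel :: real measure))
        = ennreal (sqrt (2 * pi) * \<sigma>) * (\<integral>\<^sup>+x. ennreal (normal_density 0 \<sigma> x) \<partial>lborel)"
      by (simp add: nn_integral_cmult)
    also have "(\<integral>\<^sup>+x. ennreal (normal_density 0 \<sigma> x) \<partial>lborel) = 1"
      using emeasure_space_1 by (simp add: emeasure_density)
    finally show ?thesis by simp
  qed
  have "ennreal (exp (- (norm x)\<^sup>2 / (2 * \<sigma>\<^sup>2))) = (\<Prod>b\<in>Basis. ennreal (exp (- (x \<bullet> b)\<^sup>2 / (2 * \<sigma>\<^sup>2))))" for x :: 'a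
    by (simp add: prod_ennreal exp_sum[symmetric] norm_sq_Basis sum_divide_distrib sum_negf)
  then have "(\<integral>\<^sup>+x. ennreal (exp (- (norm x)\<^sup>2 / (2 * \<sigma>\<^sup>2))) \<partial>(lborel :: 'a measure)) = (\<Prod>b\<in>(Basis::'a set). ennreal (sqrt (2 * pi) * \<sigma>))"
    by (subst 1[symmetric]) (subst nn_integral_lborel_prod[symmetric], auto)
  then show ?thesis using assms by (simp add: ennreal_power)
qed

lemma prob_space_gaussM: "prob_space (gaussM :: 'a::euclidean_space measure)"
proof
  have "emeasure gaussM (space (gaussM :: 'a measure))
      = (\<integral>\<^sup>+x. ennreal (1 / sqrt (2 * pi) ^ DIM('a)) * ennreal (exp (- (norm x)\<^sup>2 / (2 * 1\<^sup>2))) \<partial>(lborel :: 'a measure))"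
    by (simp add: gaussM_def emeasure_density gw_def ennreal_mult[symmetric])
  also have "\<dots> = ennreal (1 / sqrt (2 * pi) ^ DIM('a)) * ennreal ((sqrt (2 * pi) * 1) ^ DIM('a))"
    by (subst nn_integral_cmult) (simp, subst nn_integral_exp_norm, auto)
  also have "\<dots> = 1" by (simp add: ennreal_mult[symmetric])
  finally show "emeasure gaussM (space (gaussM :: 'a measure)) = 1" .
qed

lemma gaussM_isometry:
  fixes f :: "'a::euclidean_space \<Rightarrow> 'b::euclidean_space"
  assumes lin: "linear f" and iso: "\<And>x. norm (f x) = norm x" and dim: "DIM('a) = DIM('b)"
  shows "distr gaussM borel f = gaussM"
proof -
  have [measurable]: "f \<in> borel_measurable borel"
    using lin by (intro borel_measurable_continuous_onI) (metis linear_continuous_on linear_conv_bounded_linear)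
  have "gw (f x) = gw x" for x by (simp add: gw_def iso dim)
  then have "distr gaussM borel f = distr (density lborel (\<lambda>x. ennreal (gw (f x)))) borel f"
    by (simp add: gaussM_def)
  also have "\<dots> = density (distr lborel borel f) (\<lambda>x. ennreal (gw x))"
    by (rule density_distr[symmetric]) auto
  finally show ?thesis by (simp add: lborel_isometry[OF assms] gaussM_def)
qed

section \<open>Functions of polynomial growth\<close>

text \<open>A class that contains all polynomials in matrix entries and is closed under the
  operations used below; membership settles measurability, integrability and Fubini at once.\<close>

definition pg :: "('a::real_normed_vector \<Rightarrow> real) \<Rightarrow> bool" where
  "pg f \<longleftrightarrow> continuous_on UNIV f \<and> (\<exists>C p. \<forall>x. \<bar>f x\<bar> \<le> C * (1 + norm x) ^ p)"

lemma pgE: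
  assumes "pg f"
  obtains C p where "C \<ge> 0" "\<And>x. \<bar>f x\<bar> \<le> C * (1 + norm x) ^ p"
proof -
  obtain C p where *: "\<And>x. \<bar>f x\<bar> \<le> C * (1 + norm x) ^ p" using assms by (auto simp: pg_def)
  have "0 \<le> C * (1 + norm (0::'a)) ^ p" by (rule order.trans[OF abs_ge_zero *])
  then have "C \<ge> 0" by simp
  then show ?thesis using * by (rule that)
qed

lemma pg_const [simp, intro]: "pg (\<lambda>x. c)"
  unfolding pg_def by (intro conjI exI[of _ "\<bar>c\<bar>"] exI[of _ 0]) auto

lemma pg_linear [intro]: "bounded_linear f \<Longrightarrow> pg f"
proof -
  assume f: "bounded_linear f"
  then obtain K where "\<And>x. norm (f x) \<le> norm x * K" "K > 0" using bounded_linear.pos_bounded by blast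
  then have "\<bar>f x\<bar> \<le> K * (1 + norm x) ^ 1" for x
    by (metis add.commute add_increasing2 linorder_not_le mult.commute mult_le_cancel_left_pos not_le_imp_less order_trans power_one_right real_norm_def zero_le_one order_refl)
  then show ?thesis unfolding pg_def using linear_continuous_on[OF f] by blast
qed

lemma pg_mult [intro]:
  assumes "pg f" "pg g"
  shows "pg (\<lambda>x. f x * g x)"
proof -
  obtain C p where C: "C \<ge> 0" "\<And>x. \<bar>f x\<bar> \<le> C * (1 + norm x) ^ p" using pgE[OF assms(1)] by metis
  obtain D q where D: "D \<ge> 0" "\<And>x. \<bar>g x\<bar> \<le> D * (1 + norm x) ^ q" using pgE[OF assms(2)] by metis
  have "\<bar>f x * g x\<bar> \<le> (C * D) * (1 + norm x) ^ (p + q)" for x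
  proof -
    have "\<bar>f x * g x\<bar> \<le> (C * (1 + norm x) ^ p) * (D * (1 + norm x) ^ q)"
      unfolding abs_mult by (intro mult_mono C D) (auto simp: C D)
    then show ?thesis by (simp add: power_add mult_ac)
  qed
  then show ?thesis using assms unfolding pg_def by (intro conjI continuous_on_mult) auto
qed

lemma pg_add [intro]:
  assumes "pg f" "pg g"
  shows "pg (\<lambda>x. f x + g x)"
proof -
  obtain C p where C: "C \<ge> 0" "\<And>x. \<bar>f x\<bar> \<le> C * (1 + norm x) ^ p" using pgE[OF assms(1)] by metis
  obtain D q where D: "D \<ge> 0" "\<And>x. \<bar>g x\<bar> \<le> D * (1 + norm x) ^ q" using pgE[OF assms(2)] by metis
  have "\<bar>f x + g x\<bar> \<le> (C + D) * (1 + norm x) ^ (p + q)" for x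
  proof -
    have "C * (1 + norm x) ^ p \<le> C * (1 + norm x) ^ (p + q)"
      by (intro mult_left_mono power_increasing) (auto simp: C)
    moreover have "D * (1 + norm x) ^ q \<le> D * (1 + norm x) ^ (p + q)"
      by (intro mult_left_mono power_increasing) (auto simp: D)
    ultimately show ?thesis using C(2)[of x] D(2)[of x] by (simp add: distrib_right)
  qed
  then show ?thesis using assms unfolding pg_def by (intro conjI continuous_on_add) auto
qed

lemma pg_minus [intro]: "pg f \<Longrightarrow> pg (\<lambda>x. - f x)"
  using pg_mult[OF pg_const[of "-1"]] by simp

lemma pg_diff [intro]: "pg f \<Longrightarrow> pg g \<Longrightarrow> pg (\<lambda>x. f x - g x)"
  using pg_add[OF _ pg_minus] by simp

lemma pg_sum [intro]: "(\<And>i. i \<in> I \<Longrightarrow> pg (f i)) \<Longrightarrow> pg (\<lambda>x. \<Sum>i\<in>I. f i x)"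
  by (induction I rule: infinite_finite_induct) auto

lemma pg_prod [intro]: "(\<And>i. i \<in> I \<Longrightarrow> pg (f i)) \<Longrightarrow> pg (\<lambda>x. \<Prod>i\<in>I. f i x)"
  by (induction I rule: infinite_finite_induct) auto

lemma pg_power [intro]: "pg f \<Longrightarrow> pg (\<lambda>x. f x ^ k)"
  by (induction k) auto

lemma pg_compose:
  assumes f: "pg f" and g: "continuous_on UNIV g" "\<And>x. norm (g x) \<le> C * (1 + norm x) ^ p"
  shows "pg (\<lambda>x. f (g x))"
proof -
  obtain D q where D: "D \<ge> 0" "\<And>x. \<bar>f x\<bar> \<le> D * (1 + norm x) ^ q" using pgE[OF f] by metis
  have "\<bar>f (g x)\<bar> \<le> (D * (1 + \<bar>C\<bar>) ^ q) * (1 + norm x) ^ (p * q)" for x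
  proof -
    have "1 + norm (g x) \<le> (1 + \<bar>C\<bar>) * (1 + norm x) ^ p"
    proof -
      have "C * (1 + norm x) ^ p \<le> \<bar>C\<bar> * (1 + norm x) ^ p" by (intro mult_right_mono) auto
      moreover have "1 \<le> (1 + norm x) ^ p" by (rule one_le_power) simp
      ultimately show ?thesis using g(2)[of x] unfolding distrib_right by linarith
    qed
    then have "(1 + norm (g x)) ^ q \<le> ((1 + \<bar>C\<bar>) * (1 + norm x) ^ p) ^ q" by (intro power_mono) auto
    then have "D * (1 + norm (g x)) ^ q \<le> D * (((1 + \<bar>C\<bar>) * (1 + norm x) ^ p) ^ q)" by (rule mult_left_mono) (rule D)
    then show ?thesis using D(2)[of "g x"] by (simp add: power_mult_distrib power_mult mult_ac)
  qed
  moreover have "continuous_on UNIV (\<lambda>x. f (g x))"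
    using f g(1) unfolding pg_def by (auto intro: continuous_on_compose2)
  ultimately show ?thesis unfolding pg_def by blast
qed

lemma pg_measurable: "pg f \<Longrightarrow> f \<in> borel_measurable borel"
  by (simp add: pg_def borel_measurable_continuous_onI)

text \<open>The measures for which every function in \<open>pg\<close> is integrable: Gaussian
  measures, the Lebesgue measure on the contractions, and their images under continuous maps of
  polynomial growth.\<close>

definition has_moments :: "'a::real_normed_vector measure \<Rightarrow> bool" where
  "has_moments M \<longleftrightarrow> sets M = sets borel \<and> finite_measure M \<and> (\<forall>p. integrable M (\<lambda>x. (1 + norm x) ^ p))"

lemma integrable_pg:
  assumes M: "has_moments M" and f: "pg f"
  shows "integrable M f"
proof -
  obtain C p where C: "C \<ge> 0" "\<And>x. \<bar>f x\<bar> \<le> C * (1 + norm x) ^ p" using pgE[OF f] by metis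
  have s: "sets M = sets borel" using M by (simp add: has_moments_def)
  have m: "f \<in> borel_measurable M"
    using pg_measurable[OF f] by (simp add: measurable_cong_sets[OF s refl])
  have i: "integrable M (\<lambda>x. C * (1 + norm x) ^ p)" using M by (simp add: has_moments_def)
  have "AE x in M. norm (f x) \<le> norm (C * (1 + norm x) ^ p)"
  proof (rule AE_I2)
    fix x :: 'a
    have "0 \<le> (1 + norm x) ^ p" by simp
    then show "norm (f x) \<le> norm (C * (1 + norm x) ^ p)"
      using C(2)[of x] C(1) by (simp add: abs_mult)
  qed
  then show ?thesis by (rule Bochner_Integration.integrable_bound[OF i m])
qed

lemma has_moments_gaussM: "has_moments (gaussM :: 'a::euclidean_space measure)"
  unfolding has_moments_def
proof (intro conjI allI)
  interpret prob_space "gaussM :: 'a measure" by (rule prob_space_gaussM)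
  show "finite_measure (gaussM :: 'a measure)" by (rule finite_measure_axioms)
  fix p :: nat
  \<comment> \<open>A single term of the exponential series bounds the power by
    \<open>fact p * exp (1 + norm x)\<close>, and
    \<open>1 + norm x \<le> 2 + (norm x)\<^sup>2 / 4\<close> leaves half of the Gaussian exponent
    for convergence.\<close>
  have bound: "(1 + norm x) ^ p \<le> fact p * exp 2 * exp ((norm x)\<^sup>2 / 4)" for x :: 'a
  proof -
    have "(1 + norm x) ^ p / fact p \<le> exp (1 + norm x)"
    proof -
      have "(1 + norm x) ^ p / fact p = (\<Sum>n\<in>{p}. (1 + norm x) ^ n /\<^sub>R fact n)" by (simp add: field_simps)
      also have "\<dots> \<le> suminf (\<lambda>n. (1 + norm x) ^ n /\<^sub>R fact n)"
        by (rule sum_le_suminf[OF summable_exp_generic]) auto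
      finally show ?thesis by (simp add: exp_def)
    qed
    also have "1 + norm x \<le> 2 + (norm x)\<^sup>2 / 4"
      using zero_le_power2[of "norm x / 2 - 1"] by (simp add: power2_diff power_divide)
    finally have "(1 + norm x) ^ p / fact p \<le> exp (2 + (norm x)\<^sup>2 / 4)" by simp
    then have "(1 + norm x) ^ p / fact p \<le> exp 2 * exp ((norm x)\<^sup>2 / 4)" by (simp only: exp_add)
    then show ?thesis by (simp add: pos_divide_le_eq mult_ac)
  qed
  have "integrable lborel (\<lambda>x::'a. gw x *\<^sub>R (1 + norm x) ^ p)"
  proof (rule Bochner_Integration.integrable_bound)
    have "(\<integral>\<^sup>+x. ennreal (exp (- (norm x)\<^sup>2 / (2 * (sqrt 2)\<^sup>2))) \<partial>(lborel :: 'a measure)) < \<infinity>"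
      by (subst nn_integral_exp_norm) auto
    then have "integrable lborel (\<lambda>x::'a. exp (- (norm x)\<^sup>2 / 4))"
      by (intro integrableI_nonneg) auto
    then show "integrable lborel (\<lambda>x::'a. (fact p * exp 2 / sqrt (2 * pi) ^ DIM('a)) * exp (- (norm x)\<^sup>2 / 4))"
      by (rule integrable_mult_right)
    show "AE x::'a in lborel. norm (gw x *\<^sub>R (1 + norm x) ^ p) \<le> norm (fact p * exp 2 / sqrt (2 * pi) ^ DIM('a) * exp (- (norm x)\<^sup>2 / 4))"
    proof (rule AE_I2)
      fix x :: 'a
      have "gw x * (1 + norm x) ^ p \<le> gw x * (fact p * exp 2 * exp ((norm x)\<^sup>2 / 4))"
        by (intro mult_left_mono bound) simp
      also have "\<dots> = fact p * exp 2 / sqrt (2 * pi) ^ DIM('a) * (exp (- (norm x)\<^sup>2 / 2) * exp ((norm x)\<^sup>2 / 4))"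
        by (simp add: gw_def)
      also have "exp (- (norm x)\<^sup>2 / 2) * exp ((norm x)\<^sup>2 / 4) = exp (- (norm x)\<^sup>2 / 4)"
        by (simp add: exp_add[symmetric])
      finally show "norm (gw x *\<^sub>R (1 + norm x) ^ p) \<le> norm (fact p * exp 2 / sqrt (2 * pi) ^ DIM('a) * exp (- (norm x)\<^sup>2 / 4))"
        by simp
    qed
  qed measurable
  then show "integrable gaussM (\<lambda>x::'a. (1 + norm x) ^ p)"
    unfolding gaussM_def by (subst integrable_density) auto
qed simp

lemma has_moments_distr:
  fixes g :: "'a::real_normed_vector \<Rightarrow> 'b::real_normed_vector"
  assumes M: "has_moments M" and g: "continuous_on UNIV g" "\<And>x. norm (g x) \<le> C * (1 + norm x) ^ p"
  shows "has_moments (distr M borel g)"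
proof -
  have s: "sets M = sets borel" and fin: "finite_measure M" using M by (auto simp: has_moments_def)
  have gm: "g \<in> M \<rightarrow>\<^sub>M borel"
    using borel_measurable_continuous_onI[OF g(1)] by (simp add: measurable_cong_sets[OF s refl])
  have "integrable (distr M borel g) (\<lambda>x. (1 + norm x) ^ q)" for q
  proof (subst integrable_distr_eq[OF gm])
    have "pg (\<lambda>x::'b. (1 + norm x) ^ q)"
      unfolding pg_def by (intro conjI exI[of _ 1] exI[of _ q]) (auto intro!: continuous_intros)
    from integrable_pg[OF M pg_compose[OF this g]]
    show "integrable M (\<lambda>x. (1 + norm (g x)) ^ q)" .
  qed measurable
  then show ?thesis
    using finite_measure.finite_measure_distr[OF fin gm] by (simp add: has_moments_def)
qed

text \<open>The bound \<open>1 + norm (x, y) \<le> (1 + norm x) * (1 + norm y)\<close> splits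
  polynomial growth on the product space into a product of moments.\<close>

lemma pg_pair_integrable:
  fixes f :: "'a::euclidean_space \<times> 'b::euclidean_space \<Rightarrow> real"
  assumes M: "has_moments M" and N: "has_moments N" and f: "pg f"
  shows "integrable (M \<Otimes>\<^sub>M N) f"
proof -
  have s: "sets M = sets borel" "sets N = sets borel" and fin: "finite_measure M" "finite_measure N"
    using M N by (auto simp: has_moments_def)
  interpret M: finite_measure M by fact
  interpret N: finite_measure N by fact
  interpret P: pair_sigma_finite M N by standard
  have sp: "sets (M \<Otimes>\<^sub>M N) = sets borel" by (simp add: borel_prod[symmetric] sets_pair_measure_cong[OF s])
  obtain C p where C: "C \<ge> 0" "\<And>x. \<bar>f x\<bar> \<le> C * (1 + norm x) ^ p" using pgE[OF f] by metis
  have "integrable (M \<Otimes>\<^sub>M N) (\<lambda>z. C * ((1 + norm (fst z)) ^ p * (1 + norm (snd z)) ^ p))"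
  proof (intro integrable_mult_right)
    have mm: "(\<lambda>x. (1 + norm x) ^ p) \<in> borel_measurable M" "(\<lambda>x. (1 + norm x) ^ p) \<in> borel_measurable N"
      by (simp_all add: measurable_cong_sets[OF s(1) refl] measurable_cong_sets[OF s(2) refl])
    have *: "(\<integral>\<^sup>+z. ennreal (norm ((1 + norm (fst z)) ^ p * (1 + norm (snd z)) ^ p)) \<partial>(M \<Otimes>\<^sub>M N)) < \<infinity>"
    proof -
      have "(\<integral>\<^sup>+z. ennreal (norm ((1 + norm (fst z)) ^ p * (1 + norm (snd z)) ^ p)) \<partial>(M \<Otimes>\<^sub>M N))
        = (\<integral>\<^sup>+x. \<integral>\<^sup>+y. ennreal ((1 + norm x) ^ p) * ennreal ((1 + norm y) ^ p) \<partial>N \<partial>M)"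
      proof (subst N.nn_integral_fst[symmetric])
        show "(\<lambda>z. ennreal (norm ((1 + norm (fst z)) ^ p * (1 + norm (snd z)) ^ p))) \<in> borel_measurable (M \<Otimes>\<^sub>M N)"
          unfolding measurable_cong_sets[OF sp refl]
          by (intro measurable_compose[OF _ measurable_ennreal] borel_measurable_continuous_onI continuous_intros)
      qed (simp add: ennreal_mult' abs_mult power_abs)
      also have "\<dots> = (\<integral>\<^sup>+x. ennreal ((1 + norm x) ^ p) \<partial>M) * (\<integral>\<^sup>+y. ennreal ((1 + norm y) ^ p) \<partial>N)"
        using mm by (simp add: nn_integral_cmult nn_integral_multc)
      also have "\<dots> < \<infinity>"
      proof -
        have "(\<integral>\<^sup>+x. ennreal ((1 + norm x) ^ p) \<partial>M) < \<infinity>" "(\<integral>\<^sup>+x. ennreal ((1 + norm x) ^ p) \<partial>N) < \<infinity>"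
          using M N unfolding has_moments_def integrable_iff_bounded by (auto simp: power_abs)
        then show ?thesis by (simp add: ennreal_mult_less_top)
      qed
      finally show ?thesis .
    qed
    show "integrable (M \<Otimes>\<^sub>M N) (\<lambda>z. (1 + norm (fst z)) ^ p * (1 + norm (snd z)) ^ p)"
      unfolding integrable_iff_bounded using *
      by (auto simp: measurable_cong_sets[OF sp refl] intro!: borel_measurable_continuous_onI continuous_intros)
  qed
  moreover have "f \<in> borel_measurable (M \<Otimes>\<^sub>M N)"
    using pg_measurable[OF f] by (simp add: measurable_cong_sets[OF sp refl])
  moreover have "AE z in M \<Otimes>\<^sub>M N. norm (f z) \<le> norm (C * ((1 + norm (fst z)) ^ p * (1 + norm (snd z)) ^ p))"
  proof (rule AE_I2)
    fix z :: "'a \<times> 'b"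
    have "norm z \<le> norm (fst z) + norm (snd z)" by (metis norm_Pair_le prod.collapse)
    moreover have "0 \<le> norm (fst z) * norm (snd z)" by simp
    ultimately have "1 + norm z \<le> (1 + norm (fst z)) * (1 + norm (snd z))"
      unfolding distrib_right distrib_left mult_1_left mult_1_right by linarith
    then have "(1 + norm z) ^ p \<le> ((1 + norm (fst z)) * (1 + norm (snd z))) ^ p" by (intro power_mono) auto
    then have "C * (1 + norm z) ^ p \<le> C * ((1 + norm (fst z)) * (1 + norm (snd z))) ^ p" by (rule mult_left_mono) (rule C)
    with C(2)[of z] show "norm (f z) \<le> norm (C * ((1 + norm (fst z)) ^ p * (1 + norm (snd z)) ^ p))"
      using C(1) by (simp add: power_mult_distrib abs_mult)
  qed
  ultimately show ?thesis by (rule Bochner_Integration.integrable_bound)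
qed

lemma pg_Fubini:
  fixes f :: "'a::euclidean_space \<times> 'b::euclidean_space \<Rightarrow> real"
  assumes M: "has_moments M" and N: "has_moments N" and f: "pg f"
  shows "(\<integral>x. \<integral>y. f (x, y) \<partial>N \<partial>M) = (\<integral>y. \<integral>x. f (x, y) \<partial>M \<partial>N)"
proof -
  interpret M: finite_measure M using M by (simp add: has_moments_def)
  interpret N: finite_measure N using N by (simp add: has_moments_def)
  interpret P: pair_sigma_finite M N by standard
  show ?thesis using P.Fubini_integral[of "\<lambda>x y. f (x, y)"] pg_pair_integrable[OF assms] by simp
qed

section \<open>Spherical polynomials\<close>

lemma pg_entry [intro]: "pg (\<lambda>Y :: real ^ 'n ^ 'm. Y $ i $ j)"
  by (intro pg_linear bounded_linear_compose[OF bounded_linear_vec_nth bounded_linear_vec_nth])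

lemma pg_fst_entry [intro]: "pg (\<lambda>z :: (real ^ 'n ^ 'm) \<times> 'b::real_normed_vector. fst z $ i $ j)"
  by (intro pg_linear bounded_linear_compose[OF bounded_linear_vec_nth]
      bounded_linear_compose[OF bounded_linear_vec_nth] bounded_linear_fst)

lemma pg_snd_entry [intro]: "pg (\<lambda>z :: 'b::real_normed_vector \<times> (real ^ 'n ^ 'm). snd z $ i $ j)"
  by (intro pg_linear bounded_linear_compose[OF bounded_linear_vec_nth]
      bounded_linear_compose[OF bounded_linear_vec_nth] bounded_linear_snd)

lemma pg_matrix_mult [intro]:
  assumes "\<And>i j. pg (\<lambda>x. F x $ i $ j)" "\<And>i j. pg (\<lambda>x. G x $ i $ j)"
  shows "pg (\<lambda>x. (F x ** G x) $ i $ j)"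
  unfolding matrix_matrix_mult_def vec_lambda_beta by (intro pg_sum pg_mult assms)

lemma pg_transpose [intro]: "(\<And>i j. pg (\<lambda>x. F x $ i $ j)) \<Longrightarrow> pg (\<lambda>x. transpose (F x) $ i $ j)"
  by (simp add: transpose_def)

lemma pg_det [intro]:
  assumes "\<And>i j. pg (\<lambda>x. F x $ i $ j)"
  shows "pg (\<lambda>x. det (F x))"
  unfolding det_def by (intro pg_sum pg_mult pg_prod pg_const assms)

lemma pg_trace [intro]: "(\<And>i. pg (\<lambda>x. F x $ i $ i)) \<Longrightarrow> pg (\<lambda>x. trace (F x))"
  unfolding trace_def by auto

lemma pg_pm [intro]:
  assumes "\<And>i j. pg (\<lambda>x. F x $ i $ j)"
  shows "pg (\<lambda>x. pm I (F x))"
  unfolding pm_def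
proof (rule pg_det)
  fix i j show "pg (\<lambda>x. trunc I (F x) $ i $ j)"
    by (cases "i \<in> I \<and> j \<in> I"; cases "i = j") (auto simp: trunc_def assms)
qed

text \<open>The mean \<open>vh \<kappa> C\<close> of the power function \<open>dlt \<kappa>\<close> will turn out to be a multiple of the zonal
  polynomial, with the constant \<open>gam\<close> below.\<close>

definition dlt :: "(nat \<Rightarrow> nat) \<Rightarrow> real ^ 'm ^ 'm \<Rightarrow> real" where
  "dlt \<kappa> Z = (\<Prod>r<CARD('m). pm (seg (Suc r)) Z ^ (\<kappa> r - \<kappa> (Suc r)))"

lemma pg_dlt [intro]:
  assumes "\<And>i j. pg (\<lambda>x. F x $ i $ j)"
  shows "pg (\<lambda>x. dlt \<kappa> (F x))"
  unfolding dlt_def by (intro pg_prod pg_power pg_pm assms)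

lemma dlt_lower_conj:
  "lower_triangular T \<Longrightarrow> dlt \<kappa> (T ** Z ** transpose T) = dlt \<kappa> (T ** transpose T) * dlt \<kappa> Z"
  by (simp add: dlt_def pm_lower_conj power_mult_distrib prod.distrib)

definition vh :: "(nat \<Rightarrow> nat) \<Rightarrow> real ^ 'm ^ 'm \<Rightarrow> real" where
  "vh \<kappa> C = (\<integral>Y. dlt \<kappa> (Y ** C ** transpose Y) \<partial>(gaussM :: (real ^ 'm ^ 'm) measure))"

section \<open>Norm-preserving maps of matrices and the invariance of the Gaussian measure\<close>

lemma norm_sq_matrix: "(norm Y)\<^sup>2 = (\<Sum>i\<in>UNIV. \<Sum>j\<in>UNIV. (Y $ i $ j)\<^sup>2)" for Y :: "real ^ 'n ^ 'm"
  unfolding power2_norm_eq_inner inner_vec_def by (simp add: power2_eq_square)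

lemma norm_sq_row: "(norm (row i Y))\<^sup>2 = (\<Sum>j\<in>UNIV. (Y $ i $ j)\<^sup>2)" for Y :: "real ^ 'n ^ 'm"
  unfolding power2_norm_eq_inner inner_vec_def by (simp add: row_def power2_eq_square)

lemma norm_sq_column: "(norm (column j Y))\<^sup>2 = (\<Sum>i\<in>UNIV. (Y $ i $ j)\<^sup>2)" for Y :: "real ^ 'n ^ 'm"
  unfolding power2_norm_eq_inner inner_vec_def by (simp add: column_def power2_eq_square)

lemma norm_matrix_transpose: "norm (transpose Y) = norm Y" for Y :: "real ^ 'n ^ 'm"
proof -
  have "(norm (transpose Y))\<^sup>2 = (norm Y)\<^sup>2"
    unfolding norm_sq_matrix transpose_def by (simp add: sum.swap[of _ "UNIV :: 'm set"])
  then show ?thesis by simp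
qed

lemma norm_orthogonal_left:
  fixes Y :: "real ^ 'n ^ 'm"
  assumes U: "orthogonal_matrix U"
  shows "norm (U ** Y) = norm Y"
proof -
  have "(norm (U ** Y))\<^sup>2 = (norm Y)\<^sup>2"
  proof -
    have cs: "(norm A)\<^sup>2 = (\<Sum>j\<in>UNIV. (norm (column j A))\<^sup>2)" for A :: "real ^ 'n ^ 'm"
      by (simp add: norm_sq_matrix norm_sq_column sum.swap[of _ "UNIV :: 'm set"])
    have "column j (U ** Y) = U *v column j Y" for j
      by (simp add: vec_eq_iff column_def matrix_matrix_mult_def matrix_vector_mult_def)
    moreover have "norm (U *v x) = norm x" for x
      using U by (metis orthogonal_transformation_matrix orthogonal_transformation_norm matrix_of_matrix_vector_mul matrix_vector_mul_linear)
    ultimately show ?thesis by (simp add: cs)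
  qed
  then show ?thesis by simp
qed

lemma norm_orthogonal_right:
  fixes Y :: "real ^ 'n ^ 'm"
  assumes U: "orthogonal_matrix U"
  shows "norm (Y ** U) = norm Y"
proof -
  have "orthogonal_matrix (transpose U)" using U by simp
  from norm_orthogonal_left[OF this, of "transpose Y"] show ?thesis
    by (metis matrix_transpose_mul norm_matrix_transpose)
qed

lemma linear_left_mult: "linear (\<lambda>Y :: real ^ 'n ^ 'm. (U :: real ^ 'm ^ 'k) ** Y)"
  by (auto simp: linear_iff vec_eq_iff
      matrix_matrix_mult_def sum_distrib_left mult_ac distrib_left sum.distrib)

lemma linear_right_mult: "linear (\<lambda>Y :: real ^ 'n ^ 'm. Y ** (U :: real ^ 'k ^ 'n))"
  by (auto simp: linear_iff vec_eq_iff
      matrix_matrix_mult_def sum_distrib_left mult_ac distrib_right distrib_left sum.distrib)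

lemma linear_transpose: "linear (transpose :: real ^ 'n ^ 'm \<Rightarrow> _)"
  by (auto simp: linear_iff vec_eq_iff transpose_def)

lemma gaussM_left: "orthogonal_matrix U \<Longrightarrow> distr gaussM borel (\<lambda>Y :: real ^ 'n ^ 'm. U ** Y) = gaussM"
  by (rule gaussM_isometry[OF linear_left_mult norm_orthogonal_left]) auto

lemma gaussM_right: "orthogonal_matrix U \<Longrightarrow> distr gaussM borel (\<lambda>Y :: real ^ 'n ^ 'm. Y ** U) = gaussM"
  by (rule gaussM_isometry[OF linear_right_mult norm_orthogonal_right]) auto

lemma gaussM_transpose: "distr gaussM borel (transpose :: real ^ 'n ^ 'm \<Rightarrow> _) = gaussM"
  by (rule gaussM_isometry[OF linear_transpose norm_matrix_transpose]) (simp add: mult.commute)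

lemma linear_borel_measurable: "linear f \<Longrightarrow> f \<in> borel_measurable borel"
  for f :: "'a::euclidean_space \<Rightarrow> 'b::euclidean_space"
  by (intro borel_measurable_continuous_onI) (metis linear_continuous_on linear_conv_bounded_linear)

lemma integral_gaussM_distr:
  fixes f :: "'a::euclidean_space \<Rightarrow> 'b::euclidean_space" and g :: "'b \<Rightarrow> real"
  assumes "distr gaussM borel f = gaussM" "linear f" "g \<in> borel_measurable borel"
  shows "(\<integral>x. g (f x) \<partial>gaussM) = (\<integral>x. g x \<partial>gaussM)"
proof -
  have "f \<in> gaussM \<rightarrow>\<^sub>M borel"
    using linear_borel_measurable[OF assms(2)] by (simp add: measurable_cong_sets[OF sets_gaussM refl])
  from integral_distr[OF this assms(3)] show ?thesis by (simp add: assms(1))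
qed

lemmas integral_gaussM_left = integral_gaussM_distr[OF gaussM_left linear_left_mult]
lemmas integral_gaussM_right = integral_gaussM_distr[OF gaussM_right linear_right_mult]
lemmas integral_gaussM_transpose = integral_gaussM_distr[OF gaussM_transpose linear_transpose]

text \<open>Replacing \<open>Y\<close> by \<open>Y ** U\<close> does not change the Gaussian
  measure.\<close>

lemma vh_orthogonal:
  assumes U: "orthogonal_matrix (U :: real ^ 'm ^ 'm)"
  shows "vh \<kappa> (U ** C ** transpose U) = vh \<kappa> C"
proof -
  have "vh \<kappa> (U ** C ** transpose U) = (\<integral>Y. dlt \<kappa> ((Y ** U) ** C ** transpose (Y ** U)) \<partial>(gaussM :: (real ^ 'm ^ 'm) measure))"
    by (simp add: vh_def matrix_transpose_mul matrix_mul_assoc)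
  also have "\<dots> = vh \<kappa> C" unfolding vh_def
    by (rule integral_gaussM_right[OF U]) (intro pg_measurable pg_dlt pg_matrix_mult pg_transpose pg_entry pg_const)
  finally show ?thesis .
qed

definition oinv :: "(real ^ 'm ^ 'm) measure \<Rightarrow> bool" where
  "oinv \<nu> \<longleftrightarrow> (\<forall>U. orthogonal_matrix U \<longrightarrow> distr \<nu> borel (\<lambda>Z. U ** Z ** transpose U) = \<nu>)"

lemma oinv_dlt:
  fixes U :: "real ^ 'm ^ 'm"
  assumes "oinv \<nu>" "has_moments \<nu>" "orthogonal_matrix U"
  shows "(\<integral>Z. dlt \<kappa> (U ** Z ** transpose U) \<partial>\<nu>) = (\<integral>Z. dlt \<kappa> Z \<partial>\<nu>)"
proof -
  have s: "sets \<nu> = sets borel" using assms by (simp add: has_moments_def)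
  have "linear (\<lambda>Z. U ** Z ** transpose U)"
    using linear_compose[OF linear_left_mult linear_right_mult] by (simp add: comp_def)
  then have m: "(\<lambda>Z. U ** Z ** transpose U) \<in> \<nu> \<rightarrow>\<^sub>M borel"
    using linear_borel_measurable by (simp add: measurable_cong_sets[OF s refl])
  have "(\<integral>Z. dlt \<kappa> (U ** Z ** transpose U) \<partial>\<nu>) = (\<integral>Z. dlt \<kappa> Z \<partial>distr \<nu> borel (\<lambda>Z. U ** Z ** transpose U))"
    by (rule integral_distr[symmetric, OF m]) (intro pg_measurable pg_dlt pg_entry)
  then show ?thesis using assms by (simp add: oinv_def)
qed

text \<open>Write \<open>L\<close> as a lower triangular matrix times an orthogonal one.\<close>

lemma dlt_conj_mean:
  fixes L :: "real ^ 'm ^ 'm"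
  assumes "oinv \<nu>" "has_moments \<nu>"
  shows "(\<integral>Z. dlt \<kappa> (L ** Z ** transpose L) \<partial>\<nu>) = dlt \<kappa> (L ** transpose L) * (\<integral>Z. dlt \<kappa> Z \<partial>\<nu>)"
proof -
  obtain T H where TH: "lower_triangular T" "orthogonal_matrix H" "L = T ** H"
    using lower_orthogonal_decomposition by blast
  have LZ: "L ** Z ** transpose L = T ** (H ** Z ** transpose H) ** transpose T" for Z
    by (simp add: TH(3) matrix_transpose_mul matrix_mul_assoc)
  have "L ** transpose L = T ** transpose T"
    using TH(2) LZ[of "mat 1"] by (simp add: orthogonal_matrix_def)
  moreover have "(\<integral>Z. dlt \<kappa> (L ** Z ** transpose L) \<partial>\<nu>) = dlt \<kappa> (T ** transpose T) * (\<integral>Z. dlt \<kappa> (H ** Z ** transpose H) \<partial>\<nu>)"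
    by (simp add: LZ dlt_lower_conj[OF TH(1)])
  ultimately show ?thesis by (simp add: oinv_dlt[OF assms TH(2)])
qed

text \<open>The two means are exchanged; for fixed \<open>Y\<close> the inner one is
  \<open>dlt_conj_mean\<close> with \<open>L\<close> equal to \<open>Y\<close> times the square root
  of \<open>diagm b\<close>. This is the Gaussian form of the product formula for spherical
  functions and the source of the diagonal expansions below.\<close>

theorem vh_conj_mean:
  fixes b :: "'m::finite \<Rightarrow> real"
  assumes \<nu>: "oinv \<nu>" "has_moments \<nu>" and b: "\<And>i. b i \<ge> 0"
  shows "(\<integral>Z. vh \<kappa> (diagm (\<lambda>i. sqrt (b i)) ** Z ** diagm (\<lambda>i. sqrt (b i))) \<partial>\<nu>) = vh \<kappa> (diagm b) * (\<integral>Z. dlt \<kappa> Z \<partial>\<nu>)"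
proof -
  let ?S = "diagm (\<lambda>i. sqrt (b i)) :: real ^ 'm ^ 'm"
  have SS: "?S ** ?S = diagm b" using b by (simp add: diagm_mult)
  have "(\<integral>Z. vh \<kappa> (?S ** Z ** ?S) \<partial>\<nu>)
      = (\<integral>Z. \<integral>Y. (\<lambda>(Z, Y). dlt \<kappa> (Y ** (?S ** Z ** ?S) ** transpose Y)) (Z, Y) \<partial>(gaussM :: (real ^ 'm ^ 'm) measure) \<partial>\<nu>)"
    by (simp add: vh_def)
  also have "\<dots> = (\<integral>Y. \<integral>Z. (\<lambda>(Z, Y). dlt \<kappa> (Y ** (?S ** Z ** ?S) ** transpose Y)) (Z, Y) \<partial>\<nu> \<partial>(gaussM :: (real ^ 'm ^ 'm) measure))"
    unfolding split_beta
    by (rule pg_Fubini[OF \<nu>(2) has_moments_gaussM])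
      (intro pg_dlt pg_matrix_mult pg_transpose pg_fst_entry pg_snd_entry pg_const)
  also have "\<dots> = (\<integral>Y. dlt \<kappa> (Y ** diagm b ** transpose Y) * (\<integral>Z. dlt \<kappa> Z \<partial>\<nu>) \<partial>(gaussM :: (real ^ 'm ^ 'm) measure))"
  proof (intro Bochner_Integration.integral_cong refl)
    fix Y :: "real ^ 'm ^ 'm"
    have "Y ** (?S ** Z ** ?S) ** transpose Y = (Y ** ?S) ** Z ** transpose (Y ** ?S)" for Z
      by (simp add: matrix_transpose_mul matrix_mul_assoc)
    moreover have "(Y ** ?S) ** transpose (Y ** ?S) = Y ** diagm b ** transpose Y"
      by (simp add: matrix_transpose_mul SS[symmetric] matrix_mul_assoc)
    ultimately show "(\<integral>Z. (\<lambda>(Z, Y). dlt \<kappa> (Y ** (?S ** Z ** ?S) ** transpose Y)) (Z, Y) \<partial>\<nu>)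
        = dlt \<kappa> (Y ** diagm b ** transpose Y) * (\<integral>Z. dlt \<kappa> Z \<partial>\<nu>)"
      using dlt_conj_mean[OF \<nu>, of \<kappa> "Y ** ?S"] by simp
  qed
  also have "\<dots> = vh \<kappa> (diagm b) * (\<integral>Z. dlt \<kappa> Z \<partial>\<nu>)" by (simp add: vh_def)
  finally show ?thesis .
qed

lemma pg_vh:
  "pg (\<lambda>Y :: real ^ 'm ^ 'm. dlt \<kappa> (Y ** C ** transpose Y))"
  by (intro pg_dlt pg_matrix_mult pg_transpose pg_entry pg_const)

section \<open>Laws of sandwich products and termwise integration of expansions\<close>

lemma norm_matrix_mult_le: "norm (A ** B) \<le> norm A * norm B" for A :: "real ^ 'n ^ 'm" and B :: "real ^ 'k ^ 'n"
proof -
  have "(norm (A ** B))\<^sup>2 = (\<Sum>i\<in>UNIV. \<Sum>j\<in>UNIV. (row i A \<bullet> column j B)\<^sup>2)"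
    by (simp add: norm_sq_matrix matrix_matrix_mult_def inner_vec_def row_def column_def)
  also have "\<dots> \<le> (\<Sum>i\<in>UNIV. \<Sum>j\<in>UNIV. (norm (row i A))\<^sup>2 * (norm (column j B))\<^sup>2)"
    by (intro sum_mono) (simp add: Cauchy_Schwarz_ineq power2_norm_eq_inner)
  also have "\<dots> = (\<Sum>i\<in>UNIV. (norm (row i A))\<^sup>2) * (\<Sum>j\<in>UNIV. (norm (column j B))\<^sup>2)"
    by (simp add: sum_product)
  also have "(\<Sum>i\<in>UNIV. (norm (row i A))\<^sup>2) = (norm A)\<^sup>2"
    by (simp add: norm_sq_matrix norm_sq_row)
  also have "(\<Sum>j\<in>UNIV. (norm (column j B))\<^sup>2) = (norm B)\<^sup>2"
    by (simp add: norm_sq_matrix norm_sq_column sum.swap[of _ "UNIV :: 'n set"])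
  finally have "(norm (A ** B))\<^sup>2 \<le> (norm A * norm B)\<^sup>2" by (simp add: power_mult_distrib)
  then show ?thesis by (rule power2_le_imp_le) simp
qed

lemma continuous_sandwich: "continuous_on UNIV (\<lambda>Y :: real ^ 'n ^ 'm. Y ** B ** transpose Y)"
proof -
  have "continuous_on UNIV (\<lambda>Y :: real ^ 'n ^ 'm. \<chi> i j. (Y ** B ** transpose Y) $ i $ j)"
  proof (intro continuous_on_vec_lambda)
    fix i j
    have "pg (\<lambda>Y :: real ^ 'n ^ 'm. (Y ** B ** transpose Y) $ i $ j)"
      by (intro pg_matrix_mult pg_transpose pg_entry pg_const)
    then show "continuous_on UNIV (\<lambda>Y :: real ^ 'n ^ 'm. (Y ** B ** transpose Y) $ i $ j)" by (simp add: pg_def)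
  qed
  then show ?thesis by simp
qed

lemma norm_sandwich_le: "norm (Y ** B ** transpose Y) \<le> norm B * (1 + norm Y) ^ 2" for Y :: "real ^ 'n ^ 'm"
proof -
  have "norm (Y ** B ** transpose Y) \<le> (norm Y * norm B) * norm Y"
    using norm_matrix_mult_le[of "Y ** B" "transpose Y"] norm_matrix_mult_le[of Y B]
    by (simp add: norm_matrix_transpose) (meson mult_right_mono norm_ge_zero order_trans)
  also have "\<dots> = norm B * (norm Y)\<^sup>2" by (simp add: power2_eq_square)
  also have "\<dots> \<le> norm B * (1 + norm Y) ^ 2" by (intro mult_left_mono power_mono) auto
  finally show ?thesis .
qed

definition sandwich_law :: "(real ^ 'n ^ 'm) measure \<Rightarrow> real ^ 'n ^ 'n \<Rightarrow> (real ^ 'm ^ 'm) measure" where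
  "sandwich_law \<mu> B = distr \<mu> borel (\<lambda>Y. Y ** B ** transpose Y)"

text \<open>Conjugating the sandwich by \<open>U\<close> is the same as replacing \<open>Y\<close>
  by \<open>U ** Y\<close>, so left invariance of \<open>\<mu>\<close> becomes invariance of the law
  under orthogonal conjugation.\<close>

lemma sandwich_law:
  fixes \<mu> :: "(real ^ 'n ^ 'm) measure"
  assumes \<mu>: "has_moments \<mu>" and inv: "\<And>U. orthogonal_matrix U \<Longrightarrow> distr \<mu> borel (\<lambda>Y. U ** Y) = \<mu>"
  shows "has_moments (sandwich_law \<mu> B)" "oinv (sandwich_law \<mu> B)"
    "\<And>g. (g :: _ \<Rightarrow> real) \<in> borel_measurable borel \<Longrightarrow>
      (\<integral>Z. g Z \<partial>sandwich_law \<mu> B) = (\<integral>Y. g (Y ** B ** transpose Y) \<partial>\<mu>)"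
proof -
  show "has_moments (sandwich_law \<mu> B)" unfolding sandwich_law_def
    by (rule has_moments_distr[OF \<mu> continuous_sandwich norm_sandwich_le])
  have s: "sets \<mu> = sets borel" using \<mu> by (simp add: has_moments_def)
  have m: "(\<lambda>Y. Y ** B ** transpose Y) \<in> \<mu> \<rightarrow>\<^sub>M borel"
    using borel_measurable_continuous_onI[OF continuous_sandwich] by (simp add: measurable_cong_sets[OF s refl])
  show "(\<integral>Z. g Z \<partial>sandwich_law \<mu> B) = (\<integral>Y. g (Y ** B ** transpose Y) \<partial>\<mu>)" if "g \<in> borel_measurable borel" for g :: "_ \<Rightarrow> real"
    unfolding sandwich_law_def by (rule integral_distr[OF m that])
  show "oinv (sandwich_law \<mu> B)" unfolding oinv_def
  proof (intro allI impI)
    fix U :: "real ^ 'm ^ 'm" assume U: "orthogonal_matrix U"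
    have m1: "(\<lambda>Z. U ** Z ** transpose U) \<in> borel \<rightarrow>\<^sub>M borel"
      using linear_compose[OF linear_left_mult linear_right_mult] linear_borel_measurable by (fastforce simp: comp_def)
    have m2: "(\<lambda>Y. U ** Y) \<in> \<mu> \<rightarrow>\<^sub>M borel"
      using linear_borel_measurable[OF linear_left_mult] by (simp add: measurable_cong_sets[OF s refl])
    have m': "(\<lambda>Y :: real ^ 'n ^ 'm. Y ** B ** transpose Y) \<in> borel \<rightarrow>\<^sub>M borel"
      using borel_measurable_continuous_onI[OF continuous_sandwich] .
    have "distr (sandwich_law \<mu> B) borel (\<lambda>Z. U ** Z ** transpose U)
        = distr \<mu> borel (\<lambda>Y. U ** (Y ** B ** transpose Y) ** transpose U)"
      unfolding sandwich_law_def by (subst distr_distr[OF m1 m]) (simp add: comp_def)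
    also have "\<dots> = distr \<mu> borel ((\<lambda>Y. Y ** B ** transpose Y) \<circ> (\<lambda>Y. U ** Y))"
      by (simp add: comp_def matrix_transpose_mul matrix_mul_assoc)
    also have "\<dots> = distr (distr \<mu> borel (\<lambda>Y. U ** Y)) borel (\<lambda>Y. Y ** B ** transpose Y)"
      by (rule distr_distr[symmetric, OF m' m2])
    also have "\<dots> = sandwich_law \<mu> B" by (simp add: inv[OF U] sandwich_law_def)
    finally show "distr (sandwich_law \<mu> B) borel (\<lambda>Z. U ** Z ** transpose U) = sandwich_law \<mu> B" .
  qed
qed

lemma vh_conj_integrable:
  fixes S :: "real ^ 'm ^ 'm"
  assumes \<nu>: "has_moments \<nu>"
  shows "integrable \<nu> (\<lambda>Z. vh \<kappa> (S ** Z ** S))" "(\<lambda>Z. vh \<kappa> (S ** Z ** S)) \<in> borel_measurable borel"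
proof -
  let ?f = "\<lambda>(Z, Y :: real ^ 'm ^ 'm). dlt \<kappa> (Y ** (S ** Z ** S) ** transpose Y)"
  have f: "pg ?f" unfolding split_beta
    by (intro pg_dlt pg_matrix_mult pg_transpose pg_fst_entry pg_snd_entry pg_const)
  interpret N: finite_measure \<nu> using \<nu> by (simp add: has_moments_def)
  interpret G: prob_space "gaussM :: (real ^ 'm ^ 'm) measure" by (rule prob_space_gaussM)
  interpret P: pair_sigma_finite \<nu> "gaussM :: (real ^ 'm ^ 'm) measure" by standard
  have "integrable \<nu> (\<lambda>Z. \<integral>Y. ?f (Z, Y) \<partial>gaussM)"
    using P.integrable_fst'[OF pg_pair_integrable[OF \<nu> has_moments_gaussM f]] by simp
  then show "integrable \<nu> (\<lambda>Z. vh \<kappa> (S ** Z ** S))" by (simp add: vh_def)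
  have "sets ((borel :: (real ^ 'm ^ 'm) measure) \<Otimes>\<^sub>M (gaussM :: (real ^ 'm ^ 'm) measure)) = sets (borel \<Otimes>\<^sub>M borel)"
    by (rule sets_pair_measure_cong[OF refl sets_gaussM])
  then have s: "sets ((borel :: (real ^ 'm ^ 'm) measure) \<Otimes>\<^sub>M (gaussM :: (real ^ 'm ^ 'm) measure)) = sets borel"
    by (simp only: borel_prod)
  have "?f \<in> borel_measurable (borel \<Otimes>\<^sub>M (gaussM :: (real ^ 'm ^ 'm) measure))"
    using pg_measurable[OF f] by (simp add: measurable_cong_sets[OF s refl])
  then have "(\<lambda>Z. \<integral>Y. dlt \<kappa> (Y ** (S ** Z ** S) ** transpose Y) \<partial>(gaussM :: (real ^ 'm ^ 'm) measure)) \<in> borel_measurable borel"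
    by (rule G.borel_measurable_lebesgue_integral)
  then show "(\<lambda>Z. vh \<kappa> (S ** Z ** S)) \<in> borel_measurable borel" by (simp add: vh_def)
qed

text \<open>Applied termwise, \<open>vh_conj_mean\<close> separates each summand into a function of
  \<open>b\<close> and a function of \<open>B\<close>. The matrix \<open>Y\<close> may be
  rectangular: the expansion of \<open>f\<close> has as many variables as \<open>Y\<close> has rows,
  while \<open>B\<close> has the size of the columns.\<close>

theorem expansion_mean:
  fixes \<mu> :: "(real ^ 'n ^ 'm) measure" and f :: "real ^ 'm ^ 'm \<Rightarrow> real"
  assumes \<mu>: "has_moments \<mu>" and inv: "\<And>U. orthogonal_matrix U \<Longrightarrow> distr \<mu> borel (\<lambda>Y. U ** Y) = \<mu>"
    and f: "\<And>C. transpose C = C \<Longrightarrow> f C = (\<Sum>\<kappa>\<in>P. \<phi> \<kappa> * vh (q \<kappa>) C)"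
    and B: "transpose B = B" and b: "\<And>i. b i \<ge> 0"
  shows "(\<integral>Y. f (diagm (\<lambda>i. sqrt (b i)) ** (Y ** B ** transpose Y) ** diagm (\<lambda>i. sqrt (b i))) \<partial>\<mu>)
    = (\<Sum>\<kappa>\<in>P. \<phi> \<kappa> * vh (q \<kappa>) (diagm b) * (\<integral>Y. dlt (q \<kappa>) (Y ** B ** transpose Y) \<partial>\<mu>))"
proof -
  let ?S = "diagm (\<lambda>i. sqrt (b i)) :: real ^ 'm ^ 'm"
  have sl: "has_moments (sandwich_law \<mu> B)" "oinv (sandwich_law \<mu> B)"
    "\<And>g. (g :: _ \<Rightarrow> real) \<in> borel_measurable borel \<Longrightarrow>
      (\<integral>Z. g Z \<partial>sandwich_law \<mu> B) = (\<integral>Y. g (Y ** B ** transpose Y) \<partial>\<mu>)"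
    using sandwich_law[OF \<mu>] inv by blast+
  have sym: "transpose (?S ** (Y ** B ** transpose Y) ** ?S) = ?S ** (Y ** B ** transpose Y) ** ?S" for Y :: "real ^ 'n ^ 'm"
    by (simp add: matrix_transpose_mul B matrix_mul_assoc)
  have mv: "(\<lambda>Z. vh \<kappa> (?S ** Z ** ?S)) \<in> borel_measurable borel" for \<kappa>
    by (rule vh_conj_integrable(2)[OF sl(1)])
  have s: "sets \<mu> = sets borel" using \<mu> by (simp add: has_moments_def)
  have m: "(\<lambda>Y. Y ** B ** transpose Y) \<in> \<mu> \<rightarrow>\<^sub>M (borel :: (real ^ 'm ^ 'm) measure)"
    using borel_measurable_continuous_onI[OF continuous_sandwich] by (simp add: measurable_cong_sets[OF s refl])
  have int: "integrable \<mu> (\<lambda>Y. vh \<kappa> (?S ** (Y ** B ** transpose Y) ** ?S))" for \<kappa>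
    using vh_conj_integrable(1)[OF sl(1), of \<kappa> ?S] integrable_distr_eq[OF m mv] unfolding sandwich_law_def by blast
  have "(\<integral>Y. f (?S ** (Y ** B ** transpose Y) ** ?S) \<partial>\<mu>)
    = (\<integral>Y. (\<Sum>\<kappa>\<in>P. \<phi> \<kappa> * vh (q \<kappa>) (?S ** (Y ** B ** transpose Y) ** ?S)) \<partial>\<mu>)"
    by (simp add: f sym)
  also have "\<dots> = (\<Sum>\<kappa>\<in>P. \<phi> \<kappa> * (\<integral>Y. vh (q \<kappa>) (?S ** (Y ** B ** transpose Y) ** ?S) \<partial>\<mu>))"
    by (subst Bochner_Integration.integral_sum) (auto intro!: int)
  also have "\<dots> = (\<Sum>\<kappa>\<in>P. \<phi> \<kappa> * (vh (q \<kappa>) (diagm b) * (\<integral>Y. dlt (q \<kappa>) (Y ** B ** transpose Y) \<partial>\<mu>)))"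
  proof (intro sum.cong refl arg_cong2[where f = "(*)"])
    fix \<kappa>
    have "(\<integral>Y. vh (q \<kappa>) (?S ** (Y ** B ** transpose Y) ** ?S) \<partial>\<mu>) = (\<integral>Z. vh (q \<kappa>) (?S ** Z ** ?S) \<partial>sandwich_law \<mu> B)"
      by (rule sl(3)[symmetric, OF mv])
    also have "\<dots> = vh (q \<kappa>) (diagm b) * (\<integral>Z. dlt (q \<kappa>) Z \<partial>sandwich_law \<mu> B)"
      by (rule vh_conj_mean[OF sl(2,1) b])
    also have "(\<integral>Z. dlt (q \<kappa>) Z \<partial>sandwich_law \<mu> B) = (\<integral>Y. dlt (q \<kappa>) (Y ** B ** transpose Y) \<partial>\<mu>)"
      by (rule sl(3)) (intro pg_measurable pg_dlt pg_entry)
    finally show "(\<integral>Y. vh (q \<kappa>) (?S ** (Y ** B ** transpose Y) ** ?S) \<partial>\<mu>)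
      = vh (q \<kappa>) (diagm b) * (\<integral>Y. dlt (q \<kappa>) (Y ** B ** transpose Y) \<partial>\<mu>)" .
  qed
  finally show ?thesis by (simp add: mult.assoc)
qed

section \<open>Polynomials dominated by a partition\<close>

definition mono_eval :: "monomial \<Rightarrow> (nat \<Rightarrow> real) \<Rightarrow> real" where
  "mono_eval \<alpha> x = (\<Prod>i\<in>keys \<alpha>. x i ^ lookup \<alpha> i)"

lemma mono_eval_lessThan: "keys \<alpha> \<subseteq> {..<m} \<Longrightarrow> mono_eval \<alpha> x = (\<Prod>i<m. x i ^ lookup \<alpha> i)"
  unfolding mono_eval_def by (rule prod.mono_neutral_left) (auto simp: in_keys_iff)

lemma mono_eval_add:
  "keys \<alpha> \<subseteq> {..<m} \<Longrightarrow> keys \<beta> \<subseteq> {..<m} \<Longrightarrow> mono_eval (\<alpha> + \<beta>) x = mono_eval \<alpha> x * mono_eval \<beta> x"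
  using keys_add[of \<alpha> \<beta>]
  by (subst (1 2 3) mono_eval_lessThan[where m = m]) (auto simp: lookup_add power_add prod.distrib)

definition psum :: "monomial \<Rightarrow> nat \<Rightarrow> nat" where "psum \<alpha> r = (\<Sum>i<r. lookup \<alpha> i)"

lemma psum_add: "psum (\<alpha> + \<beta>) r = psum \<alpha> r + psum \<beta> r"
  by (simp add: psum_def lookup_add sum.distrib)

lemma psum_inject: "(\<And>r. psum \<alpha> r = psum \<beta> r) \<Longrightarrow> \<alpha> = \<beta>"
proof (rule poly_mapping_eqI)
  fix i assume *: "\<And>r. psum \<alpha> r = psum \<beta> r"
  show "lookup \<alpha> i = lookup \<beta> i" using *[of i] *[of "Suc i"] by (simp add: psum_def)
qed

lemma sum_keys_psum: "keys \<alpha> \<subseteq> {..<m} \<Longrightarrow> (\<Sum>i\<in>keys \<alpha>. lookup \<alpha> i) = psum \<alpha> m"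
  unfolding psum_def by (rule sum.mono_neutral_left) (auto simp: in_keys_iff)

lemma psum_ge: "keys \<alpha> \<subseteq> {..<m} \<Longrightarrow> m \<le> r \<Longrightarrow> psum \<alpha> r = psum \<alpha> m"
  unfolding psum_def by (rule sum.mono_neutral_right) (auto simp: in_keys_iff)

text \<open>At the first index where the exponents differ, the partial sums differ by the same
  amount.\<close>

lemma dominated_imp_le:
  assumes "\<And>r. psum \<alpha> r \<le> psum \<beta> r"
  shows "\<alpha> \<le> \<beta>"
proof (cases "\<alpha> = \<beta>")
  case False
  then have "\<exists>i. lookup \<alpha> i \<noteq> lookup \<beta> i" by (meson poly_mapping_eqI)
  define k where "k = (LEAST i. lookup \<alpha> i \<noteq> lookup \<beta> i)"
  have k: "lookup \<alpha> k \<noteq> lookup \<beta> k" unfolding k_def by (rule LeastI_ex) fact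
  have l: "lookup \<alpha> i = lookup \<beta> i" if "i < k" for i using not_less_Least that unfolding k_def by blast
  have "lookup \<alpha> k < lookup \<beta> k"
    using assms[of "Suc k"] k l by (simp add: psum_def)
  then have "\<alpha> < \<beta>" using l by (auto simp: less_poly_mapping.rep_eq less_fun_def)
  then show ?thesis by simp
qed simp

text \<open>The bound \<open>w\<close> is an arbitrary function and not the partial sums of a
  partition, so that the bounds of a product of polynomials are simply added.\<close>

definition domw :: "nat \<Rightarrow> (nat \<Rightarrow> nat) \<Rightarrow> monomial set" where
  "domw m w = {\<alpha>. keys \<alpha> \<subseteq> {..<m} \<and> psum \<alpha> m = w m \<and> (\<forall>r. psum \<alpha> r \<le> w r)}"

definition Mon :: "nat \<Rightarrow> nat \<Rightarrow> monomial set" where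
  "Mon m k = {\<alpha>. keys \<alpha> \<subseteq> {..<m} \<and> psum \<alpha> m = k}"

lemma finite_Mon: "finite (Mon m k)"
proof (rule finite_imageD)
  show "inj_on (\<lambda>\<alpha>. \<lambda>i\<in>{..<m}. lookup \<alpha> i) (Mon m k)"
  proof (rule inj_onI, rule poly_mapping_eqI)
    fix \<alpha> \<beta> i assume \<alpha>: "\<alpha> \<in> Mon m k" and \<beta>: "\<beta> \<in> Mon m k"
      and eq: "(\<lambda>i\<in>{..<m}. lookup \<alpha> i) = (\<lambda>i\<in>{..<m}. lookup \<beta> i)"
    show "lookup \<alpha> i = lookup \<beta> i"
    proof (cases "i < m")
      case True then show ?thesis using fun_cong[OF eq, of i] by simp
    next
      case False
      then have "i \<notin> keys \<alpha>" "i \<notin> keys \<beta>" using \<alpha> \<beta> by (auto simp: Mon_def)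
      then show ?thesis by (simp add: in_keys_iff)
    qed
  qed
  have "(\<lambda>\<alpha>. \<lambda>i\<in>{..<m}. lookup \<alpha> i) ` Mon m k \<subseteq> {..<m} \<rightarrow>\<^sub>E {..k}"
  proof (rule image_subsetI, rule PiE_I)
    fix \<alpha> i assume "\<alpha> \<in> Mon m k" "i \<in> {..<m}"
    then show "(\<lambda>i\<in>{..<m}. lookup \<alpha> i) i \<in> {..k}"
      unfolding Mon_def psum_def by (auto intro: member_le_sum)
  qed auto
  then show "finite ((\<lambda>\<alpha>. \<lambda>i\<in>{..<m}. lookup \<alpha> i) ` Mon m k)" by (rule finite_subset) (auto intro: finite_PiE)
qed

lemma domw_subset: "domw m w \<subseteq> Mon m (w m)" by (auto simp: domw_def Mon_def)

lemma finite_domw: "finite (domw m w)" using domw_subset finite_Mon by (rule finite_subset)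

text \<open>Every exponent of degree \<open>k\<close> is dominated by that of the
  \<open>k\<close>-th power of the first variable; the value \<open>0\<close> at
  \<open>r = 0\<close> makes the bound equal to the partial sums of this extremal exponent.\<close>

lemma Mon_eq_domw: "m > 0 \<Longrightarrow> Mon m k = domw m (\<lambda>r. if r = 0 then 0 else k)"
proof -
  assume m: "m > 0"
  have *: "psum \<alpha> r \<le> psum \<alpha> m" if \<alpha>: "keys \<alpha> \<subseteq> {..<m}" for \<alpha> r
  proof (cases "r \<le> m")
    case True then show ?thesis unfolding psum_def by (intro sum_mono2) auto
  qed (use psum_ge[OF \<alpha>, of r] in simp)
  have z: "psum \<alpha> 0 = 0" for \<alpha> by (simp add: psum_def)
  show ?thesis
  proof (intro equalityI subsetI)
    fix \<alpha> assume "\<alpha> \<in> Mon m k"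
    then show "\<alpha> \<in> domw m (\<lambda>r. if r = 0 then 0 else k)" using * m z by (auto simp: Mon_def domw_def)
  next
    fix \<alpha> assume "\<alpha> \<in> domw m (\<lambda>r. if r = 0 then 0 else k)"
    then show "\<alpha> \<in> Mon m k" using m by (auto simp: Mon_def domw_def)
  qed
qed

text \<open>\<open>g Y\<close> is a polynomial with exponents in \<open>domw m w\<close>; the extremal exponent \<open>\<tau>\<close>, whose partial sums
  are \<open>w\<close>, has the coefficient \<open>l Y\<close>.\<close>

definition expands :: "nat \<Rightarrow> (nat \<Rightarrow> nat) \<Rightarrow> monomial \<Rightarrow> ('y::real_normed_vector \<Rightarrow> real) \<Rightarrow> ('y \<Rightarrow> (nat \<Rightarrow> real) \<Rightarrow> real) \<Rightarrow> bool" where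
  "expands m w \<tau> l g \<longleftrightarrow> keys \<tau> \<subseteq> {..<m} \<and> (\<forall>r. psum \<tau> r = w r) \<and>
    (\<exists>c. (\<forall>\<alpha>. pg (c \<alpha>)) \<and> c \<tau> = l \<and> (\<forall>Y x. g Y x = (\<Sum>\<alpha>\<in>domw m w. c \<alpha> Y * mono_eval \<alpha> x)))"

lemma expands_one: "expands m (\<lambda>_. 0) 0 (\<lambda>_. 1) (\<lambda>_ _. 1)"
proof -
  have "domw m (\<lambda>_. 0) = {0}"
  proof (intro equalityI subsetI)
    fix \<alpha> :: monomial assume "\<alpha> \<in> domw m (\<lambda>_. 0)"
    then show "\<alpha> \<in> {0}" by (auto simp: domw_def psum_def intro!: psum_inject)
  qed (auto simp: domw_def psum_def)
  then show ?thesis unfolding expands_def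
    by (intro conjI exI[of _ "\<lambda>_ _. 1"]) (auto simp: psum_def mono_eval_def)
qed

text \<open>The extremal coefficient is multiplicative since an exponent with maximal partial sums
  splits in only one way: neither summand can fall short of its own bound.\<close>

lemma expands_mult:
  assumes "expands m w \<tau> l g" "expands m w' \<tau>' l' g'"
  shows "expands m (\<lambda>r. w r + w' r) (\<tau> + \<tau>') (\<lambda>Y. l Y * l' Y) (\<lambda>Y x. g Y x * g' Y x)"
proof -
  obtain c where \<tau>: "keys \<tau> \<subseteq> {..<m}" "\<And>r. psum \<tau> r = w r" and c: "\<And>\<alpha>. pg (c \<alpha>)" "c \<tau> = l"
    "\<And>Y x. g Y x = (\<Sum>\<alpha>\<in>domw m w. c \<alpha> Y * mono_eval \<alpha> x)" using assms(1) unfolding expands_def by blast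
  obtain c' where \<tau>': "keys \<tau>' \<subseteq> {..<m}" "\<And>r. psum \<tau>' r = w' r" and c': "\<And>\<alpha>. pg (c' \<alpha>)" "c' \<tau>' = l'"
    "\<And>Y x. g' Y x = (\<Sum>\<alpha>\<in>domw m w'. c' \<alpha> Y * mono_eval \<alpha> x)" using assms(2) unfolding expands_def by blast
  let ?S = "domw m w \<times> domw m w'" and ?T = "domw m (\<lambda>r. w r + w' r)"
  define d where "d \<gamma> Y = (\<Sum>p\<in>{p\<in>?S. fst p + snd p = \<gamma>}. c (fst p) Y * c' (snd p) Y)" for \<gamma> Y
  have fin: "finite ?S" by (simp add: finite_domw)
  have pgd: "pg (d \<gamma>)" for \<gamma> unfolding d_def by (intro pg_sum pg_mult c(1) c'(1))
  have key: "keys (\<tau> + \<tau>') \<subseteq> {..<m}" using keys_add[of \<tau> \<tau>'] \<tau>(1) \<tau>'(1) by blast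
  have top: "{p\<in>?S. fst p + snd p = \<tau> + \<tau>'} = {(\<tau>, \<tau>')}"
  proof -
    have "(\<tau>, \<tau>') \<in> ?S" using \<tau> \<tau>' by (auto simp: domw_def)
    moreover have "\<alpha> = \<tau> \<and> \<beta> = \<tau>'" if "(\<alpha>, \<beta>) \<in> ?S" "\<alpha> + \<beta> = \<tau> + \<tau>'" for \<alpha> \<beta>
    proof -
      have "psum \<alpha> r = psum \<tau> r \<and> psum \<beta> r = psum \<tau>' r" for r
      proof -
        have "psum \<alpha> r \<le> w r" "psum \<beta> r \<le> w' r" using that(1) by (auto simp: domw_def)
        moreover have "psum \<alpha> r + psum \<beta> r = w r + w' r"
          using arg_cong[OF that(2), of "\<lambda>t. psum t r"] by (simp add: psum_add \<tau> \<tau>')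
        ultimately show ?thesis by (simp add: \<tau> \<tau>')
      qed
      then show ?thesis by (simp add: psum_inject)
    qed
    ultimately show ?thesis by auto
  qed
  have sub: "(\<lambda>p. fst p + snd p) ` ?S \<subseteq> ?T"
  proof safe
    fix \<alpha> \<beta> assume a: "\<alpha> \<in> domw m w" "\<beta> \<in> domw m w'"
    then have "keys (\<alpha> + \<beta>) \<subseteq> {..<m}" using keys_add[of \<alpha> \<beta>] by (auto simp: domw_def)
    then show "fst (\<alpha>, \<beta>) + snd (\<alpha>, \<beta>) \<in> ?T" using a by (auto simp: domw_def psum_add add_mono)
  qed
  have "g Y x * g' Y x = (\<Sum>\<gamma>\<in>?T. d \<gamma> Y * mono_eval \<gamma> x)" for Y x
  proof -
    have "g Y x * g' Y x = (\<Sum>p\<in>?S. (c (fst p) Y * c' (snd p) Y) * mono_eval (fst p + snd p) x)"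
      unfolding c(3) c'(3) sum_product sum.cartesian_product
    proof (rule sum.cong[OF refl], clarify)
      fix \<alpha> \<beta> assume "\<alpha> \<in> domw m w" "\<beta> \<in> domw m w'"
      then have "mono_eval (\<alpha> + \<beta>) x = mono_eval \<alpha> x * mono_eval \<beta> x"
        by (intro mono_eval_add) (auto simp: domw_def)
      then show "c \<alpha> Y * mono_eval \<alpha> x * (c' \<beta> Y * mono_eval \<beta> x)
        = c (fst (\<alpha>, \<beta>)) Y * c' (snd (\<alpha>, \<beta>)) Y * mono_eval (fst (\<alpha>, \<beta>) + snd (\<alpha>, \<beta>)) x" by simp
    qed
    also have "\<dots> = (\<Sum>\<gamma>\<in>?T. \<Sum>p\<in>{p\<in>?S. fst p + snd p = \<gamma>}. (c (fst p) Y * c' (snd p) Y) * mono_eval (fst p + snd p) x)"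
      by (rule sum.group[symmetric, OF fin finite_domw sub])
    also have "\<dots> = (\<Sum>\<gamma>\<in>?T. d \<gamma> Y * mono_eval \<gamma> x)"
      unfolding d_def sum_distrib_right by (intro sum.cong refl) auto
    finally show ?thesis .
  qed
  moreover have "d (\<tau> + \<tau>') = (\<lambda>Y. l Y * l' Y)" unfolding d_def top using c(2) c'(2) by auto
  ultimately show ?thesis unfolding expands_def using key pgd \<tau> \<tau>' by (auto simp: psum_add)
qed

lemma expands_cong:
  assumes "expands m w \<tau> l g" "\<And>r. w r = w' r" "\<And>Y. l Y = l' Y" "\<And>Y x. g Y x = g' Y x"
  shows "\<exists>\<tau>. expands m w' \<tau> l' g'"
proof -
  have "w = w'" "l = l'" using assms by auto
  moreover have "g = g'" using assms(4) by (intro ext) auto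
  ultimately show ?thesis using assms(1) by blast
qed

lemma expands_power:
  assumes "expands m w \<tau> l g"
  shows "\<exists>\<tau>. expands m (\<lambda>r. n * w r) \<tau> (\<lambda>Y. l Y ^ n) (\<lambda>Y x. g Y x ^ n)"
proof (induction n)
  case 0
  show ?case using expands_one by auto
next
  case (Suc n)
  then obtain \<tau>' where "expands m (\<lambda>r. n * w r) \<tau>' (\<lambda>Y. l Y ^ n) (\<lambda>Y x. g Y x ^ n)" by blast
  from expands_mult[OF assms this] show ?case by auto
qed

lemma expands_prod:
  assumes "\<And>i. i < (N::nat) \<Longrightarrow> \<exists>\<tau>. expands m (w i) \<tau> (l i) (g i)"
  shows "\<exists>\<tau>. expands m (\<lambda>r. \<Sum>i<N. w i r) \<tau> (\<lambda>Y. \<Prod>i<N. l i Y) (\<lambda>Y x. \<Prod>i<N. g i Y x)"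
  using assms
proof (induction N)
  case 0
  show ?case using expands_one by auto
next
  case (Suc N)
  then obtain \<tau> \<tau>' where "expands m (\<lambda>r. \<Sum>i<N. w i r) \<tau> (\<lambda>Y. \<Prod>i<N. l i Y) (\<lambda>Y x. \<Prod>i<N. g i Y x)"
    "expands m (w N) \<tau>' (l N) (g N)" by (meson lessI less_SucI)
  from expands_mult[OF this] show ?case by auto
qed

text \<open>Expanding the rows of \<open>Y diag(x) Y\<^sup>T\<close> one by one leaves only square-free monomials, since a repeated
  index produces a determinant with two equal rows.\<close>

lemma expands_pm:
  assumes s: "s \<le> CARD('m)"
  shows "\<exists>\<tau>. expands CARD('m) (\<lambda>r. min r s) \<tau> (\<lambda>Y :: real ^ 'm ^ 'm. (det (trunc (seg s) Y))\<^sup>2)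
    (\<lambda>Y x. pm (seg s) (Y ** diagm (\<lambda>i. x (rk i)) ** transpose Y))"
proof -
  let ?m = "CARD('m)" and ?I = "seg s :: 'm set"
  \<comment> \<open>One column index for every row in the block and the identity elsewhere, which is
    the index set for expanding a determinant whose rows are sums.\<close>
  define F where "F = {f :: 'm \<Rightarrow> 'm. (\<forall>i\<in>?I. f i \<in> UNIV) \<and> (\<forall>i. i \<notin> ?I \<longrightarrow> f i = i)}"
  define F' where "F' = {f\<in>F. inj_on f ?I}"
  have finF: "finite F" by simp
  define R where "R Y l = (\<chi> j. if j \<in> ?I then Y $ j $ l else 0)" for Y :: "real ^ 'm ^ 'm" and l
  define q where "q f Y = (\<Prod>i\<in>?I. Y $ i $ f i) * det (\<chi> i. if i \<in> ?I then R Y (f i) else axis i 1)" for f and Y :: "real ^ 'm ^ 'm"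
  define mon where "mon f = (\<Sum>i\<in>?I. Poly_Mapping.single (rk (f i)) (1::nat))" for f :: "'m \<Rightarrow> 'm"
  have lmon: "lookup (mon f) l = card {i\<in>?I. rk (f i) = l}" for f l
    by (simp add: mon_def lookup_sum lookup_single when_def sum.If_cases Int_def)
  have kmon: "keys (mon f) \<subseteq> {..<?m}" for f
    by (auto simp: in_keys_iff lmon card_gt_0_iff)
  have pmon: "psum (mon f) r = card {i\<in>?I. rk (f i) < r}" for f r
  proof -
    have "psum (mon f) r = (\<Sum>l<r. \<Sum>i\<in>{i\<in>?I. rk (f i) < r}. if rk (f i) = l then 1 else 0)"
      unfolding psum_def lmon by (intro sum.cong refl) (auto simp: sum.If_cases Int_def intro!: arg_cong[where f = card])
    also have "\<dots> = (\<Sum>i\<in>{i\<in>?I. rk (f i) < r}. \<Sum>l<r. if rk (f i) = l then 1 else 0)" by (rule sum.swap)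
    also have "\<dots> = (\<Sum>i\<in>{i\<in>?I. rk (f i) < r}. 1)" by (intro sum.cong refl) auto
    finally show ?thesis by simp
  qed
  have emon: "mono_eval (mon f) x = (\<Prod>i\<in>?I. x (rk (f i)))" for f x
  proof -
    have "(\<Prod>i\<in>?I. x (rk (f i))) = (\<Prod>l<?m. \<Prod>i\<in>{i\<in>?I. rk (f i) = l}. x (rk (f i)))"
      by (rule prod.group[symmetric]) auto
    also have "\<dots> = (\<Prod>l<?m. x l ^ lookup (mon f) l)"
      by (intro prod.cong refl) (simp add: lmon)
    finally show ?thesis by (simp add: mono_eval_lessThan[OF kmon])
  qed
  have exp: "pm ?I (Y ** diagm (\<lambda>i. x (rk i)) ** transpose Y) = (\<Sum>f\<in>F'. q f Y * mono_eval (mon f) x)" for Y :: "real ^ 'm ^ 'm" and x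
  proof -
    define a where "a i l = (x (rk l) * Y $ i $ l) *s R Y l" for i l
    have "trunc ?I (Y ** diagm (\<lambda>i. x (rk i)) ** transpose Y) = (\<chi> i. if i \<in> ?I then sum (a i) UNIV else axis i 1)"
    proof -
      have "(Y ** diagm (\<lambda>i. x (rk i)) ** transpose Y) $ i $ j = (\<Sum>l\<in>UNIV. x (rk l) * Y $ i $ l * Y $ j $ l)" for i j
        by (subst matrix_matrix_mult_def) (simp add: diagm_mult_right transpose_def mult_ac)
      then show ?thesis
        by (auto simp: vec_eq_iff trunc_def a_def R_def axis_def)
    qed
    then have "pm ?I (Y ** diagm (\<lambda>i. x (rk i)) ** transpose Y)
        = (\<Sum>f\<in>F. det (\<chi> i. if i \<in> ?I then a i (f i) else axis i 1))"
      unfolding pm_def F_def by (simp add: det_linear_rows_sum_lemma)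
    also have "\<dots> = (\<Sum>f\<in>F. q f Y * mono_eval (mon f) x)"
    proof (rule sum.cong[OF refl])
      fix f
      have "(\<chi> i. if i \<in> ?I then a i (f i) else axis i 1)
        = (\<chi> i. (if i \<in> ?I then x (rk (f i)) * Y $ i $ f i else 1) *s (if i \<in> ?I then R Y (f i) else axis i 1))"
        by (auto simp: vec_eq_iff a_def)
      then have "det (\<chi> i. if i \<in> ?I then a i (f i) else axis i 1)
        = (\<Prod>i\<in>UNIV. if i \<in> ?I then x (rk (f i)) * Y $ i $ f i else 1) * det (\<chi> i. if i \<in> ?I then R Y (f i) else axis i 1)"
        by (simp only: det_rows_mul)
      also have "(\<Prod>i\<in>UNIV. if i \<in> ?I then x (rk (f i)) * Y $ i $ f i else 1) = (\<Prod>i\<in>?I. x (rk (f i)) * Y $ i $ f i)"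
        by (simp add: prod.If_cases)
      finally show "det (\<chi> i. if i \<in> ?I then a i (f i) else axis i 1) = q f Y * mono_eval (mon f) x"
        by (simp add: q_def emon prod.distrib)
    qed
    also have "\<dots> = (\<Sum>f\<in>F'. q f Y * mono_eval (mon f) x)"
    proof (rule sum.mono_neutral_right[OF finF])
      show "\<forall>f\<in>F - F'. q f Y * mono_eval (mon f) x = 0"
      proof
        fix f assume "f \<in> F - F'"
        then obtain i j where ij: "i \<in> ?I" "j \<in> ?I" "i \<noteq> j" "f i = f j" by (auto simp: F'_def inj_on_def)
        have "det (\<chi> i. if i \<in> ?I then R Y (f i) else axis i 1) = 0"
          by (rule det_identical_rows[OF ij(3)]) (use ij in \<open>simp add: row_def\<close>)
        then show "q f Y * mono_eval (mon f) x = 0" by (simp add: q_def)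
      qed
    qed (auto simp: F'_def)
    finally show ?thesis .
  qed
  define \<tau> where "\<tau> = mon id"
  have p\<tau>: "psum \<tau> r = min r s" for r
  proof -
    have "{i\<in>?I. rk (id i) < r} = seg (min r s)" by (auto simp: seg_def)
    then show ?thesis using s by (simp add: \<tau>_def pmon card_seg)
  qed
  have memF: "mon f \<in> domw ?m (\<lambda>r. min r s)" if "f \<in> F'" for f
  proof -
    have inj: "inj_on (\<lambda>i. rk (f i)) ?I" using that by (auto simp: F'_def inj_on_def)
    have "card {i\<in>?I. rk (f i) < r} \<le> r" for r
    proof -
      have "card {i\<in>?I. rk (f i) < r} = card ((\<lambda>i. rk (f i)) ` {i\<in>?I. rk (f i) < r})"
        by (rule card_image[symmetric]) (rule inj_on_subset[OF inj], auto)
      also have "\<dots> \<le> card {..<r}" by (rule card_mono) auto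
      finally show ?thesis by simp
    qed
    moreover have "card {i\<in>?I. rk (f i) < r} \<le> s" for r
      using card_mono[of ?I "{i\<in>?I. rk (f i) < r}"] card_seg[OF s] by simp
    ultimately show ?thesis using kmon s by (simp add: domw_def pmon card_seg)
  qed
  define c where "c \<alpha> Y = (\<Sum>f\<in>{f\<in>F'. mon f = \<alpha>}. q f Y)" for \<alpha> Y
  have pgc: "pg (c \<alpha>)" for \<alpha> unfolding c_def q_def
  proof (intro pg_sum pg_mult pg_prod pg_entry pg_det)
    fix f i j show "pg (\<lambda>Y. (\<chi> i. if i \<in> ?I then R Y (f i) else axis i 1) $ i $ j)"
      by (cases "i \<in> ?I"; cases "j \<in> ?I") (auto simp: R_def)
  qed
  have main: "pm ?I (Y ** diagm (\<lambda>i. x (rk i)) ** transpose Y) = (\<Sum>\<alpha>\<in>domw ?m (\<lambda>r. min r s). c \<alpha> Y * mono_eval \<alpha> x)" for Y x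
  proof -
    have "(\<Sum>f\<in>F'. q f Y * mono_eval (mon f) x)
        = (\<Sum>\<alpha>\<in>domw ?m (\<lambda>r. min r s). \<Sum>f\<in>{f\<in>F'. mon f = \<alpha>}. q f Y * mono_eval (mon f) x)"
      by (rule sum.group[symmetric, OF _ finite_domw]) (use memF finF in \<open>auto simp: F'_def\<close>)
    also have "\<dots> = (\<Sum>\<alpha>\<in>domw ?m (\<lambda>r. min r s). c \<alpha> Y * mono_eval \<alpha> x)"
      unfolding c_def sum_distrib_right by (intro sum.cong refl) auto
    finally show ?thesis by (simp add: exp)
  qed
  \<comment> \<open>At the point with \<open>s\<close> ones followed by zeros, an injective
    \<open>f\<close> survives exactly if it maps the block onto itself, that is, if its monomial is
    the extremal one. So \<open>c \<tau> Y\<close> is the minor at this point, where the sandwich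
    factors into the block of \<open>Y\<close> and its transpose.\<close>
  have top: "c \<tau> Y = (det (trunc ?I Y))\<^sup>2" for Y
  proof -
    let ?x = "\<lambda>l. if l < s then 1 else 0 :: real"
    have "(\<Sum>f\<in>F'. q f Y * mono_eval (mon f) ?x) = (\<Sum>f\<in>{f\<in>F'. mon f = \<tau>}. q f Y)"
    proof (rule sum.mono_neutral_cong_right)
      show "finite F'" by (simp add: F'_def)
      have *: "mono_eval (mon f) ?x = (if mon f = \<tau> then 1 else 0)" if f: "f \<in> F'" for f
      proof (cases "\<forall>i\<in>?I. f i \<in> ?I")
        case True
        have "{i\<in>?I. rk (f i) < r} = f -` seg (min r s) \<inter> ?I" for r using True by (auto simp: seg_def)
        moreover have "card (f -` seg (min r s) \<inter> ?I) = min r s" for r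
        proof -
          have "f ` ?I = ?I"
            using True f by (intro card_subset_eq) (auto simp: F'_def card_image)
          then have "f ` (f -` seg (min r s) \<inter> ?I) = seg (min r s)" by (auto simp: seg_def image_iff set_eq_iff)
          moreover have "inj_on f (f -` seg (min r s) \<inter> ?I)" using f by (auto simp: F'_def inj_on_def)
          ultimately show ?thesis using s by (metis card_image card_seg min.coboundedI2)
        qed
        ultimately have "mon f = \<tau>" by (intro psum_inject) (simp add: pmon p\<tau>)
        moreover have "mono_eval (mon f) ?x = 1" unfolding emon using True by (intro prod.neutral) (auto simp: seg_def)
        ultimately show ?thesis by simp
      next
        case False
        then obtain i where i: "i \<in> ?I" "\<not> rk (f i) < s" by (auto simp: seg_def)
        then have "mono_eval (mon f) ?x = 0" unfolding emon by (intro prod_zero) auto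
        moreover have "mon f \<noteq> \<tau>"
        proof
          assume "mon f = \<tau>"
          then have "card {i\<in>?I. rk (f i) < s} = card ?I" using p\<tau>[of s] pmon[of f s] card_seg[OF s] by simp
          then have "{i\<in>?I. rk (f i) < s} = ?I" by (intro card_subset_eq) auto
          then show False using i by blast
        qed
        ultimately show ?thesis by simp
      qed
      show "\<forall>f\<in>F' - {f\<in>F'. mon f = \<tau>}. q f Y * mono_eval (mon f) ?x = 0" using * by auto
      show "\<And>f. f \<in> {f\<in>F'. mon f = \<tau>} \<Longrightarrow> q f Y * mono_eval (mon f) ?x = q f Y" using * by auto
    qed auto
    then have "c \<tau> Y = pm ?I (Y ** diagm (\<lambda>i. ?x (rk i)) ** transpose Y)"
      using exp[of Y ?x] by (simp only: c_def)
    also have "trunc ?I (Y ** diagm (\<lambda>i. ?x (rk i)) ** transpose Y) = trunc ?I Y ** transpose (trunc ?I Y)"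
    proof (intro vec_eq_iff[THEN iffD2] allI)
      fix i j
      have 1: "(Y ** diagm (\<lambda>i. ?x (rk i)) ** transpose Y) $ i $ j = (\<Sum>k\<in>UNIV. if k \<in> ?I then Y $ i $ k * Y $ j $ k else 0)"
        by (subst matrix_matrix_mult_def) (auto simp: diagm_mult_right transpose_def seg_def intro!: sum.cong)
      have 2: "(trunc ?I Y ** transpose (trunc ?I Y)) $ i $ j = (\<Sum>k\<in>UNIV. trunc ?I Y $ i $ k * trunc ?I Y $ j $ k)"
        by (simp add: matrix_matrix_mult_def transpose_def)
      show "trunc ?I (Y ** diagm (\<lambda>i. ?x (rk i)) ** transpose Y) $ i $ j = (trunc ?I Y ** transpose (trunc ?I Y)) $ i $ j"
      proof (cases "i \<in> ?I \<and> j \<in> ?I")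
        case True
        have "trunc ?I (Y ** diagm (\<lambda>i. ?x (rk i)) ** transpose Y) $ i $ j = (\<Sum>k\<in>UNIV. if k \<in> ?I then Y $ i $ k * Y $ j $ k else 0)"
          using True by (simp add: trunc_def 1)
        also have "\<dots> = (\<Sum>k\<in>UNIV. trunc ?I Y $ i $ k * trunc ?I Y $ j $ k)"
          using True by (intro sum.cong refl) (auto simp: trunc_def)
        finally show ?thesis by (simp add: 2)
      next
        case False
        have "(\<Sum>k\<in>UNIV. trunc ?I Y $ i $ k * trunc ?I Y $ j $ k) = (\<Sum>k\<in>UNIV. if k = i then (if i = j then 1 else 0) else 0)"
          using False by (intro sum.cong refl) (auto simp: trunc_def)
        then show ?thesis unfolding 2 using False by (auto simp: trunc_def)
      qed
    qed
    then have "pm ?I (Y ** diagm (\<lambda>i. ?x (rk i)) ** transpose Y) = (det (trunc ?I Y))\<^sup>2"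
      by (simp add: pm_def det_mul power2_eq_square)
    finally show ?thesis .
  qed
  show ?thesis
  proof (intro exI[of _ \<tau>])
    show "expands ?m (\<lambda>r. min r s) \<tau> (\<lambda>Y. (det (trunc ?I Y))\<^sup>2) (\<lambda>Y x. pm ?I (Y ** diagm (\<lambda>i. x (rk i)) ** transpose Y))"
      unfolding expands_def
    proof (intro conjI exI[of _ c] allI)
      show "c \<tau> = (\<lambda>Y. (det (trunc ?I Y))\<^sup>2)" using top by auto
    qed (use pgc main p\<tau> kmon in \<open>simp_all add: \<tau>_def\<close>)
  qed
qed

section \<open>The basis of spherical polynomials\<close>

definition parts :: "nat \<Rightarrow> nat \<Rightarrow> monomial set" where
  "parts m k = {\<kappa>\<in>Mon m k. antimono (lookup \<kappa>)}"

text \<open>The support of an antitone sequence is an initial segment, so bounding the number of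
  nonzero parts is bounding their positions.\<close>

lemma partitions_eq_parts: "partitions m k = parts m k"
proof (intro equalityI subsetI)
  fix \<kappa> assume "\<kappa> \<in> partitions m k"
  then have a: "antimono (lookup \<kappa>)" and c: "card (keys \<kappa>) \<le> m" and s: "(\<Sum>i\<in>keys \<kappa>. lookup \<kappa> i) = k"
    by (auto simp: partitions_def)
  have "i < m" if i: "i \<in> keys \<kappa>" for i
  proof -
    have "{..i} \<subseteq> keys \<kappa>"
    proof
      fix j assume "j \<in> {..i}"
      then have "lookup \<kappa> j \<ge> lookup \<kappa> i" using a by (auto dest: antimonoD)
      then show "j \<in> keys \<kappa>" using i by (auto simp: in_keys_iff)
    qed
    then have "card {..i} \<le> card (keys \<kappa>)" by (intro card_mono) auto
    then show ?thesis using c by simp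
  qed
  then have "keys \<kappa> \<subseteq> {..<m}" by auto
  then show "\<kappa> \<in> parts m k" using a s sum_keys_psum by (auto simp: parts_def Mon_def)
next
  fix \<kappa> assume "\<kappa> \<in> parts m k"
  then have k: "keys \<kappa> \<subseteq> {..<m}" "psum \<kappa> m = k" "antimono (lookup \<kappa>)" by (auto simp: parts_def Mon_def)
  then have "card (keys \<kappa>) \<le> m" using card_mono[OF _ k(1)] by simp
  then show "\<kappa> \<in> partitions m k" using k sum_keys_psum[OF k(1)] by (simp add: partitions_def)
qed

lemma finite_parts: "finite (parts m k)" unfolding parts_def using finite_Mon by simp

lemma parts_zero_beyond: "\<kappa> \<in> parts m k \<Longrightarrow> m \<le> i \<Longrightarrow> lookup \<kappa> i = 0"
  by (auto simp: parts_def Mon_def in_keys_iff subset_iff)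

definition sph :: "'m::finite itself \<Rightarrow> monomial \<Rightarrow> (nat \<Rightarrow> real) \<Rightarrow> real" where
  "sph _ \<kappa> x = vh (lookup \<kappa>) (diagm (\<lambda>i. x (rk i)) :: real ^ 'm ^ 'm)"

text \<open>Summation by parts; the boundary term vanishes for a partition with at most
  \<open>N\<close> parts. In use, the exponents of the minors, which are differences of consecutive
  parts, are weighted with the partial sums \<open>min s (Suc r)\<close> of the extremal monomials
  of the minors and add up to the partial sums of the partition.\<close>

lemma antimono_abel:
  fixes f :: "nat \<Rightarrow> nat"
  assumes "antimono f"
  shows "(\<Sum>r<N. (f r - f (Suc r)) * min s (Suc r)) + f N * min s N = (\<Sum>i<min s N. f i)"
proof (induction N)
  case (Suc N)
  have le: "f (Suc N) \<le> f N" using assms by (simp add: antimono_def)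
  have "(f N - f (Suc N)) * min s (Suc N) + f (Suc N) * min s (Suc N) = f N * min s (Suc N)"
    using le by (simp add: add_mult_distrib[symmetric])
  moreover have "f N * min s (Suc N) + (\<Sum>i<min s N. f i) = f N * min s N + (\<Sum>i<min s (Suc N). f i)"
    by (cases "s \<le> N") (auto simp: min_def not_le le_Suc_eq)
  ultimately show ?case using Suc by simp
qed simp

lemma dlt_expands:
  assumes \<kappa>: "\<kappa> \<in> parts CARD('m) k"
  shows "\<exists>\<tau>. expands CARD('m) (psum \<kappa>) \<tau>
    (\<lambda>Y :: real ^ 'm ^ 'm. \<Prod>r<CARD('m). (det (trunc (seg (Suc r)) Y))\<^sup>2 ^ (lookup \<kappa> r - lookup \<kappa> (Suc r)))
    (\<lambda>Y x. dlt (lookup \<kappa>) (Y ** diagm (\<lambda>i. x (rk i)) ** transpose Y))"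
proof -
  let ?m = "CARD('m)"
  have "\<exists>\<tau>. expands ?m (\<lambda>s. \<Sum>r<?m. (lookup \<kappa> r - lookup \<kappa> (Suc r)) * min s (Suc r)) \<tau>
      (\<lambda>Y :: real ^ 'm ^ 'm. \<Prod>r<?m. (det (trunc (seg (Suc r)) Y))\<^sup>2 ^ (lookup \<kappa> r - lookup \<kappa> (Suc r)))
      (\<lambda>Y x. \<Prod>r<?m. pm (seg (Suc r)) (Y ** diagm (\<lambda>i. x (rk i)) ** transpose Y) ^ (lookup \<kappa> r - lookup \<kappa> (Suc r)))"
  proof (rule expands_prod)
    fix r assume "r < ?m"
    then obtain \<tau> where "expands ?m (\<lambda>s. min s (Suc r)) \<tau> (\<lambda>Y :: real ^ 'm ^ 'm. (det (trunc (seg (Suc r)) Y))\<^sup>2)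
      (\<lambda>Y x. pm (seg (Suc r)) (Y ** diagm (\<lambda>i. x (rk i)) ** transpose Y))" using expands_pm[of "Suc r", where 'm = 'm] by auto
    from expands_power[OF this]
    show "\<exists>\<tau>. expands ?m (\<lambda>s. (lookup \<kappa> r - lookup \<kappa> (Suc r)) * min s (Suc r)) \<tau>
      (\<lambda>Y :: real ^ 'm ^ 'm. (det (trunc (seg (Suc r)) Y))\<^sup>2 ^ (lookup \<kappa> r - lookup \<kappa> (Suc r)))
      (\<lambda>Y x. pm (seg (Suc r)) (Y ** diagm (\<lambda>i. x (rk i)) ** transpose Y) ^ (lookup \<kappa> r - lookup \<kappa> (Suc r)))" by blast
  qed
  then obtain \<tau> where E: "expands ?m (\<lambda>s. \<Sum>r<?m. (lookup \<kappa> r - lookup \<kappa> (Suc r)) * min s (Suc r)) \<tau>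
      (\<lambda>Y :: real ^ 'm ^ 'm. \<Prod>r<?m. (det (trunc (seg (Suc r)) Y))\<^sup>2 ^ (lookup \<kappa> r - lookup \<kappa> (Suc r)))
      (\<lambda>Y x. \<Prod>r<?m. pm (seg (Suc r)) (Y ** diagm (\<lambda>i. x (rk i)) ** transpose Y) ^ (lookup \<kappa> r - lookup \<kappa> (Suc r)))" by blast
  show ?thesis
  proof (rule expands_cong[OF E])
    fix s
    have k: "antimono (lookup \<kappa>)" "keys \<kappa> \<subseteq> {..<?m}" using \<kappa> by (auto simp: parts_def Mon_def)
    have "(\<Sum>r<?m. (lookup \<kappa> r - lookup \<kappa> (Suc r)) * min s (Suc r)) = psum \<kappa> (min s ?m)"
      using antimono_abel[OF k(1), of s ?m] parts_zero_beyond[OF \<kappa>, of ?m] by (simp add: psum_def)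
    also have "\<dots> = psum \<kappa> s" using psum_ge[OF k(2), of s] by (cases "s \<le> ?m") (auto simp: min_def)
    finally show "(\<Sum>r<?m. (lookup \<kappa> r - lookup \<kappa> (Suc r)) * min s (Suc r)) = psum \<kappa> s" .
  qed (auto simp: dlt_def)
qed

text \<open>A continuous function that is positive somewhere stays above a positive bound on a ball,
  and the Gaussian density vanishes nowhere.\<close>

lemma integral_gaussM_pos:
  fixes f :: "'a::euclidean_space \<Rightarrow> real"
  assumes f: "pg f" and nn: "\<And>x. f x \<ge> 0" and pos: "f a > 0"
  shows "(\<integral>x. f x \<partial>gaussM) > 0"
proof -
  have cont: "continuous_on UNIV f" using f by (simp add: pg_def)
  have int: "integrable gaussM f" by (rule integrable_pg[OF has_moments_gaussM f])
  have "open {x. f x > f a / 2}" using cont by (intro open_Collect_less continuous_on_const) auto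
  moreover have "a \<in> {x. f x > f a / 2}" using pos by simp
  ultimately obtain e where e: "e > 0" "ball a e \<subseteq> {x. f x > f a / 2}" by (meson openE)
  show ?thesis
  proof (rule ccontr)
    assume "\<not> ?thesis"
    moreover have "(\<integral>x. f x \<partial>gaussM) \<ge> 0" using nn by (intro integral_nonneg_AE) auto
    ultimately have "(\<integral>x. f x \<partial>gaussM) = 0" by simp
    then have "AE x in gaussM. f x = 0"
      using integral_nonneg_eq_0_iff_AE[OF int] nn by simp
    then have "AE x in (lborel :: 'a measure). f x = 0 "
      unfolding gaussM_def by (subst (asm) AE_density) (auto simp: gw_def)
    then have "AE x in (lborel :: 'a measure). x \<notin> ball a e"
      by (rule AE_mp) (use e pos in \<open>auto intro!: AE_I2\<close>)
    then have "emeasure lborel (ball a e) = 0" by (subst (asm) AE_iff_measurable[OF _ refl]) (auto simp: ball_def)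
    then show False using e(1) by (simp add: emeasure_ball unit_ball_vol_pos less_imp_neq[symmetric] zero_less_power)
  qed
qed

text \<open>The leading coefficient is a positive Gaussian mean.\<close>

lemma sph_coefficients:
  assumes \<kappa>: "\<kappa> \<in> parts CARD('m) k"
  shows "\<exists>c. (\<forall>\<alpha>. c \<alpha> \<noteq> 0 \<longrightarrow> \<alpha> \<in> domw CARD('m) (psum \<kappa>)) \<and> c \<kappa> > 0 \<and>
    (\<forall>x. sph TYPE('m::finite) \<kappa> x = (\<Sum>\<alpha>\<in>Mon CARD('m) k. c \<alpha> * mono_eval \<alpha> x))"
proof -
  let ?m = "CARD('m)"
  let ?l = "\<lambda>Y :: real ^ 'm ^ 'm. \<Prod>r<?m. (det (trunc (seg (Suc r)) Y))\<^sup>2 ^ (lookup \<kappa> r - lookup \<kappa> (Suc r))"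
  obtain \<tau> where E: "expands ?m (psum \<kappa>) \<tau> ?l
    (\<lambda>Y x. dlt (lookup \<kappa>) (Y ** diagm (\<lambda>i. x (rk i)) ** transpose Y))" using dlt_expands[OF \<kappa>] by blast
  then have \<tau>: "\<tau> = \<kappa>" unfolding expands_def by (intro psum_inject) blast
  obtain c where c: "\<And>\<alpha>. pg (c \<alpha>)" "c \<kappa> = ?l"
    "\<And>Y x. dlt (lookup \<kappa>) (Y ** diagm (\<lambda>i. x (rk i)) ** transpose Y) = (\<Sum>\<alpha>\<in>domw ?m (psum \<kappa>). c \<alpha> Y * mono_eval \<alpha> x)"
    using E unfolding expands_def \<tau> by blast
  have k: "psum \<kappa> ?m = k" using \<kappa> by (auto simp: parts_def Mon_def)
  define d where "d \<alpha> = (if \<alpha> \<in> domw ?m (psum \<kappa>) then \<integral>Y. c \<alpha> Y \<partial>gaussM else 0)" for \<alpha>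
  have "sph TYPE('m) \<kappa> x = (\<Sum>\<alpha>\<in>Mon ?m k. d \<alpha> * mono_eval \<alpha> x)" for x
  proof -
    have "sph TYPE('m) \<kappa> x = (\<integral>Y. (\<Sum>\<alpha>\<in>domw ?m (psum \<kappa>). c \<alpha> Y * mono_eval \<alpha> x) \<partial>gaussM)"
      unfolding sph_def vh_def c(3) ..
    also have "\<dots> = (\<Sum>\<alpha>\<in>domw ?m (psum \<kappa>). d \<alpha> * mono_eval \<alpha> x)"
      by (subst Bochner_Integration.integral_sum)
        (auto simp: d_def intro!: integrable_pg[OF has_moments_gaussM] pg_mult c(1))
    also have "\<dots> = (\<Sum>\<alpha>\<in>Mon ?m k. d \<alpha> * mono_eval \<alpha> x)"
      by (rule sum.mono_neutral_left[OF finite_Mon]) (use domw_subset[of ?m "psum \<kappa>"] k in \<open>auto simp: d_def\<close>)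
    finally show ?thesis .
  qed
  moreover have "d \<kappa> > 0"
  proof -
    have "\<kappa> \<in> domw ?m (psum \<kappa>)" using \<kappa> by (auto simp: parts_def Mon_def domw_def)
    moreover have "(\<integral>Y. ?l Y \<partial>gaussM) > 0"
    proof (rule integral_gaussM_pos[where a = "mat 1"])
      show "pg ?l" using c by metis
      have "trunc I (mat 1 :: real ^ 'm ^ 'm) = mat 1" for I by (auto simp: trunc_def mat_def vec_eq_iff)
      then show "?l (mat 1) > 0" by simp
    qed (auto intro!: prod_nonneg)
    ultimately show ?thesis by (simp add: d_def c(2))
  qed
  ultimately show ?thesis by (intro exI[of _ d]) (auto simp: d_def)
qed

definition sphc :: "'m::finite itself \<Rightarrow> monomial \<Rightarrow> monomial \<Rightarrow> real" where
  "sphc _ \<kappa> = (SOME c. (\<forall>\<alpha>. c \<alpha> \<noteq> 0 \<longrightarrow> \<alpha> \<in> domw CARD('m) (psum \<kappa>)) \<and> c \<kappa> > 0 \<and>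
    (\<forall>x. sph TYPE('m) \<kappa> x = (\<Sum>\<alpha>\<in>Mon CARD('m) (psum \<kappa> CARD('m)). c \<alpha> * mono_eval \<alpha> x)))"

lemma sphc:
  assumes \<kappa>: "\<kappa> \<in> parts CARD('m) k"
  shows "sphc TYPE('m::finite) \<kappa> \<alpha> \<noteq> 0 \<Longrightarrow> \<alpha> \<in> domw CARD('m) (psum \<kappa>)"
    "sphc TYPE('m) \<kappa> \<kappa> > 0"
    "sph TYPE('m) \<kappa> x = (\<Sum>\<alpha>\<in>Mon CARD('m) k. sphc TYPE('m) \<kappa> \<alpha> * mono_eval \<alpha> x)"
proof -
  have k: "psum \<kappa> CARD('m) = k" using \<kappa> by (auto simp: parts_def Mon_def)
  from someI_ex[OF sph_coefficients[OF \<kappa>]]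
  have *: "(\<forall>\<alpha>. sphc TYPE('m) \<kappa> \<alpha> \<noteq> 0 \<longrightarrow> \<alpha> \<in> domw CARD('m) (psum \<kappa>)) \<and> sphc TYPE('m) \<kappa> \<kappa> > 0 \<and>
    (\<forall>x. sph TYPE('m) \<kappa> x = (\<Sum>\<alpha>\<in>Mon CARD('m) k. sphc TYPE('m) \<kappa> \<alpha> * mono_eval \<alpha> x))"
    unfolding sphc_def k .
  then show "sphc TYPE('m::finite) \<kappa> \<alpha> \<noteq> 0 \<Longrightarrow> \<alpha> \<in> domw CARD('m) (psum \<kappa>)"
    "sphc TYPE('m) \<kappa> \<kappa> > 0"
    "sph TYPE('m) \<kappa> x = (\<Sum>\<alpha>\<in>Mon CARD('m) k. sphc TYPE('m) \<kappa> \<alpha> * mono_eval \<alpha> x)" by blast+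
qed

text \<open>Substitute \<open>x\<^sub>i = t ^ B ^ i\<close> with \<open>B\<close> larger than all exponents.\<close>

lemma digits_unique:
  fixes a b :: "nat \<Rightarrow> nat"
  assumes "\<And>i. i < m \<Longrightarrow> a i < B" "\<And>i. i < m \<Longrightarrow> b i < B" "(\<Sum>i<m. a i * B ^ i) = (\<Sum>i<m. b i * B ^ i)" "i < m"
  shows "a i = b i"
  using assms
proof (induction m arbitrary: a b i)
  case (Suc m)
  have e: "(\<Sum>i<Suc m. c i * B ^ i) = c 0 + B * (\<Sum>i<m. c (Suc i) * B ^ i)" for c :: "nat \<Rightarrow> nat"
    unfolding sum.lessThan_Suc_shift by (simp add: sum_distrib_left mult_ac)
  have eq: "a 0 + B * (\<Sum>i<m. a (Suc i) * B ^ i) = b 0 + B * (\<Sum>i<m. b (Suc i) * B ^ i)"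
    using Suc.prems(3) unfolding e .
  have "a 0 < B" "b 0 < B" using Suc.prems by auto
  then have 0: "a 0 = b 0" using arg_cong[OF eq, of "\<lambda>n. n mod B"] by simp
  moreover have "B > 0" using \<open>a 0 < B\<close> by simp
  ultimately have s: "(\<Sum>i<m. a (Suc i) * B ^ i) = (\<Sum>i<m. b (Suc i) * B ^ i)" using eq by simp
  show ?case
  proof (cases i)
    case (Suc j)
    then show ?thesis using Suc.IH[of "\<lambda>i. a (Suc i)" "\<lambda>i. b (Suc i)" j] s Suc.prems by auto
  qed (use 0 in simp)
qed simp

text \<open>Along the curve the sum becomes a univariate polynomial whose coefficients are the
  \<open>c \<alpha>\<close> without overlap. Only points with positive coordinates are tested,
  because the kernel identities are available for nonnegative arguments only.\<close>

lemma mono_eval_independent: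
  assumes z: "\<And>x. (\<And>i. x i > 0) \<Longrightarrow> (\<Sum>\<alpha>\<in>Mon m k. c \<alpha> * mono_eval \<alpha> x) = 0" and \<alpha>: "\<alpha> \<in> Mon m k"
  shows "c \<alpha> = 0"
proof -
  define B where "B = Suc k"
  define N where "N \<alpha> = (\<Sum>i<m. lookup \<alpha> i * B ^ i)" for \<alpha> :: monomial
  have less: "lookup \<alpha> i < B" if "\<alpha> \<in> Mon m k" "i < m" for \<alpha> i
    using that member_le_sum[of i "{..<m}" "lookup \<alpha>"] by (auto simp: Mon_def psum_def B_def)
  have inj: "inj_on N (Mon m k)"
  proof (rule inj_onI, rule poly_mapping_eqI)
    fix \<alpha> \<beta> i assume a: "\<alpha> \<in> Mon m k" and b: "\<beta> \<in> Mon m k" and eq: "N \<alpha> = N \<beta>"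
    show "lookup \<alpha> i = lookup \<beta> i"
    proof (cases "i < m")
      case True
      then show ?thesis using digits_unique[of m "lookup \<alpha>" B "lookup \<beta>"] less a b eq by (auto simp: N_def)
    next
      case False
      then have "i \<notin> keys \<alpha>" "i \<notin> keys \<beta>" using a b by (auto simp: Mon_def)
      then show ?thesis by (simp add: in_keys_iff)
    qed
  qed
  define Q where "Q = (\<Sum>\<alpha>\<in>Mon m k. monom (c \<alpha>) (N \<alpha>))"
  have "poly Q t = 0" if t: "t > 0" for t
  proof -
    have "mono_eval \<alpha> (\<lambda>i. t ^ B ^ i) = t ^ N \<alpha>" if "\<alpha> \<in> Mon m k" for \<alpha>
      using that mono_eval_lessThan[of \<alpha> m] by (simp add: Mon_def N_def power_sum power_mult[symmetric] mult.commute)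
    then have "poly Q t = (\<Sum>\<alpha>\<in>Mon m k. c \<alpha> * mono_eval \<alpha> (\<lambda>i. t ^ B ^ i))"
      by (simp add: Q_def poly_sum poly_monom)
    then show ?thesis using z[of "\<lambda>i. t ^ B ^ i"] t by simp
  qed
  then have "{0<..} \<subseteq> {t. poly Q t = 0}" by auto
  then have "infinite {t. poly Q t = 0}" using infinite_Ioi infinite_super by blast
  then have "Q = 0" using poly_roots_finite by blast
  then have "0 = coeff Q (N \<alpha>)" by simp
  also have "\<dots> = (\<Sum>\<beta>\<in>Mon m k. if \<beta> = \<alpha> then c \<beta> else 0)"
    unfolding Q_def coeff_sum coeff_monom using inj \<alpha> by (intro sum.cong) (auto simp: inj_on_def)
  also have "\<dots> = c \<alpha>" using \<alpha> by (simp add: finite_Mon)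
  finally show ?thesis by simp
qed

text \<open>The expansions are triangular: for the lexicographically largest \<open>\<mu>\<close>
  with \<open>d \<mu> \<noteq> 0\<close>, no other polynomial that occurs contains the monomial
  \<open>\<mu>\<close>, while its coefficient in its own polynomial is positive.\<close>

lemma sph_independent:
  assumes z: "\<And>x. (\<And>i. x i > 0) \<Longrightarrow> (\<Sum>\<kappa>\<in>parts CARD('m) k. d \<kappa> * sph TYPE('m::finite) \<kappa> x) = 0"
    and \<kappa>: "\<kappa> \<in> parts CARD('m) k"
  shows "d \<kappa> = 0"
proof (rule ccontr)
  let ?m = "CARD('m)" and ?P = "parts CARD('m) k"
  assume "d \<kappa> \<noteq> 0"
  define K where "K = {\<nu>\<in>?P. d \<nu> \<noteq> 0}"
  have K: "finite K" "K \<noteq> {}" using \<open>d \<kappa> \<noteq> 0\<close> \<kappa> finite_parts by (auto simp: K_def)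
  define \<mu> where "\<mu> = Max K"
  have \<mu>: "\<mu> \<in> K" "\<And>\<nu>. \<nu> \<in> K \<Longrightarrow> \<nu> \<le> \<mu>" using K by (auto simp: \<mu>_def)
  then have \<mu>P: "\<mu> \<in> ?P" "d \<mu> \<noteq> 0" by (auto simp: K_def)
  have "(\<Sum>\<nu>\<in>?P. d \<nu> * sphc TYPE('m) \<nu> \<mu>) = 0"
  proof (rule mono_eval_independent[where m = ?m and k = k and c = "\<lambda>\<alpha>. \<Sum>\<nu>\<in>?P. d \<nu> * sphc TYPE('m) \<nu> \<alpha>"])
    fix x :: "nat \<Rightarrow> real" assume "\<And>i. x i > 0"
    then have "0 = (\<Sum>\<nu>\<in>?P. d \<nu> * sph TYPE('m) \<nu> x)" using z by simp
    also have "\<dots> = (\<Sum>\<nu>\<in>?P. \<Sum>\<alpha>\<in>Mon ?m k. d \<nu> * sphc TYPE('m) \<nu> \<alpha> * mono_eval \<alpha> x)"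
      by (intro sum.cong refl) (simp add: sphc(3)[where k = k] sum_distrib_left mult_ac)
    also have "\<dots> = (\<Sum>\<alpha>\<in>Mon ?m k. (\<Sum>\<nu>\<in>?P. d \<nu> * sphc TYPE('m) \<nu> \<alpha>) * mono_eval \<alpha> x)"
      by (subst sum.swap) (simp add: sum_distrib_right)
    finally show "(\<Sum>\<alpha>\<in>Mon ?m k. (\<Sum>\<nu>\<in>?P. d \<nu> * sphc TYPE('m) \<nu> \<alpha>) * mono_eval \<alpha> x) = 0" by simp
  qed (use \<mu>P in \<open>auto simp: parts_def\<close>)
  also have "(\<Sum>\<nu>\<in>?P. d \<nu> * sphc TYPE('m) \<nu> \<mu>) = (\<Sum>\<nu>\<in>?P. if \<nu> = \<mu> then d \<mu> * sphc TYPE('m) \<mu> \<mu> else 0)"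
  proof (rule sum.cong[OF refl])
    fix \<nu> assume \<nu>: "\<nu> \<in> ?P"
    show "d \<nu> * sphc TYPE('m) \<nu> \<mu> = (if \<nu> = \<mu> then d \<mu> * sphc TYPE('m) \<mu> \<mu> else 0)"
    proof (rule ccontr)
      assume *: "\<not> ?thesis"
      then have "\<nu> \<noteq> \<mu>" "d \<nu> \<noteq> 0" "sphc TYPE('m) \<nu> \<mu> \<noteq> 0" by (auto split: if_splits)
      then have "\<mu> \<le> \<nu>" using sphc(1)[OF \<nu>] by (intro dominated_imp_le) (auto simp: domw_def)
      moreover have "\<nu> \<le> \<mu>" using \<mu>(2) \<nu> \<open>d \<nu> \<noteq> 0\<close> by (auto simp: K_def)
      ultimately show False using \<open>\<nu> \<noteq> \<mu>\<close> by simp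
    qed
  qed
  also have "\<dots> = d \<mu> * sphc TYPE('m) \<mu> \<mu>" using \<mu>P by (simp add: finite_parts)
  finally show False using \<mu>P sphc(2)[OF \<mu>P(1)] by simp
qed

section \<open>Symmetric polynomials in terms of spherical polynomials\<close>

lemma permute_diagm:
  assumes \<pi>: "\<pi> permutes {..<CARD('m)}"
  obtains U :: "real ^ 'm ^ 'm" where "orthogonal_matrix U"
    "\<And>x. diagm (\<lambda>i. x (\<pi> (rk i))) = U ** diagm (\<lambda>i. x (rk i)) ** transpose U"
proof -
  define \<sigma> :: "'m \<Rightarrow> 'm" where "\<sigma> i = ix (\<pi> (rk i))" for i
  have r\<sigma>: "rk (\<sigma> i) = \<pi> (rk i)" for i
    using permutes_in_image[OF \<pi>, of "rk i"] by (simp add: \<sigma>_def)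
  have inj: "\<sigma> i = \<sigma> j \<longleftrightarrow> i = j" for i j
    by (metis r\<sigma> permutes_inj[OF \<pi>] injD rk_inj)
  define U :: "real ^ 'm ^ 'm" where "U = (\<chi> i j. if j = \<sigma> i then 1 else 0)"
  have UD: "U ** diagm d ** transpose U = diagm (\<lambda>i. d (\<sigma> i))" for d
  proof (intro vec_eq_iff[THEN iffD2] allI)
    fix i j
    have "(U ** diagm d ** transpose U) $ i $ j = (\<Sum>k\<in>UNIV. (U ** diagm d) $ i $ k * transpose U $ k $ j)"
      by (subst matrix_matrix_mult_def) simp
    also have "\<dots> = (\<Sum>k\<in>UNIV. if k = \<sigma> i then (if k = \<sigma> j then d k else 0) else 0)"
      unfolding diagm_mult_right by (intro sum.cong refl) (auto simp: transpose_def U_def)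
    finally have "(U ** diagm d ** transpose U) $ i $ j = (\<Sum>k\<in>UNIV. if k = \<sigma> i then (if k = \<sigma> j then d k else 0) else 0)" .
    then show "(U ** diagm d ** transpose U) $ i $ j = diagm (\<lambda>i. d (\<sigma> i)) $ i $ j"
      by (simp add: diagm_def inj)
  qed
  have "U ** transpose U = mat 1" using UD[of "\<lambda>_. 1"] by (simp add: mat_eq_diagm[symmetric])
  then have U: "orthogonal_matrix U" by (metis matrix_left_right_inverse orthogonal_matrix_def)
  have "diagm (\<lambda>i. x (\<pi> (rk i))) = U ** diagm (\<lambda>i. x (rk i)) ** transpose U" for x :: "nat \<Rightarrow> real"
    by (simp add: UD r\<sigma>)
  with U show thesis by (rule that)
qed

lemma sph_permute:
  assumes \<pi>: "\<pi> permutes {..<CARD('m)}"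
  shows "sph TYPE('m::finite) \<kappa> (x \<circ> \<pi>) = sph TYPE('m) \<kappa> x"
proof -
  obtain U :: "real ^ 'm ^ 'm" where U: "orthogonal_matrix U"
    "\<And>x. diagm (\<lambda>i. x (\<pi> (rk i))) = U ** diagm (\<lambda>i. x (rk i)) ** transpose U"
    using permute_diagm[OF \<pi>] by blast
  then show ?thesis by (simp add: sph_def vh_orthogonal[OF U(1)])
qed

lemma lookup_map_key: "inj f \<Longrightarrow> lookup (Poly_Mapping.map_key f p) i = lookup p (f i)"
  by (simp add: map_key.rep_eq)

lemma symmetric_coefficients:
  assumes sym: "\<And>\<pi> x. \<pi> permutes {..<m} \<Longrightarrow> (\<Sum>\<alpha>\<in>Mon m k. c \<alpha> * mono_eval \<alpha> (x \<circ> \<pi>)) = (\<Sum>\<alpha>\<in>Mon m k. c \<alpha> * mono_eval \<alpha> x)"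
    and i: "i < m" and j: "j < m" and \<alpha>: "\<alpha> \<in> Mon m k"
  shows "c (Poly_Mapping.map_key (Transposition.transpose i j) \<alpha>) = c \<alpha>" "Poly_Mapping.map_key (Transposition.transpose i j) \<alpha> \<in> Mon m k"
proof -
  let ?\<pi> = "Transposition.transpose i j" and ?T = "Poly_Mapping.map_key (Transposition.transpose i j) :: monomial \<Rightarrow> monomial"
  have \<pi>: "?\<pi> permutes {..<m}" using i j by (intro permutes_swap_id) auto
  have inj: "inj ?\<pi>" by simp
  have TT: "?T (?T \<beta>) = \<beta>" for \<beta> by (rule poly_mapping_eqI) (simp add: lookup_map_key)
  have mem: "?T \<beta> \<in> Mon m k" if "\<beta> \<in> Mon m k" for \<beta>
  proof -
    have "keys (?T \<beta>) \<subseteq> {..<m}"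
    proof
      fix l assume "l \<in> keys (?T \<beta>)"
      then have "?\<pi> l \<in> keys \<beta>" by (simp add: in_keys_iff lookup_map_key)
      then have "?\<pi> l < m" using that by (auto simp: Mon_def)
      then show "l \<in> {..<m}" using permutes_in_image[OF \<pi>, of l] by simp
    qed
    moreover have "psum (?T \<beta>) m = psum \<beta> m"
      unfolding psum_def lookup_map_key[OF inj] using sum.permute[OF \<pi>, of "lookup \<beta>"] by (simp add: comp_def)
    ultimately show ?thesis using that by (simp add: Mon_def)
  qed
  then show "?T \<alpha> \<in> Mon m k" using \<alpha> by blast
  have ev: "mono_eval \<beta> (x \<circ> ?\<pi>) = mono_eval (?T \<beta>) x" if "\<beta> \<in> Mon m k" for \<beta> x
  proof -
    have "mono_eval \<beta> (x \<circ> ?\<pi>) = (\<Prod>l<m. x (?\<pi> l) ^ lookup \<beta> l)"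
      using that mono_eval_lessThan[of \<beta> m] by (simp add: Mon_def)
    also have "\<dots> = (\<Prod>l<m. x l ^ lookup \<beta> (?\<pi> l))"
      using prod.permute[OF \<pi>, of "\<lambda>l. x (?\<pi> l) ^ lookup \<beta> l"] by (simp add: comp_def)
    also have "\<dots> = mono_eval (?T \<beta>) x"
      using mem[OF that] mono_eval_lessThan[of "?T \<beta>" m] by (simp add: Mon_def lookup_map_key)
    finally show ?thesis .
  qed
  have "c (?T \<alpha>) - c \<alpha> = 0"
  proof (rule mono_eval_independent[where m = m and k = k and c = "\<lambda>\<alpha>. c (?T \<alpha>) - c \<alpha>"])
    fix x :: "nat \<Rightarrow> real"
    have "(\<Sum>\<beta>\<in>Mon m k. c \<beta> * mono_eval \<beta> x) = (\<Sum>\<beta>\<in>Mon m k. c \<beta> * mono_eval (?T \<beta>) x)"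
      using sym[OF \<pi>, of x] ev by simp
    also have "\<dots> = (\<Sum>\<beta>\<in>Mon m k. c (?T \<beta>) * mono_eval \<beta> x)"
      by (rule sum.reindex_bij_witness[of _ ?T ?T]) (auto simp: mem TT)
    finally show "(\<Sum>\<alpha>\<in>Mon m k. (c (?T \<alpha>) - c \<alpha>) * mono_eval \<alpha> x) = 0"
      by (simp add: left_diff_distrib sum_subtractf)
  qed (rule \<alpha>)
  then show "c (?T \<alpha>) = c \<alpha>" by simp
qed

text \<open>If a later exponent exceeded an earlier one, exchanging the two would give a
  lexicographically larger monomial with the same coefficient.\<close>

lemma leading_is_partition:
  assumes sym: "\<And>\<pi> x. \<pi> permutes {..<m} \<Longrightarrow> (\<Sum>\<alpha>\<in>Mon m k. c \<alpha> * mono_eval \<alpha> (x \<circ> \<pi>)) = (\<Sum>\<alpha>\<in>Mon m k. c \<alpha> * mono_eval \<alpha> x)"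
    and \<alpha>: "\<alpha> \<in> Mon m k" "c \<alpha> \<noteq> 0" and max: "\<And>\<beta>. \<beta> \<in> Mon m k \<Longrightarrow> c \<beta> \<noteq> 0 \<Longrightarrow> \<beta> \<le> \<alpha>"
  shows "\<alpha> \<in> parts m k"
proof -
  have "lookup \<alpha> j \<le> lookup \<alpha> i" if ij: "i \<le> j" for i j
  proof (rule ccontr)
    assume *: "\<not> lookup \<alpha> j \<le> lookup \<alpha> i"
    then have j: "j < m" using \<alpha>(1) by (metis (no_types, lifting) Mon_def in_keys_iff lessThan_iff mem_Collect_eq not_le subsetD zero_le)
    have ij': "i < j" using ij * by (metis le_refl nat_less_le)
    let ?\<beta> = "Poly_Mapping.map_key (Transposition.transpose i j) \<alpha>"
    note s = symmetric_coefficients[OF sym, of i j \<alpha>]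
    have i: "i < m" using ij' j by simp
    have "?\<beta> \<le> \<alpha>" using max[OF s(2)] s(1) i j \<alpha> by simp
    moreover have "\<alpha> < ?\<beta>"
      unfolding less_poly_mapping.rep_eq less_fun_def
      by (rule exI[of _ i]) (use * ij' in \<open>auto simp: lookup_map_key Transposition.transpose_def\<close>)
    ultimately show False by simp
  qed
  then show ?thesis using \<alpha> by (auto simp: parts_def antimono_def)
qed

text \<open>The leading monomial is a partition and is removed by subtracting a multiple of its
  spherical polynomial, which brings in only smaller monomials. The induction counts all monomials
  below some occurring monomial, because the number of occurring monomials itself may grow.\<close>

theorem sph_span:
  assumes sym: "\<And>\<pi> x. \<pi> permutes {..<CARD('m)} \<Longrightarrow>
    (\<Sum>\<alpha>\<in>Mon CARD('m) k. c \<alpha> * mono_eval \<alpha> (x \<circ> \<pi>)) = (\<Sum>\<alpha>\<in>Mon CARD('m) k. c \<alpha> * mono_eval \<alpha> x)"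
  shows "\<exists>d. \<forall>x. (\<Sum>\<alpha>\<in>Mon CARD('m) k. c \<alpha> * mono_eval \<alpha> x) = (\<Sum>\<kappa>\<in>parts CARD('m) k. d \<kappa> * sph TYPE('m::finite) \<kappa> x)"
  using assms
proof (induction "card {\<beta>\<in>Mon CARD('m) k. \<exists>\<alpha>\<in>Mon CARD('m) k. c \<alpha> \<noteq> 0 \<and> \<beta> \<le> \<alpha>}" arbitrary: c rule: less_induct)
  case less
  let ?m = "CARD('m)" and ?M = "Mon CARD('m) k" and ?P = "parts CARD('m) k"
  show ?case
  proof (cases "\<forall>\<alpha>\<in>?M. c \<alpha> = 0")
    case True
    then show ?thesis by (intro exI[of _ "\<lambda>_. 0"]) simp
  next
    case False
    define K where "K = {\<alpha>\<in>?M. c \<alpha> \<noteq> 0}"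
    have K: "finite K" "K \<noteq> {}" using False finite_Mon by (auto simp: K_def)
    define \<kappa> where "\<kappa> = Max K"
    have "\<kappa> \<in> K" "\<And>\<beta>. \<beta> \<in> K \<Longrightarrow> \<beta> \<le> \<kappa>" using K by (auto simp: \<kappa>_def)
    then have \<kappa>: "\<kappa> \<in> ?M" "c \<kappa> \<noteq> 0" "\<And>\<beta>. \<beta> \<in> ?M \<Longrightarrow> c \<beta> \<noteq> 0 \<Longrightarrow> \<beta> \<le> \<kappa>" by (auto simp: K_def)
    have \<kappa>P: "\<kappa> \<in> ?P" using leading_is_partition[OF less.prems \<kappa>] by blast
    define b where "b = c \<kappa> / sphc TYPE('m) \<kappa> \<kappa>"
    define c' where "c' \<alpha> = c \<alpha> - b * sphc TYPE('m) \<kappa> \<alpha>" for \<alpha>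
    have ev': "(\<Sum>\<alpha>\<in>?M. c' \<alpha> * mono_eval \<alpha> x) = (\<Sum>\<alpha>\<in>?M. c \<alpha> * mono_eval \<alpha> x) - b * sph TYPE('m) \<kappa> x" for x
      unfolding c'_def sphc(3)[OF \<kappa>P] left_diff_distrib sum_subtractf sum_distrib_left by (simp add: mult.assoc)
    have c'\<kappa>: "c' \<kappa> = 0" using sphc(2)[OF \<kappa>P] by (simp add: c'_def b_def)
    have le: "\<beta> \<le> \<kappa>" if "\<beta> \<in> ?M" "c' \<beta> \<noteq> 0" for \<beta>
    proof (cases "c \<beta> = 0")
      case True
      then have "sphc TYPE('m) \<kappa> \<beta> \<noteq> 0" using that by (auto simp: c'_def)
      then show ?thesis using sphc(1)[OF \<kappa>P] by (intro dominated_imp_le) (auto simp: domw_def)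
    qed (use \<kappa>(3) that in auto)
    have "card {\<beta>\<in>?M. \<exists>\<alpha>\<in>?M. c' \<alpha> \<noteq> 0 \<and> \<beta> \<le> \<alpha>} < card {\<beta>\<in>?M. \<exists>\<alpha>\<in>?M. c \<alpha> \<noteq> 0 \<and> \<beta> \<le> \<alpha>}"
    proof (rule psubset_card_mono)
      show "finite {\<beta>\<in>?M. \<exists>\<alpha>\<in>?M. c \<alpha> \<noteq> 0 \<and> \<beta> \<le> \<alpha>}" using finite_Mon by simp
      have "\<kappa> \<notin> {\<beta>\<in>?M. \<exists>\<alpha>\<in>?M. c' \<alpha> \<noteq> 0 \<and> \<beta> \<le> \<alpha>}"
        using le c'\<kappa> by (auto dest: order.antisym)
      moreover have "\<kappa> \<in> {\<beta>\<in>?M. \<exists>\<alpha>\<in>?M. c \<alpha> \<noteq> 0 \<and> \<beta> \<le> \<alpha>}" using \<kappa> by auto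
      moreover have "{\<beta>\<in>?M. \<exists>\<alpha>\<in>?M. c' \<alpha> \<noteq> 0 \<and> \<beta> \<le> \<alpha>} \<subseteq> {\<beta>\<in>?M. \<exists>\<alpha>\<in>?M. c \<alpha> \<noteq> 0 \<and> \<beta> \<le> \<alpha>}"
        using le \<kappa> by (auto intro: order.trans)
      ultimately show "{\<beta>\<in>?M. \<exists>\<alpha>\<in>?M. c' \<alpha> \<noteq> 0 \<and> \<beta> \<le> \<alpha>} \<subset> {\<beta>\<in>?M. \<exists>\<alpha>\<in>?M. c \<alpha> \<noteq> 0 \<and> \<beta> \<le> \<alpha>}" by blast
    qed
    then obtain d where d: "\<And>x. (\<Sum>\<alpha>\<in>?M. c' \<alpha> * mono_eval \<alpha> x) = (\<Sum>\<nu>\<in>?P. d \<nu> * sph TYPE('m) \<nu> x)"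
      using less.hyps[of c'] by (auto simp: ev' less.prems sph_permute)
    have "(\<Sum>\<alpha>\<in>?M. c \<alpha> * mono_eval \<alpha> x) = (\<Sum>\<nu>\<in>?P. (d \<nu> + (if \<nu> = \<kappa> then b else 0)) * sph TYPE('m) \<nu> x)" for x
    proof -
      have "(\<Sum>\<nu>\<in>?P. (if \<nu> = \<kappa> then b else 0) * sph TYPE('m) \<nu> x) = b * sph TYPE('m) \<kappa> x"
        using \<kappa>P finite_parts[of ?m k] by (simp add: if_distrib[of "\<lambda>z. z * _"] cong: if_cong)
      then show ?thesis using d[of x] ev'[of x] by (simp add: distrib_right sum.distrib)
    qed
    then show ?thesis by (intro exI[of _ "\<lambda>\<nu>. d \<nu> + (if \<nu> = \<kappa> then b else 0)"] allI)
  qed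
qed

section \<open>Expansion of powers of the trace\<close>

definition homp :: "nat \<Rightarrow> nat \<Rightarrow> ((nat \<Rightarrow> real) \<Rightarrow> real) \<Rightarrow> bool" where
  "homp m k f \<longleftrightarrow> (\<exists>c. \<forall>x. f x = (\<Sum>\<alpha>\<in>Mon m k. c \<alpha> * mono_eval \<alpha> x))"

lemma homp_mono: "keys \<alpha> \<subseteq> {..<m} \<Longrightarrow> psum \<alpha> m = k \<Longrightarrow> homp m k (mono_eval \<alpha>)"
  unfolding homp_def
proof (intro exI[of _ "\<lambda>\<beta>. if \<beta> = \<alpha> then 1 else 0"] allI)
  fix x assume "keys \<alpha> \<subseteq> {..<m}" "psum \<alpha> m = k"
  then have "\<alpha> \<in> Mon m k" by (simp add: Mon_def)
  moreover have "(\<Sum>\<beta>\<in>Mon m k. (if \<beta> = \<alpha> then 1 else 0) * mono_eval \<beta> x) = (\<Sum>\<beta>\<in>Mon m k. if \<beta> = \<alpha> then mono_eval \<alpha> x else 0)"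
    by (intro sum.cong) auto
  ultimately show "mono_eval \<alpha> x = (\<Sum>\<beta>\<in>Mon m k. (if \<beta> = \<alpha> then 1 else 0) * mono_eval \<beta> x)"
    by (simp add: finite_Mon)
qed

lemma homp_add: "homp m k f \<Longrightarrow> homp m k g \<Longrightarrow> homp m k (\<lambda>x. f x + g x)"
  unfolding homp_def
proof (elim exE)
  fix c d assume "\<forall>x. f x = (\<Sum>\<alpha>\<in>Mon m k. c \<alpha> * mono_eval \<alpha> x)" "\<forall>x. g x = (\<Sum>\<alpha>\<in>Mon m k. d \<alpha> * mono_eval \<alpha> x)"
  then show "\<exists>c. \<forall>x. f x + g x = (\<Sum>\<alpha>\<in>Mon m k. c \<alpha> * mono_eval \<alpha> x)"
    by (intro exI[of _ "\<lambda>\<alpha>. c \<alpha> + d \<alpha>"]) (simp add: distrib_right sum.distrib)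
qed

lemma homp_cmult: "homp m k f \<Longrightarrow> homp m k (\<lambda>x. a * f x)"
  unfolding homp_def
proof (elim exE)
  fix c assume "\<forall>x. f x = (\<Sum>\<alpha>\<in>Mon m k. c \<alpha> * mono_eval \<alpha> x)"
  then show "\<exists>c. \<forall>x. a * f x = (\<Sum>\<alpha>\<in>Mon m k. c \<alpha> * mono_eval \<alpha> x)"
    by (intro exI[of _ "\<lambda>\<alpha>. a * c \<alpha>"]) (simp add: sum_distrib_left mult_ac)
qed

lemma homp_sum: "(\<And>i. i \<in> I \<Longrightarrow> homp m k (f i)) \<Longrightarrow> homp m k (\<lambda>x. \<Sum>i\<in>I. f i x)"
proof (induction I rule: infinite_finite_induct)
  case (insert i I)
  then show ?case using homp_add[of m k "f i"] by simp
qed (auto simp: homp_def intro!: exI[of _ "\<lambda>_. 0"])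

text \<open>A polynomial without parameter is read as one whose coefficients are constant in a dummy
  real parameter, so that \<open>expands_mult\<close> performs the convolution of the
  coefficients.\<close>

lemma homp_mult:
  assumes m: "m > 0" and f: "homp m k f" and g: "homp m l g"
  shows "homp m (k + l) (\<lambda>x. f x * g x)"
proof -
  let ?w = "\<lambda>k r. if r = 0 then 0 else k :: nat"
  have t: "keys (Poly_Mapping.single 0 k) \<subseteq> {..<m}" "psum (Poly_Mapping.single 0 k) r = ?w k r" for k r
    using m by (auto simp: psum_def lookup_single when_def)
  have *: "\<exists>c0. expands m (?w k) (Poly_Mapping.single 0 k) c0 (\<lambda>(_::real) x. f x)" if h: "homp m k f" for k f
  proof -
    obtain c where "\<And>x. f x = (\<Sum>\<alpha>\<in>Mon m k. c \<alpha> * mono_eval \<alpha> x)" using h unfolding homp_def by blast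
    then show ?thesis unfolding expands_def
      by (intro exI[of _ "\<lambda>_. c (Poly_Mapping.single 0 k)"] conjI exI[of _ "\<lambda>\<alpha> _. c \<alpha>"])
        (use t in \<open>auto simp: Mon_eq_domw[OF m]\<close>)
  qed
  obtain c d where "expands m (?w k) (Poly_Mapping.single 0 k) c (\<lambda>(_::real) x. f x)"
    "expands m (?w l) (Poly_Mapping.single 0 l) d (\<lambda>(_::real) x. g x)" using *[OF f] *[OF g] by blast
  from expands_mult[OF this] obtain c where
    "\<And>(Y::real) x. f x * g x = (\<Sum>\<alpha>\<in>domw m (\<lambda>r. ?w k r + ?w l r). c \<alpha> Y * mono_eval \<alpha> x)"
    unfolding expands_def by blast
  then have "f x * g x = (\<Sum>\<alpha>\<in>Mon m (k + l). c \<alpha> 0 * mono_eval \<alpha> x)" for x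
    by (simp add: Mon_eq_domw[OF m] if_distrib[of "\<lambda>z. z + _"] cong: if_cong)
  then show ?thesis unfolding homp_def by (intro exI[of _ "\<lambda>\<alpha>. c \<alpha> 0"]) blast
qed

lemma homp_one: "homp m 0 (\<lambda>_. 1)"
  using homp_mono[of 0 m 0] by (simp add: psum_def mono_eval_def[abs_def])

lemma homp_power: "m > 0 \<Longrightarrow> homp m k f \<Longrightarrow> homp m (k * n) (\<lambda>x. f x ^ n)"
proof (induction n)
  case (Suc n) then show ?case using homp_mult[of m k f "k * n" "\<lambda>x. f x ^ n"] by simp
qed (simp add: homp_one)

lemma homp_power_sum: "homp m k (\<lambda>x. \<Sum>i<m. x i ^ k)"
proof (rule homp_sum)
  fix i assume i: "i \<in> {..<m}"
  have "homp m k (mono_eval (Poly_Mapping.single i k))"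
    using i by (intro homp_mono) (auto simp: psum_def lookup_single when_def)
  moreover have "mono_eval (Poly_Mapping.single i k) = (\<lambda>x. x i ^ k)"
    by (cases "k = 0") (auto simp: mono_eval_def)
  ultimately show "homp m k (\<lambda>x. x i ^ k)" by simp
qed

text \<open>An invariant function is determined by its values on diagonal matrices, where
  \<open>sph_span\<close> applies; both sides are invariant, so the identity extends to all
  symmetric matrices by diagonalization.\<close>

lemma invariant_expansion:
  fixes f :: "real ^ 'm ^ 'm \<Rightarrow> real"
  assumes inv: "\<And>U C. orthogonal_matrix U \<Longrightarrow> f (transpose U ** C ** U) = f C"
    and hom: "homp CARD('m) k (\<lambda>x. f (diagm (\<lambda>i. x (rk i))))"
    and sym: "\<And>\<pi> x. \<pi> permutes {..<CARD('m)} \<Longrightarrow> f (diagm (\<lambda>i. x (\<pi> (rk i)))) = f (diagm (\<lambda>i. x (rk i)))"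
  shows "\<exists>\<phi>. \<forall>C. transpose C = C \<longrightarrow> f C = (\<Sum>\<kappa>\<in>parts CARD('m) k. \<phi> \<kappa> * vh (lookup \<kappa>) C)"
proof -
  obtain c where c: "\<And>x. f (diagm (\<lambda>i. x (rk i))) = (\<Sum>\<alpha>\<in>Mon CARD('m) k. c \<alpha> * mono_eval \<alpha> x)"
    using hom by (auto simp: homp_def)
  have "\<exists>d. \<forall>x. (\<Sum>\<alpha>\<in>Mon CARD('m) k. c \<alpha> * mono_eval \<alpha> x) = (\<Sum>\<kappa>\<in>parts CARD('m) k. d \<kappa> * sph TYPE('m) \<kappa> x)"
    by (rule sph_span) (simp add: c[symmetric] sym)
  then obtain d where d: "\<And>x. f (diagm (\<lambda>i. x (rk i))) = (\<Sum>\<kappa>\<in>parts CARD('m) k. d \<kappa> * sph TYPE('m) \<kappa> x)"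
    using c by auto
  have "f C = (\<Sum>\<kappa>\<in>parts CARD('m) k. d \<kappa> * vh (lookup \<kappa>) C)" if C: "transpose C = C" for C :: "real ^ 'm ^ 'm"
  proof -
    obtain U e where U: "orthogonal_matrix U" "C = transpose U ** diagm e ** U"
      using symmetric_diagonalization[OF C] by blast
    have "orthogonal_matrix (transpose U)" using U(1) by simp
    from vh_orthogonal[OF this] have v: "vh q C = vh q (diagm e)" for q by (simp add: U(2))
    show ?thesis
      using inv[OF U(1), of "diagm e"] d[of "\<lambda>l. e (ix l)"] by (simp add: v sph_def U(2)[symmetric])
  qed
  then show ?thesis by blast
qed

lemma trace_orthogonal: "orthogonal_matrix U \<Longrightarrow> trace (transpose U ** C ** U) = trace C" for U :: "real ^ 'm ^ 'm"
  by (metis matrix_mul_assoc matrix_mul_lid orthogonal_matrix_def trace_mul_sym)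

lemma trace_diagm_rk: "trace (diagm (\<lambda>i::'m::finite. x (rk i))) = (\<Sum>l<CARD('m). x l)"
  by (simp add: trace_diagm sum_ix)

lemma trace_power_expansion:
  "\<exists>\<phi>. \<forall>C :: real ^ 'm ^ 'm. transpose C = C \<longrightarrow> trace C ^ k = (\<Sum>\<kappa>\<in>parts CARD('m) k. \<phi> \<kappa> * vh (lookup \<kappa>) C)"
proof (rule invariant_expansion)
  show "homp CARD('m) k (\<lambda>x. trace (diagm (\<lambda>i::'m. x (rk i))) ^ k)"
    using homp_power[OF _ homp_power_sum[of "CARD('m)" 1], of k] by (simp add: trace_diagm_rk)
  show "trace (diagm (\<lambda>i::'m. x (\<pi> (rk i)))) ^ k = trace (diagm (\<lambda>i::'m. x (rk i))) ^ k"
    if "\<pi> permutes {..<CARD('m)}" for \<pi> and x :: "nat \<Rightarrow> real"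
    unfolding trace_diagm_rk trace_diagm_rk[of "\<lambda>l. x (\<pi> l)"] using sum.permute[OF that, of x] by (simp add: comp_def)
qed (simp add: trace_orthogonal)

text \<open>This invariant is the one that the differential operator produces from the kernel of
  \<open>trace C ^ k\<close>; its expansion shows that the image of the kernel is again
  diagonal.\<close>

lemma trace_square_expansion:
  assumes k: "k \<ge> 2"
  shows "\<exists>\<phi>. \<forall>C :: real ^ 'm ^ 'm. transpose C = C \<longrightarrow>
    trace (C ** C) * trace C ^ (k - 2) = (\<Sum>\<kappa>\<in>parts CARD('m) k. \<phi> \<kappa> * vh (lookup \<kappa>) C)"
proof (rule invariant_expansion)
  have e: "trace (diagm (\<lambda>i::'m. x (rk i)) ** diagm (\<lambda>i. x (rk i))) = (\<Sum>l<CARD('m). x l ^ 2)" for x :: "nat \<Rightarrow> real"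
    using trace_diagm_rk[of "\<lambda>l. x l * x l", where 'm = 'm] by (simp add: diagm_mult power2_eq_square)
  show "homp CARD('m) k (\<lambda>x. trace (diagm (\<lambda>i::'m. x (rk i)) ** diagm (\<lambda>i. x (rk i))) * trace (diagm (\<lambda>i::'m. x (rk i))) ^ (k - 2))"
    using homp_mult[OF _ homp_power_sum[of "CARD('m)" 2] homp_power[OF _ homp_power_sum[of "CARD('m)" 1], of "k - 2"]] k
    unfolding e trace_diagm_rk by (simp only: le_add_diff_inverse mult_1 zero_less_card_finite power_one_right)
  show "trace (diagm (\<lambda>i::'m. x (\<pi> (rk i))) ** diagm (\<lambda>i. x (\<pi> (rk i)))) * trace (diagm (\<lambda>i::'m. x (\<pi> (rk i)))) ^ (k - 2)
    = trace (diagm (\<lambda>i::'m. x (rk i)) ** diagm (\<lambda>i. x (rk i))) * trace (diagm (\<lambda>i::'m. x (rk i))) ^ (k - 2)"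
    if "\<pi> permutes {..<CARD('m)}" for \<pi> and x :: "nat \<Rightarrow> real"
    unfolding e e[of "\<lambda>l. x (\<pi> l)"] trace_diagm_rk trace_diagm_rk[of "\<lambda>l. x (\<pi> l)"]
    using sum.permute[OF that, of x] sum.permute[OF that, of "\<lambda>l. x l ^ 2"] by (simp add: comp_def)
  fix U C :: "real ^ 'm ^ 'm" assume U: "orthogonal_matrix U"
  have "(transpose U ** C ** U) ** (transpose U ** C ** U) = transpose U ** (C ** C) ** U"
    using U by (metis matrix_mul_assoc matrix_mul_lid orthogonal_matrix_def)
  then show "trace ((transpose U ** C ** U) ** (transpose U ** C ** U)) * trace (transpose U ** C ** U) ^ (k - 2)
    = trace (C ** C) * trace C ^ (k - 2)" using U by (simp add: trace_orthogonal)
qed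

text \<open>The choice of coefficients depends on \<open>\<kappa>\<close> only through its weight,
  so a single expansion of the power of the trace is used for all partitions of the same
  number.\<close>

definition gam :: "'m::finite itself \<Rightarrow> monomial \<Rightarrow> real" where
  "gam _ \<kappa> = (SOME \<phi>. \<forall>C :: real ^ 'm ^ 'm. transpose C = C \<longrightarrow>
    trace C ^ psum \<kappa> CARD('m) = (\<Sum>\<nu>\<in>parts CARD('m) (psum \<kappa> CARD('m)). \<phi> \<nu> * vh (lookup \<nu>) C)) \<kappa>"

lemma trace_power_gam:
  fixes C :: "real ^ 'm ^ 'm"
  assumes "transpose C = C"
  shows "trace C ^ k = (\<Sum>\<kappa>\<in>parts CARD('m) k. gam TYPE('m) \<kappa> * vh (lookup \<kappa>) C)"
proof -
  define \<phi> where "\<phi> = (SOME \<phi>. \<forall>C :: real ^ 'm ^ 'm. transpose C = C \<longrightarrow>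
    trace C ^ k = (\<Sum>\<nu>\<in>parts CARD('m) k. \<phi> \<nu> * vh (lookup \<nu>) C))"
  have "trace C ^ k = (\<Sum>\<kappa>\<in>parts CARD('m) k. \<phi> \<kappa> * vh (lookup \<kappa>) C)"
    using someI_ex[OF trace_power_expansion[of k, where 'm = 'm]] assms unfolding \<phi>_def by blast
  also have "\<dots> = (\<Sum>\<kappa>\<in>parts CARD('m) k. gam TYPE('m) \<kappa> * vh (lookup \<kappa>) C)"
    by (intro sum.cong refl) (auto simp: gam_def \<phi>_def parts_def Mon_def)
  finally show ?thesis .
qed

lemma power_sum_gam:
  "(\<Sum>i<CARD('m::finite). x i) ^ k = (\<Sum>\<kappa>\<in>parts CARD('m) k. gam TYPE('m) \<kappa> * sph TYPE('m) \<kappa> x)"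
  using trace_power_gam[of "diagm (\<lambda>i::'m. x (rk i))" k] by (simp add: trace_diagm_rk sph_def)

section \<open>The kernel of two diagonal matrices\<close>

abbreviation dg :: "(nat \<Rightarrow> real) \<Rightarrow> real ^ 'm::finite ^ 'm" where "dg x \<equiv> diagm (\<lambda>i. x (rk i))"

lemma sph_eq_mean: "sph TYPE('m::finite) \<kappa> x = (\<integral>Y. dlt (lookup \<kappa>) (Y ** dg x ** transpose Y) \<partial>(gaussM :: (real ^ 'm ^ 'm) measure))"
  by (simp add: sph_def vh_def)

text \<open>\<open>expansion_mean\<close> has the square roots of \<open>b\<close> outside and
  \<open>a\<close> inside the sandwich, while the kernels have \<open>b\<close> inside; transposing
  the Gaussian matrix exchanges the roles.\<close>

lemma kernel_expansion:
  fixes f :: "real ^ 'm ^ 'm \<Rightarrow> real"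
  assumes f: "\<And>C. transpose C = C \<Longrightarrow> f C = (\<Sum>\<kappa>\<in>P. \<phi> \<kappa> * vh (lookup \<kappa>) C)" and b: "\<And>i. b i \<ge> 0"
    and g: "g \<in> borel_measurable borel"
    and fg: "\<And>Y. f (diagm (\<lambda>i. sqrt (b (rk i))) ** (Y ** dg a ** transpose Y) ** diagm (\<lambda>i. sqrt (b (rk i)))) = g (transpose Y)"
  shows "(\<integral>Y. g Y \<partial>(gaussM :: (real ^ 'm ^ 'm) measure)) = (\<Sum>\<kappa>\<in>P. \<phi> \<kappa> * sph TYPE('m) \<kappa> b * sph TYPE('m) \<kappa> a)"
proof -
  have "(\<integral>Y. g Y \<partial>(gaussM :: (real ^ 'm ^ 'm) measure)) = (\<integral>Y. g (transpose Y) \<partial>(gaussM :: (real ^ 'm ^ 'm) measure))"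
    by (rule integral_gaussM_transpose[symmetric, OF g])
  also have "\<dots> = (\<Sum>\<kappa>\<in>P. \<phi> \<kappa> * vh (lookup \<kappa>) (diagm (\<lambda>i. b (rk i)) :: real ^ 'm ^ 'm) *
      (\<integral>Y. dlt (lookup \<kappa>) (Y ** dg a ** transpose Y) \<partial>(gaussM :: (real ^ 'm ^ 'm) measure)))"
    unfolding fg[symmetric]
  proof (rule expansion_mean[where q = lookup and B = "dg a" and b = "\<lambda>i. b (rk i)" and f = f and \<phi> = \<phi> and P = P])
    show "has_moments (gaussM :: (real ^ 'm ^ 'm) measure)" by (rule has_moments_gaussM)
    show "distr gaussM borel (\<lambda>Y :: real ^ 'm ^ 'm. U ** Y) = gaussM" if "orthogonal_matrix U" for U :: "real ^ 'm ^ 'm"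
      using that by (rule gaussM_left)
  qed (use f b in auto)
  finally show ?thesis by (simp add: sph_eq_mean vh_def)
qed

lemma trace_sandwich_diagm:
  fixes Z :: "real ^ 'm ^ 'm"
  assumes "\<And>i. b i \<ge> 0"
  shows "trace (diagm (\<lambda>i. sqrt (b i)) ** Z ** diagm (\<lambda>i. sqrt (b i))) = trace (diagm b ** Z)"
    "trace ((diagm (\<lambda>i. sqrt (b i)) ** Z ** diagm (\<lambda>i. sqrt (b i))) ** (diagm (\<lambda>i. sqrt (b i)) ** Z ** diagm (\<lambda>i. sqrt (b i))))
      = trace (diagm b ** Z ** diagm b ** Z)"
proof -
  let ?S = "diagm (\<lambda>i. sqrt (b i)) :: real ^ 'm ^ 'm"
  have SS: "?S ** ?S = diagm b" using assms by (simp add: diagm_mult)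
  have "trace (?S ** Z ** ?S) = trace (?S ** (?S ** Z))" by (rule trace_mul_sym)
  also have "?S ** (?S ** Z) = diagm b ** Z" by (simp only: matrix_mul_assoc SS)
  finally show "trace (?S ** Z ** ?S) = trace (diagm b ** Z)" .
  have "(?S ** Z ** ?S) ** (?S ** Z ** ?S) = (?S ** Z ** (?S ** ?S) ** Z) ** ?S" by (simp only: matrix_mul_assoc)
  then have "trace ((?S ** Z ** ?S) ** (?S ** Z ** ?S)) = trace ((?S ** Z ** (?S ** ?S) ** Z) ** ?S)" by simp
  also have "\<dots> = trace (?S ** (?S ** Z ** (?S ** ?S) ** Z))" by (rule trace_mul_sym)
  also have "?S ** (?S ** Z ** (?S ** ?S) ** Z) = (?S ** ?S) ** Z ** (?S ** ?S) ** Z" by (simp only: matrix_mul_assoc)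
  finally show "trace ((?S ** Z ** ?S) ** (?S ** Z ** ?S)) = trace (diagm b ** Z ** diagm b ** Z)" by (simp only: SS)
qed

lemma pg_sandwich_entry [intro]: "pg (\<lambda>Y :: real ^ 'n ^ 'm. (A ** (Y ** B ** transpose Y)) $ i $ j)"
  by (intro pg_matrix_mult pg_const pg_transpose pg_entry)

text \<open>Only \<open>b\<close> enters through a square root; \<open>a\<close> remains
  unrestricted, so the kernel can be differentiated in \<open>a\<close>.\<close>

lemma kernel_trace:
  assumes b: "\<And>i. b i \<ge> 0"
  shows "(\<integral>Y. trace (dg a ** (Y ** dg b ** transpose Y)) ^ k \<partial>(gaussM :: (real ^ 'm ^ 'm) measure))
    = (\<Sum>\<kappa>\<in>parts CARD('m::finite) k. gam TYPE('m) \<kappa> * sph TYPE('m) \<kappa> b * sph TYPE('m) \<kappa> a)"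
proof (rule kernel_expansion[where f = "\<lambda>C. trace C ^ k"])
  show "(\<lambda>Y :: real ^ 'm ^ 'm. trace (dg a ** (Y ** dg b ** transpose Y)) ^ k) \<in> borel_measurable borel"
    by (intro pg_measurable pg_power pg_trace pg_sandwich_entry)
  fix Y :: "real ^ 'm ^ 'm"
  let ?S = "diagm (\<lambda>i. sqrt (b (rk i))) :: real ^ 'm ^ 'm"
  have "trace (?S ** (Y ** dg a ** transpose Y) ** ?S) = trace (dg b ** (Y ** dg a ** transpose Y))"
    by (rule trace_sandwich_diagm(1)) (rule b)
  also have "\<dots> = trace ((dg b ** Y) ** (dg a ** transpose Y))" by (simp only: matrix_mul_assoc)
  also have "\<dots> = trace ((dg a ** transpose Y) ** (dg b ** Y))" by (rule trace_mul_sym)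
  finally show "trace (?S ** (Y ** dg a ** transpose Y) ** ?S) ^ k
    = trace (dg a ** (transpose Y ** dg b ** transpose (transpose Y))) ^ k"
    by (simp only: matrix_mul_assoc transpose_transpose)
qed (auto simp: trace_power_gam b)

lemma kernel_trace_square:
  assumes k: "k \<ge> 2"
  obtains \<eta> where "\<And>a b. (\<And>i. b i \<ge> 0) \<Longrightarrow>
    (\<integral>Y. trace (dg a ** (Y ** dg b ** transpose Y) ** dg a ** (Y ** dg b ** transpose Y)) *
      trace (dg a ** (Y ** dg b ** transpose Y)) ^ (k - 2) \<partial>(gaussM :: (real ^ 'm ^ 'm) measure))
    = (\<Sum>\<kappa>\<in>parts CARD('m::finite) k. \<eta> \<kappa> * sph TYPE('m) \<kappa> b * sph TYPE('m) \<kappa> a)"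
proof -
  obtain \<eta> where \<eta>: "\<And>C :: real ^ 'm ^ 'm. transpose C = C \<Longrightarrow>
    trace (C ** C) * trace C ^ (k - 2) = (\<Sum>\<kappa>\<in>parts CARD('m) k. \<eta> \<kappa> * vh (lookup \<kappa>) C)"
    using trace_square_expansion[OF k] by blast
  show ?thesis
  proof (rule that[of \<eta>], rule kernel_expansion[OF \<eta>])
    fix a b :: "nat \<Rightarrow> real" assume b: "\<And>i. b i \<ge> 0"
    then show "\<And>i. b i \<ge> 0" .
    show "(\<lambda>Y :: real ^ 'm ^ 'm. trace (dg a ** (Y ** dg b ** transpose Y) ** dg a ** (Y ** dg b ** transpose Y)) *
      trace (dg a ** (Y ** dg b ** transpose Y)) ^ (k - 2)) \<in> borel_measurable borel"
      by (intro pg_measurable pg_mult pg_power pg_trace pg_matrix_mult pg_const pg_transpose pg_entry)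
    fix Y :: "real ^ 'm ^ 'm"
    let ?S = "diagm (\<lambda>i. sqrt (b (rk i))) :: real ^ 'm ^ 'm" and ?Z = "Y ** dg a ** transpose Y"
    have 1: "trace (?S ** ?Z ** ?S) = trace (dg a ** (transpose Y ** dg b ** Y))"
    proof -
      have "trace (?S ** ?Z ** ?S) = trace (dg b ** ?Z)" by (rule trace_sandwich_diagm(1)) (rule b)
      also have "\<dots> = trace ((dg b ** Y) ** (dg a ** transpose Y))" by (simp only: matrix_mul_assoc)
      also have "\<dots> = trace ((dg a ** transpose Y) ** (dg b ** Y))" by (rule trace_mul_sym)
      finally show ?thesis by (simp only: matrix_mul_assoc)
    qed
    have "trace ((?S ** ?Z ** ?S) ** (?S ** ?Z ** ?S)) = trace (dg b ** ?Z ** dg b ** ?Z)"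
      by (rule trace_sandwich_diagm(2)) (rule b)
    also have "\<dots> = trace ((dg b ** Y) ** (dg a ** transpose Y ** dg b ** Y ** dg a ** transpose Y))" by (simp only: matrix_mul_assoc)
    also have "\<dots> = trace ((dg a ** transpose Y ** dg b ** Y ** dg a ** transpose Y) ** (dg b ** Y))" by (rule trace_mul_sym)
    finally have 2: "trace ((?S ** ?Z ** ?S) ** (?S ** ?Z ** ?S))
        = trace (dg a ** (transpose Y ** dg b ** Y) ** dg a ** (transpose Y ** dg b ** Y))"
      by (simp only: matrix_mul_assoc)
    show "trace ((?S ** ?Z ** ?S) ** (?S ** ?Z ** ?S)) * trace (?S ** ?Z ** ?S) ^ (k - 2)
      = trace (dg a ** (transpose Y ** dg b ** transpose (transpose Y)) ** dg a ** (transpose Y ** dg b ** transpose (transpose Y))) *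
        trace (dg a ** (transpose Y ** dg b ** transpose (transpose Y))) ^ (k - 2)"
      unfolding 1 2 transpose_transpose ..
  qed
qed

section \<open>Non-vanishing of the coefficients of the trace powers\<close>

lemma sum_alternating_Pow: "finite U \<Longrightarrow> (\<Sum>T\<in>Pow U. (-1) ^ card T) = (if U = {} then 1 else 0 :: real)"
proof (induction U rule: finite_induct)
  case (insert a U)
  have "(\<Sum>T\<in>Pow (insert a U). (-1) ^ card T) = (\<Sum>T\<in>Pow U. (-1) ^ card T) + (\<Sum>T\<in>insert a ` Pow U. (-1) ^ card T :: real)"
    unfolding Pow_insert using insert by (intro sum.union_disjoint) auto
  also have "(\<Sum>T\<in>insert a ` Pow U. (-1) ^ card T :: real) = (\<Sum>T\<in>Pow U. (-1) ^ card (insert a T))"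
    using insert by (subst sum.reindex) (auto simp: inj_on_def)
  also have "\<dots> = (\<Sum>T\<in>Pow U. - ((-1) ^ card T))"
  proof (intro sum.cong refl)
    fix T assume "T \<in> Pow U"
    then have "finite T" "a \<notin> T" using insert finite_subset by auto
    then show "(-1 :: real) ^ card (insert a T) = - ((-1) ^ card T)" by simp
  qed
  finally show ?case by (simp add: sum_negf)
qed simp

text \<open>Expanding the powers gives a sum over maps of the index set to itself, and the
  alternating sum over \<open>S\<close> keeps only the surjective ones, which are the permutations.
  The signs stand outside the powers: what is raised to the power \<open>k\<close> is a plain sum,
  hence a form with semidefinite matrix when the summands are such forms.\<close>

lemma polarization:
  fixes x :: "nat \<Rightarrow> real"
  shows "fact k * (\<Prod>i<k. x i) = (\<Sum>S\<in>Pow {..<k}. (-1) ^ (k - card S) * (\<Sum>i\<in>S. x i) ^ k)"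
proof -
  let ?F = "{..<k} \<rightarrow>\<^sub>E {..<k}"
  have finF: "finite ?F" by (intro finite_PiE) auto
  have pw: "(\<Sum>i\<in>S. x i) ^ k = (\<Sum>f\<in>?F. if f ` {..<k} \<subseteq> S then \<Prod>j<k. x (f j) else 0)" if S: "S \<in> Pow {..<k}" for S
  proof -
    have fS: "finite S" using S finite_subset by auto
    have "(\<Sum>i\<in>S. x i) ^ k = (\<Prod>j<k. \<Sum>i\<in>S. x i)" by simp
    also have "\<dots> = (\<Sum>f\<in>{..<k} \<rightarrow>\<^sub>E S. \<Prod>j<k. x (f j))"
      by (rule prod_sum_PiE) (use fS in auto)
    also have "{..<k} \<rightarrow>\<^sub>E S = {f\<in>?F. f ` {..<k} \<subseteq> S}" using S by (auto simp: PiE_iff image_subset_iff extensional_def)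
    finally show ?thesis using finF by (simp add: sum.inter_filter)
  qed
  have alt: "(\<Sum>S\<in>Pow {..<k}. if A \<subseteq> S then (-1) ^ (k - card S) else 0) = (if A = {..<k} then 1 else 0 :: real)"
    if A: "A \<subseteq> {..<k}" for A
  proof -
    have "(\<Sum>S\<in>Pow {..<k}. if A \<subseteq> S then (-1) ^ (k - card S) else 0 :: real) = (\<Sum>S\<in>{S\<in>Pow {..<k}. A \<subseteq> S}. (-1) ^ (k - card S))"
      by (rule sum.inter_filter[symmetric]) simp
    also have "\<dots> = (\<Sum>T\<in>Pow ({..<k} - A). (-1) ^ card T)"
    proof (rule sum.reindex_bij_witness[of _ "\<lambda>T. {..<k} - T" "\<lambda>S. {..<k} - S"])
      fix S assume "S \<in> {S\<in>Pow {..<k}. A \<subseteq> S}"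
      then show "(-1 :: real) ^ card ({..<k} - S) = (-1) ^ (k - card S)" by (auto simp: card_Diff_subset finite_subset[OF _ finite_lessThan])
    qed (use A in auto)
    also have "\<dots> = (if A = {..<k} then 1 else 0)" using A by (subst sum_alternating_Pow) auto
    finally show ?thesis .
  qed
  have "(\<Sum>S\<in>Pow {..<k}. (-1) ^ (k - card S) * (\<Sum>i\<in>S. x i) ^ k)
    = (\<Sum>S\<in>Pow {..<k}. \<Sum>f\<in>?F. (if f ` {..<k} \<subseteq> S then (-1) ^ (k - card S) else 0) * (\<Prod>j<k. x (f j)))"
    by (intro sum.cong refl) (simp add: pw sum_distrib_left if_distrib[of "\<lambda>z. z * _"] if_distrib[of "\<lambda>z. _ * z"] cong: if_cong)
  also have "\<dots> = (\<Sum>f\<in>?F. (\<Sum>S\<in>Pow {..<k}. if f ` {..<k} \<subseteq> S then (-1) ^ (k - card S) else 0) * (\<Prod>j<k. x (f j)))"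
    unfolding sum_distrib_right by (rule sum.swap)
  also have "\<dots> = (\<Sum>f\<in>?F. (if f ` {..<k} = {..<k} then 1 else 0) * (\<Prod>j<k. x (f j)))"
    by (intro sum.cong refl) (subst alt, auto simp: PiE_iff)
  also have "\<dots> = (\<Sum>f\<in>{f\<in>?F. f ` {..<k} = {..<k}}. \<Prod>i<k. x i)"
    unfolding sum.inter_filter[OF finF]
  proof (intro sum.cong refl)
    fix f
    show "(if f ` {..<k} = {..<k} then 1 else 0) * (\<Prod>j<k. x (f j)) = (if f ` {..<k} = {..<k} then \<Prod>i<k. x i else 0)"
    proof (cases "f ` {..<k} = {..<k}")
      case True
      then have "bij_betw f {..<k} {..<k}" by (simp add: bij_betw_def eq_card_imp_inj_on)
      from prod.reindex_bij_betw[OF this, of x] show ?thesis using True by simp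
    qed simp
  qed
  also have "\<dots> = real (card {f\<in>?F. f ` {..<k} = {..<k}}) * (\<Prod>i<k. x i)" by simp
  also have "card {f\<in>?F. f ` {..<k} = {..<k}} = card {p. p permutes {..<k}}"
  proof (rule bij_betw_same_card)
    show "bij_betw (\<lambda>f i. if i < k then f i else i) {f\<in>?F. f ` {..<k} = {..<k}} {p. p permutes {..<k}}"
    proof (rule bij_betwI[where g = "\<lambda>p. restrict p {..<k}"])
      show "(\<lambda>f i. if i < k then f i else i) \<in> {f\<in>?F. f ` {..<k} = {..<k}} \<rightarrow> {p. p permutes {..<k}}"
      proof safe
        fix f assume f: "f ` {..<k} = {..<k}"
        then have "bij_betw f {..<k} {..<k}" by (simp add: bij_betw_def eq_card_imp_inj_on)
        then have "bij_betw (\<lambda>i. if i < k then f i else i) {..<k} {..<k}" by (subst bij_betw_cong) auto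
        then show "(\<lambda>i. if i < k then f i else i) permutes {..<k}" by (rule bij_imp_permutes) auto
      qed
      show "(\<lambda>p. restrict p {..<k}) \<in> {p. p permutes {..<k}} \<rightarrow> {f\<in>?F. f ` {..<k} = {..<k}}"
      proof (intro funcsetI CollectI conjI)
        fix p assume "p \<in> {p. p permutes {..<k}}"
        then have p: "p permutes {..<k}" by simp
        show "restrict p {..<k} ` {..<k} = {..<k}" using permutes_image[OF p] by simp
        then show "restrict p {..<k} \<in> ?F" by (auto simp: PiE_iff)
      qed
    qed (auto simp: PiE_iff extensional_def restrict_def fun_eq_iff permutes_def)
  qed
  also have "card {p. p permutes {..<k}} = fact k" by (rule card_permutations) auto
  finally show ?thesis by simp
qed

text \<open>Homogeneous polynomials in linear forms \<open>trace (B ** C)\<close> with semidefinite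
  \<open>B\<close>. The restriction on \<open>B\<close> comes from \<open>kernel_trace\<close>,
  where the eigenvalues of \<open>B\<close> must be nonnegative.\<close>

inductive psdp :: "nat \<Rightarrow> (real ^ 'm ^ 'm \<Rightarrow> real) \<Rightarrow> bool" where
  form: "psd B \<Longrightarrow> psdp 1 (\<lambda>C. trace (B ** C))"
| const: "psdp 0 (\<lambda>C. c)"
| add: "psdp k f \<Longrightarrow> psdp k g \<Longrightarrow> psdp k (\<lambda>C. f C + g C)"
| mult: "psdp k f \<Longrightarrow> psdp l g \<Longrightarrow> psdp (k + l) (\<lambda>C. f C * g C)"

lemma psdp_cmult: "psdp k f \<Longrightarrow> psdp k (\<lambda>C. c * f C)"
  using psdp.mult[OF psdp.const] by simp

lemma psdp_zero: "psdp k (\<lambda>C :: real ^ 'm ^ 'm. 0)"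
proof (induction k)
  case (Suc k)
  have "psd (mat 0 :: real ^ 'm ^ 'm)" by (simp add: mat_eq_diagm psd_diagm)
  from psdp.mult[OF psdp_cmult[OF psdp.form[OF this], of 0] Suc] show ?case by simp
qed (rule psdp.const)

lemma psdp_prod: "finite S \<Longrightarrow> (\<And>i. i \<in> S \<Longrightarrow> psdp (n i) (f i)) \<Longrightarrow> psdp (\<Sum>i\<in>S. n i) (\<lambda>C. \<Prod>i\<in>S. f i C)"
proof (induction S rule: finite_induct)
  case (insert a S)
  then show ?case using psdp.mult[of "n a" "f a"] by simp
qed (simp add: psdp.const)

lemma psdp_sum: "finite S \<Longrightarrow> (\<And>i. i \<in> S \<Longrightarrow> psdp n (f i)) \<Longrightarrow> psdp n (\<lambda>C. \<Sum>i\<in>S. f i C)"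
proof (induction S rule: finite_induct)
  case (insert a S)
  then show ?case using psdp.add[of n "f a"] by simp
qed (simp add: psdp_zero)

lemma psdp_power: "psdp k f \<Longrightarrow> psdp (n * k) (\<lambda>C. f C ^ n)"
proof (induction n)
  case (Suc n) then show ?case using psdp.mult[of k f "n * k"] by simp
qed (simp add: psdp.const)

text \<open>A form \<open>trace (B ** C)\<close> with symmetric \<open>B\<close> depends only on the
  symmetric part of \<open>C\<close>, so only the entries of that part can be generated.\<close>

definition sympart :: "real ^ 'm ^ 'm \<Rightarrow> real ^ 'm ^ 'm" where
  "sympart C = (\<chi> i j. (C $ i $ j + C $ j $ i) / 2)"

text \<open>The rank-one forms of \<open>axis i 1 + axis j 1\<close>, \<open>axis i 1\<close> and
  \<open>axis j 1\<close> are semidefinite, and a signed combination of them isolates the mixed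
  entry.\<close>

lemma psdp_entry: "psdp 1 (\<lambda>C :: real ^ 'm ^ 'm. sympart C $ i $ j)"
proof -
  define E where "E v = (\<chi> i j. v $ i * v $ j)" for v :: "real ^ 'm"
  have tr: "trace (E v ** C) = v \<bullet> (C *v v)" for v C
    by (simp add: trace_def matrix_matrix_mult_def E_def inner_vec_def matrix_vector_mult_def sum_distrib_left mult_ac)
      (subst sum.swap, simp add: mult_ac)
  have ax: "axis i 1 \<bullet> (C *v axis j 1) = C $ i $ j" for C :: "real ^ 'm ^ 'm" and i j
    by (simp add: inner_axis' matrix_vector_mult_basis column_def)
  have psdE: "psd (E v)" for v
  proof -
    have "w \<bullet> (E v *v w) = (v \<bullet> w)\<^sup>2" for w
      by (simp add: inner_vec_def matrix_vector_mult_def E_def power2_eq_square sum_product sum_distrib_left mult_ac)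
    then show ?thesis by (simp add: psd_def E_def transpose_def mult.commute)
  qed
  have a: "trace (E (axis i 1) ** C) = C $ i $ i" for i C
    by (simp add: tr ax)
  have a2: "trace (E (axis i 1 + axis j 1) ** C) = C $ i $ i + C $ j $ j + C $ i $ j + C $ j $ i" for C
    by (simp add: tr ax matrix_vector_right_distrib inner_add_left inner_add_right)
  have "psdp 1 (\<lambda>C. (1/2) * trace (E (axis i 1 + axis j 1) ** C) + ((-1/2) * trace (E (axis i 1) ** C) + (-1/2) * trace (E (axis j 1) ** C)))"
    by (intro psdp.add psdp_cmult psdp.form psdE)
  moreover have "(\<lambda>C. (1/2) * trace (E (axis i 1 + axis j 1) ** C) + ((-1/2) * trace (E (axis i 1) ** C) + (-1/2) * trace (E (axis j 1) ** C)))
    = (\<lambda>C. sympart C $ i $ j)"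
    by (simp add: a a2 sympart_def fun_eq_iff field_simps)
  ultimately show ?thesis by simp
qed

lemma psdp_pm: "psdp (card I) (\<lambda>C :: real ^ 'm ^ 'm. pm I (sympart C))"
proof -
  have "psdp (card I) (\<lambda>C :: real ^ 'm ^ 'm. \<Sum>p\<in>{p. p permutes UNIV}. of_int (sign p) * (\<Prod>i\<in>UNIV. trunc I (sympart C) $ i $ p i))"
  proof (intro psdp_sum psdp_cmult)
    fix p :: "'m \<Rightarrow> 'm"
    have "psdp (\<Sum>i\<in>UNIV. if i \<in> I then 1 else 0) (\<lambda>C :: real ^ 'm ^ 'm. \<Prod>i\<in>UNIV. trunc I (sympart C) $ i $ p i)"
    proof (rule psdp_prod)
      fix i
      show "psdp (if i \<in> I then 1 else 0) (\<lambda>C :: real ^ 'm ^ 'm. trunc I (sympart C) $ i $ p i)"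
      proof (cases "i \<in> I")
        case True
        then show ?thesis using psdp_entry[of i "p i"] psdp_zero[of 1]
          by (cases "p i \<in> I") (auto simp: trunc_def)
      qed (simp add: trunc_def psdp.const)
    qed simp
    then show "psdp (card I) (\<lambda>C :: real ^ 'm ^ 'm. \<Prod>i\<in>UNIV. trunc I (sympart C) $ i $ p i)"
      by (simp add: sum.If_cases)
  qed simp
  then show ?thesis by (simp add: pm_def det_def)
qed

lemma psdp_dlt:
  assumes \<kappa>: "\<kappa> \<in> parts CARD('m) k"
  shows "psdp k (\<lambda>C :: real ^ 'm ^ 'm. dlt (lookup \<kappa>) (sympart C))"
proof -
  let ?m = "CARD('m)"
  have "psdp (\<Sum>r<?m. (lookup \<kappa> r - lookup \<kappa> (Suc r)) * card (seg (Suc r) :: 'm set))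
    (\<lambda>C :: real ^ 'm ^ 'm. \<Prod>r<?m. pm (seg (Suc r)) (sympart C) ^ (lookup \<kappa> r - lookup \<kappa> (Suc r)))"
    by (intro psdp_prod psdp_power psdp_pm) simp
  also have "(\<Sum>r<?m. (lookup \<kappa> r - lookup \<kappa> (Suc r)) * card (seg (Suc r) :: 'm set))
      = (\<Sum>r<?m. (lookup \<kappa> r - lookup \<kappa> (Suc r)) * min ?m (Suc r))"
    by (intro sum.cong refl) (simp add: card_seg)
  also have "\<dots> = k"
    using antimono_abel[of "lookup \<kappa>" ?m ?m] \<kappa> parts_zero_beyond[OF \<kappa>, of ?m] by (simp add: parts_def Mon_def psum_def)
  finally show ?thesis by (simp add: dlt_def)
qed

text \<open>Polarization applies to products of exactly \<open>k\<close> forms, so the inductively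
  built polynomials are flattened to sums of such products.\<close>

lemma psdp_normal_form:
  assumes "psdp k f"
  shows "\<exists>L. (\<forall>(c, Bs)\<in>set L. length Bs = k \<and> (\<forall>B\<in>set Bs. psd B)) \<and>
    (\<forall>C. f C = (\<Sum>(c, Bs)\<leftarrow>L. c * (\<Prod>B\<leftarrow>Bs. trace (B ** C))))"
  using assms
proof induction
  case (form B)
  then show ?case by (intro exI[of _ "[(1, [B])]"]) simp
next
  case (const c)
  then show ?case by (intro exI[of _ "[(c, [])]"]) simp
next
  case (add k f g)
  then obtain L L' where "\<forall>(c, Bs)\<in>set L. length Bs = k \<and> (\<forall>B\<in>set Bs. psd B)"
    "\<forall>C. f C = (\<Sum>(c, Bs)\<leftarrow>L. c * (\<Prod>B\<leftarrow>Bs. trace (B ** C)))"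
    "\<forall>(c, Bs)\<in>set L'. length Bs = k \<and> (\<forall>B\<in>set Bs. psd B)"
    "\<forall>C. g C = (\<Sum>(c, Bs)\<leftarrow>L'. c * (\<Prod>B\<leftarrow>Bs. trace (B ** C)))" by blast
  then show ?case by (intro exI[of _ "L @ L'"]) auto
next
  case (mult k f l g)
  then obtain L L' where L: "\<forall>(c, Bs)\<in>set L. length Bs = k \<and> (\<forall>B\<in>set Bs. psd B)"
    "\<forall>C. f C = (\<Sum>(c, Bs)\<leftarrow>L. c * (\<Prod>B\<leftarrow>Bs. trace (B ** C)))"
    "\<forall>(c, Bs)\<in>set L'. length Bs = l \<and> (\<forall>B\<in>set Bs. psd B)"
    "\<forall>C. g C = (\<Sum>(c, Bs)\<leftarrow>L'. c * (\<Prod>B\<leftarrow>Bs. trace (B ** C)))" by blast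
  define N where "N = concat (map (\<lambda>(c, Bs). map (\<lambda>(c', Bs'). (c * c', Bs @ Bs')) L') L)"
  have inner: "(\<Sum>(c', Bs')\<leftarrow>map (\<lambda>(c', Bs'). (c * c', Bs @ Bs')) L'. c' * (\<Prod>B\<leftarrow>Bs'. trace (B ** C)))
      = c * (\<Prod>B\<leftarrow>Bs. trace (B ** C)) * (\<Sum>(c', Bs')\<leftarrow>L'. c' * (\<Prod>B\<leftarrow>Bs'. trace (B ** C)))" for c Bs C
    by (induction L') (auto simp: algebra_simps)
  have "(\<Sum>(c, Bs)\<leftarrow>N. c * (\<Prod>B\<leftarrow>Bs. trace (B ** C)))
      = (\<Sum>(c, Bs)\<leftarrow>L. c * (\<Prod>B\<leftarrow>Bs. trace (B ** C))) * (\<Sum>(c, Bs)\<leftarrow>L'. c * (\<Prod>B\<leftarrow>Bs. trace (B ** C)))" for C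
    unfolding N_def
  proof (induction L)
    case (Cons a L)
    obtain c Bs where a: "a = (c, Bs)" by (cases a)
    show ?case
      unfolding a list.map concat.simps map_append sum_list_append prod.case inner Cons.IH sum_list.Cons distrib_right ..
  qed simp
  moreover have "\<forall>(c, Bs)\<in>set N. length Bs = k + l \<and> (\<forall>B\<in>set Bs. psd B)"
    using L(1,3) by (fastforce simp: N_def)
  ultimately show ?case using L(2,4) by (intro exI[of _ N]) simp
qed

lemma psd_sum: "finite S \<Longrightarrow> (\<And>i. i \<in> S \<Longrightarrow> psd (B i)) \<Longrightarrow> psd (\<Sum>i\<in>S. B i)"
proof (induction S rule: finite_induct)
  case empty
  then show ?case using psd_diagm[of "\<lambda>_. 0"] by (simp add: diagm_def zero_vec_def)
next
  case (insert a S)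
  then have "psd (B a)" "psd (\<Sum>i\<in>S. B i)" by auto
  then show ?case using insert
    by (simp add: psd_def matrix_vector_mult_add_rdistrib inner_add_right) (simp add: transpose_def vec_eq_iff)
qed

lemma trace_sum_mult: "trace ((\<Sum>i\<in>S. B i) ** C) = (\<Sum>i\<in>S. trace (B i ** C))" for C :: "real ^ 'm ^ 'm"
proof (induction S rule: infinite_finite_induct)
  case (insert a S) then show ?case by (simp add: trace_add[symmetric]) (simp add: matrix_matrix_mult_def trace_def distrib_right sum.distrib)
qed (simp_all add: trace_def matrix_matrix_mult_def)

lemma prod_list_nth: "(\<Prod>B\<leftarrow>Bs. h B) = (\<Prod>i<length Bs. h (Bs ! i))" for h :: "_ \<Rightarrow> real"
  by (induction Bs) (auto simp: prod.lessThan_Suc_shift simp del: prod.lessThan_Suc)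

text \<open>The mean of \<open>trace (B ** C) ^ k\<close> over
  \<open>C = Y ** dg x ** transpose Y\<close> is a combination of spherical polynomials in
  \<open>x\<close> in which the coefficient of each \<open>\<nu>\<close> carries the factor
  \<open>gam\<close> of \<open>\<nu>\<close>. By polarization and linearity the same holds for the
  mean of the power function of \<open>\<kappa>\<close>, which is the spherical polynomial of
  \<open>\<kappa>\<close> itself, and independence makes its coefficient equal to 1.\<close>

lemma gam_nonzero:
  assumes \<kappa>: "\<kappa> \<in> parts CARD('m::finite) k"
  shows "gam TYPE('m) \<kappa> \<noteq> 0"
proof -
  let ?P = "parts CARD('m) k"
  let ?G = "gaussM :: (real ^ 'm ^ 'm) measure"
  define T where "T g \<longleftrightarrow> (\<exists>h. \<forall>x. (\<integral>Y. g (Y ** dg x ** transpose Y) \<partial>?G) = (\<Sum>\<nu>\<in>?P. gam TYPE('m) \<nu> * h \<nu> * sph TYPE('m) \<nu> x))"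
    for g :: "real ^ 'm ^ 'm \<Rightarrow> real"
  define good where "good g \<longleftrightarrow> T g \<and> (\<forall>x. integrable ?G (\<lambda>Y. g (Y ** dg x ** transpose Y)))" for g
  have good_zero: "good (\<lambda>_. 0)" unfolding good_def T_def by (intro conjI exI[of _ "\<lambda>_. 0"]) auto
  have good_add: "good (\<lambda>C. f C + g C)" if f: "good f" and g: "good g" for f g
  proof -
    obtain h1 where h1: "\<And>x. (\<integral>Y. f (Y ** dg x ** transpose Y) \<partial>?G) = (\<Sum>\<nu>\<in>?P. gam TYPE('m) \<nu> * h1 \<nu> * sph TYPE('m) \<nu> x)"
      using f by (auto simp: good_def T_def)
    obtain h2 where h2: "\<And>x. (\<integral>Y. g (Y ** dg x ** transpose Y) \<partial>?G) = (\<Sum>\<nu>\<in>?P. gam TYPE('m) \<nu> * h2 \<nu> * sph TYPE('m) \<nu> x)"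
      using g by (auto simp: good_def T_def)
    show ?thesis using f g h1 h2 unfolding good_def T_def
      by (intro conjI exI[of _ "\<lambda>\<nu>. h1 \<nu> + h2 \<nu>"]) (auto simp: distrib_left distrib_right sum.distrib)
  qed
  have good_cmult: "good (\<lambda>C. c * f C)" if f: "good f" for f c
  proof -
    obtain h1 where h1: "\<And>x. (\<integral>Y. f (Y ** dg x ** transpose Y) \<partial>?G) = (\<Sum>\<nu>\<in>?P. gam TYPE('m) \<nu> * h1 \<nu> * sph TYPE('m) \<nu> x)"
      using f by (auto simp: good_def T_def)
    show ?thesis using f h1 unfolding good_def T_def
      by (intro conjI exI[of _ "\<lambda>\<nu>. c * h1 \<nu>"]) (auto simp: sum_distrib_left mult_ac)
  qed
  have good_sum: "good (\<lambda>C. \<Sum>i\<in>S. f i C)" if "finite S" "\<And>i. i \<in> S \<Longrightarrow> good (f i)" for f :: "'i \<Rightarrow> _" and S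
    using that by (induction S rule: finite_induct) (auto intro: good_zero good_add)
  have good_list: "good (\<lambda>C. \<Sum>a\<leftarrow>L. f a C)" if "\<And>a. a \<in> set L \<Longrightarrow> good (f a)" for f :: "'i \<Rightarrow> _" and L
    using that by (induction L) (auto intro: good_zero good_add)
  \<comment> \<open>\<open>B\<close> is diagonalized and its orthogonal part absorbed into
    \<open>Y\<close>, which reduces the mean to \<open>kernel_trace\<close>.\<close>
  have good_form: "good (\<lambda>C. trace (B ** C) ^ k)" if B: "psd B" for B
  proof -
    obtain U d where U: "orthogonal_matrix U" "B = transpose U ** diagm d ** U" and d: "\<And>i. d i \<ge> 0"
      using psd_diagonalization[OF B] by blast
    have int: "integrable ?G (\<lambda>Y. trace (A ** (Y ** dg x ** transpose Y)) ^ k)" for x A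
      by (intro integrable_pg[OF has_moments_gaussM] pg_power pg_trace pg_sandwich_entry)
    have "(\<integral>Y. trace (B ** (Y ** dg x ** transpose Y)) ^ k \<partial>?G)
      = (\<Sum>\<nu>\<in>?P. gam TYPE('m) \<nu> * sph TYPE('m) \<nu> (\<lambda>l. d (ix l)) * sph TYPE('m) \<nu> x)" for x
    proof -
      have pgm: "(\<lambda>Y. trace (diagm d ** (Y ** dg x ** transpose Y)) ^ k) \<in> borel_measurable borel"
        by (intro pg_measurable pg_power pg_trace pg_sandwich_entry)
      have pgm': "(\<lambda>Y. trace (dg x ** (Y ** diagm d ** transpose Y)) ^ k) \<in> borel_measurable borel"
        by (intro pg_measurable pg_power pg_trace pg_sandwich_entry)
      have "trace (B ** (Y ** dg x ** transpose Y)) = trace (diagm d ** ((U ** Y) ** dg x ** transpose (U ** Y)))" for Y :: "real ^ 'm ^ 'm"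
      proof -
        have "trace (B ** (Y ** dg x ** transpose Y)) = trace (transpose U ** (diagm d ** U ** Y ** dg x ** transpose Y))"
          by (simp only: U(2) matrix_mul_assoc)
        also have "\<dots> = trace ((diagm d ** U ** Y ** dg x ** transpose Y) ** transpose U)" by (rule trace_mul_sym)
        finally show ?thesis by (simp only: matrix_transpose_mul matrix_mul_assoc)
      qed
      then have "(\<integral>Y. trace (B ** (Y ** dg x ** transpose Y)) ^ k \<partial>?G) = (\<integral>Y. trace (diagm d ** (Y ** dg x ** transpose Y)) ^ k \<partial>?G)"
        using integral_gaussM_left[OF U(1) pgm] by (simp only:)
      also have "\<dots> = (\<integral>Y. trace (dg x ** (transpose Y ** diagm d ** transpose (transpose Y))) ^ k \<partial>?G)"
      proof (intro Bochner_Integration.integral_cong refl arg_cong[where f = "\<lambda>z. z ^ k"])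
        fix Y :: "real ^ 'm ^ 'm"
        have "trace (diagm d ** (Y ** dg x ** transpose Y)) = trace ((diagm d ** Y) ** (dg x ** transpose Y))" by (simp only: matrix_mul_assoc)
        also have "\<dots> = trace ((dg x ** transpose Y) ** (diagm d ** Y))" by (rule trace_mul_sym)
        finally show "trace (diagm d ** (Y ** dg x ** transpose Y)) = trace (dg x ** (transpose Y ** diagm d ** transpose (transpose Y)))"
          by (simp only: matrix_mul_assoc transpose_transpose)
      qed
      also have "\<dots> = (\<integral>Y. trace (dg x ** (Y ** diagm d ** transpose Y)) ^ k \<partial>?G)"
        by (rule integral_gaussM_transpose[OF pgm'])
      also have "\<dots> = (\<integral>Y. trace (dg x ** (Y ** dg (\<lambda>l. d (ix l)) ** transpose Y)) ^ k \<partial>?G)" by simp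
      also have "\<dots> = (\<Sum>\<nu>\<in>?P. gam TYPE('m) \<nu> * sph TYPE('m) \<nu> (\<lambda>l. d (ix l)) * sph TYPE('m) \<nu> x)"
        by (rule kernel_trace) (rule d)
      finally show ?thesis .
    qed
    then show ?thesis using int unfolding good_def T_def
      by (intro conjI exI[of _ "\<lambda>\<nu>. sph TYPE('m) \<nu> (\<lambda>l. d (ix l))"] allI)
  qed
  have good_prod: "good (\<lambda>C. \<Prod>B\<leftarrow>Bs. trace (B ** C))" if Bs: "length Bs = k" "\<forall>B\<in>set Bs. psd B" for Bs
  proof -
    have "good (\<lambda>C. (1 / fact k) * (\<Sum>S\<in>Pow {..<k}. (-1) ^ (k - card S) * trace ((\<Sum>i\<in>S. Bs ! i) ** C) ^ k))"
    proof (intro good_cmult good_sum good_form psd_sum)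
      fix S i assume S: "S \<in> Pow {..<k}"
      then show "finite S" using finite_subset by auto
      assume "i \<in> S"
      then show "psd (Bs ! i)" using S Bs by auto
    qed simp
    also have "(\<lambda>C. (1 / fact k) * (\<Sum>S\<in>Pow {..<k}. (-1) ^ (k - card S) * trace ((\<Sum>i\<in>S. Bs ! i) ** C) ^ k))
      = (\<lambda>C. \<Prod>B\<leftarrow>Bs. trace (B ** C))"
    proof
      fix C
      show "(1 / fact k) * (\<Sum>S\<in>Pow {..<k}. (-1) ^ (k - card S) * trace ((\<Sum>i\<in>S. Bs ! i) ** C) ^ k) = (\<Prod>B\<leftarrow>Bs. trace (B ** C))"
        unfolding trace_sum_mult polarization[symmetric] prod_list_nth Bs(1) by simp
    qed
    finally show ?thesis .
  qed
  obtain L where L: "\<forall>(c, Bs)\<in>set L. length Bs = k \<and> (\<forall>B\<in>set Bs. psd B)"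
    "\<And>C :: real ^ 'm ^ 'm. dlt (lookup \<kappa>) (sympart C) = (\<Sum>(c, Bs)\<leftarrow>L. c * (\<Prod>B\<leftarrow>Bs. trace (B ** C)))"
    using psdp_normal_form[OF psdp_dlt[OF \<kappa>]] by blast
  have "good (\<lambda>C. \<Sum>(c, Bs)\<leftarrow>L. c * (\<Prod>B\<leftarrow>Bs. trace (B ** C)))"
    by (rule good_list) (use L(1) in \<open>auto intro!: good_cmult good_prod\<close>)
  then have "good (\<lambda>C. dlt (lookup \<kappa>) (sympart C))"
    by (simp only: L(2))
  then obtain h where h: "\<And>x. (\<integral>Y. dlt (lookup \<kappa>) (sympart (Y ** dg x ** transpose Y)) \<partial>?G) = (\<Sum>\<nu>\<in>?P. gam TYPE('m) \<nu> * h \<nu> * sph TYPE('m) \<nu> x)"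
    by (auto simp: good_def T_def)
  have "sympart (Y ** dg x ** transpose Y) = Y ** dg x ** transpose Y" for Y :: "real ^ 'm ^ 'm" and x
  proof -
    have "transpose (Y ** dg x ** transpose Y) = Y ** dg x ** transpose Y" by (simp add: matrix_transpose_mul matrix_mul_assoc)
    then have "(Y ** dg x ** transpose Y) $ j $ i = (Y ** dg x ** transpose Y) $ i $ j" for i j
      by (metis (no_types, lifting) transpose_def vec_lambda_beta)
    then show ?thesis by (simp add: sympart_def vec_eq_iff)
  qed
  then have "sph TYPE('m) \<kappa> x = (\<Sum>\<nu>\<in>?P. gam TYPE('m) \<nu> * h \<nu> * sph TYPE('m) \<nu> x)" for x
    using h[of x] by (simp add: sph_eq_mean)
  moreover have "(\<Sum>\<nu>\<in>?P. (if \<nu> = \<kappa> then 1 else 0) * sph TYPE('m) \<nu> x) = sph TYPE('m) \<kappa> x" for x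
  proof -
    have "(\<Sum>\<nu>\<in>?P. (if \<nu> = \<kappa> then 1 else 0) * sph TYPE('m) \<nu> x) = (\<Sum>\<nu>\<in>?P. if \<nu> = \<kappa> then sph TYPE('m) \<kappa> x else 0)"
      by (intro sum.cong) auto
    then show ?thesis using \<kappa> by (simp add: finite_parts)
  qed
  ultimately have "(\<Sum>\<nu>\<in>?P. (gam TYPE('m) \<nu> * h \<nu> - (if \<nu> = \<kappa> then 1 else 0)) * sph TYPE('m) \<nu> x) = 0" for x
    unfolding left_diff_distrib sum_subtractf by simp
  from sph_independent[OF this \<kappa>] show ?thesis by auto
qed

section \<open>The differential operator\<close>

text \<open>Polynomials in a real variable whose coefficients lie in \<open>pg\<close> and whose
  degree is bounded: they are integrated coefficientwise against the Gaussian measure, so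
  differentiation under the integral sign needs no limit argument.\<close>

definition pgpoly :: "('y::real_normed_vector \<Rightarrow> real poly) \<Rightarrow> bool" where
  "pgpoly P \<longleftrightarrow> (\<forall>j. pg (\<lambda>Y. coeff (P Y) j)) \<and> (\<exists>N. \<forall>Y. degree (P Y) \<le> N)"

lemma pgpoly_const: "pgpoly (\<lambda>_. c)"
  by (auto simp: pgpoly_def)

lemma pgpoly_pCons: "pg u \<Longrightarrow> pgpoly P \<Longrightarrow> pgpoly (\<lambda>Y. pCons (u Y) (P Y))"
  unfolding pgpoly_def
proof (elim conjE exE, intro conjI allI)
  fix j N assume u: "pg u" and P: "\<forall>j. pg (\<lambda>Y. coeff (P Y) j)" "\<forall>Y. degree (P Y) \<le> N"
  show "pg (\<lambda>Y. coeff (pCons (u Y) (P Y)) j)" by (cases j) (use u P in auto)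
  show "\<exists>N. \<forall>Y. degree (pCons (u Y) (P Y)) \<le> N"
    using P(2) by (intro exI[of _ "Suc N"]) (meson degree_pCons_le le_trans Suc_le_mono)
qed

lemma pgpoly_mult: "pgpoly P \<Longrightarrow> pgpoly Q \<Longrightarrow> pgpoly (\<lambda>Y. P Y * Q Y)"
  unfolding pgpoly_def
proof (elim conjE exE, intro conjI allI)
  fix j N M assume P: "\<forall>j. pg (\<lambda>Y. coeff (P Y) j)" "\<forall>Y. degree (P Y) \<le> N"
    and Q: "\<forall>j. pg (\<lambda>Y. coeff (Q Y) j)" "\<forall>Y. degree (Q Y) \<le> M"
  show "pg (\<lambda>Y. coeff (P Y * Q Y) j)" unfolding coeff_mult using P Q by (intro pg_sum pg_mult) auto
  show "\<exists>N. \<forall>Y. degree (P Y * Q Y) \<le> N"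
    using P(2) Q(2) by (intro exI[of _ "N + M"]) (meson add_mono degree_mult_le le_trans)
qed

lemma pgpoly_power: "pgpoly P \<Longrightarrow> pgpoly (\<lambda>Y. P Y ^ k)"
  by (induction k) (auto intro: pgpoly_const pgpoly_mult)

lemma integral_pgpoly:
  fixes P :: "'y::euclidean_space \<Rightarrow> real poly"
  assumes P: "pgpoly P"
  obtains R where "\<And>t. (\<integral>Y. poly (P Y) t \<partial>gaussM) = poly R t" "\<And>j. coeff R j = (\<integral>Y. coeff (P Y) j \<partial>gaussM)"
proof -
  obtain N where N: "\<And>Y. degree (P Y) \<le> N" using P by (auto simp: pgpoly_def)
  have int: "integrable gaussM (\<lambda>Y. coeff (P Y) j)" for j
    using P by (intro integrable_pg[OF has_moments_gaussM]) (auto simp: pgpoly_def)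
  define R where "R = (\<Sum>j\<le>N. monom (\<integral>Y. coeff (P Y) j \<partial>gaussM) j)"
  have z: "coeff (P Y) j = 0" if "j > N" for Y j
    by (rule coeff_eq_0) (use N[of Y] that in simp)
  have "coeff R j = (\<integral>Y. coeff (P Y) j \<partial>gaussM)" for j
  proof -
    have "coeff R j = (if j \<le> N then \<integral>Y. coeff (P Y) j \<partial>gaussM else 0)"
      by (simp add: R_def coeff_sum if_distrib cong: if_cong)
    then show ?thesis using z by (cases "j \<le> N") auto
  qed
  moreover have "(\<integral>Y. poly (P Y) t \<partial>gaussM) = poly R t" for t
  proof -
    have "poly (P Y) t = (\<Sum>j\<le>N. coeff (P Y) j * t ^ j)" for Y
    proof -
      have "poly (P Y) t = (\<Sum>j\<le>degree (P Y). coeff (P Y) j * t ^ j)" by (rule poly_altdef)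
      also have "\<dots> = (\<Sum>j\<le>N. coeff (P Y) j * t ^ j)"
        by (rule sum.mono_neutral_left) (use N[of Y] in \<open>auto simp: coeff_eq_0\<close>)
      finally show ?thesis .
    qed
    then have "(\<integral>Y. poly (P Y) t \<partial>gaussM) = (\<Sum>j\<le>N. (\<integral>Y. coeff (P Y) j \<partial>gaussM) * t ^ j)"
      using int by simp
    then show ?thesis by (simp add: R_def poly_sum poly_monom)
  qed
  ultimately show ?thesis using that by blast
qed

lemma deriv_integral_pgpoly:
  fixes P :: "'y::euclidean_space \<Rightarrow> real poly"
  assumes P: "pgpoly P"
  shows "deriv (\<lambda>t. \<integral>Y. poly (P Y) t \<partial>gaussM) = (\<lambda>t. \<integral>Y. poly (pderiv (P Y)) t \<partial>gaussM)" "pgpoly (\<lambda>Y. pderiv (P Y))"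
proof -
  show P': "pgpoly (\<lambda>Y. pderiv (P Y))"
    using P unfolding pgpoly_def coeff_pderiv degree_pderiv by (auto intro!: pg_mult) (meson diff_le_self le_trans)
  obtain R where R: "\<And>t. (\<integral>Y. poly (P Y) t \<partial>gaussM) = poly R t" "\<And>j. coeff R j = (\<integral>Y. coeff (P Y) j \<partial>gaussM)"
    using integral_pgpoly[OF P] by blast
  obtain R' where R': "\<And>t. (\<integral>Y. poly (pderiv (P Y)) t \<partial>gaussM) = poly R' t" "\<And>j. coeff R' j = (\<integral>Y. coeff (pderiv (P Y)) j \<partial>gaussM)"
    using integral_pgpoly[OF P'] by blast
  have "R' = pderiv R" by (rule poly_eqI) (simp add: R'(2) R(2) coeff_pderiv)
  then show "deriv (\<lambda>t. \<integral>Y. poly (P Y) t \<partial>gaussM) = (\<lambda>t. \<integral>Y. poly (pderiv (P Y)) t \<partial>gaussM)"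
    by (auto simp: R R' fun_eq_iff intro!: DERIV_imp_deriv poly_DERIV)
qed

text \<open>The truncated exponents \<open>k - 1\<close> and \<open>k - 2\<close> do no harm,
  because their factors \<open>k\<close> and \<open>k choose 2\<close> vanish where truncation
  occurs.\<close>

lemma coeff2_power_quadratic:
  fixes u v w :: real
  shows "coeff ([:u, v, w:] ^ k) 0 = u ^ k" "coeff ([:u, v, w:] ^ k) 1 = real k * u ^ (k - 1) * v"
    "coeff ([:u, v, w:] ^ k) 2 = real k * u ^ (k - 1) * w + real (k choose 2) * u ^ (k - 2) * v\<^sup>2"
proof -
  have "coeff ([:u, v, w:] ^ k) 0 = u ^ k \<and> coeff ([:u, v, w:] ^ k) 1 = real k * u ^ (k - 1) * v \<and>
    coeff ([:u, v, w:] ^ k) 2 = real k * u ^ (k - 1) * w + real (k choose 2) * u ^ (k - 2) * v\<^sup>2"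
  proof (induction k)
    case (Suc k)
    let ?p = "[:u, v, w:] ^ k"
    have c: "coeff ([:u, v, w:] ^ Suc k) 0 = u * coeff ?p 0"
      "coeff ([:u, v, w:] ^ Suc k) 1 = u * coeff ?p 1 + v * coeff ?p 0"
      "coeff ([:u, v, w:] ^ Suc k) 2 = u * coeff ?p 2 + v * coeff ?p 1 + w * coeff ?p 0"
      by (simp_all add: coeff_mult coeff_pCons numeral_2_eq_2 atMost_Suc)
    have u1: "real k * (u * u ^ (k - 1)) = real k * u ^ k" by (cases k) auto
    have u2: "real (k choose 2) * (u * u ^ (k - 2)) = real (k choose 2) * u ^ (k - 1)"
    proof (cases "k \<ge> 2")
      case True
      then obtain j where "k = Suc (Suc j)" by (metis add_2_eq_Suc le_Suc_ex)
      then show ?thesis by simp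
    qed (auto simp: binomial_eq_0)
    have ch: "Suc k choose 2 = k + (k choose 2)" by (simp add: numeral_2_eq_2)
    from Suc have "coeff ?p 0 = u ^ k" "coeff ?p 1 = real k * u ^ (k - 1) * v"
      "coeff ?p 2 = real k * u ^ (k - 1) * w + real (k choose 2) * u ^ (k - 2) * v\<^sup>2" by auto
    moreover have "u * (real k * u ^ (k - 1) * w + real (k choose 2) * u ^ (k - 2) * v\<^sup>2) + v * (real k * u ^ (k - 1) * v) + w * u ^ k
      = (real k * (u * u ^ (k - 1))) * w + (real (k choose 2) * (u * u ^ (k - 2))) * v\<^sup>2 + real k * u ^ (k - 1) * v\<^sup>2 + u ^ k * w"
      by (simp add: algebra_simps power2_eq_square)
    ultimately show ?case unfolding c ch u1 u2 using u1 by (simp add: algebra_simps)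
  qed (auto simp: coeff_1 numeral_2_eq_2)
  then show "coeff ([:u, v, w:] ^ k) 0 = u ^ k" "coeff ([:u, v, w:] ^ k) 1 = real k * u ^ (k - 1) * v"
    "coeff ([:u, v, w:] ^ k) 2 = real k * u ^ (k - 1) * w + real (k choose 2) * u ^ (k - 2) * v\<^sup>2" by auto
qed

text \<open>Rotations in the \<open>(i, j)\<close> plane: with \<open>\<tau>\<close> the tangent of the angle, the diagonal matrix \<open>d\<close> is turned into a
  matrix whose product with \<open>1 + \<tau>\<^sup>2\<close> is quadratic in \<open>\<tau>\<close>; comparing the coefficients of \<open>\<tau>\<^sup>2\<close> gives the relation.\<close>

lemma rotation_relation:
  fixes d :: "'m::finite \<Rightarrow> real" and B :: "real ^ 'm ^ 'm"
  defines "S \<equiv> \<lambda>Y :: real ^ 'm ^ 'm. Y ** B ** transpose Y"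
  assumes B: "transpose B = B" and ij: "i \<noteq> j" and d: "d i \<noteq> d j" and k: "k \<ge> 1"
  shows "(\<integral>Y. (S Y $ i $ i - S Y $ j $ j) * trace (diagm d ** S Y) ^ (k - 1) \<partial>gaussM)
    = 2 * real (k - 1) * (d i - d j) * (\<integral>Y. (S Y $ i $ j)\<^sup>2 * trace (diagm d ** S Y) ^ (k - 2) \<partial>gaussM)"
proof -
  let ?G = "gaussM :: (real ^ 'm ^ 'm) measure"
  let ?P = "\<lambda>Y. trace (diagm d ** S Y)"
  have symS: "S Y $ b $ a = S Y $ a $ b" for Y a b
  proof -
    have "transpose (S Y) = S Y" by (simp add: S_def matrix_transpose_mul B matrix_mul_assoc)
    then have "transpose (S Y) $ a $ b = S Y $ a $ b" by simp
    then show ?thesis by (simp add: transpose_def)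
  qed
  have pgS: "pg (\<lambda>Y. S Y $ a $ b)" for a b
    unfolding S_def by (intro pg_matrix_mult pg_transpose pg_entry pg_const)
  have tr: "trace (A ** Z) = (\<Sum>a\<in>UNIV. \<Sum>b\<in>UNIV. A $ a $ b * Z $ b $ a)" for A Z :: "real ^ 'm ^ 'm"
    by (simp add: trace_def matrix_matrix_mult_def)
  have trP: "?P Y = (\<Sum>a\<in>UNIV. d a * S Y $ a $ a)" for Y
    by (simp add: trace_def diagm_mult_left)
  have pgP: "pg ?P" unfolding trP by (intro pg_sum pg_mult pg_const pgS)
  \<comment> \<open>\<open>poly (q Y) \<tau>\<close> is \<open>1 + \<tau>\<^sup>2\<close> times the
    trace after the rotation with tangent \<open>\<tau>\<close>; the factor clears the denominators
    of the squared cosine and sine.\<close>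
  define q where "q Y = [:?P Y, 2 * (d i - d j) * S Y $ i $ j, ?P Y - (d i - d j) * (S Y $ i $ i - S Y $ j $ j):]" for Y
  have pgq: "pgpoly (\<lambda>Y. q Y ^ k)" unfolding q_def
    by (intro pgpoly_power pgpoly_pCons pgpoly_const pg_mult pg_diff pg_const pgP pgS)
  have rot: "(\<integral>Y. poly (q Y ^ k) \<tau> \<partial>?G) = (1 + \<tau>\<^sup>2) ^ k * (\<integral>Y. ?P Y ^ k \<partial>?G)" for \<tau>
  proof -
    define r where "r = sqrt (1 + \<tau>\<^sup>2)"
    have "1 + \<tau>\<^sup>2 > 0" by (simp add: add_pos_nonneg)
    then have r: "r > 0" "r\<^sup>2 = 1 + \<tau>\<^sup>2" by (simp_all add: r_def)
    define c where "c = 1 / r" define s where "s = \<tau> / r"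
    have cs: "c\<^sup>2 + s\<^sup>2 = 1" using r(1) unfolding c_def s_def power_divide add_divide_distrib[symmetric] power_one r(2)[symmetric] by simp
    define U :: "real ^ 'm ^ 'm" where "U = (\<chi> a b. if a = i then (if b = i then c else if b = j then s else 0)
      else if a = j then (if b = i then - s else if b = j then c else 0) else if a = b then 1 else 0)"
    have ru: "row a U = (if a = i then c *\<^sub>R axis i 1 + s *\<^sub>R axis j 1 else if a = j then c *\<^sub>R axis j 1 - s *\<^sub>R axis i 1 else axis a 1)" for a
      using ij by (auto simp: row_def U_def vec_eq_iff axis_def)
    have rr: "row a U \<bullet> row b U = (if a = b then 1 else 0)" for a b
      using ij cs by (auto simp: ru inner_add_left inner_add_right inner_diff_left inner_diff_right inner_axis_axis power2_eq_square algebra_simps)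
    have U: "orthogonal_matrix U"
      unfolding orthogonal_matrix_orthonormal_rows by (auto simp: rr norm_eq_1 orthogonal_def)
    have pgm: "(\<lambda>Y. ?P Y ^ k) \<in> borel_measurable borel" by (intro pg_measurable pg_power pgP)
    have SU: "S (U ** Y) $ a $ a = row a U \<bullet> (S Y *v row a U)" for a Y
    proof -
      have "S (U ** Y) = U ** S Y ** transpose U" by (simp add: S_def matrix_transpose_mul matrix_mul_assoc)
      then show ?thesis
        by (simp add: matrix_matrix_mult_def matrix_vector_mult_def inner_vec_def transpose_def row_def sum_distrib_left sum_distrib_right)
          (subst sum.swap, simp add: mult_ac)
    qed
    have ax: "axis a 1 \<bullet> (S Y *v axis b 1) = S Y $ a $ b" for a b Y
      by (simp add: inner_axis' matrix_vector_mult_basis column_def)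
    have PU: "poly (q Y) \<tau> = r\<^sup>2 * ?P (U ** Y)" for Y
    proof -
      let ?s = "\<lambda>a b. S Y $ a $ b"
      have e: "S (U ** Y) $ a $ a = (if a = i then c\<^sup>2 * ?s i i + 2 * c * s * ?s i j + s\<^sup>2 * ?s j j
        else if a = j then s\<^sup>2 * ?s i i - 2 * c * s * ?s i j + c\<^sup>2 * ?s j j else ?s a a)" for a
      proof -
        have bil: "(x *\<^sub>R axis a 1 + y *\<^sub>R axis b 1) \<bullet> (S Y *v (x *\<^sub>R axis a 1 + y *\<^sub>R axis b 1))
          = x\<^sup>2 * ?s a a + 2 * x * y * ?s a b + y\<^sup>2 * ?s b b" for x y a b
          unfolding matrix_vector_right_distrib matrix_vector_mult_scaleR inner_add_left inner_add_right
            inner_scaleR_left inner_scaleR_right ax symS[of Y b a] by (simp add: power2_eq_square algebra_simps)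
        consider "a = i" | "a = j" | "a \<noteq> i" "a \<noteq> j" by blast
        then show ?thesis
        proof cases
          case 1 then show ?thesis using bil[of c i s j] by (simp add: SU ru)
        next
          case 2 then show ?thesis using bil[of c j "- s" i] ij symS[of Y j i] by (simp add: SU ru)
        next
          case 3 then show ?thesis by (simp add: SU ru ax)
        qed
      qed
      have sp: "(\<Sum>a\<in>UNIV. f a) = f i + f j + (\<Sum>a\<in>UNIV - {i, j}. f a)" for f :: "'m \<Rightarrow> real"
      proof -
        have "(\<Sum>a\<in>UNIV. f a) = (\<Sum>a\<in>{i, j}. f a) + (\<Sum>a\<in>UNIV - {i, j}. f a)" 
          using sum.subset_diff[of "{i, j}" UNIV f] by simp
        then show ?thesis using ij by simp
      qed
      have rest: "(\<Sum>a\<in>UNIV - {i, j}. d a * S (U ** Y) $ a $ a) = (\<Sum>a\<in>UNIV - {i, j}. d a * ?s a a)"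
        by (intro sum.cong) (auto simp: e)
      have P': "?P (U ** Y) = d i * (c\<^sup>2 * ?s i i + 2 * c * s * ?s i j + s\<^sup>2 * ?s j j)
        + d j * (s\<^sup>2 * ?s i i - 2 * c * s * ?s i j + c\<^sup>2 * ?s j j) + (\<Sum>a\<in>UNIV - {i, j}. d a * ?s a a)"
        unfolding trP sp[of "\<lambda>a. d a * S (U ** Y) $ a $ a"] rest using ij by (simp add: e)
      have "r\<^sup>2 * c\<^sup>2 = 1" "r\<^sup>2 * s\<^sup>2 = \<tau>\<^sup>2" "r\<^sup>2 * (c * s) = \<tau>"
        using r(1) by (simp_all add: c_def s_def power2_eq_square)
      moreover have "r\<^sup>2 * ?P (U ** Y) = d i * ((r\<^sup>2 * c\<^sup>2) * ?s i i + 2 * (r\<^sup>2 * (c * s)) * ?s i j + (r\<^sup>2 * s\<^sup>2) * ?s j j)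
        + d j * ((r\<^sup>2 * s\<^sup>2) * ?s i i - 2 * (r\<^sup>2 * (c * s)) * ?s i j + (r\<^sup>2 * c\<^sup>2) * ?s j j) + r\<^sup>2 * (\<Sum>a\<in>UNIV - {i, j}. d a * ?s a a)"
        unfolding P' by (simp add: algebra_simps)
      ultimately have "r\<^sup>2 * ?P (U ** Y) = d i * (?s i i + 2 * \<tau> * ?s i j + \<tau>\<^sup>2 * ?s j j)
        + d j * (\<tau>\<^sup>2 * ?s i i - 2 * \<tau> * ?s i j + ?s j j) + (1 + \<tau>\<^sup>2) * (\<Sum>a\<in>UNIV - {i, j}. d a * ?s a a)"
        unfolding r(2) by simp
      moreover have "?P Y = d i * ?s i i + d j * ?s j j + (\<Sum>a\<in>UNIV - {i, j}. d a * ?s a a)"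
        unfolding trP sp[of "\<lambda>a. d a * ?s a a"] ..
      ultimately show ?thesis by (simp add: q_def algebra_simps power2_eq_square)
    qed
    have "(\<integral>Y. poly (q Y ^ k) \<tau> \<partial>?G) = (\<integral>Y. (r\<^sup>2) ^ k * ?P (U ** Y) ^ k \<partial>?G)"
      by (simp add: poly_power PU power_mult_distrib)
    also have "\<dots> = (r\<^sup>2) ^ k * (\<integral>Y. ?P (U ** Y) ^ k \<partial>?G)" by simp
    also have "(\<integral>Y. ?P (U ** Y) ^ k \<partial>?G) = (\<integral>Y. ?P Y ^ k \<partial>?G)"
      by (rule integral_gaussM_left[OF U pgm])
    finally show ?thesis by (simp add: r(2))
  qed
  obtain R where R: "\<And>t. (\<integral>Y. poly (q Y ^ k) t \<partial>?G) = poly R t" "\<And>n. coeff R n = (\<integral>Y. coeff (q Y ^ k) n \<partial>?G)"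
    using integral_pgpoly[OF pgq] by blast
  \<comment> \<open>Both sides are polynomials that agree at every real point, so their coefficients
    may be compared.\<close>
  have "R = smult (\<integral>Y. ?P Y ^ k \<partial>?G) ([:1, 0, 1:] ^ k)"
  proof (rule poly_eq_poly_eq_iff[THEN iffD1], rule ext)
    fix t
    have "poly R t = (1 + t\<^sup>2) ^ k * (\<integral>Y. ?P Y ^ k \<partial>?G)" by (simp only: R(1)[symmetric] rot)
    then show "poly R t = poly (smult (\<integral>Y. ?P Y ^ k \<partial>?G) ([:1, 0, 1:] ^ k)) t"
      by (simp add: poly_power power2_eq_square)
  qed
  then have "coeff R 2 = (\<integral>Y. ?P Y ^ k \<partial>?G) * real k"
    using coeff2_power_quadratic(3)[of 1 0 1 k] by simp
  moreover have "coeff R 2 = (\<integral>Y. real k * ?P Y ^ k - real k * (d i - d j) * ((S Y $ i $ i - S Y $ j $ j) * ?P Y ^ (k - 1))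
      + real (k choose 2) * 4 * (d i - d j)\<^sup>2 * ((S Y $ i $ j)\<^sup>2 * ?P Y ^ (k - 2)) \<partial>?G)"
    unfolding R(2)
  proof (intro Bochner_Integration.integral_cong refl)
    fix Y
    have pk: "?P Y ^ (k - 1) * ?P Y = ?P Y ^ k" using k by (metis Suc_pred' mult.commute not_less_eq_eq power_Suc0_right power_add power_one_right Suc_diff_1 One_nat_def less_eq_Suc_le power_Suc2)
    show "coeff (q Y ^ k) 2 = real k * ?P Y ^ k - real k * (d i - d j) * ((S Y $ i $ i - S Y $ j $ j) * ?P Y ^ (k - 1))
      + real (k choose 2) * 4 * (d i - d j)\<^sup>2 * ((S Y $ i $ j)\<^sup>2 * ?P Y ^ (k - 2))"
      unfolding q_def coeff2_power_quadratic(3) pk[symmetric] by (simp add: power2_eq_square algebra_simps)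
  qed
  moreover have "\<dots> = real k * (\<integral>Y. ?P Y ^ k \<partial>?G) - real k * (d i - d j) * (\<integral>Y. (S Y $ i $ i - S Y $ j $ j) * ?P Y ^ (k - 1) \<partial>?G)
      + real (k choose 2) * 4 * (d i - d j)\<^sup>2 * (\<integral>Y. (S Y $ i $ j)\<^sup>2 * ?P Y ^ (k - 2) \<partial>?G)"
  proof -
    have "integrable ?G (\<lambda>Y. ?P Y ^ k)" "integrable ?G (\<lambda>Y. (S Y $ i $ i - S Y $ j $ j) * ?P Y ^ (k - 1))"
      "integrable ?G (\<lambda>Y. (S Y $ i $ j)\<^sup>2 * ?P Y ^ (k - 2))"
      by (intro integrable_pg[OF has_moments_gaussM] pg_mult pg_power pg_diff pgS pgP)+
    then show ?thesis by simp
  qed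
  ultimately have "real k * (d i - d j) * (\<integral>Y. (S Y $ i $ i - S Y $ j $ j) * ?P Y ^ (k - 1) \<partial>?G)
      = (real (k choose 2) * 4) * (d i - d j)\<^sup>2 * (\<integral>Y. (S Y $ i $ j)\<^sup>2 * ?P Y ^ (k - 2) \<partial>?G)" by simp
  also have "real (k choose 2) * 4 = 2 * real k * real (k - 1)"
    using choose_two[of k] k by (simp add: real_of_nat_div of_nat_diff)
  finally have "(real k * (d i - d j)) * (\<integral>Y. (S Y $ i $ i - S Y $ j $ j) * ?P Y ^ (k - 1) \<partial>?G)
    = (real k * (d i - d j)) * (2 * real (k - 1) * (d i - d j) * (\<integral>Y. (S Y $ i $ j)\<^sup>2 * ?P Y ^ (k - 2) \<partial>?G))"
    by (simp add: power2_eq_square mult_ac)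
  then show ?thesis using d k by simp
qed

section \<open>The operator on polynomials and on the kernel\<close>

lemma homp_line:
  assumes "homp m k f"
  shows "\<exists>p. \<forall>t. f (x(i := t)) = poly p t"
proof -
  obtain c where c: "\<And>x. f x = (\<Sum>\<alpha>\<in>Mon m k. c \<alpha> * mono_eval \<alpha> x)" using assms unfolding homp_def by blast
  have m: "mono_eval \<alpha> (x(i := t)) = poly (monom (\<Prod>l\<in>keys \<alpha> - {i}. x l ^ lookup \<alpha> l) (lookup \<alpha> i)) t" for \<alpha> t
  proof -
    have "mono_eval \<alpha> (x(i := t)) = (if i \<in> keys \<alpha> then t ^ lookup \<alpha> i else 1) * (\<Prod>l\<in>keys \<alpha> - {i}. (x(i := t)) l ^ lookup \<alpha> l)"
      unfolding mono_eval_def by (cases "i \<in> keys \<alpha>") (auto simp: prod.remove)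
    also have "(\<Prod>l\<in>keys \<alpha> - {i}. (x(i := t)) l ^ lookup \<alpha> l) = (\<Prod>l\<in>keys \<alpha> - {i}. x l ^ lookup \<alpha> l)"
      by (intro prod.cong) auto
    finally show ?thesis by (auto simp: poly_monom in_keys_iff simp del: fun_upd_apply)
  qed
  show ?thesis
    by (intro exI[of _ "\<Sum>\<alpha>\<in>Mon m k. smult (c \<alpha>) (monom (\<Prod>l\<in>keys \<alpha> - {i}. x l ^ lookup \<alpha> l) (lookup \<alpha> i))"])
      (simp add: c m poly_sum)
qed

lemma deriv_poly: "deriv (poly p) = poly (pderiv p)" for p :: "real poly"
  by (rule ext) (rule DERIV_imp_deriv, rule poly_DERIV)

text \<open>\<open>deriv\<close> is additive only on differentiable functions; it suffices that the
  summands are polynomial along every coordinate line.\<close>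

lemma zonal_operator_sum:
  assumes f: "\<And>\<kappa>. \<kappa> \<in> P \<Longrightarrow> homp m k (f \<kappa>)"
  shows "zonal_operator m (\<lambda>x. \<Sum>\<kappa>\<in>P. c \<kappa> * f \<kappa> x) x = (\<Sum>\<kappa>\<in>P. c \<kappa> * zonal_operator m (f \<kappa>) x)"
proof -
  have d: "deriv (\<lambda>t. \<Sum>\<kappa>\<in>P. c \<kappa> * f \<kappa> (x(i := t))) (x i) = (\<Sum>\<kappa>\<in>P. c \<kappa> * deriv (\<lambda>t. f \<kappa> (x(i := t))) (x i))"
    "(deriv ^^ 2) (\<lambda>t. \<Sum>\<kappa>\<in>P. c \<kappa> * f \<kappa> (x(i := t))) (x i) = (\<Sum>\<kappa>\<in>P. c \<kappa> * (deriv ^^ 2) (\<lambda>t. f \<kappa> (x(i := t))) (x i))" for i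
  proof -
    have "\<forall>\<kappa>\<in>P. \<exists>p. \<forall>t. f \<kappa> (x(i := t)) = poly p t" using homp_line[OF f] by blast
    then obtain p where p: "\<And>\<kappa>. \<kappa> \<in> P \<Longrightarrow> (\<lambda>t. f \<kappa> (x(i := t))) = poly (p \<kappa>)" by (metis ext)
    have e: "(\<lambda>t. \<Sum>\<kappa>\<in>P. c \<kappa> * f \<kappa> (x(i := t))) = poly (\<Sum>\<kappa>\<in>P. smult (c \<kappa>) (p \<kappa>))"
      using p by (auto simp: fun_eq_iff poly_sum)
    have pd: "pderiv (\<Sum>\<kappa>\<in>P. smult (c \<kappa>) (q \<kappa>)) = (\<Sum>\<kappa>\<in>P. smult (c \<kappa>) (pderiv (q \<kappa>)))" for q :: "'a \<Rightarrow> real poly"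
      by (induction P rule: infinite_finite_induct) (auto simp: pderiv_add pderiv_smult)
    show "deriv (\<lambda>t. \<Sum>\<kappa>\<in>P. c \<kappa> * f \<kappa> (x(i := t))) (x i) = (\<Sum>\<kappa>\<in>P. c \<kappa> * deriv (\<lambda>t. f \<kappa> (x(i := t))) (x i))"
      unfolding e deriv_poly pd poly_sum poly_smult by (intro sum.cong refl) (simp add: p deriv_poly)
    show "(deriv ^^ 2) (\<lambda>t. \<Sum>\<kappa>\<in>P. c \<kappa> * f \<kappa> (x(i := t))) (x i) = (\<Sum>\<kappa>\<in>P. c \<kappa> * (deriv ^^ 2) (\<lambda>t. f \<kappa> (x(i := t))) (x i))"
      unfolding e numeral_2_eq_2 funpow.simps comp_apply id_apply deriv_poly pd poly_sum poly_smult
      by (intro sum.cong refl) (simp add: p deriv_poly)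
  qed
  show ?thesis
    unfolding zonal_operator_def d
    by (simp add: sum_distrib_left sum_distrib_right distrib_left sum.distrib sum.swap[of _ P] mult_ac)
qed

lemma homp_sph: "\<kappa> \<in> parts CARD('m) k \<Longrightarrow> homp CARD('m) k (sph TYPE('m::finite) \<kappa>)"
  unfolding homp_def using sphc(3) by blast

text \<open>The difference of the two summands is
  \<open>x i * x j * (A i + A j) / (2 * (x i - x j))\<close>, which is antisymmetric in
  \<open>i\<close> and \<open>j\<close> and cancels in the double sum. This is how the poles of the
  operator disappear.\<close>

lemma symmetrized_sum:
  fixes x A :: "nat \<Rightarrow> real" and B :: "nat \<Rightarrow> nat \<Rightarrow> real"
  assumes inj: "inj_on x {..<m}" and B: "\<And>i j. B i j = B j i"
    and AB: "\<And>i j. i < m \<Longrightarrow> j < m \<Longrightarrow> i \<noteq> j \<Longrightarrow> A i - A j = 2 * (x i - x j) * B i j"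
  shows "(\<Sum>i<m. \<Sum>j\<in>{..<m} - {i}. (x i)\<^sup>2 / (x i - x j) * A i) = (\<Sum>i<m. \<Sum>j\<in>{..<m} - {i}. x i * x j * B i j + x i * A i)"
proof -
  define T where "T i j = (if i = j then 0 else (x i)\<^sup>2 / (x i - x j) * A i - (x i * x j * B i j + x i * A i))" for i j
  have anti: "T i j = - T j i" if "i < m" "j < m" for i j
  proof (cases "i = j")
    case False
    then have n: "x i - x j \<noteq> 0" "x j - x i \<noteq> 0" using inj that by (auto simp: inj_on_def)
    have T: "T i j = x i * x j * (A i + A j) / (2 * (x i - x j))" if "i < m" "j < m" "x i - x j \<noteq> 0" "i \<noteq> j" for i j
    proof -
      have "2 * (x i - x j) * T i j = 2 * (x i)\<^sup>2 * A i - (x i * x j * (2 * (x i - x j) * B i j) + 2 * (x i - x j) * x i * A i)"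
        using that by (simp add: T_def field_simps)
      also have "\<dots> = x i * x j * (A i + A j)"
        unfolding AB[OF that(1,2,4), symmetric] by (simp add: algebra_simps power2_eq_square)
      finally show ?thesis using that(3) by (simp add: field_simps)
    qed
    have "T j i = x j * x i * (A j + A i) / (- (2 * (x i - x j)))" using T[of j i] n that False by simp
    then show ?thesis using T[of i j] n that False unfolding divide_minus_right by (simp add: mult.commute add.commute)
  qed (simp add: T_def)
  have "(\<Sum>i<m. \<Sum>j<m. T i j) = (\<Sum>j<m. \<Sum>i<m. T i j)" by (rule sum.swap)
  also have "\<dots> = (\<Sum>j<m. \<Sum>i<m. - T j i)"
    by (intro sum.cong refl anti) auto
  also have "\<dots> = - (\<Sum>i<m. \<Sum>j<m. T i j)" by (simp add: sum_negf)
  finally have "(\<Sum>i<m. \<Sum>j<m. T i j) = 0" by simp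
  moreover have "(\<Sum>j<m. T i j) = (\<Sum>j\<in>{..<m} - {i}. (x i)\<^sup>2 / (x i - x j) * A i - (x i * x j * B i j + x i * A i))" for i
    by (rule sum.mono_neutral_cong_right) (auto simp: T_def)
  ultimately show ?thesis by (simp add: sum_subtractf)
qed

text \<open>\<open>A i\<close> and \<open>B i i\<close> are the first and second partial derivatives
  of the kernel, and \<open>rotation_relation\<close> expresses \<open>A i - A j\<close> by
  \<open>B i j\<close>. With \<open>symmetrized_sum\<close> the singular part becomes the
  off-diagonal part of the sum of \<open>x i * x j * B i j\<close>, whose diagonal part comes from
  the second derivatives, plus a multiple of the Euler operator.\<close>

theorem zonal_operator_kernel:
  fixes b :: "nat \<Rightarrow> real" and k :: nat
  defines "S \<equiv> \<lambda>Y :: real ^ 'm::finite ^ 'm. Y ** dg b ** transpose Y"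
  defines "F \<equiv> \<lambda>x. \<integral>Y. trace (dg x ** S Y) ^ k \<partial>gaussM"
  assumes inj: "inj_on x {..<CARD('m)}"
  shows "zonal_operator CARD('m) F x =
    real k * real (k - 1) * (\<integral>Y. trace (dg x ** S Y ** dg x ** S Y) * trace (dg x ** S Y) ^ (k - 2) \<partial>gaussM)
      + real k * (real CARD('m) - 1) * F x"
proof -
  let ?m = "CARD('m)" and ?G = "gaussM :: (real ^ 'm ^ 'm) measure"
  let ?P = "\<lambda>Y. trace (dg x ** S Y)"
  define s where "s i j Y = S Y $ ix i $ ix j" for i j Y
  have pgs: "pg (s i j)" for i j unfolding s_def S_def by (intro pg_matrix_mult pg_transpose pg_entry pg_const)
  have tr: "trace (dg y ** S Y) = (\<Sum>l<?m. y l * s l l Y)" for y Y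
    by (simp add: trace_def diagm_mult_left sum_ix s_def)
  have pgP: "pg ?P" unfolding tr by (intro pg_sum pg_mult pg_const pgs)
  have symS: "s j i Y = s i j Y" for i j Y
  proof -
    have "transpose (S Y) = S Y" by (simp add: S_def matrix_transpose_mul matrix_mul_assoc)
    then have "transpose (S Y) $ ix i $ ix j = S Y $ ix i $ ix j" by simp
    then show ?thesis by (simp add: transpose_def s_def)
  qed
  have int: "integrable ?G g" if "pg g" for g by (rule integrable_pg[OF has_moments_gaussM that])
  define A where "A i = real k * (\<integral>Y. s i i Y * ?P Y ^ (k - 1) \<partial>?G)" for i
  define B where "B i j = real k * real (k - 1) * (\<integral>Y. (s i j Y)\<^sup>2 * ?P Y ^ (k - 2) \<partial>?G)" for i j
  have D: "deriv (\<lambda>t. F (x(i := t))) (x i) = A i" "(deriv ^^ 2) (\<lambda>t. F (x(i := t))) (x i) = B i i" if i: "i < ?m" for i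
  proof -
    define u where "u Y = (\<Sum>l\<in>{..<?m} - {i}. x l * s l l Y)" for Y
    have pgu: "pg u" unfolding u_def by (intro pg_sum pg_mult pg_const pgs)
    define q where "q Y = [:u Y, s i i Y:]" for Y
    have pgq: "pgpoly (\<lambda>Y. q Y ^ k)" unfolding q_def
      by (intro pgpoly_power pgpoly_pCons pgpoly_const pgu pgs)
    have tq: "trace (dg (x(i := t)) ** S Y) = poly (q Y) t" for t Y
    proof -
      have "trace (dg (x(i := t)) ** S Y) = (x(i := t)) i * s i i Y + (\<Sum>l\<in>{..<?m} - {i}. (x(i := t)) l * s l l Y)"
        unfolding tr using i by (intro sum.remove) auto
      also have "(\<Sum>l\<in>{..<?m} - {i}. (x(i := t)) l * s l l Y) = u Y"
        unfolding u_def by (intro sum.cong) auto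
      finally show ?thesis by (simp add: q_def)
    qed
    have qx: "poly (q Y) (x i) = ?P Y" for Y using tq[of "x i" Y] by simp
    have F: "(\<lambda>t. F (x(i := t))) = (\<lambda>t. \<integral>Y. poly (q Y ^ k) t \<partial>?G)"
      unfolding F_def tq poly_power ..
    have pq: "pderiv (q Y) = [:s i i Y:]" for Y by (simp add: q_def pderiv_pCons)
    have pqk: "pderiv (q Y ^ n) = smult (real n) (q Y ^ (n - 1)) * [:s i i Y:]" for n Y
      by (cases n) (simp_all add: pderiv_power_Suc pq del: power_Suc)
    show "deriv (\<lambda>t. F (x(i := t))) (x i) = A i"
      unfolding F deriv_integral_pgpoly(1)[OF pgq] pqk by (simp add: poly_power qx A_def mult_ac)
    have "pderiv (pderiv (q Y ^ k)) = smult (real k * real (k - 1)) (q Y ^ (k - 2)) * [:(s i i Y)\<^sup>2:]" for Y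
      unfolding pqk pderiv_mult pderiv_smult by (simp add: pderiv_pCons power2_eq_square mult_ac numeral_2_eq_2 diff_diff_left)
    then have e: "poly (pderiv (pderiv (q Y ^ k))) (x i) = real k * real (k - 1) * ((s i i Y)\<^sup>2 * ?P Y ^ (k - 2))" for Y
      by (simp add: poly_power qx mult_ac)
    show "(deriv ^^ 2) (\<lambda>t. F (x(i := t))) (x i) = B i i"
      unfolding F numeral_2_eq_2 funpow.simps comp_apply id_apply deriv_integral_pgpoly(1)[OF pgq]
        deriv_integral_pgpoly(1)[OF deriv_integral_pgpoly(2)[OF pgq]] e
      by (simp add: B_def numeral_2_eq_2)
  qed
  have AB: "A i - A j = 2 * (x i - x j) * B i j" if ij: "i < ?m" "j < ?m" "i \<noteq> j" for i j
  proof (cases "k = 0")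
    case False
    then have k: "k \<ge> 1" by simp
    have n: "(ix i :: 'm) \<noteq> ix j" using ij by (metis rk_ix)
    have "x i \<noteq> x j" using inj ij by (auto simp: inj_on_def)
    then have d: "x (rk (ix i :: 'm)) \<noteq> x (rk (ix j :: 'm))" using ij by simp
    have "A i - A j = real k * (\<integral>Y. (s i i Y - s j j Y) * ?P Y ^ (k - 1) \<partial>?G)"
    proof -
      have "integrable ?G (\<lambda>Y. s i i Y * ?P Y ^ (k - 1))" "integrable ?G (\<lambda>Y. s j j Y * ?P Y ^ (k - 1))"
        by (intro int pg_mult pg_power pgs pgP)+
      then show ?thesis by (simp add: A_def left_diff_distrib right_diff_distrib)
    qed
    also have "(\<integral>Y. (s i i Y - s j j Y) * ?P Y ^ (k - 1) \<partial>?G)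
      = 2 * real (k - 1) * (x i - x j) * (\<integral>Y. (s i j Y)\<^sup>2 * ?P Y ^ (k - 2) \<partial>?G)"
      using rotation_relation[where B = "dg b" and d = "\<lambda>i. x (rk i)", OF _ n d k] ij unfolding s_def S_def by simp
    finally show ?thesis by (simp add: B_def)
  qed (simp add: A_def B_def)
  have Bsym: "B i j = B j i" for i j by (simp add: B_def symS[of i j])
  have "zonal_operator ?m F x = (\<Sum>i<?m. (x i)\<^sup>2 * B i i) + (\<Sum>i<?m. \<Sum>j\<in>{..<?m} - {i}. (x i)\<^sup>2 / (x i - x j) * A i)"
    unfolding zonal_operator_def by (simp add: D)
  also have "(\<Sum>i<?m. \<Sum>j\<in>{..<?m} - {i}. (x i)\<^sup>2 / (x i - x j) * A i)
      = (\<Sum>i<?m. \<Sum>j\<in>{..<?m} - {i}. x i * x j * B i j) + (real ?m - 1) * (\<Sum>i<?m. x i * A i)"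
  proof -
    have "(\<Sum>i<?m. \<Sum>j\<in>{..<?m} - {i}. (x i)\<^sup>2 / (x i - x j) * A i) = (\<Sum>i<?m. \<Sum>j\<in>{..<?m} - {i}. x i * x j * B i j + x i * A i)"
      by (rule symmetrized_sum[OF inj]) (use Bsym AB in auto)
    moreover have "(\<Sum>j\<in>{..<?m} - {i}. x i * x j * B i j + x i * A i) = (\<Sum>j\<in>{..<?m} - {i}. x i * x j * B i j) + (real ?m - 1) * (x i * A i)"
      if "i < ?m" for i using that by (simp add: sum.distrib of_nat_diff Suc_leI)
    ultimately show ?thesis by (simp add: sum.distrib sum_distrib_left)
  qed
  also have "(\<Sum>i<?m. (x i)\<^sup>2 * B i i) + ((\<Sum>i<?m. \<Sum>j\<in>{..<?m} - {i}. x i * x j * B i j) + (real ?m - 1) * (\<Sum>i<?m. x i * A i))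
      = (\<Sum>i<?m. \<Sum>j<?m. x i * x j * B i j) + (real ?m - 1) * (\<Sum>i<?m. x i * A i)"
  proof -
    have "(\<Sum>j<?m. x i * x j * B i j) = (x i)\<^sup>2 * B i i + (\<Sum>j\<in>{..<?m} - {i}. x i * x j * B i j)" if "i < ?m" for i
      using that by (subst sum.remove[of _ i]) (auto simp: power2_eq_square)
    then show ?thesis by (simp add: sum.distrib)
  qed
  \<comment> \<open>Euler's identity for a function that is homogeneous of degree
    \<open>k\<close>.\<close>
  also have "(\<Sum>i<?m. x i * A i) = real k * F x"
  proof (cases "k = 0")
    case False
    have "(\<Sum>i<?m. x i * A i) = real k * (\<Sum>i<?m. \<integral>Y. x i * s i i Y * ?P Y ^ (k - 1) \<partial>?G)"
      by (simp add: A_def sum_distrib_left mult_ac)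
    also have "(\<Sum>i<?m. \<integral>Y. x i * s i i Y * ?P Y ^ (k - 1) \<partial>?G) = (\<integral>Y. (\<Sum>i<?m. x i * s i i Y * ?P Y ^ (k - 1)) \<partial>?G)"
      by (rule Bochner_Integration.integral_sum[symmetric]) (intro int pg_mult pg_power pg_const pgs pgP)
    also have "\<dots> = (\<integral>Y. ?P Y ^ k \<partial>?G)"
    proof (intro Bochner_Integration.integral_cong refl)
      fix Y
      have "(\<Sum>i<?m. x i * s i i Y * ?P Y ^ (k - 1)) = ?P Y * ?P Y ^ (k - 1)" by (simp add: tr sum_distrib_right)
      then show "(\<Sum>i<?m. x i * s i i Y * ?P Y ^ (k - 1)) = ?P Y ^ k" using False by (simp add: power_eq_if)
    qed
    finally show ?thesis by (simp add: F_def)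
  qed (simp add: A_def)
  also have "(\<Sum>i<?m. \<Sum>j<?m. x i * x j * B i j)
      = real k * real (k - 1) * (\<integral>Y. trace (dg x ** S Y ** dg x ** S Y) * ?P Y ^ (k - 2) \<partial>?G)"
  proof -
    have t: "trace (dg x ** S Y ** dg x ** S Y) = (\<Sum>i<?m. \<Sum>j<?m. x i * x j * (s i j Y)\<^sup>2)" for Y
    proof -
      have "trace (dg x ** S Y ** dg x ** S Y) = (\<Sum>a\<in>UNIV. \<Sum>b\<in>UNIV. x (rk a) * S Y $ a $ b * x (rk b) * S Y $ b $ a)"
        unfolding trace_def matrix_mul_assoc[of "dg x ** S Y" "dg x" "S Y", symmetric]
        by (subst (2) matrix_matrix_mult_def) (simp add: diagm_mult_left mult_ac)
      also have "\<dots> = (\<Sum>i<?m. \<Sum>j<?m. x i * s i j Y * x j * s j i Y)" by (simp add: sum_ix s_def)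
      finally show ?thesis by (simp add: symS[of _ _ Y] power2_eq_square) (intro sum.cong refl, simp add: symS mult_ac)
    qed
    have "(\<Sum>i<?m. \<Sum>j<?m. x i * x j * B i j) = real k * real (k - 1) * (\<Sum>i<?m. \<Sum>j<?m. \<integral>Y. x i * x j * (s i j Y)\<^sup>2 * ?P Y ^ (k - 2) \<partial>?G)"
      by (simp add: B_def sum_distrib_left mult_ac)
    also have "(\<Sum>i<?m. \<Sum>j<?m. \<integral>Y. x i * x j * (s i j Y)\<^sup>2 * ?P Y ^ (k - 2) \<partial>?G)
       = (\<integral>Y. (\<Sum>i<?m. \<Sum>j<?m. x i * x j * (s i j Y)\<^sup>2 * ?P Y ^ (k - 2)) \<partial>?G)"
      by (subst Bochner_Integration.integral_sum | intro sum.cong refl int pg_sum pg_mult pg_power pg_const pgs pgP)+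
    finally show ?thesis by (simp add: t sum_distrib_right)
  qed
  finally show ?thesis by simp
qed

text \<open>The kernel and its image under the operator, taken in \<open>a\<close>, are both
  diagonal expansions. Comparing the coefficients of the independent polynomials in \<open>b\<close>
  at a fixed point \<open>x\<close> gives the eigenvalue equation; the eigenvalue is still
  unidentified here.\<close>

theorem sph_eigenfunction:
  assumes \<kappa>: "\<kappa> \<in> parts CARD('m::finite) k"
  shows "\<exists>\<rho>. \<forall>x. inj_on x {..<CARD('m)} \<longrightarrow> zonal_operator CARD('m) (sph TYPE('m) \<kappa>) x = \<rho> * sph TYPE('m) \<kappa> x"
proof -
  let ?P = "parts CARD('m) k" and ?g = "gam TYPE('m)"
  have "\<exists>\<eta>. \<forall>a b. (\<forall>i. b i \<ge> 0) \<longrightarrow>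
    real k * real (k - 1) * (\<integral>Y. trace (dg a ** (Y ** dg b ** transpose Y) ** dg a ** (Y ** dg b ** transpose Y)) *
      trace (dg a ** (Y ** dg b ** transpose Y)) ^ (k - 2) \<partial>(gaussM :: (real ^ 'm ^ 'm) measure))
    = (\<Sum>\<kappa>\<in>?P. \<eta> \<kappa> * sph TYPE('m) \<kappa> b * sph TYPE('m) \<kappa> a)"
  proof (cases "k \<ge> 2")
    case True
    from kernel_trace_square[OF this] obtain \<eta> where \<eta>: "\<And>a b. (\<And>i. b i \<ge> 0) \<Longrightarrow>
    (\<integral>Y. trace (dg a ** (Y ** dg b ** transpose Y) ** dg a ** (Y ** dg b ** transpose Y)) *
      trace (dg a ** (Y ** dg b ** transpose Y)) ^ (k - 2) \<partial>(gaussM :: (real ^ 'm ^ 'm) measure))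
    = (\<Sum>\<kappa>\<in>?P. \<eta> \<kappa> * sph TYPE('m) \<kappa> b * sph TYPE('m) \<kappa> a)" by blast
    show ?thesis
      by (intro exI[of _ "\<lambda>\<kappa>. real k * real (k - 1) * \<eta> \<kappa>"] allI impI, subst \<eta>) (auto simp: sum_distrib_left mult_ac)
  next
    case False
    then have "real k * real (k - 1) = 0" by auto
    then show ?thesis by (intro exI[of _ "\<lambda>_. 0"]) simp
  qed
  then obtain \<eta> where \<eta>: "\<And>a b. (\<forall>i. b i \<ge> 0) \<Longrightarrow>
    real k * real (k - 1) * (\<integral>Y. trace (dg a ** (Y ** dg b ** transpose Y) ** dg a ** (Y ** dg b ** transpose Y)) *
      trace (dg a ** (Y ** dg b ** transpose Y)) ^ (k - 2) \<partial>(gaussM :: (real ^ 'm ^ 'm) measure))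
    = (\<Sum>\<kappa>\<in>?P. \<eta> \<kappa> * sph TYPE('m) \<kappa> b * sph TYPE('m) \<kappa> a)" by blast
  \<comment> \<open>\<open>\<eta>\<close> comes from the squared trace term of
    \<open>zonal_operator_kernel\<close>, the other summand from its Euler term; dividing by
    \<open>gam\<close> is legitimate by \<open>gam_nonzero\<close>.\<close>
  define \<rho> where "\<rho> = (\<eta> \<kappa> + real k * (real CARD('m) - 1) * ?g \<kappa>) / ?g \<kappa>"
  have "zonal_operator CARD('m) (sph TYPE('m) \<kappa>) x = \<rho> * sph TYPE('m) \<kappa> x" if inj: "inj_on x {..<CARD('m)}" for x
  proof -
    have "?g \<kappa> * zonal_operator CARD('m) (sph TYPE('m) \<kappa>) x - (\<eta> \<kappa> + real k * (real CARD('m) - 1) * ?g \<kappa>) * sph TYPE('m) \<kappa> x = 0"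
    proof (rule sph_independent[OF _ \<kappa>, where d = "\<lambda>\<kappa>. ?g \<kappa> * zonal_operator CARD('m) (sph TYPE('m) \<kappa>) x
        - (\<eta> \<kappa> + real k * (real CARD('m) - 1) * ?g \<kappa>) * sph TYPE('m) \<kappa> x"])
      fix b :: "nat \<Rightarrow> real" assume "\<And>i. b i > 0"
      then have b: "b i \<ge> 0" for i by (simp add: less_imp_le)
      note K = kernel_trace[of b, where k = k and 'm = 'm, OF b]
      have "(\<Sum>\<kappa>\<in>?P. (?g \<kappa> * sph TYPE('m) \<kappa> b) * zonal_operator CARD('m) (sph TYPE('m) \<kappa>) x)
        = zonal_operator CARD('m) (\<lambda>a. \<Sum>\<kappa>\<in>?P. (?g \<kappa> * sph TYPE('m) \<kappa> b) * sph TYPE('m) \<kappa> a) x"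
        by (rule zonal_operator_sum[symmetric]) (rule homp_sph)
      also have "\<dots> = (\<Sum>\<kappa>\<in>?P. \<eta> \<kappa> * sph TYPE('m) \<kappa> b * sph TYPE('m) \<kappa> x)
        + real k * (real CARD('m) - 1) * (\<Sum>\<kappa>\<in>?P. ?g \<kappa> * sph TYPE('m) \<kappa> b * sph TYPE('m) \<kappa> x)"
        using zonal_operator_kernel[OF inj, of b k] \<eta>[of b x] b unfolding K by simp
      finally show "(\<Sum>\<kappa>\<in>?P. (?g \<kappa> * zonal_operator CARD('m) (sph TYPE('m) \<kappa>) x
        - (\<eta> \<kappa> + real k * (real CARD('m) - 1) * ?g \<kappa>) * sph TYPE('m) \<kappa> x) * sph TYPE('m) \<kappa> b) = 0"
        unfolding left_diff_distrib distrib_right sum_subtractf sum.distrib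
        by (simp add: sum_distrib_left mult_ac)
    qed
    then show ?thesis using gam_nonzero[OF \<kappa>] by (simp add: \<rho>_def field_simps)
  qed
  then show ?thesis by blast
qed

section \<open>Identification of the zonal polynomials\<close>

text \<open>Each derivative multiplied by its variable reproduces the monomial, so the operator acts
  on it as a multiplier; the dependence of the multiplier on the point is confined to the quotients
  \<open>x i / (x i - x j)\<close>.\<close>

lemma zonal_operator_mono:
  assumes \<alpha>: "keys \<alpha> \<subseteq> {..<m}" and x: "\<And>i. i < m \<Longrightarrow> x i \<noteq> 0"
  shows "zonal_operator m (mono_eval \<alpha>) x = mono_eval \<alpha> x *
    ((\<Sum>i<m. real (lookup \<alpha> i) * (real (lookup \<alpha> i) - 1)) + (\<Sum>i<m. \<Sum>j\<in>{..<m} - {i}. real (lookup \<alpha> i) * (x i / (x i - x j))))"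
proof -
  have D: "(x i) * deriv (\<lambda>t. mono_eval \<alpha> (x(i := t))) (x i) = real (lookup \<alpha> i) * mono_eval \<alpha> x"
    "(x i)\<^sup>2 * (deriv ^^ 2) (\<lambda>t. mono_eval \<alpha> (x(i := t))) (x i) = real (lookup \<alpha> i) * (real (lookup \<alpha> i) - 1) * mono_eval \<alpha> x"
    if i: "i < m" for i
  proof -
    let ?a = "lookup \<alpha> i"
    define K where "K = (\<Prod>l\<in>{..<m} - {i}. x l ^ lookup \<alpha> l)"
    have e: "mono_eval \<alpha> (x(i := t)) = poly (monom K ?a) t" for t
    proof -
      have "mono_eval \<alpha> (x(i := t)) = (x(i := t)) i ^ ?a * (\<Prod>l\<in>{..<m} - {i}. (x(i := t)) l ^ lookup \<alpha> l)"
        unfolding mono_eval_lessThan[OF \<alpha>] using i by (intro prod.remove) auto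
      also have "(\<Prod>l\<in>{..<m} - {i}. (x(i := t)) l ^ lookup \<alpha> l) = K" unfolding K_def by (intro prod.cong) auto
      finally show ?thesis by (simp only: poly_monom fun_upd_same mult.commute)
    qed
    have v: "mono_eval \<alpha> x = K * x i ^ ?a" using e[of "x i"] by (simp add: poly_monom)
    have d1: "deriv (\<lambda>t. mono_eval \<alpha> (x(i := t))) = poly (monom (real ?a * K) (?a - 1))"
      unfolding e by (simp add: deriv_poly pderiv_monom)
    have d2: "(deriv ^^ 2) (\<lambda>t. mono_eval \<alpha> (x(i := t))) = poly (monom (real (?a - 1) * (real ?a * K)) (?a - 1 - 1))"
      unfolding numeral_2_eq_2 funpow.simps comp_apply id_apply d1 by (simp add: deriv_poly pderiv_monom)
    show "(x i) * deriv (\<lambda>t. mono_eval \<alpha> (x(i := t))) (x i) = real ?a * mono_eval \<alpha> x"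
      unfolding d1 v by (cases ?a) (auto simp: poly_monom)
    show "(x i)\<^sup>2 * (deriv ^^ 2) (\<lambda>t. mono_eval \<alpha> (x(i := t))) (x i) = real ?a * (real ?a - 1) * mono_eval \<alpha> x"
    proof -
      consider "?a = 0" | "?a = 1" | n where "?a = Suc (Suc n)" by (metis One_nat_def not0_implies_Suc)
      then show ?thesis unfolding d2 v by cases (auto simp: poly_monom power2_eq_square)
    qed
  qed
  have E: "(x i)\<^sup>2 / (x i - x j) * deriv (\<lambda>t. mono_eval \<alpha> (x(i := t))) (x i) = mono_eval \<alpha> x * (real (lookup \<alpha> i) * (x i / (x i - x j)))"
    if "i < m" for i j
  proof -
    have "(x i)\<^sup>2 / (x i - x j) * deriv (\<lambda>t. mono_eval \<alpha> (x(i := t))) (x i)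
      = (x i / (x i - x j)) * (x i * deriv (\<lambda>t. mono_eval \<alpha> (x(i := t))) (x i))" by (simp add: power2_eq_square)
    then show ?thesis unfolding D(1)[OF that] by (simp add: mult_ac)
  qed
  have "(\<Sum>i<m. (x i)\<^sup>2 * (deriv ^^ 2) (\<lambda>t. mono_eval \<alpha> (x(i := t))) (x i)) = mono_eval \<alpha> x * (\<Sum>i<m. real (lookup \<alpha> i) * (real (lookup \<alpha> i) - 1))"
    unfolding sum_distrib_left by (intro sum.cong refl) (simp only: D(2) lessThan_iff mult_ac)
  moreover have "(\<Sum>i<m. \<Sum>j\<in>{..<m} - {i}. (x i)\<^sup>2 / (x i - x j) * deriv (\<lambda>t. mono_eval \<alpha> (x(i := t))) (x i))
      = mono_eval \<alpha> x * (\<Sum>i<m. \<Sum>j\<in>{..<m} - {i}. real (lookup \<alpha> i) * (x i / (x i - x j)))"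
    unfolding sum_distrib_left by (intro sum.cong refl) (simp only: E lessThan_iff)
  ultimately show ?thesis unfolding zonal_operator_def by (simp only: distrib_left)
qed

text \<open>The exponent of \<open>u\<close> in the monomial at \<open>x i = u ^ i\<close>; for
  partitions it is the classical statistic \<open>n(\<kappa>)\<close>.\<close>

definition nsum :: "nat \<Rightarrow> monomial \<Rightarrow> nat" where "nsum m \<alpha> = (\<Sum>i<m. i * lookup \<alpha> i)"

lemma nsum_psum: "nsum m \<alpha> + (\<Sum>r<m. psum \<alpha> (Suc r)) = m * psum \<alpha> m"
  by (induction m) (auto simp: nsum_def psum_def algebra_simps)

text \<open>By \<open>nsum_psum\<close>, smaller partial sums mean a larger
  \<open>nsum\<close>.\<close>

lemma nsum_less:
  assumes \<alpha>: "\<alpha> \<in> domw m (psum \<kappa>)" and \<kappa>: "keys \<kappa> \<subseteq> {..<m}" and ne: "\<alpha> \<noteq> \<kappa>"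
  shows "nsum m \<kappa> < nsum m \<alpha>"
proof -
  have le: "psum \<alpha> r \<le> psum \<kappa> r" and eq: "psum \<alpha> m = psum \<kappa> m" and ka: "keys \<alpha> \<subseteq> {..<m}" for r
    using \<alpha> by (auto simp: domw_def)
  obtain r where r: "psum \<alpha> r \<noteq> psum \<kappa> r" using ne psum_inject by blast
  have "r < m"
  proof (rule ccontr)
    assume "\<not> r < m"
    then show False using r psum_ge[OF ka, of r] psum_ge[OF \<kappa>, of r] eq by simp
  qed
  moreover have "r \<noteq> 0" using r by (auto simp: psum_def intro: ccontr)
  ultimately obtain s where s: "r = Suc s" "s < m" by (cases r) auto
  have "(\<Sum>r<m. psum \<alpha> (Suc r)) < (\<Sum>r<m. psum \<kappa> (Suc r))"
    by (rule sum_strict_mono_ex1) (use le r s in \<open>auto simp: order.strict_iff_order\<close>)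
  then show ?thesis using nsum_psum[of m \<alpha>] nsum_psum[of m \<kappa>] eq by simp
qed

text \<open>For fixed \<open>i\<close> there are \<open>m - 1 - i\<close> indices
  \<open>j > i\<close>. In the usual numbering from 1 this is the sum of
  \<open>\<kappa>_i (\<kappa>_i - i)\<close> plus \<open>k (m - 1)\<close>, where \<open>k\<close>
  is the weight.\<close>

definition zonal_eigenvalue :: "nat \<Rightarrow> monomial \<Rightarrow> real" where
  "zonal_eigenvalue m \<kappa> = (\<Sum>i<m. real (lookup \<kappa> i) * (real (lookup \<kappa> i) - 1)) + (\<Sum>i<m. \<Sum>j\<in>{..<m} - {i}. if i < j then real (lookup \<kappa> i) else 0)"

text \<open>Evaluate at \<open>x\<^sub>i = u ^ i\<close> and let \<open>u\<close> tend to \<open>0\<close>: the extremal monomial dominates and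
  \<open>x\<^sub>i / (x\<^sub>i - x\<^sub>j)\<close> tends to \<open>1\<close> or \<open>0\<close>.\<close>

lemma zonal_eigenvalue_unique:
  assumes \<kappa>: "\<kappa> \<in> Mon m k" "c \<kappa> \<noteq> 0" and dom: "\<And>\<alpha>. c \<alpha> \<noteq> 0 \<Longrightarrow> \<alpha> \<in> domw m (psum \<kappa>)"
    and eig: "\<And>x. inj_on x {..<m} \<Longrightarrow> zonal_operator m (\<lambda>x. \<Sum>\<alpha>\<in>Mon m k. c \<alpha> * mono_eval \<alpha> x) x = \<rho> * (\<Sum>\<alpha>\<in>Mon m k. c \<alpha> * mono_eval \<alpha> x)"
  shows "\<rho> = zonal_eigenvalue m \<kappa>"
proof -
  \<comment> \<open>The quotient \<open>x i / (x i - x j)\<close> at \<open>x i = u ^ i\<close>,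
    with the smaller power of \<open>u\<close> cancelled so that it is regular at
    \<open>u = 0\<close>.\<close>
  define g where "g i j u = (if i < j then 1 / (1 - u ^ (j - i)) else u ^ (i - j) / (u ^ (i - j) - 1))" for i j :: nat and u :: real
  define G where "G \<alpha> u = (\<Sum>i<m. real (lookup \<alpha> i) * (real (lookup \<alpha> i) - 1)) + (\<Sum>i<m. \<Sum>j\<in>{..<m} - {i}. real (lookup \<alpha> i) * g i j u)" for \<alpha> u
  have lim: "(g i j \<longlongrightarrow> (if i < j then 1 else 0)) (at_right 0)" if "i \<noteq> j" for i j
  proof (cases "i < j")
    case True
    have "((\<lambda>u::real. 1 / (1 - u ^ (j - i))) \<longlongrightarrow> 1 / (1 - 0 ^ (j - i))) (at_right 0)"
      using True by (intro tendsto_intros) (auto simp: power_0_left)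
    then show ?thesis using True by (simp add: g_def[abs_def] power_0_left)
  next
    case False
    have "((\<lambda>u::real. u ^ (i - j) / (u ^ (i - j) - 1)) \<longlongrightarrow> 0 ^ (i - j) / (0 ^ (i - j) - 1)) (at_right 0)"
      using False that by (intro tendsto_intros) (auto simp: power_0_left)
    then show ?thesis using False that by (simp add: g_def[abs_def] power_0_left)
  qed
  have limG: "(G \<alpha> \<longlongrightarrow> zonal_eigenvalue m \<alpha>) (at_right 0)" for \<alpha>
  proof -
    have "(G \<alpha> \<longlongrightarrow> (\<Sum>i<m. real (lookup \<alpha> i) * (real (lookup \<alpha> i) - 1)) + (\<Sum>i<m. \<Sum>j\<in>{..<m} - {i}. real (lookup \<alpha> i) * (if i < j then 1 else 0))) (at_right 0)"
      unfolding G_def[abs_def] by (intro tendsto_intros lim) auto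
    then show ?thesis by (simp add: zonal_eigenvalue_def if_distrib cong: if_cong)
  qed
  have N: "nsum m \<kappa> \<le> nsum m \<alpha>" if "c \<alpha> \<noteq> 0" for \<alpha>
    using nsum_less[OF dom[OF that]] \<kappa> by (cases "\<alpha> = \<kappa>") (auto simp: Mon_def)
  \<comment> \<open>The eigenvalue equation divided by \<open>u ^ nsum m \<kappa>\<close>, the
    lowest power that occurs; in the limit only the term of \<open>\<kappa>\<close>
    survives.\<close>
  define H where "H u = (\<Sum>\<alpha>\<in>Mon m k. c \<alpha> * u ^ (nsum m \<alpha> - nsum m \<kappa>) * (G \<alpha> u - \<rho>))" for u
  have H0: "H u = 0" if u: "0 < u" "u < 1" for u
  proof -
    define x where "x i = u ^ i" for i
    have inj: "inj_on x {..<m}" using u by (auto simp: inj_on_def x_def dest: power_inject_exp'[THEN iffD1, rotated 2])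
    have xg: "x i / (x i - x j) = g i j u" if "i \<noteq> j" for i j
    proof (cases "i < j")
      case True
      then have "u ^ j = u ^ i * u ^ (j - i)" by (simp add: power_add[symmetric])
      then have "x i - x j = u ^ i * (1 - u ^ (j - i))" by (simp add: x_def algebra_simps)
      then show ?thesis using True u by (simp add: g_def x_def)
    next
      case False
      then have "u ^ i = u ^ j * u ^ (i - j)" by (simp add: power_add[symmetric])
      then have "x i - x j = u ^ j * (u ^ (i - j) - 1)" "x i = u ^ j * u ^ (i - j)" by (simp_all add: x_def algebra_simps)
      then show ?thesis using False u by (simp add: g_def)
    qed
    have me: "mono_eval \<alpha> x = u ^ nsum m \<alpha>" if "\<alpha> \<in> Mon m k" for \<alpha>
      using that mono_eval_lessThan[of \<alpha> m] by (simp add: Mon_def nsum_def x_def power_sum power_mult[symmetric])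
    have zm: "zonal_operator m (mono_eval \<alpha>) x = u ^ nsum m \<alpha> * G \<alpha> u" if "\<alpha> \<in> Mon m k" for \<alpha>
    proof -
      have "keys \<alpha> \<subseteq> {..<m}" using that by (simp add: Mon_def)
      from zonal_operator_mono[OF this, of x]
      have "zonal_operator m (mono_eval \<alpha>) x = mono_eval \<alpha> x *
        ((\<Sum>i<m. real (lookup \<alpha> i) * (real (lookup \<alpha> i) - 1)) + (\<Sum>i<m. \<Sum>j\<in>{..<m} - {i}. real (lookup \<alpha> i) * (x i / (x i - x j))))"
        using u by (simp add: x_def)
      also have "(\<Sum>i<m. \<Sum>j\<in>{..<m} - {i}. real (lookup \<alpha> i) * (x i / (x i - x j))) = (\<Sum>i<m. \<Sum>j\<in>{..<m} - {i}. real (lookup \<alpha> i) * g i j u)"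
        by (intro sum.cong refl) (auto simp: xg)
      finally show ?thesis by (simp add: G_def me[OF that])
    qed
    have "zonal_operator m (\<lambda>x. \<Sum>\<alpha>\<in>Mon m k. c \<alpha> * mono_eval \<alpha> x) x = (\<Sum>\<alpha>\<in>Mon m k. c \<alpha> * zonal_operator m (mono_eval \<alpha>) x)"
      by (rule zonal_operator_sum[where k = k]) (auto intro: homp_mono simp: Mon_def)
    then have "(\<Sum>\<alpha>\<in>Mon m k. c \<alpha> * (u ^ nsum m \<alpha> * G \<alpha> u)) = \<rho> * (\<Sum>\<alpha>\<in>Mon m k. c \<alpha> * u ^ nsum m \<alpha>)"
      using eig[OF inj] by (simp add: zm me)
    then have "(\<Sum>\<alpha>\<in>Mon m k. c \<alpha> * u ^ nsum m \<alpha> * (G \<alpha> u - \<rho>)) = 0"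
      unfolding right_diff_distrib sum_subtractf by (simp add: sum_distrib_left mult_ac)
    also have "(\<Sum>\<alpha>\<in>Mon m k. c \<alpha> * u ^ nsum m \<alpha> * (G \<alpha> u - \<rho>)) = u ^ nsum m \<kappa> * H u"
      unfolding H_def sum_distrib_left
    proof (intro sum.cong refl)
      fix \<alpha>
      show "c \<alpha> * u ^ nsum m \<alpha> * (G \<alpha> u - \<rho>) = u ^ nsum m \<kappa> * (c \<alpha> * u ^ (nsum m \<alpha> - nsum m \<kappa>) * (G \<alpha> u - \<rho>))"
        using N[of \<alpha>] by (cases "c \<alpha> = 0") (auto simp: power_add[symmetric])
    qed
    finally show ?thesis using u by simp
  qed
  have "(H \<longlongrightarrow> (\<Sum>\<alpha>\<in>Mon m k. c \<alpha> * 0 ^ (nsum m \<alpha> - nsum m \<kappa>) * (zonal_eigenvalue m \<alpha> - \<rho>))) (at_right 0)"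
    unfolding H_def[abs_def] by (intro tendsto_intros limG)
  also have "(\<Sum>\<alpha>\<in>Mon m k. c \<alpha> * 0 ^ (nsum m \<alpha> - nsum m \<kappa>) * (zonal_eigenvalue m \<alpha> - \<rho>))
      = (\<Sum>\<alpha>\<in>Mon m k. if \<alpha> = \<kappa> then c \<kappa> * (zonal_eigenvalue m \<kappa> - \<rho>) else 0)"
  proof (intro sum.cong refl)
    fix \<alpha>
    show "c \<alpha> * 0 ^ (nsum m \<alpha> - nsum m \<kappa>) * (zonal_eigenvalue m \<alpha> - \<rho>) = (if \<alpha> = \<kappa> then c \<kappa> * (zonal_eigenvalue m \<kappa> - \<rho>) else 0)"
      using nsum_less[OF dom, of \<alpha>] \<kappa> by (cases "c \<alpha> = 0") (auto simp: power_0_left Mon_def)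
  qed
  also have "\<dots> = c \<kappa> * (zonal_eigenvalue m \<kappa> - \<rho>)" using \<kappa> by (simp add: finite_Mon)
  finally have "(H \<longlongrightarrow> c \<kappa> * (zonal_eigenvalue m \<kappa> - \<rho>)) (at_right 0)" .
  moreover have "(H \<longlongrightarrow> 0) (at_right 0)"
  proof (rule tendsto_eventually)
    show "\<forall>\<^sub>F u in at_right 0. H u = 0"
      using eventually_at_right_real[of 0 1] by (auto elim!: eventually_mono intro: H0)
  qed
  ultimately have "c \<kappa> * (zonal_eigenvalue m \<kappa> - \<rho>) = 0" by (rule tendsto_unique[rotated]) simp
  then show ?thesis using \<kappa> by simp
qed

lemma zonal_eigenvalue_alt:
  assumes "\<kappa> \<in> Mon m k"
  shows "zonal_eigenvalue m \<kappa> = (\<Sum>i<m. (real (lookup \<kappa> i))\<^sup>2) + (real m - 2) * real k - real (nsum m \<kappa>)"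
proof -
  have k: "(\<Sum>i<m. real (lookup \<kappa> i)) = real k" using assms by (auto simp: Mon_def psum_def)
  have "(\<Sum>j\<in>{..<m} - {i}. if i < j then real (lookup \<kappa> i) else 0) = (real m - 1 - real i) * real (lookup \<kappa> i)" if "i < m" for i
  proof -
    have "(\<Sum>j\<in>{..<m} - {i}. if i < j then real (lookup \<kappa> i) else 0) = (\<Sum>j\<in>{i<..<m}. real (lookup \<kappa> i))"
      by (rule sum.mono_neutral_cong_right) auto
    then show ?thesis using that by (simp add: of_nat_diff Suc_leI)
  qed
  then have "zonal_eigenvalue m \<kappa> = (\<Sum>i<m. (real (lookup \<kappa> i))\<^sup>2 + (real m - 2) * real (lookup \<kappa> i) - real (i * lookup \<kappa> i))"
    unfolding zonal_eigenvalue_def sum.distrib[symmetric]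
    by (intro sum.cong refl) (simp add: power2_eq_square algebra_simps)
  then show ?thesis by (simp add: sum.distrib sum_subtractf sum_distrib_left[symmetric] k nsum_def)
qed

lemma abel_nonneg:
  fixes a :: "nat \<Rightarrow> nat" and d :: "nat \<Rightarrow> real"
  assumes "antimono a" "\<And>r. (\<Sum>i<r. d i) \<ge> 0"
  shows "(\<Sum>i<m. real (a i) * d i) \<ge> real (a m) * (\<Sum>i<m. d i)"
proof (induction m)
  case (Suc m)
  have "real (a (Suc m)) * (\<Sum>i<Suc m. d i) \<le> real (a m) * (\<Sum>i<Suc m. d i)"
    using assms by (intro mult_right_mono) (auto simp: antimono_def simp del: sum.lessThan_Suc)
  also have "\<dots> \<le> (\<Sum>i<Suc m. real (a i) * d i)" using Suc by (simp add: distrib_left)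
  finally show ?case .
qed simp

text \<open>With \<open>d = \<kappa> - \<alpha>\<close> the sums of squares differ by the sum of the
  squares of \<open>d\<close> plus twice the sum of the products of \<open>\<alpha>\<close> and
  \<open>d\<close>. The latter is nonnegative by summation by parts, and \<open>nsum\<close>
  decreases strictly. Dominance is essential: \<open>(4,1,1)\<close> and \<open>(3,3)\<close> are
  comparable lexicographically but not by dominance, and share an eigenvalue.\<close>

lemma zonal_eigenvalue_less:
  assumes \<alpha>: "\<alpha> \<in> parts m k" and \<kappa>: "\<kappa> \<in> parts m k" and dom: "\<alpha> \<in> domw m (psum \<kappa>)" and ne: "\<alpha> \<noteq> \<kappa>"
  shows "zonal_eigenvalue m \<alpha> < zonal_eigenvalue m \<kappa>"
proof -
  have M: "\<alpha> \<in> Mon m k" "\<kappa> \<in> Mon m k" "antimono (lookup \<alpha>)" using \<alpha> \<kappa> by (auto simp: parts_def)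
  define d where "d i = real (lookup \<kappa> i) - real (lookup \<alpha> i)" for i
  have D: "(\<Sum>i<r. d i) \<ge> 0" for r
  proof -
    have "psum \<alpha> r \<le> psum \<kappa> r" using dom by (auto simp: domw_def)
    then have "real (psum \<alpha> r) \<le> real (psum \<kappa> r)" by simp
    then show ?thesis by (simp add: d_def sum_subtractf psum_def)
  qed
  have "0 \<le> (\<Sum>i<m. real (lookup \<alpha> i) * d i)"
    using abel_nonneg[OF M(3) D, of m] D[of m] by (meson mult_nonneg_nonneg of_nat_0_le_iff order_trans)
  moreover have "(\<Sum>i<m. (real (lookup \<kappa> i))\<^sup>2) - (\<Sum>i<m. (real (lookup \<alpha> i))\<^sup>2) = (\<Sum>i<m. (d i)\<^sup>2) + 2 * (\<Sum>i<m. real (lookup \<alpha> i) * d i)"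
    unfolding sum_subtractf[symmetric] sum_distrib_left sum.distrib[symmetric]
    by (intro sum.cong refl) (simp add: d_def power2_eq_square algebra_simps)
  moreover have "(\<Sum>i<m. (d i)\<^sup>2) \<ge> 0" by (intro sum_nonneg) auto
  moreover have "nsum m \<kappa> < nsum m \<alpha>" using nsum_less[OF dom _ ne] M by (auto simp: Mon_def)
  ultimately show ?thesis unfolding zonal_eigenvalue_alt[OF M(1)] zonal_eigenvalue_alt[OF M(2)] by simp
qed

lemma zonal_eigenvalue_sph:
  assumes \<kappa>: "\<kappa> \<in> parts CARD('m::finite) k" and x: "inj_on x {..<CARD('m)}"
  shows "zonal_operator CARD('m) (sph TYPE('m) \<kappa>) x = zonal_eigenvalue CARD('m) \<kappa> * sph TYPE('m) \<kappa> x"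
proof -
  obtain \<rho> where \<rho>: "\<And>x. inj_on x {..<CARD('m)} \<Longrightarrow> zonal_operator CARD('m) (sph TYPE('m) \<kappa>) x = \<rho> * sph TYPE('m) \<kappa> x"
    using sph_eigenfunction[OF \<kappa>] by blast
  have "sph TYPE('m) \<kappa> = (\<lambda>x. \<Sum>\<alpha>\<in>Mon CARD('m) k. sphc TYPE('m) \<kappa> \<alpha> * mono_eval \<alpha> x)"
    using sphc(3)[OF \<kappa>] by blast
  then have "\<rho> = zonal_eigenvalue CARD('m) \<kappa>"
    using \<rho> sphc(1,2)[OF \<kappa>] \<kappa>
    by (intro zonal_eigenvalue_unique[where c = "sphc TYPE('m) \<kappa>" and k = k]) (auto simp: parts_def)
  then show ?thesis using \<rho>[OF x] by simp
qed

section \<open>Existence and uniqueness of the zonal family\<close>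

lemma eval_poly_Mon:
  assumes "keys p \<subseteq> Mon m k"
  shows "eval_poly p x = (\<Sum>\<alpha>\<in>Mon m k. lookup p \<alpha> * mono_eval \<alpha> x)"
proof -
  have "eval_poly p x = (\<Sum>\<alpha>\<in>keys p. lookup p \<alpha> * mono_eval \<alpha> x)" by (simp add: eval_poly_def mono_eval_def)
  also have "\<dots> = (\<Sum>\<alpha>\<in>Mon m k. lookup p \<alpha> * mono_eval \<alpha> x)"
    by (rule sum.mono_neutral_left[OF finite_Mon assms]) (auto simp: in_keys_iff)
  finally show ?thesis .
qed

lemma homogeneous_symmetric_Mon: "homogeneous_symmetric m k p \<Longrightarrow> keys p \<subseteq> Mon m k"
  by (auto simp: homogeneous_symmetric_def Mon_def sum_keys_psum)

text \<open>In the expansion of \<open>p\<close> by spherical polynomials only partitions dominated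
  by \<open>\<kappa>\<close> occur, and among these the eigenvalue of \<open>\<kappa>\<close> is
  attained by \<open>\<kappa>\<close> alone; applying the operator removes all other terms.\<close>

lemma zonal_shape_unique:
  assumes \<kappa>: "\<kappa> \<in> parts CARD('m::finite) k" and hs: "homogeneous_symmetric CARD('m) k p" and zs: "zonal_shape CARD('m) \<kappa> p"
  shows "\<exists>c. \<forall>x. eval_poly p x = c * sph TYPE('m) \<kappa> x"
proof -
  let ?m = "CARD('m)" and ?P = "parts CARD('m) k"
  note kp = homogeneous_symmetric_Mon[OF hs]
  note ev = eval_poly_Mon[OF kp]
  have dom: "\<alpha> \<in> domw ?m (psum \<kappa>)" if "lookup p \<alpha> \<noteq> 0" for \<alpha>
  proof -
    have a: "\<alpha> \<in> keys p" using that by (simp add: in_keys_iff)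
    then have "\<alpha> \<in> Mon ?m k" using kp by blast
    moreover have "psum \<alpha> r \<le> psum \<kappa> r" for r using zs a by (auto simp: zonal_shape_def psum_def)
    ultimately show ?thesis using \<kappa> by (auto simp: domw_def Mon_def parts_def)
  qed
  have "\<exists>d. \<forall>x. (\<Sum>\<alpha>\<in>Mon ?m k. lookup p \<alpha> * mono_eval \<alpha> x) = (\<Sum>\<nu>\<in>?P. d \<nu> * sph TYPE('m) \<nu> x)"
    by (rule sph_span) (use hs ev in \<open>auto simp: homogeneous_symmetric_def\<close>)
  then obtain d where d: "\<And>x. eval_poly p x = (\<Sum>\<nu>\<in>?P. d \<nu> * sph TYPE('m) \<nu> x)" using ev by auto
  have coef: "lookup p \<alpha> = (\<Sum>\<nu>\<in>?P. d \<nu> * sphc TYPE('m) \<nu> \<alpha>)" if \<alpha>: "\<alpha> \<in> Mon ?m k" for \<alpha>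
  proof -
    have "lookup p \<alpha> - (\<Sum>\<nu>\<in>?P. d \<nu> * sphc TYPE('m) \<nu> \<alpha>) = 0"
    proof (rule mono_eval_independent[where c = "\<lambda>\<alpha>. lookup p \<alpha> - (\<Sum>\<nu>\<in>?P. d \<nu> * sphc TYPE('m) \<nu> \<alpha>)", OF _ \<alpha>])
      fix x :: "nat \<Rightarrow> real"
      have "(\<Sum>\<alpha>\<in>Mon ?m k. (\<Sum>\<nu>\<in>?P. d \<nu> * sphc TYPE('m) \<nu> \<alpha>) * mono_eval \<alpha> x) = (\<Sum>\<nu>\<in>?P. d \<nu> * sph TYPE('m) \<nu> x)"
        unfolding sum_distrib_right
        by (subst sum.swap, intro sum.cong refl) (simp add: sphc(3)[where k = k] sum_distrib_left mult_ac)
      then show "(\<Sum>\<alpha>\<in>Mon ?m k. (lookup p \<alpha> - (\<Sum>\<nu>\<in>?P. d \<nu> * sphc TYPE('m) \<nu> \<alpha>)) * mono_eval \<alpha> x) = 0"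
        using d[of x] ev[of x] by (simp add: left_diff_distrib sum_subtractf)
    qed
    then show ?thesis by simp
  qed
  \<comment> \<open>The largest \<open>\<mu>\<close> with \<open>d \<mu> \<noteq> 0\<close> that is
    not dominated by \<open>\<kappa>\<close> would leave its own monomial in \<open>p\<close>: any
    other polynomial containing this monomial belongs to a partition that dominates
    \<open>\<mu>\<close>, hence is not dominated by \<open>\<kappa>\<close> either and is
    lexicographically larger.\<close>
  have domd: "\<nu> \<in> domw ?m (psum \<kappa>)" if "\<nu> \<in> ?P" "d \<nu> \<noteq> 0" for \<nu>
  proof (rule ccontr)
    assume nd: "\<nu> \<notin> domw ?m (psum \<kappa>)"
    define K where "K = {\<nu>\<in>?P. d \<nu> \<noteq> 0 \<and> \<nu> \<notin> domw ?m (psum \<kappa>)}"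
    have K: "finite K" "K \<noteq> {}" using that nd finite_parts by (auto simp: K_def)
    define \<mu> where "\<mu> = Max K"
    have "\<mu> \<in> K" "\<And>\<nu>. \<nu> \<in> K \<Longrightarrow> \<nu> \<le> \<mu>" using K by (auto simp: \<mu>_def)
    then have \<mu>: "\<mu> \<in> ?P" "d \<mu> \<noteq> 0" "\<mu> \<notin> domw ?m (psum \<kappa>)" "\<And>\<nu>. \<nu> \<in> K \<Longrightarrow> \<nu> \<le> \<mu>" by (auto simp: K_def)
    have "(\<Sum>\<nu>\<in>?P. d \<nu> * sphc TYPE('m) \<nu> \<mu>) = (\<Sum>\<nu>\<in>?P. if \<nu> = \<mu> then d \<mu> * sphc TYPE('m) \<mu> \<mu> else 0)"
    proof (rule sum.cong[OF refl])
      fix \<nu> assume \<nu>: "\<nu> \<in> ?P"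
      show "d \<nu> * sphc TYPE('m) \<nu> \<mu> = (if \<nu> = \<mu> then d \<mu> * sphc TYPE('m) \<mu> \<mu> else 0)"
      proof (rule ccontr)
        assume *: "\<not> ?thesis"
        then have n: "\<nu> \<noteq> \<mu>" "d \<nu> \<noteq> 0" "sphc TYPE('m) \<nu> \<mu> \<noteq> 0" by (auto split: if_splits)
        then have dm: "\<mu> \<in> domw ?m (psum \<nu>)" using sphc(1)[OF \<nu>] by blast
        have "\<nu> \<notin> domw ?m (psum \<kappa>)"
        proof
          assume "\<nu> \<in> domw ?m (psum \<kappa>)"
          then have "\<mu> \<in> domw ?m (psum \<kappa>)" using dm unfolding domw_def by (auto intro: le_trans)
          then show False using \<mu> by simp
        qed
        then have "\<nu> \<le> \<mu>" using \<mu>(4) \<nu> n by (auto simp: K_def)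
        moreover have "\<mu> \<le> \<nu>" using dm by (intro dominated_imp_le) (auto simp: domw_def)
        ultimately show False using n by simp
      qed
    qed
    also have "\<dots> = d \<mu> * sphc TYPE('m) \<mu> \<mu>" using \<mu> by (simp add: finite_parts)
    finally have "lookup p \<mu> \<noteq> 0" using coef[of \<mu>] \<mu> sphc(2)[OF \<mu>(1)] by (auto simp: parts_def)
    then show False using dom \<mu> by blast
  qed
  have "lookup p \<kappa> \<noteq> 0" using zs by (auto simp: zonal_shape_def in_keys_iff)
  obtain \<rho> where \<rho>0: "\<And>x. inj_on x {..<?m} \<Longrightarrow> zonal_operator ?m (eval_poly p) x = \<rho> * eval_poly p x"
    using zs by (auto simp: zonal_shape_def)
  have eig: "zonal_operator ?m (\<lambda>x. \<Sum>\<alpha>\<in>Mon ?m k. lookup p \<alpha> * mono_eval \<alpha> x) x = \<rho> * (\<Sum>\<alpha>\<in>Mon ?m k. lookup p \<alpha> * mono_eval \<alpha> x)"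
    if "inj_on x {..<?m}" for x
  proof -
    have "eval_poly p = (\<lambda>x. \<Sum>\<alpha>\<in>Mon ?m k. lookup p \<alpha> * mono_eval \<alpha> x)" using ev by (intro ext)
    with \<rho>0[OF that] show ?thesis by (simp only:)
  qed
  have \<rho>: "\<rho> = zonal_eigenvalue ?m \<kappa>"
    using \<kappa> \<open>lookup p \<kappa> \<noteq> 0\<close> dom eig by (intro zonal_eigenvalue_unique[where c = "lookup p" and k = k]) (auto simp: parts_def)
  have "d \<nu> = 0" if \<nu>: "\<nu> \<in> ?P" "\<nu> \<noteq> \<kappa>" for \<nu>
  proof (rule ccontr)
    assume "d \<nu> \<noteq> 0"
    then have less: "zonal_eigenvalue ?m \<nu> < zonal_eigenvalue ?m \<kappa>"
      using zonal_eigenvalue_less[OF \<nu>(1) \<kappa> domd \<nu>(2)] \<nu> by blast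
    have inj: "inj_on (\<lambda>i. 1 + real i) {..<?m}" by (auto simp: inj_on_def)
    define E where "E = (\<lambda>x. \<Sum>\<alpha>\<in>Mon ?m k. lookup p \<alpha> * mono_eval \<alpha> x)"
    have E: "E = (\<lambda>x. \<Sum>\<nu>\<in>?P. d \<nu> * sph TYPE('m) \<nu> x)" using d ev by (auto simp: E_def)
    define z where "z \<mu> = d \<mu> * (zonal_eigenvalue ?m \<mu> - \<rho>)" for \<mu>
    have zz: "(\<Sum>\<mu>\<in>?P. z \<mu> * sph TYPE('m) \<mu> x) = 0" if inj: "inj_on x {..<?m}" for x
    proof -
      have "zonal_operator ?m E x = (\<Sum>\<mu>\<in>?P. d \<mu> * zonal_operator ?m (sph TYPE('m) \<mu>) x)"
        unfolding E by (rule zonal_operator_sum) (rule homp_sph)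
      also have "\<dots> = (\<Sum>\<mu>\<in>?P. d \<mu> * (zonal_eigenvalue ?m \<mu> * sph TYPE('m) \<mu> x))"
        by (intro sum.cong refl) (simp add: zonal_eigenvalue_sph[OF _ inj])
      finally have "(\<Sum>\<mu>\<in>?P. d \<mu> * (zonal_eigenvalue ?m \<mu> * sph TYPE('m) \<mu> x)) = \<rho> * (\<Sum>\<mu>\<in>?P. d \<mu> * sph TYPE('m) \<mu> x)"
        using eig[OF inj] fun_cong[OF E, of x] unfolding E_def by (simp only:)
      then show ?thesis
        by (simp add: z_def left_diff_distrib right_diff_distrib sum_subtractf sum_distrib_left mult_ac)
    qed
    have "z \<nu> = 0"
    proof (rule sph_independent[OF _ \<nu>(1)])
      fix x :: "nat \<Rightarrow> real"
      define f where "f x = (\<Sum>\<mu>\<in>?P. z \<mu> * sph TYPE('m) \<mu> x)" for x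
      \<comment> \<open>A polynomial vanishing off the hyperplanes \<open>x\<^sub>i = x\<^sub>j\<close> vanishes.\<close>
      have "homp ?m k f" unfolding f_def by (intro homp_sum homp_cmult homp_sph)
      then obtain c where c: "\<And>x. f x = (\<Sum>\<alpha>\<in>Mon ?m k. c \<alpha> * mono_eval \<alpha> x)" by (auto simp: homp_def)
      \<comment> \<open>Two coordinates of \<open>y s\<close> coincide for finitely many
        \<open>s\<close> only, so the points off the hyperplanes accumulate at
        \<open>x\<close>.\<close>
      define y where "y s i = x i + s * real i" for s i
      have "continuous_on UNIV (\<lambda>s. f (y s))"
        unfolding c mono_eval_def y_def by (intro continuous_intros)
      then have "((\<lambda>s. f (y s)) \<longlongrightarrow> f (y 0)) (at_right 0)"
        by (metis UNIV_I continuous_on_eq_continuous_at filterlim_at_split isCont_def open_UNIV)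
      moreover have "\<forall>\<^sub>F s in at_right 0. f (y s) = 0"
      proof -
        define Z where "Z = (\<lambda>(i, j). (x j - x i) / (real i - real j)) ` ({..<?m} \<times> {..<?m})"
        have fin: "finite Z" by (simp add: Z_def)
        have "f (y s) = 0" if "s \<notin> Z" for s
        proof -
          have "inj_on (y s) {..<?m}"
          proof (rule inj_onI, rule ccontr)
            fix i j assume ij: "i \<in> {..<?m}" "j \<in> {..<?m}" "y s i = y s j" "i \<noteq> j"
            then have "s * (real i - real j) = x j - x i" by (simp add: y_def algebra_simps)
            then have "s = (x j - x i) / (real i - real j)" using ij by (simp add: field_simps)
            then show False using that ij by (auto simp: Z_def)
          qed
          then show ?thesis using zz by (simp add: f_def)
        qed
        moreover have "\<forall>\<^sub>F s in at_right 0. s \<notin> Z"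
        proof -
          have "\<not> 0 islimpt Z" using fin by (rule islimpt_finite)
          then have "\<forall>\<^sub>F s in at 0. s \<notin> Z" by (simp add: islimpt_iff_eventually)
          then show ?thesis by (rule filter_leD[OF at_le, rotated]) simp
        qed
        ultimately show ?thesis by (auto elim: eventually_mono)
      qed
      then have "((\<lambda>s. f (y s)) \<longlongrightarrow> 0) (at_right 0)" by (rule tendsto_eventually)
      ultimately have "f (y 0) = 0" by (rule tendsto_unique[OF trivial_limit_at_right_real])
      moreover have "y 0 = x" by (simp add: y_def fun_eq_iff)
      ultimately show "(\<Sum>\<mu>\<in>?P. z \<mu> * sph TYPE('m) \<mu> x) = 0" by (simp add: f_def)
    qed
    then show False using \<open>d \<nu> \<noteq> 0\<close> less \<rho> by (simp add: z_def)
  qed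
  then have "eval_poly p x = d \<kappa> * sph TYPE('m) \<kappa> x" for x
    unfolding d using \<kappa> by (subst sum.mono_neutral_right[of ?P "{\<kappa>}"]) (auto simp: finite_parts)
  then show ?thesis by blast
qed

lemma poly_mapping_of_coefficients:
  "\<exists>p :: mpolynomial. \<forall>\<alpha>. lookup p \<alpha> = (if \<alpha> \<in> Mon m k then c \<alpha> else 0)"
proof -
  have "lookup (\<Sum>\<beta>\<in>Mon m k. Poly_Mapping.single \<beta> (c \<beta>)) \<alpha> = (if \<alpha> \<in> Mon m k then c \<alpha> else 0)" for \<alpha>
    by (simp add: lookup_sum lookup_single when_def finite_Mon)
  then show ?thesis by blast
qed

text \<open>The family with coefficients \<open>gam\<close> times \<open>sphc\<close> satisfies all
  conditions, the normalisation being \<open>power_sum_gam\<close>. Any other family consists of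
  multiples of the spherical polynomials, and the normalisation together with their independence
  fixes the factors, so the description by \<open>THE\<close> has a unique solution.\<close>

theorem zonal_poly_eval:
  assumes \<kappa>: "\<kappa> \<in> parts CARD('m::finite) k"
  shows "eval_poly (zonal_poly CARD('m) \<kappa>) x = gam TYPE('m) \<kappa> * sph TYPE('m) \<kappa> x"
proof -
  let ?m = "CARD('m)" and ?g = "gam TYPE('m)"
  \<comment> \<open>The weight of \<open>\<nu>\<close> selects the degree, so that one function
    serves all \<open>k\<close> simultaneously, as \<open>zonal_family\<close> demands.\<close>
  have "\<exists>p :: mpolynomial. \<forall>\<alpha>. lookup p \<alpha> = (if \<alpha> \<in> Mon ?m (psum \<nu> ?m) then ?g \<nu> * sphc TYPE('m) \<nu> \<alpha> else 0)" for \<nu>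
    by (rule poly_mapping_of_coefficients)
  then obtain C where C: "\<And>\<nu> \<alpha>. lookup (C \<nu> :: mpolynomial) \<alpha> = (if \<alpha> \<in> Mon ?m (psum \<nu> ?m) then ?g \<nu> * sphc TYPE('m) \<nu> \<alpha> else 0)"
    by metis
  have Cl: "lookup (C \<nu>) \<alpha> = (if \<alpha> \<in> Mon ?m k then ?g \<nu> * sphc TYPE('m) \<nu> \<alpha> else 0)" if "\<nu> \<in> parts ?m k" for \<nu> \<alpha> k
    using that C[of \<nu> \<alpha>] by (auto simp: parts_def Mon_def)
  have kC: "keys (C \<nu>) \<subseteq> Mon ?m k" if "\<nu> \<in> parts ?m k" for \<nu> k
    using Cl[OF that] by (auto simp: in_keys_iff split: if_splits)
  have eC: "eval_poly (C \<nu>) x = ?g \<nu> * sph TYPE('m) \<nu> x" if \<nu>: "\<nu> \<in> parts ?m k" for \<nu> k x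
    unfolding eval_poly_Mon[OF kC[OF \<nu>]] sphc(3)[OF \<nu>] sum_distrib_left by (intro sum.cong refl) (simp add: Cl[OF \<nu>])
  have fam: "zonal_family ?m C"
    unfolding zonal_family_def partitions_eq_parts
  proof (intro conjI allI ballI)
    fix k \<nu> assume \<nu>: "\<nu> \<in> parts ?m k"
    have eC': "eval_poly (C \<nu>) = (\<lambda>x. \<Sum>_\<in>{()}. ?g \<nu> * sph TYPE('m) \<nu> x)" using eC[OF \<nu>] by auto
    show "homogeneous_symmetric ?m k (C \<nu>)"
      unfolding homogeneous_symmetric_def using kC[OF \<nu>] sum_keys_psum
      by (auto simp: Mon_def eC[OF \<nu>] sph_permute subset_iff)
    have dm: "\<alpha> \<in> domw ?m (psum \<nu>)" if "\<alpha> \<in> keys (C \<nu>)" for \<alpha>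
      using that sphc(1)[OF \<nu>, of \<alpha>] Cl[OF \<nu>, of \<alpha>] by (auto simp: in_keys_iff split: if_splits)
    have "zonal_operator ?m (eval_poly (C \<nu>)) x = zonal_eigenvalue ?m \<nu> * eval_poly (C \<nu>) x" if "inj_on x {..<?m}" for x
      unfolding eC' by (subst zonal_operator_sum[where k = k]) (auto simp: homp_sph[OF \<nu>] zonal_eigenvalue_sph[OF \<nu> that])
    moreover have "\<nu> \<in> keys (C \<nu>)"
      using Cl[OF \<nu>, of \<nu>] \<nu> gam_nonzero[OF \<nu>] sphc(2)[OF \<nu>] by (auto simp: in_keys_iff parts_def)
    moreover have "\<alpha> \<le> \<nu>" if "\<alpha> \<in> keys (C \<nu>)" for \<alpha>
      using dm[OF that] by (intro dominated_imp_le) (auto simp: domw_def)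
    moreover have "(\<Sum>i<r. lookup \<alpha> i) \<le> (\<Sum>i<r. lookup \<nu> i)" if "\<alpha> \<in> keys (C \<nu>)" for \<alpha> r
      using dm[OF that] by (auto simp: domw_def psum_def)
    ultimately show "zonal_shape ?m \<nu> (C \<nu>)" unfolding zonal_shape_def by blast
  next
    fix k x
    show "(\<Sum>\<nu>\<in>parts ?m k. eval_poly (C \<nu>) x) = (\<Sum>i<?m. x i) ^ k"
      unfolding power_sum_gam[where 'm = 'm] by (intro sum.cong refl) (simp add: eC)
  qed
  have uniq: "D \<kappa> = C \<kappa>" if D: "zonal_family ?m D" for D
  proof -
    have Dp: "homogeneous_symmetric ?m k (D \<nu>)" "zonal_shape ?m \<nu> (D \<nu>)" if "\<nu> \<in> parts ?m k" for \<nu>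
      using D that unfolding zonal_family_def partitions_eq_parts by auto
    have "\<forall>\<nu>\<in>parts ?m k. \<exists>c. \<forall>x. eval_poly (D \<nu>) x = c * sph TYPE('m) \<nu> x"
      using zonal_shape_unique Dp by blast
    then obtain c where c: "\<And>\<nu> x. \<nu> \<in> parts ?m k \<Longrightarrow> eval_poly (D \<nu>) x = c \<nu> * sph TYPE('m) \<nu> x" by metis
    have "c \<kappa> - ?g \<kappa> = 0"
    proof (rule sph_independent[OF _ \<kappa>, where d = "\<lambda>\<nu>. c \<nu> - ?g \<nu>"])
      fix x :: "nat \<Rightarrow> real"
      have "(\<Sum>\<nu>\<in>parts ?m k. c \<nu> * sph TYPE('m) \<nu> x) = (\<Sum>i<?m. x i) ^ k"
      proof -
        have "(\<Sum>\<nu>\<in>parts ?m k. eval_poly (D \<nu>) x) = (\<Sum>i<?m. x i) ^ k"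
          using D unfolding zonal_family_def partitions_eq_parts by blast
        moreover have "(\<Sum>\<nu>\<in>parts ?m k. eval_poly (D \<nu>) x) = (\<Sum>\<nu>\<in>parts ?m k. c \<nu> * sph TYPE('m) \<nu> x)"
          by (intro sum.cong refl c)
        ultimately show ?thesis by simp
      qed
      then show "(\<Sum>\<nu>\<in>parts ?m k. (c \<nu> - ?g \<nu>) * sph TYPE('m) \<nu> x) = 0"
        unfolding power_sum_gam[where 'm = 'm] by (simp add: left_diff_distrib sum_subtractf)
    qed
    then have e: "eval_poly (D \<kappa>) x = eval_poly (C \<kappa>) x" for x using c[OF \<kappa>] eC[OF \<kappa>] by simp
    have kD: "keys (D \<kappa>) \<subseteq> Mon ?m k" using homogeneous_symmetric_Mon Dp(1)[OF \<kappa>] by blast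
    show ?thesis
    proof (rule poly_mapping_eqI)
      fix \<alpha>
      show "lookup (D \<kappa>) \<alpha> = lookup (C \<kappa>) \<alpha>"
      proof (cases "\<alpha> \<in> Mon ?m k")
        case True
        have "lookup (D \<kappa>) \<alpha> - lookup (C \<kappa>) \<alpha> = 0"
        proof (rule mono_eval_independent[OF _ True, where c = "\<lambda>\<alpha>. lookup (D \<kappa>) \<alpha> - lookup (C \<kappa>) \<alpha>"])
          fix x :: "nat \<Rightarrow> real"
          show "(\<Sum>\<alpha>\<in>Mon ?m k. (lookup (D \<kappa>) \<alpha> - lookup (C \<kappa>) \<alpha>) * mono_eval \<alpha> x) = 0"
            using e[of x] unfolding eval_poly_Mon[OF kD] eval_poly_Mon[OF kC[OF \<kappa>]] left_diff_distrib sum_subtractf by simp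
        qed
        then show ?thesis by simp
      next
        case False
        then have "\<alpha> \<notin> keys (D \<kappa>)" "\<alpha> \<notin> keys (C \<kappa>)" using kD kC[OF \<kappa>] by auto
        then show ?thesis by (simp add: in_keys_iff)
      qed
    qed
  qed
  have "zonal_poly ?m \<kappa> = C \<kappa>"
    unfolding zonal_poly_def
  proof (rule the_equality)
    show "\<exists>C'. zonal_family ?m C' \<and> C \<kappa> = C' \<kappa>" using fam by blast
    show "\<And>p. \<exists>D. zonal_family ?m D \<and> p = D \<kappa> \<Longrightarrow> p = C \<kappa>" using uniq by auto
  qed
  then show ?thesis by (simp add: eC[OF \<kappa>])
qed

section \<open>Averages of products of leading minors\<close>

lemma homp_dlt_mean:
  assumes \<mu>: "has_moments (\<mu> :: (real ^ 'm ^ 'm) measure)" and \<kappa>: "\<kappa> \<in> parts CARD('m) k"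
  shows "homp CARD('m) k (\<lambda>x. \<integral>Y. dlt (lookup \<kappa>) (Y ** dg x ** transpose Y) \<partial>\<mu>)"
proof -
  let ?m = "CARD('m)"
  obtain c where c: "\<And>\<alpha>. pg (c \<alpha>)"
    "\<And>(Y :: real ^ 'm ^ 'm) x. dlt (lookup \<kappa>) (Y ** dg x ** transpose Y) = (\<Sum>\<alpha>\<in>domw ?m (psum \<kappa>). c \<alpha> Y * mono_eval \<alpha> x)"
    using dlt_expands[OF \<kappa>] unfolding expands_def by blast
  have k: "psum \<kappa> ?m = k" using \<kappa> by (auto simp: parts_def Mon_def)
  have "(\<integral>Y. dlt (lookup \<kappa>) (Y ** dg x ** transpose Y) \<partial>\<mu>) = (\<Sum>\<alpha>\<in>domw ?m (psum \<kappa>). (\<integral>Y. c \<alpha> Y \<partial>\<mu>) * mono_eval \<alpha> x)" for x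
    unfolding c(2) by (subst Bochner_Integration.integral_sum) (auto intro!: integrable_pg[OF \<mu>] pg_mult c(1))
  also have "\<dots> x = (\<Sum>\<alpha>\<in>Mon ?m k. (if \<alpha> \<in> domw ?m (psum \<kappa>) then \<integral>Y. c \<alpha> Y \<partial>\<mu> else 0) * mono_eval \<alpha> x)" for x
    by (rule sum.mono_neutral_cong_left[OF finite_Mon]) (use domw_subset[of ?m "psum \<kappa>"] k in auto)
  finally show ?thesis unfolding homp_def
    by (intro exI[of _ "\<lambda>\<alpha>. if \<alpha> \<in> domw ?m (psum \<kappa>) then \<integral>Y. c \<alpha> Y \<partial>\<mu> else 0"]) blast
qed

text \<open>As a Gram matrix the sandwich has leading minors that are products of squared distances,
  hence nonnegative.\<close>

lemma gramm_sandwich: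
  fixes Y :: "real ^ 'm ^ 'n"
  assumes "\<And>i. a i \<ge> 0"
  shows "Y ** diagm a ** transpose Y = gramm (\<lambda>i. diagm (\<lambda>j. sqrt (a j)) *v (Y $ i))"
proof (intro vec_eq_iff[THEN iffD2] allI)
  fix i j
  have "(Y ** diagm a ** transpose Y) $ i $ j = (\<Sum>k\<in>UNIV. (Y ** diagm a) $ i $ k * Y $ j $ k)"
    by (subst matrix_matrix_mult_def) (simp add: transpose_def)
  also have "\<dots> = (\<Sum>k\<in>UNIV. (sqrt (a k) * Y $ i $ k) * (sqrt (a k) * Y $ j $ k))"
  proof (intro sum.cong refl)
    fix k
    have "sqrt (a k) * sqrt (a k) = a k" using assms by simp
    then have "(sqrt (a k) * Y $ i $ k) * (sqrt (a k) * Y $ j $ k) = a k * (Y $ i $ k * Y $ j $ k)"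
      by (metis mult.assoc mult.left_commute)
    then show "(Y ** diagm a) $ i $ k * Y $ j $ k = (sqrt (a k) * Y $ i $ k) * (sqrt (a k) * Y $ j $ k)"
      by (simp only: diagm_mult_right mult_ac)
  qed
  finally show "(Y ** diagm a ** transpose Y) $ i $ j = gramm (\<lambda>i. diagm (\<lambda>j. sqrt (a j)) *v (Y $ i)) $ i $ j"
    by (simp add: gramm_def inner_vec_def diagm_mult_vec)
qed

lemma gramm_rows: "Y ** transpose Y = gramm (($) Y)" for Y :: "real ^ 'm ^ 'n"
  using gramm_sandwich[of "\<lambda>_. 1" Y] by (simp add: mat_eq_diagm[symmetric])

lemma pm_seg_gramm:
  fixes z :: "'n::finite \<Rightarrow> 'v::euclidean_space"
  assumes "r \<le> CARD('n)"
  shows "pm (seg r) (gramm z) = (\<Prod>i<r. (infdist (z (ix i)) (span ((\<lambda>j. z (ix j)) ` {..<i})))\<^sup>2)"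
  using assms
proof (induction r)
  case (Suc r)
  have "seg r = (ix ` {..<r} :: 'n set)"
    using Suc.prems by (force simp: seg_def image_iff intro: ix_rk[symmetric])
  then have "(\<lambda>j. z (ix j)) ` {..<r} = z ` seg r" by auto
  then show ?case using Suc by (simp add: seg_Suc pm_gramm_insert ix_notin_seg)
qed simp

lemma pm_gramm_nonneg:
  fixes z :: "'n::finite \<Rightarrow> 'v::euclidean_space"
  shows "r \<le> CARD('n) \<Longrightarrow> pm (seg r) (gramm z) \<ge> 0"
  unfolding pm_seg_gramm by (intro prod_nonneg) auto

lemma dlt_gramm_nonneg: "dlt \<kappa> (gramm z) \<ge> 0" for z :: "'n::finite \<Rightarrow> 'v::euclidean_space"
  unfolding dlt_def by (intro prod_nonneg zero_le_power pm_gramm_nonneg ballI) auto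

lemma sph_one_pos: "sph TYPE('m::finite) \<kappa> (\<lambda>_. 1) > 0"
proof -
  have "(\<integral>Y. dlt (lookup \<kappa>) (Y ** mat 1 ** transpose Y) \<partial>(gaussM :: (real ^ 'm ^ 'm) measure)) > 0"
  proof (rule integral_gaussM_pos[where a = "mat 1"])
    have "trunc I (mat 1 :: real ^ 'm ^ 'm) = mat 1" for I by (auto simp: trunc_def mat_def vec_eq_iff)
    then show "dlt (lookup \<kappa>) ((mat 1 :: real ^ 'm ^ 'm) ** mat 1 ** transpose (mat 1)) > 0" by (simp add: dlt_def pm_def)
  qed (rule pg_vh, simp add: gramm_rows dlt_gramm_nonneg)
  then show ?thesis by (simp add: sph_eq_mean mat_eq_diagm[symmetric])
qed

text \<open>Let \<open>f C\<close> be the mean over \<open>\<mu>\<close> of the power function of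
  \<open>X ** C ** transpose X\<close>; it is invariant and has an expansion with unknown
  coefficients \<open>\<phi>\<close>. Its mean over \<open>C = Y ** dg a ** transpose Y\<close> with
  Gaussian \<open>Y\<close> is computed by this expansion and also by exchanging the integrals, and
  the comparison leaves only the term of \<open>\<kappa>\<close>.\<close>

theorem dlt_mean_proportional:
  fixes \<mu> :: "(real ^ 'm ^ 'm) measure"
  assumes \<mu>: "has_moments \<mu>" and inv: "\<And>U. orthogonal_matrix U \<Longrightarrow> distr \<mu> borel (\<lambda>Y. Y ** U) = \<mu>"
    and \<kappa>: "\<kappa> \<in> parts CARD('m) k"
  shows "(\<integral>Y. dlt (lookup \<kappa>) (Y ** dg a ** transpose Y) \<partial>\<mu>) * sph TYPE('m) \<kappa> (\<lambda>_. 1)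
    = (\<integral>Y. dlt (lookup \<kappa>) (Y ** transpose Y) \<partial>\<mu>) * sph TYPE('m) \<kappa> a"
proof -
  let ?P = "parts CARD('m) k" and ?d = "dlt (lookup \<kappa>)" and ?g = "gaussM :: (real ^ 'm ^ 'm) measure"
  define f where "f C = (\<integral>X. ?d (X ** C ** transpose X) \<partial>\<mu>)" for C :: "real ^ 'm ^ 'm"
  define c where "c = (\<integral>X. ?d (X ** transpose X) \<partial>\<mu>)"
  have s: "sets \<mu> = sets borel" using \<mu> by (simp add: has_moments_def)
  have f_inv: "f (V ** C ** transpose V) = f C" if V: "orthogonal_matrix V" for V C
  proof -
    have m: "(\<lambda>Y. Y ** V) \<in> \<mu> \<rightarrow>\<^sub>M borel"
      using linear_borel_measurable[OF linear_right_mult] by (simp add: measurable_cong_sets[OF s refl])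
    have "f C = (\<integral>X. ?d (X ** C ** transpose X) \<partial>distr \<mu> borel (\<lambda>Y. Y ** V))" by (simp add: f_def inv[OF V])
    also have "\<dots> = (\<integral>Y. ?d ((Y ** V) ** C ** transpose (Y ** V)) \<partial>\<mu>)"
      by (rule integral_distr[OF m]) (intro pg_measurable pg_vh)
    finally show ?thesis by (simp add: f_def matrix_transpose_mul matrix_mul_assoc)
  qed
  have "\<exists>\<phi>. \<forall>C. transpose C = C \<longrightarrow> f C = (\<Sum>\<nu>\<in>?P. \<phi> \<nu> * vh (lookup \<nu>) C)"
  proof (rule invariant_expansion)
    show "f (transpose U ** C ** U) = f C" if "orthogonal_matrix U" for U C
      using f_inv[of "transpose U"] that by simp
    show "homp CARD('m) k (\<lambda>x. f (dg x))" unfolding f_def by (rule homp_dlt_mean[OF \<mu> \<kappa>])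
    show "f (diagm (\<lambda>i. x (\<pi> (rk i)))) = f (dg x)" if \<pi>: "\<pi> permutes {..<CARD('m)}" for \<pi> x
    proof -
      obtain U :: "real ^ 'm ^ 'm" where U: "orthogonal_matrix U"
        "\<And>x. diagm (\<lambda>i. x (\<pi> (rk i))) = U ** diagm (\<lambda>i. x (rk i)) ** transpose U"
        using permute_diagm[OF \<pi>] by blast
      then show ?thesis by (simp add: f_inv)
    qed
  qed
  then obtain \<phi> where \<phi>: "\<And>C. transpose C = C \<Longrightarrow> f C = (\<Sum>\<nu>\<in>?P. \<phi> \<nu> * vh (lookup \<nu>) C)" by blast
  \<comment> \<open>On the left every term carries its value at the identity, from
    \<open>expansion_mean\<close> with \<open>b = 1\<close>; on the right
    \<open>dlt_conj_mean\<close> extracts the spherical polynomial of \<open>\<kappa>\<close>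
    alone.\<close>
  have E: "(\<Sum>\<nu>\<in>?P. \<phi> \<nu> * sph TYPE('m) \<nu> (\<lambda>_. 1) * sph TYPE('m) \<nu> a) = c * sph TYPE('m) \<kappa> a" for a
  proof -
    have "(\<integral>Y. f (diagm (\<lambda>i. sqrt 1) ** (Y ** dg a ** transpose Y) ** diagm (\<lambda>i. sqrt 1)) \<partial>?g)
      = (\<Sum>\<nu>\<in>?P. \<phi> \<nu> * vh (lookup \<nu>) (diagm (\<lambda>i::'m. 1)) * (\<integral>Y. dlt (lookup \<nu>) (Y ** dg a ** transpose Y) \<partial>?g))"
      using has_moments_gaussM gaussM_left \<phi> by (rule expansion_mean[where q = lookup]) auto
    then have "(\<Sum>\<nu>\<in>?P. \<phi> \<nu> * sph TYPE('m) \<nu> (\<lambda>_. 1) * sph TYPE('m) \<nu> a) = (\<integral>Y. f (Y ** dg a ** transpose Y) \<partial>?g)"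
      by (simp add: sph_def vh_def[of _ "dg a"] mat_eq_diagm[symmetric])
    also have "\<dots> = (\<integral>Y. \<integral>X. (\<lambda>(Y, X). ?d (X ** (Y ** dg a ** transpose Y) ** transpose X)) (Y, X) \<partial>\<mu> \<partial>?g)"
      by (simp add: f_def)
    also have "\<dots> = (\<integral>X. \<integral>Y. (\<lambda>(Y, X). ?d (X ** (Y ** dg a ** transpose Y) ** transpose X)) (Y, X) \<partial>?g \<partial>\<mu>)"
      unfolding split_beta
      by (rule pg_Fubini[OF has_moments_gaussM \<mu>])
        (intro pg_dlt pg_matrix_mult pg_transpose pg_fst_entry pg_snd_entry pg_const)
    also have "\<dots> = (\<integral>X. ?d (X ** transpose X) * sph TYPE('m) \<kappa> a \<partial>\<mu>)"
    proof (intro Bochner_Integration.integral_cong refl)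
      fix X :: "real ^ 'm ^ 'm"
      have *: "(\<integral>Z. g Z \<partial>sandwich_law ?g (dg a)) = (\<integral>Y. g (Y ** dg a ** transpose Y) \<partial>?g)"
        if "g \<in> borel_measurable borel" for g :: "real ^ 'm ^ 'm \<Rightarrow> real"
        using has_moments_gaussM gaussM_left that by (rule sandwich_law(3))
      have h: "has_moments (sandwich_law ?g (dg a))" using has_moments_gaussM gaussM_left by (rule sandwich_law(1))
      have o: "oinv (sandwich_law ?g (dg a))" using has_moments_gaussM gaussM_left by (rule sandwich_law(2))
      have "(\<integral>Y. ?d (X ** (Y ** dg a ** transpose Y) ** transpose X) \<partial>?g) = (\<integral>Z. ?d (X ** Z ** transpose X) \<partial>sandwich_law ?g (dg a))"
        by (rule *[symmetric]) (intro pg_measurable pg_dlt pg_matrix_mult pg_transpose pg_entry pg_const)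
      also have "\<dots> = ?d (X ** transpose X) * (\<integral>Z. ?d Z \<partial>sandwich_law ?g (dg a))" by (rule dlt_conj_mean[OF o h])
      also have "(\<integral>Z. ?d Z \<partial>sandwich_law ?g (dg a)) = sph TYPE('m) \<kappa> a"
        unfolding sph_eq_mean by (rule *) (intro pg_measurable pg_dlt pg_entry)
      finally show "(\<integral>Y. (\<lambda>(Y, X). ?d (X ** (Y ** dg a ** transpose Y) ** transpose X)) (Y, X) \<partial>?g) = ?d (X ** transpose X) * sph TYPE('m) \<kappa> a"
        by simp
    qed
    finally show ?thesis by (simp add: c_def)
  qed
  define \<delta> where "\<delta> \<nu> = \<phi> \<nu> * sph TYPE('m) \<nu> (\<lambda>_. 1) - (if \<nu> = \<kappa> then c else 0)" for \<nu>
  have \<delta>: "\<delta> \<nu> = 0" if "\<nu> \<in> ?P" for \<nu>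
  proof (rule sph_independent[OF _ that])
    fix x :: "nat \<Rightarrow> real"
    have "(\<Sum>\<nu>\<in>?P. (if \<nu> = \<kappa> then c else 0) * sph TYPE('m) \<nu> x) = (\<Sum>\<nu>\<in>?P. if \<nu> = \<kappa> then c * sph TYPE('m) \<kappa> x else 0)"
      by (intro sum.cong) auto
    also have "\<dots> = c * sph TYPE('m) \<kappa> x" using \<kappa> by (simp add: finite_parts)
    finally show "(\<Sum>\<nu>\<in>?P. \<delta> \<nu> * sph TYPE('m) \<nu> x) = 0"
      using E[of x] unfolding \<delta>_def left_diff_distrib sum_subtractf by simp
  qed
  have "\<phi> \<nu> = (if \<nu> = \<kappa> then c / sph TYPE('m) \<kappa> (\<lambda>_. 1) else 0)" if "\<nu> \<in> ?P" for \<nu>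
    using \<delta>[OF that] sph_one_pos[of \<nu>, where 'm = 'm] by (auto simp: \<delta>_def field_simps split: if_splits)
  then have "(\<Sum>\<nu>\<in>?P. \<phi> \<nu> * vh (lookup \<nu>) (dg a :: real ^ 'm ^ 'm)) = (\<Sum>\<nu>\<in>?P. if \<nu> = \<kappa> then c / sph TYPE('m) \<kappa> (\<lambda>_. 1) * sph TYPE('m) \<kappa> a else 0)"
    by (intro sum.cong) (auto simp: sph_def)
  also have "\<dots> = c / sph TYPE('m) \<kappa> (\<lambda>_. 1) * sph TYPE('m) \<kappa> a" using \<kappa> by (simp add: finite_parts)
  finally have "f (dg a) = c / sph TYPE('m) \<kappa> (\<lambda>_. 1) * sph TYPE('m) \<kappa> a" using \<phi>[of "dg a"] by simp
  then show ?thesis using sph_one_pos[of \<kappa>, where 'm = 'm] by (simp add: f_def c_def)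
qed

section \<open>Rectangular matrices, padded by zero rows\<close>

definition padm :: "real ^ 'm ^ 'n \<Rightarrow> real ^ 'm ^ 'm" where
  "padm Z = (\<chi> i. if rk i < CARD('n) then Z $ ix (rk i) else 0)"

lemma linear_padm: "linear (padm :: real ^ 'm ^ 'n \<Rightarrow> _)"
  by (rule linearI) (auto simp: padm_def vec_eq_iff)

lemma padm_mult: "padm Z ** U = padm (Z ** U)"
  by (simp add: padm_def vec_eq_iff matrix_matrix_mult_def)

lemma norm_padm_le: "norm (padm Z) \<le> norm Z" if "CARD('n) \<le> CARD('m)" for Z :: "real ^ 'm ^ 'n"
proof (rule power2_le_imp_le)
  have "(norm (padm Z))\<^sup>2 = (\<Sum>i<CARD('m). (norm (padm Z $ ix i))\<^sup>2)"
    unfolding power2_norm_eq_inner by (subst inner_vec_def) (simp add: sum_ix)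
  also have "\<dots> = (\<Sum>i<CARD('n). (norm (Z $ ix i))\<^sup>2)"
    using that by (intro sum.mono_neutral_cong_right) (auto simp: padm_def)
  also have "\<dots> = (norm Z)\<^sup>2" unfolding power2_norm_eq_inner by (subst inner_vec_def) (simp add: sum_ix)
  finally show "(norm (padm Z))\<^sup>2 \<le> (norm Z)\<^sup>2" by simp
qed simp

text \<open>\<open>\<kappa>\<close> has at most \<open>CARD('n)\<close> parts, so the minors that
  involve the zero rows have exponent \<open>0\<close>; the smaller minors agree because the rows
  are copied in the order of \<open>rk\<close>.\<close>

lemma dlt_padm:
  fixes Z :: "real ^ 'm ^ 'n"
  assumes nm: "CARD('n) \<le> CARD('m)" and \<kappa>: "\<kappa> \<in> parts CARD('n) k" and a: "\<And>i. a i \<ge> 0"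
  shows "dlt (lookup \<kappa>) (padm Z ** diagm a ** transpose (padm Z)) = dlt (lookup \<kappa>) (Z ** diagm a ** transpose Z)"
proof -
  let ?S = "diagm (\<lambda>j. sqrt (a j))"
  have "pm (seg (Suc r) :: 'm set) (padm Z ** diagm a ** transpose (padm Z)) = pm (seg (Suc r) :: 'n set) (Z ** diagm a ** transpose Z)"
    if r: "r < CARD('n)" for r
  proof -
    have e: "?S *v padm Z $ ix i = ?S *v Z $ ix i" if "i \<le> r" for i using that r nm by (simp add: padm_def)
    have "(\<lambda>j. ?S *v padm Z $ ix j) ` {..<i} = (\<lambda>j. ?S *v Z $ ix j) ` {..<i}" if "i \<le> r" for i
      using that by (intro image_cong refl e) auto
    then show ?thesis using r nm unfolding gramm_sandwich[OF a]
      by (subst (1 2) pm_seg_gramm) (auto intro!: prod.cong simp: e less_Suc_eq_le)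
  qed
  moreover have "lookup \<kappa> r - lookup \<kappa> (Suc r) = 0" if "r \<ge> CARD('n)" for r
    using parts_zero_beyond[OF \<kappa>, of r] that by simp
  ultimately show ?thesis unfolding dlt_def using nm
    by (intro prod.mono_neutral_cong_right) auto
qed

lemma parts_mono: "n \<le> m \<Longrightarrow> \<kappa> \<in> parts n k \<Longrightarrow> \<kappa> \<in> parts m k"
  using psum_ge[of \<kappa> n m] by (force simp: parts_def Mon_def)

corollary dlt_mean_proportional_rect:
  fixes \<mu> :: "(real ^ 'm ^ 'n) measure"
  assumes nm: "CARD('n) \<le> CARD('m)"
    and \<mu>: "has_moments \<mu>" and inv: "\<And>U. orthogonal_matrix U \<Longrightarrow> distr \<mu> borel (\<lambda>Y. Y ** U) = \<mu>"
    and \<kappa>: "\<kappa> \<in> parts CARD('n) k" and a: "\<And>i. a i \<ge> 0"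
  shows "(\<integral>Y. dlt (lookup \<kappa>) (Y ** dg a ** transpose Y) \<partial>\<mu>) * sph TYPE('m) \<kappa> (\<lambda>_. 1)
    = (\<integral>Y. dlt (lookup \<kappa>) (Y ** transpose Y) \<partial>\<mu>) * sph TYPE('m) \<kappa> a"
proof -
  have s: "sets \<mu> = sets borel" using \<mu> by (simp add: has_moments_def)
  have m: "padm \<in> \<mu> \<rightarrow>\<^sub>M borel"
    using linear_borel_measurable[OF linear_padm] by (simp add: measurable_cong_sets[OF s refl])
  have int: "(\<integral>Y. dlt (lookup \<kappa>) (Y ** diagm d ** transpose Y) \<partial>distr \<mu> borel padm)
    = (\<integral>Y. dlt (lookup \<kappa>) (Y ** diagm d ** transpose Y) \<partial>\<mu>)" if "\<And>i. d i \<ge> 0" for d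
    by (subst integral_distr[OF m]) (auto simp: dlt_padm[OF nm \<kappa> that] intro: pg_measurable pg_vh)
  have "(\<integral>Y. dlt (lookup \<kappa>) (Y ** dg a ** transpose Y) \<partial>distr \<mu> borel padm) * sph TYPE('m) \<kappa> (\<lambda>_. 1)
    = (\<integral>Y. dlt (lookup \<kappa>) (Y ** transpose Y) \<partial>distr \<mu> borel padm) * sph TYPE('m) \<kappa> a"
  proof (rule dlt_mean_proportional)
    show "has_moments (distr \<mu> borel padm)"
    proof (rule has_moments_distr[OF \<mu>])
      show "continuous_on UNIV (padm :: real ^ 'm ^ 'n \<Rightarrow> _)"
        using linear_padm by (metis linear_continuous_on linear_conv_bounded_linear)
      show "norm (padm Y) \<le> 1 * (1 + norm Y) ^ 1" for Y :: "real ^ 'm ^ 'n" using norm_padm_le[OF nm, of Y] by simp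
    qed
    show "\<kappa> \<in> parts CARD('m) k" using nm \<kappa> by (rule parts_mono)
    fix U :: "real ^ 'm ^ 'm" assume U: "orthogonal_matrix U"
    have m1: "(\<lambda>Y :: real ^ 'm ^ 'n. Y ** U) \<in> \<mu> \<rightarrow>\<^sub>M borel"
      using linear_borel_measurable[OF linear_right_mult] by (simp add: measurable_cong_sets[OF s refl])
    have "distr (distr \<mu> borel padm) borel (\<lambda>Y. Y ** U) = distr \<mu> borel ((\<lambda>Y. Y ** U) \<circ> padm)"
      by (rule distr_distr[OF linear_borel_measurable[OF linear_right_mult] m])
    also have "(\<lambda>Y. Y ** U) \<circ> padm = padm \<circ> (\<lambda>Y :: real ^ 'm ^ 'n. Y ** U)" by (auto simp: padm_mult)
    also have "distr \<mu> borel \<dots> = distr (distr \<mu> borel (\<lambda>Y. Y ** U)) borel padm"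
      by (rule distr_distr[symmetric, OF linear_borel_measurable[OF linear_padm] m1])
    also have "\<dots> = distr \<mu> borel padm" by (simp add: inv[OF U])
    finally show "distr (distr \<mu> borel padm) borel (\<lambda>Y. Y ** U) = distr \<mu> borel padm" .
  qed
  then show ?thesis
    using int[of "\<lambda>i. a (rk i)"] int[of "\<lambda>_. 1"] a by (simp add: mat_eq_diagm[symmetric])
qed

section \<open>Linear changes of variables\<close>

lemma nn_integral_isometry:
  fixes f :: "'a::euclidean_space \<Rightarrow> 'b::euclidean_space"
  assumes lin: "linear f" and iso: "\<And>x. norm (f x) = norm x" and dim: "DIM('a) = DIM('b)"
    and g: "g \<in> borel_measurable borel"
  shows "(\<integral>\<^sup>+x. g (f x) \<partial>lborel) = (\<integral>\<^sup>+y. g y \<partial>lborel)"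
proof -
  have m: "f \<in> lborel \<rightarrow>\<^sub>M borel" using linear_borel_measurable[OF lin] by simp
  have "(\<integral>\<^sup>+y. g y \<partial>lborel) = (\<integral>\<^sup>+y. g y \<partial>distr lborel borel f)"
    by (simp add: lborel_isometry[OF lin iso dim])
  then show ?thesis by (subst nn_integral_distr[OF m, symmetric]) (use g in auto)
qed

lemma norm_orthogonal_vec: "orthogonal_matrix U \<Longrightarrow> norm (U *v x) = norm x" for U :: "real ^ 'm ^ 'm"
  by (metis orthogonal_transformation_def orthogonal_transformation_matrix orthogonal_transformation matrix_of_matrix_vector_mul matrix_vector_mul_linear)

lemma nn_integral_orthogonal:
  fixes U :: "real ^ 'm ^ 'm"
  assumes "orthogonal_matrix U" "g \<in> borel_measurable borel"
  shows "(\<integral>\<^sup>+x. g (U *v x) \<partial>lborel) = (\<integral>\<^sup>+y. g y \<partial>lborel)"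
  by (rule nn_integral_isometry) (use assms in \<open>auto simp: norm_orthogonal_vec\<close>)

lemma nn_integral_diagm:
  fixes d :: "'m::finite \<Rightarrow> real"
  assumes d: "\<And>i. d i > 0" and g: "g \<in> borel_measurable borel"
  shows "(\<integral>\<^sup>+y. g y \<partial>lborel) = ennreal (\<Prod>i\<in>UNIV. d i) * (\<integral>\<^sup>+x. g (diagm d *v x) \<partial>lborel)"
proof -
  let ?c = "\<lambda>b. (diagm d *v b) \<bullet> b"
  have ax: "(diagm d *v axis i 1) \<bullet> axis i 1 = d i" for i by (simp add: inner_axis diagm_mult_vec)
  have eq: "(\<Sum>j\<in>Basis. (?c j * (x \<bullet> j)) *\<^sub>R j) = diagm d *v x" for x
  proof (rule vec_eq_iff[THEN iffD2], rule allI)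
    fix i
    have "(\<Sum>j\<in>Basis. (?c j * (x \<bullet> j)) *\<^sub>R j) $ i = (\<Sum>j\<in>Basis. (?c j * (x \<bullet> j)) *\<^sub>R j) \<bullet> axis i 1" by (simp add: inner_axis)
    also have "\<dots> = ?c (axis i 1) * (x \<bullet> axis i 1)" by (rule inner_sum_left_Basis) (simp add: axis_in_Basis_iff)
    finally show "(\<Sum>j\<in>Basis. (?c j * (x \<bullet> j)) *\<^sub>R j) $ i = (diagm d *v x) $ i"
      by (simp add: ax inner_axis diagm_mult_vec)
  qed
  have B: "Basis = range (\<lambda>i::'m. axis i (1::real))" by (auto simp: Basis_vec_def)
  have "inj (\<lambda>i::'m. axis i (1::real))" by (auto simp: inj_on_def axis_eq_axis)
  then have "(\<Prod>j\<in>Basis. \<bar>?c j\<bar>) = (\<Prod>i\<in>UNIV. \<bar>d i\<bar>)" unfolding B by (subst prod.reindex) (auto simp: ax)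
  then have p: "(\<Prod>j\<in>Basis. \<bar>?c j\<bar>) = (\<Prod>i\<in>UNIV. d i)" using d by (simp add: abs_of_pos)
  have c: "?c j \<noteq> 0" if "j \<in> Basis" for j
    using that d unfolding B by (force simp: ax dest: less_imp_neq)
  have m: "(\<lambda>x. diagm d *v x) \<in> lborel \<rightarrow>\<^sub>M borel" using linear_borel_measurable[OF matrix_vector_mul_linear] by simp
  have "(lborel :: (real ^ 'm) measure) = density (distr lborel borel (\<lambda>x. diagm d *v x)) (\<lambda>_. \<Prod>i\<in>UNIV. d i)"
    using lborel_affine_euclidean[of ?c 0, OF c] by (simp add: eq p)
  then have "(\<integral>\<^sup>+y. g y \<partial>lborel) = (\<integral>\<^sup>+y. g y \<partial>density (distr lborel borel (\<lambda>x. diagm d *v x)) (\<lambda>_. \<Prod>i\<in>UNIV. d i))"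
    by (rule arg_cong)
  also have "\<dots> = (\<integral>\<^sup>+y. ennreal (\<Prod>i\<in>UNIV. d i) * g y \<partial>distr lborel borel (\<lambda>x. diagm d *v x))"
    using g by (subst nn_integral_density) auto
  also have "\<dots> = ennreal (\<Prod>i\<in>UNIV. d i) * (\<integral>\<^sup>+y. g y \<partial>distr lborel borel (\<lambda>x. diagm d *v x))"
    using g by (intro nn_integral_cmult) auto
  also have "(\<integral>\<^sup>+y. g y \<partial>distr lborel borel (\<lambda>x. diagm d *v x)) = (\<integral>\<^sup>+x. g (diagm d *v x) \<partial>lborel)"
    by (rule nn_integral_distr[OF m]) (use g in auto)
  finally show ?thesis .
qed

section \<open>Integrals over a ball\<close>

text \<open>The squared distance to the subspace on which the coordinates in \<open>A\<close>
  vanish.\<close>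

definition rho :: "'m set \<Rightarrow> real ^ 'm \<Rightarrow> real" where "rho A u = (\<Sum>i\<in>A. (u $ i)\<^sup>2)"

lemma rho_nonneg [simp]: "rho A u \<ge> 0" unfolding rho_def by (intro sum_nonneg) auto

lemma norm_rho: "(norm u)\<^sup>2 = rho A u + rho (- A) u" for u :: "real ^ 'm"
proof -
  have "(norm u)\<^sup>2 = rho UNIV u" unfolding power2_norm_eq_inner by (simp add: inner_vec_def rho_def power2_eq_square)
  also have "UNIV = A \<union> - A" by blast
  also have "rho (A \<union> - A) u = rho A u + rho (- A) u" unfolding rho_def by (rule sum.union_disjoint) auto
  finally show ?thesis .
qed

lemma rho_measurable [measurable]: "rho A \<in> borel_measurable borel"
  unfolding rho_def by (intro borel_measurable_continuous_onI continuous_intros)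

lemma AE_rho_pos: "A \<noteq> {} \<Longrightarrow> AE u :: real ^ 'm in lborel. rho A u > 0"
proof -
  assume "A \<noteq> {}"
  then obtain i where i: "i \<in> A" by blast
  have "axis i (1::real) \<in> Basis" by (simp add: axis_in_Basis_iff)
  then have "AE u :: real ^ 'm in lborel. u \<bullet> axis i 1 \<noteq> 0" by (rule AE_lborel_inner_neq)
  then show ?thesis
  proof (rule AE_mp, intro AE_I2 impI)
    fix u :: "real ^ 'm" assume "u \<bullet> axis i 1 \<noteq> 0"
    then have "0 < (u $ i)\<^sup>2" by (simp add: inner_axis)
    also have "\<dots> \<le> rho A u" unfolding rho_def by (rule member_le_sum) (use i in auto)
    finally show "rho A u > 0" .
  qed
qed

lemma nn_integral_exp_tail:
  assumes "s > 0"
  shows "(\<integral>\<^sup>+c. ennreal (exp (- c * s)) * indicator {1..} c \<partial>lborel) = ennreal (exp (- s) / s)"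
proof -
  have "((\<lambda>c. - exp (- c * s) / s) \<longlongrightarrow> - 0 / s) at_top"
    using assms by (intro tendsto_intros) (real_asymp | simp)+
  then have "(\<integral>\<^sup>+c. ennreal (exp (- c * s)) * indicator {1..} c \<partial>lborel) = ennreal (0 - (- exp (- 1 * s) / s))"
    using assms by (intro nn_integral_FTC_atLeast[where F = "\<lambda>c. - exp (- c * s) / s"])
      (auto intro!: derivative_eq_intros simp: field_simps)
  then show ?thesis by simp
qed

lemma nn_integral_powr_tail:
  assumes "s > 0"
  shows "(\<integral>\<^sup>+c. ennreal (c powr (- s - 1)) * indicator {1..} c \<partial>lborel) = ennreal (1 / s)"
proof -
  have "((\<lambda>c. - (c powr (- s)) / s) \<longlongrightarrow> - 0 / s) at_top"
    using assms by (intro tendsto_intros tendsto_neg_powr) (auto intro: filterlim_ident)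
  then have "(\<integral>\<^sup>+c. ennreal (c powr (- s - 1)) * indicator {1..} c \<partial>lborel) = ennreal (0 - (- (1 powr (- s)) / s))"
    using assms by (intro nn_integral_FTC_atLeast[where F = "\<lambda>c. - (c powr (- s)) / s"])
      (auto intro!: derivative_eq_intros simp: field_simps)
  then show ?thesis by simp
qed

text \<open>Integrating the scaling relation in \<open>c\<close> over \<open>[1, \<infinity>)\<close> turns \<open>exp (- c \<rho>)\<close> into \<open>exp (- \<rho>) / \<rho>\<close>,
  which gives the recursion in \<open>q\<close>.\<close>

lemma nn_integral_rho_exp:
  fixes A :: "'m::finite set"
  assumes A: "A \<noteq> {}"
  shows "(\<integral>\<^sup>+u. (if rho A u > 0 then ennreal (rho A u ^ q * exp (- (norm u)\<^sup>2)) else 0) \<partial>lborel)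
    = ennreal (sqrt pi ^ CARD('m) * pochhammer (real (card A) / 2) q)"
proof (induction q)
  case 0
  have "(\<integral>\<^sup>+u. (if rho A u > 0 then ennreal (rho A u ^ 0 * exp (- (norm u)\<^sup>2)) else 0) \<partial>lborel)
    = (\<integral>\<^sup>+u. ennreal (exp (- (norm u)\<^sup>2 / (2 * (1 / sqrt 2)\<^sup>2))) \<partial>(lborel :: (real ^ 'm) measure))"
    by (rule nn_integral_cong_AE) (use AE_rho_pos[OF A] in \<open>auto simp: power_divide elim!: AE_mp\<close>)
  also have "\<dots> = ennreal ((sqrt (2 * pi) * (1 / sqrt 2)) ^ CARD('m))" by (subst nn_integral_exp_norm) auto
  finally show ?case by (simp add: real_sqrt_mult)
next
  case (Suc q)
  let ?K = "\<lambda>q. (\<integral>\<^sup>+u. (if rho A u > 0 then ennreal (rho A u ^ q * exp (- (norm u)\<^sup>2)) else 0) \<partial>lborel)"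
  \<comment> \<open>Scaling the coordinates in \<open>A\<close> by \<open>1 / sqrt c\<close>
    produces the power \<open>c powr (- s - 1)\<close>, whose integral over
    \<open>[1, \<infinity>)\<close> is \<open>1 / s\<close>; so \<open>s\<close> is the next factor
    of the Pochhammer symbol.\<close>
  define s where "s = real (card A) / 2 + real q"
  have s: "s > 0" using A by (simp add: s_def card_gt_0_iff add_pos_nonneg)
  define g where "g c u = (if rho A u > 0 then ennreal (rho A u ^ Suc q * exp (- (c * rho A u + rho (- A) u))) else 0)" for c and u :: "real ^ 'm"
  have gm: "(\<lambda>(c, u). g c u) \<in> borel_measurable (borel \<Otimes>\<^sub>M borel)" unfolding g_def by measurable
  have gm1: "g c \<in> borel_measurable borel" for c unfolding g_def by measurable
  have scale: "(\<integral>\<^sup>+u. g c u \<partial>lborel) = ennreal (c powr (- s - 1)) * ?K (Suc q)" if c: "c > 0" for c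
  proof -
    define d where "d i = (if i \<in> A then 1 / sqrt c else 1)" for i
    have d: "d i > 0" for i using c by (simp add: d_def)
    have "(\<Prod>i\<in>UNIV. d i) = (1 / sqrt c) ^ card A" unfolding d_def by (simp add: prod.If_cases)
    also have "\<dots> = c powr (- real (card A) / 2)"
      using c by (simp add: powr_half_sqrt[symmetric] powr_powr powr_realpow[symmetric] powr_minus_divide[symmetric] field_simps)
    finally have p: "(\<Prod>i\<in>UNIV. d i) = c powr (- real (card A) / 2)" .
    have rA: "rho A (diagm d *v u) = rho A u / c" for u
      unfolding rho_def diagm_mult_vec sum_divide_distrib by (intro sum.cong) (use c in \<open>auto simp: d_def power_mult_distrib power_divide\<close>)
    have rB: "rho (- A) (diagm d *v u) = rho (- A) u" for u
      unfolding rho_def diagm_mult_vec by (intro sum.cong) (auto simp: d_def)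
    have g: "g c (diagm d *v u) = ennreal (c powr (- real (Suc q))) * (if rho A u > 0 then ennreal (rho A u ^ Suc q * exp (- (norm u)\<^sup>2)) else 0)" for u
    proof (cases "rho A u > 0")
      case True
      have "c powr (- real (Suc q)) = 1 / c ^ Suc q"
        using c by (simp add: powr_minus_divide powr_realpow del: power_Suc of_nat_Suc)
      moreover have "c * (rho A u / c) = rho A u" using c by simp
      ultimately show ?thesis using c True unfolding g_def rA rB norm_rho[of u A]
        by (simp add: ennreal_mult''[symmetric] power_divide del: power_Suc of_nat_Suc)
    qed (use c in \<open>simp add: g_def rA zero_less_divide_iff\<close>)
    have "(\<integral>\<^sup>+u. g c u \<partial>lborel) = ennreal (c powr (- real (card A) / 2)) * (\<integral>\<^sup>+u. g c (diagm d *v u) \<partial>lborel)"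
      unfolding p[symmetric] by (rule nn_integral_diagm[OF d gm1])
    also have "(\<integral>\<^sup>+u. g c (diagm d *v u) \<partial>lborel) = ennreal (c powr (- real (Suc q))) * ?K (Suc q)"
      unfolding g by (rule nn_integral_cmult) measurable
    also have "ennreal (c powr (- real (card A) / 2)) * (ennreal (c powr (- real (Suc q))) * ?K (Suc q)) = ennreal (c powr (- s - 1)) * ?K (Suc q)"
    proof -
      have "- real (card A) / 2 + - real (Suc q) = - s - 1" by (simp add: s_def)
      then show ?thesis
        unfolding mult.assoc[symmetric] ennreal_mult[OF powr_ge_zero powr_ge_zero, symmetric] powr_add[symmetric] by (rule arg_cong)
    qed
    finally show ?thesis .
  qed
  have "?K q = (\<integral>\<^sup>+u. (\<integral>\<^sup>+c. g c u * indicator {1..} c \<partial>lborel) \<partial>lborel)"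
  proof (rule nn_integral_cong)
    fix u :: "real ^ 'm"
    show "(if rho A u > 0 then ennreal (rho A u ^ q * exp (- (norm u)\<^sup>2)) else 0) = (\<integral>\<^sup>+c. g c u * indicator {1..} c \<partial>lborel)"
    proof (cases "rho A u > 0")
      case True
      have "(\<integral>\<^sup>+c. g c u * indicator {1..} c \<partial>lborel)
        = (\<integral>\<^sup>+c. ennreal (rho A u ^ Suc q * exp (- rho (- A) u)) * (ennreal (exp (- c * rho A u)) * indicator {1..} c) \<partial>lborel)"
      proof (rule nn_integral_cong)
        fix c :: real
        have "exp (- (c * rho A u + rho (- A) u)) = exp (- rho (- A) u) * exp (- c * rho A u)"
          by (simp add: exp_add[symmetric])
        then show "g c u * indicator {1..} c = ennreal (rho A u ^ Suc q * exp (- rho (- A) u)) * (ennreal (exp (- c * rho A u)) * indicator {1..} c)"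
          using True by (simp only: g_def if_True mult.assoc[symmetric] ennreal_mult''[OF exp_ge_zero])
      qed
      also have "\<dots> = ennreal (rho A u ^ Suc q * exp (- rho (- A) u)) * ennreal (exp (- rho A u) / rho A u)"
        unfolding nn_integral_exp_tail[OF True, symmetric] by (rule nn_integral_cmult) measurable
      also have "\<dots> = ennreal (rho A u ^ q * exp (- (norm u)\<^sup>2))"
        using True unfolding norm_rho[of u A] by (simp add: ennreal_mult[symmetric] exp_add[symmetric] exp_diff exp_minus field_simps)
      finally show ?thesis using True by simp
    qed (simp add: g_def)
  qed
  also have "\<dots> = (\<integral>\<^sup>+c. (\<integral>\<^sup>+u. g c u * indicator {1..} c \<partial>lborel) \<partial>lborel)"
  proof (rule lborel_pair.Fubini')
    show "(\<lambda>(c, u :: real ^ 'm). g c u * indicator {1..} c) \<in> borel_measurable (lborel \<Otimes>\<^sub>M lborel)"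
      unfolding g_def by measurable
  qed
  also have "\<dots> = (\<integral>\<^sup>+c. ?K (Suc q) * (ennreal (c powr (- s - 1)) * indicator {1..} c) \<partial>lborel)"
    by (intro nn_integral_cong) (auto simp: indicator_def scale mult_ac)
  also have "\<dots> = ?K (Suc q) * ennreal (1 / s)"
    by (subst nn_integral_cmult) (auto simp: nn_integral_powr_tail[OF s])
  finally have "?K (Suc q) * ennreal (1 / s) * ennreal s = ?K q * ennreal s" by simp
  moreover have "ennreal (1 / s) * ennreal s = 1" using s by (simp add: ennreal_mult[symmetric])
  ultimately have "?K (Suc q) = ?K q * ennreal s" by (simp add: mult.assoc)
  moreover have "sqrt pi ^ CARD('m) * pochhammer (real (card A) / 2) (Suc q) = sqrt pi ^ CARD('m) * pochhammer (real (card A) / 2) q * s"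
    by (simp add: pochhammer_Suc s_def)
  ultimately show ?case unfolding Suc using s by (simp only: ennreal_mult''[OF less_imp_le])
qed

lemma nn_integral_Gamma:
  fixes a :: real
  assumes "a > 0"
  shows "(\<integral>\<^sup>+t. (if t > 0 then ennreal (exp (- t) * t powr (a - 1)) else 0) \<partial>lborel) = ennreal (Gamma a)"
  unfolding Gamma_conv_nn_integral_real[OF assms]
  by (rule nn_integral_cong) (auto simp: indicator_def exp_minus divide_inverse mult.commute)

text \<open>Replacing the radius \<open>1\<close> by \<open>sqrt t\<close> and integrating against \<open>exp (- t)\<close> factorises the integral.\<close>

lemma nn_integral_ball_rho:
  fixes A :: "'m::finite set"
  assumes A: "A \<noteq> {}"
  shows "(\<integral>\<^sup>+u. (if rho A u > 0 \<and> norm u < 1 then ennreal (sqrt (1 - (norm u)\<^sup>2) ^ j * rho A u ^ q) else 0) \<partial>lborel)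
    = ennreal (sqrt pi ^ CARD('m) * pochhammer (real (card A) / 2) q * Gamma (real j / 2 + 1) /
        Gamma (real j / 2 + 1 + real CARD('m) / 2 + real q))" (is "?B = _")
proof -
  \<comment> \<open>The degree of homogeneity in \<open>t\<close>: \<open>j / 2\<close> from the
    square root, \<open>CARD('m) / 2\<close> from the volume and \<open>q\<close> from
    \<open>rho\<close>.\<close>
  define e where "e = real j / 2 + real CARD('m) / 2 + real q"
  have e: "e + 1 > 0" "real j / 2 + 1 > 0" by (simp_all add: e_def add_nonneg_pos)
  define h where "h t u = (if rho A u > 0 \<and> (norm u)\<^sup>2 < t then ennreal (sqrt (t - (norm u)\<^sup>2) ^ j * rho A u ^ q) else 0)"
    for t and u :: "real ^ 'm"
  have hm: "h t \<in> borel_measurable borel" for t unfolding h_def by measurable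
  have scale: "(\<integral>\<^sup>+u. h t u \<partial>lborel) = ennreal (t powr e) * ?B" if t: "t > 0" for t
  proof -
    have sc: "diagm (\<lambda>_. sqrt t) *v u = sqrt t *\<^sub>R u" for u :: "real ^ 'm" by (simp add: vec_eq_iff diagm_mult_vec)
    have r: "rho A (sqrt t *\<^sub>R u) = t * rho A u" for u
      unfolding rho_def sum_distrib_left using t by (intro sum.cong) (auto simp: power_mult_distrib)
    have n: "(norm (sqrt t *\<^sub>R u))\<^sup>2 = t * (norm u)\<^sup>2" for u :: "real ^ 'm" using t by (simp add: power_mult_distrib)
    have n1: "t * (norm u)\<^sup>2 < t \<longleftrightarrow> norm u < 1" for u :: "real ^ 'm"
      using t by (simp add: abs_square_less_1[of "norm u", simplified])
    have hs: "h t (sqrt t *\<^sub>R u) = ennreal (sqrt t ^ j * t ^ q) *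
      (if rho A u > 0 \<and> norm u < 1 then ennreal (sqrt (1 - (norm u)\<^sup>2) ^ j * rho A u ^ q) else 0)" for u
    proof (cases "rho A u > 0 \<and> norm u < 1")
      case True
      have "sqrt (t - t * (norm u)\<^sup>2) = sqrt t * sqrt (1 - (norm u)\<^sup>2)"
        by (simp add: real_sqrt_mult[symmetric] right_diff_distrib)
      moreover have "0 \<le> sqrt t ^ j * t ^ q" using t by simp
      ultimately show ?thesis using True t unfolding h_def r n n1
        by (simp add: ennreal_mult'[symmetric] power_mult_distrib mult_ac)
    next
      case False
      then have "\<not> (rho A (sqrt t *\<^sub>R u) > 0 \<and> (norm (sqrt t *\<^sub>R u))\<^sup>2 < t)"
        using t unfolding r n n1 by (simp add: zero_less_mult_iff)
      then show ?thesis using False unfolding h_def by (simp only: if_False mult_zero_right)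
    qed
    have "(\<integral>\<^sup>+u. h t u \<partial>lborel) = ennreal (sqrt t ^ CARD('m)) * (\<integral>\<^sup>+u. h t (sqrt t *\<^sub>R u) \<partial>lborel)"
      using nn_integral_diagm[OF _ hm[of t], of "\<lambda>_. sqrt t"] t by (simp add: sc)
    also have "(\<integral>\<^sup>+u. h t (sqrt t *\<^sub>R u) \<partial>lborel) = ennreal (sqrt t ^ j * t ^ q) * ?B"
      unfolding hs by (rule nn_integral_cmult) measurable
    also have "ennreal (sqrt t ^ CARD('m)) * (ennreal (sqrt t ^ j * t ^ q) * ?B) = ennreal (t powr e) * ?B"
    proof -
      have "sqrt t ^ k = t powr (real k / 2)" for k
        using t by (simp add: powr_half_sqrt[symmetric] powr_powr powr_realpow[symmetric])
      then have "sqrt t ^ CARD('m) * (sqrt t ^ j * t ^ q) = t powr e"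
        using t by (simp add: e_def powr_add powr_realpow)
      then show ?thesis using t by (simp add: mult.assoc[symmetric] ennreal_mult[symmetric])
    qed
    finally show ?thesis .
  qed
  have "ennreal (Gamma (e + 1)) * ?B = (\<integral>\<^sup>+t. (if t > 0 then ennreal (exp (- t) * t powr (e + 1 - 1)) else 0) * ?B \<partial>lborel)"
    unfolding nn_integral_Gamma[OF e(1), symmetric] by (rule nn_integral_multc[symmetric]) measurable
  also have "\<dots> = (\<integral>\<^sup>+t. (\<integral>\<^sup>+u. ennreal (exp (- t)) * h t u \<partial>lborel) \<partial>lborel)"
  proof (rule nn_integral_cong)
    fix t :: real
    show "(if t > 0 then ennreal (exp (- t) * t powr (e + 1 - 1)) else 0) * ?B = (\<integral>\<^sup>+u. ennreal (exp (- t)) * h t u \<partial>lborel)"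
    proof (cases "t > 0")
      case True
      have "(\<integral>\<^sup>+u. ennreal (exp (- t)) * h t u \<partial>lborel) = ennreal (exp (- t)) * (\<integral>\<^sup>+u. h t u \<partial>lborel)"
        by (rule nn_integral_cmult) (use hm in simp)
      then show ?thesis using True by (simp add: scale ennreal_mult mult.assoc)
    next
      case False
      then have "h t u = 0" for u using zero_le_power2[of "norm u"] unfolding h_def by (intro if_not_P) linarith
      then show ?thesis using False by simp
    qed
  qed
  also have "\<dots> = (\<integral>\<^sup>+u. (\<integral>\<^sup>+t. ennreal (exp (- t)) * h t u \<partial>lborel) \<partial>lborel)"
  proof (rule lborel_pair.Fubini'[symmetric])
    show "(\<lambda>(t, u). ennreal (exp (- t)) * h t u) \<in> borel_measurable (lborel \<Otimes>\<^sub>M lborel)"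
      unfolding h_def by measurable
  qed
  also have "\<dots> = (\<integral>\<^sup>+u. ennreal (Gamma (real j / 2 + 1)) * (if rho A u > 0 then ennreal (rho A u ^ q * exp (- (norm u)\<^sup>2)) else 0) \<partial>lborel)"
  proof (rule nn_integral_cong)
    fix u :: "real ^ 'm"
    let ?n = "(norm u)\<^sup>2"
    show "(\<integral>\<^sup>+t. ennreal (exp (- t)) * h t u \<partial>lborel)
      = ennreal (Gamma (real j / 2 + 1)) * (if rho A u > 0 then ennreal (rho A u ^ q * exp (- ?n)) else 0)"
    proof (cases "rho A u > 0")
      \<comment> \<open>The shift \<open>t = (norm u)\<^sup>2 + s\<close> splits off the Gaussian
        factor in \<open>u\<close> and leaves a gamma integral in \<open>s\<close>.\<close>
      case True
      have "(\<integral>\<^sup>+t. ennreal (exp (- t)) * h t u \<partial>lborel) = (\<integral>\<^sup>+s. ennreal (exp (- (?n + 1 * s))) * h (?n + 1 * s) u \<partial>lborel)"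
        by (subst nn_integral_real_affine[where c = 1 and t = ?n]) (auto simp: h_def)
      also have "\<dots> = (\<integral>\<^sup>+s. ennreal (rho A u ^ q * exp (- ?n)) * (if s > 0 then ennreal (exp (- s) * s powr (real j / 2 + 1 - 1)) else 0) \<partial>lborel)"
      proof (rule nn_integral_cong)
        fix s :: real
        show "ennreal (exp (- (?n + 1 * s))) * h (?n + 1 * s) u
          = ennreal (rho A u ^ q * exp (- ?n)) * (if s > 0 then ennreal (exp (- s) * s powr (real j / 2 + 1 - 1)) else 0)"
        proof (cases "s > 0")
          case s: True
          have "sqrt s ^ j = s powr (real j / 2)"
            using s by (simp add: powr_half_sqrt[symmetric] powr_powr powr_realpow[symmetric])
          moreover have "exp (- (?n + 1 * s)) = exp (- ?n) * exp (- s)" by (simp add: exp_add[symmetric])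
          ultimately have "exp (- (?n + 1 * s)) * (sqrt s ^ j * rho A u ^ q) = (rho A u ^ q * exp (- ?n)) * (exp (- s) * s powr (real j / 2))"
            by (simp only: mult_ac)
          then show ?thesis using True s by (simp add: h_def ennreal_mult[symmetric])
        qed (simp add: h_def)
      qed
      also have "\<dots> = ennreal (rho A u ^ q * exp (- ?n)) * ennreal (Gamma (real j / 2 + 1))"
        unfolding nn_integral_Gamma[OF e(2), symmetric] by (rule nn_integral_cmult) measurable
      finally show ?thesis using True by (simp add: mult.commute)
    qed (simp add: h_def)
  qed
  also have "\<dots> = ennreal (Gamma (real j / 2 + 1)) * ennreal (sqrt pi ^ CARD('m) * pochhammer (real (card A) / 2) q)"
    unfolding nn_integral_rho_exp[OF A, symmetric] by (rule nn_integral_cmult) measurable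
  finally have eq: "ennreal (Gamma (e + 1)) * ?B = ennreal (Gamma (real j / 2 + 1)) * ennreal (sqrt pi ^ CARD('m) * pochhammer (real (card A) / 2) q)" .
  have G: "Gamma (e + 1) > 0" "Gamma (real j / 2 + 1) > 0" using e by (auto intro: Gamma_real_pos)
  have "ennreal (1 / Gamma (e + 1)) * ennreal (Gamma (e + 1)) = 1" using G by (simp add: ennreal_mult[symmetric])
  then have "?B = ennreal (1 / Gamma (e + 1)) * (ennreal (Gamma (e + 1)) * ?B)" by (simp add: mult.assoc[symmetric])
  also have "\<dots> = ennreal (1 / Gamma (e + 1) * (Gamma (real j / 2 + 1) * (sqrt pi ^ CARD('m) * pochhammer (real (card A) / 2) q)))"
  proof -
    have "0 \<le> sqrt pi ^ CARD('m) * pochhammer (real (card A) / 2) q" 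
      using A by (intro mult_nonneg_nonneg pochhammer_nonneg) (auto simp: card_gt_0_iff)
    then show ?thesis unfolding eq using G by (simp add: ennreal_mult[symmetric] del: times_divide_eq_left)
  qed
  finally show ?thesis by (simp add: e_def mult_ac add_ac)
qed

section \<open>Square roots and rank-one perturbations\<close>

lemma positive_definite_det: "positive_definite A \<Longrightarrow> det A > 0" for A :: "real ^ 'm ^ 'm"
proof -
  assume "positive_definite A"
  then obtain U d where U: "orthogonal_matrix U" "A = transpose U ** diagm d ** U" "\<And>i. d i > 0"
    by (rule positive_definite_diagonalization) blast
  have "det U * det U = 1"
    using U(1) det_orthogonal_matrix[OF U(1)] by auto
  then have "det A = (\<Prod>i\<in>UNIV. d i)" unfolding U(2) by (simp add: det_mul det_diagm mult.assoc mult.left_commute)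
  then show ?thesis using U(3) by (simp add: prod_pos)
qed

text \<open>Definiteness is split into a closed condition and the nonvanishing of a determinant,
  which makes the set of definite matrices Borel.\<close>

lemma positive_definite_iff: "positive_definite A \<longleftrightarrow> psd A \<and> det A \<noteq> 0" for A :: "real ^ 'm ^ 'm"
proof
  assume A: "positive_definite A"
  have "v \<bullet> (A *v v) \<ge> 0" for v using A by (cases "v = 0") (auto simp: positive_definite_def intro: less_imp_le)
  then show "psd A \<and> det A \<noteq> 0" using positive_definite_det[OF A] A by (auto simp: psd_def positive_definite_def)
next
  assume A: "psd A \<and> det A \<noteq> 0"
  then obtain U d where U: "orthogonal_matrix U" "A = transpose U ** diagm d ** U" "\<And>i. d i \<ge> 0"
    using psd_diagonalization by blast
  have "det (diagm d) \<noteq> 0" using A unfolding U(2) by (auto simp: det_mul)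
  then have d: "d i > 0" for i using U(3)[of i] by (auto simp: det_diagm order.strict_iff_order)
  have "v \<bullet> (A *v v) > 0" if "v \<noteq> 0" for v
  proof -
    have "U *v v \<noteq> 0" using that orthogonal_matrix_ex_vec(2)[OF U(1), of v] by auto
    then obtain i where "(U *v v) $ i \<noteq> 0" by (auto simp: vec_eq_iff)
    then have "0 < d i * ((U *v v) $ i)\<^sup>2" using d by simp
    also have "\<dots> \<le> (\<Sum>i\<in>UNIV. d i * ((U *v v) $ i)\<^sup>2)" by (rule member_le_sum) (auto simp: U(3))
    finally show ?thesis unfolding U(2) quadratic_form_conj quadratic_form_diagm .
  qed
  then show "positive_definite A" using A by (auto simp: psd_def positive_definite_def)
qed

text \<open>The square root is taken on the eigenvalues. All properties are stated for the same
  \<open>Q\<close>: it fixes the vectors fixed by \<open>M\<close>, since the root of the eigenvalue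
  1 is 1, and the change of variables is a diagonal scaling between two orthogonal maps.\<close>

lemma positive_definite_sqrt:
  fixes M :: "real ^ 'm ^ 'm"
  assumes "positive_definite M"
  obtains Q where "transpose Q = Q" "Q ** Q = M" "det Q = sqrt (det M)"
    "\<And>v. M *v v = v \<Longrightarrow> Q *v v = v"
    "\<And>g. g \<in> borel_measurable borel \<Longrightarrow> (\<integral>\<^sup>+y. g y \<partial>lborel) = ennreal (det Q) * (\<integral>\<^sup>+x. g (Q *v x) \<partial>lborel)"
proof -
  obtain U d where U: "orthogonal_matrix U" "M = transpose U ** diagm d ** U" "\<And>i. d i > 0"
    using positive_definite_diagonalization[OF assms] by blast
  have UU: "U ** transpose U = mat 1" using U(1) by (simp add: orthogonal_matrix_def)
  define e where "e i = sqrt (d i)" for i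
  have e: "e i > 0" "e i * e i = d i" for i using U(3)[of i] by (simp_all add: e_def)
  define Q where "Q = transpose U ** diagm e ** U"
  have dU: "det U * det U = 1" using U(1) det_orthogonal_matrix[OF U(1)] by auto
  have detQ: "det Q = (\<Prod>i\<in>UNIV. e i)" using dU unfolding Q_def by (simp add: det_mul det_diagm mult.assoc mult.left_commute)
  have QQ: "Q ** Q = M"
  proof -
    have "Q ** Q = transpose U ** diagm e ** (U ** transpose U) ** diagm e ** U" by (simp only: Q_def matrix_mul_assoc)
    also have "\<dots> = transpose U ** (diagm e ** diagm e) ** U" by (simp only: UU matrix_mul_rid matrix_mul_assoc)
    finally show ?thesis by (simp only: U(2) diagm_mult e(2))
  qed
  show ?thesis
  proof
    show "transpose Q = Q" by (simp add: Q_def matrix_transpose_mul matrix_mul_assoc)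
    show "Q ** Q = M" by fact
    have "det M = det Q * det Q" using QQ det_mul by metis
    moreover have "det Q > 0" using e by (simp add: detQ prod_pos)
    ultimately show "det Q = sqrt (det M)" by simp
    show "Q *v v = v" if "M *v v = v" for v
    proof -
      have "(U *v (M *v v)) $ i = (U *v v) $ i" for i using that by simp
      moreover have "U *v (M *v v) = diagm d *v (U *v v)"
        unfolding U(2) by (simp only: matrix_vector_mul_assoc matrix_mul_assoc UU matrix_mul_lid)
      ultimately have "d i * (U *v v) $ i = (U *v v) $ i" for i by (simp add: diagm_mult_vec)
      then have "e i * (U *v v) $ i = (U *v v) $ i" for i by (cases "(U *v v) $ i = 0") (auto simp: e_def)
      then have "diagm e *v (U *v v) = U *v v" by (simp add: vec_eq_iff diagm_mult_vec)
      then have "transpose U *v (diagm e *v (U *v v)) = v" using orthogonal_matrix_ex_vec(2)[OF U(1)] by simp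
      then show ?thesis unfolding Q_def by (simp only: matrix_vector_mul_assoc matrix_mul_assoc)
    qed
    fix g :: "real ^ 'm \<Rightarrow> ennreal" assume g: "g \<in> borel_measurable borel"
    have lm: "(\<lambda>x. g (B *v x)) \<in> borel_measurable borel" for B :: "real ^ 'm ^ 'm"
      using measurable_compose[OF linear_borel_measurable[OF matrix_vector_mul_linear[of B]] g] .
    have "(\<integral>\<^sup>+y. g y \<partial>lborel) = (\<integral>\<^sup>+y. g (transpose U *v y) \<partial>lborel)"
      by (rule nn_integral_orthogonal[symmetric]) (use U(1) g in auto)
    also have "\<dots> = ennreal (\<Prod>i\<in>UNIV. e i) * (\<integral>\<^sup>+x. g (transpose U *v (diagm e *v x)) \<partial>lborel)"
      by (rule nn_integral_diagm[OF e(1) lm])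
    also have "(\<integral>\<^sup>+x. g (transpose U *v (diagm e *v x)) \<partial>lborel) = (\<integral>\<^sup>+x. g (transpose U *v (diagm e *v (U *v x))) \<partial>lborel)"
      using nn_integral_orthogonal[OF U(1) lm[of "transpose U ** diagm e"]]
      by (simp only: matrix_vector_mul_assoc matrix_mul_assoc)
    finally show "(\<integral>\<^sup>+y. g y \<partial>lborel) = ennreal (det Q) * (\<integral>\<^sup>+x. g (Q *v x) \<partial>lborel)"
      unfolding detQ unfolding Q_def by (simp only: matrix_vector_mul_assoc matrix_mul_assoc)
  qed
qed

section \<open>Rank-one perturbations of the identity\<close>

definition outer :: "real ^ 'm \<Rightarrow> real ^ 'm ^ 'm" where "outer z = (\<chi> a b. z $ a * z $ b)"

lemma quadratic_form_outer: "v \<bullet> (outer z *v v) = (z \<bullet> v)\<^sup>2"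
proof -
  have "outer z *v v = (z \<bullet> v) *\<^sub>R z"
    by (simp add: vec_eq_iff outer_def matrix_vector_mult_def inner_vec_def sum_distrib_left mult_ac)
  then show ?thesis by (simp add: power2_eq_square inner_commute)
qed

lemma transpose_minus: "transpose (A - B) = transpose A - transpose B" for A :: "real ^ 'n ^ 'm"
  by (simp add: transpose_def vec_eq_iff)

lemma matrix_diff_rdistrib: "(A - B) ** C = A ** C - B ** C" for A B :: "real ^ 'k ^ 'm"
  by (simp add: matrix_matrix_mult_def vec_eq_iff left_diff_distrib sum_subtractf)

lemma matrix_diff_ldistrib: "A ** (B - C) = A ** B - A ** C" for A :: "real ^ 'k ^ 'm"
  by (simp add: matrix_matrix_mult_def vec_eq_iff right_diff_distrib sum_subtractf)

lemma transpose_outer: "transpose (outer z) = outer z"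
  by (simp add: transpose_def outer_def vec_eq_iff mult.commute)

lemma outer_conj: "A ** outer z ** transpose A = outer (A *v z)" for A :: "real ^ 'm ^ 'n"
  by (simp add: vec_eq_iff outer_def matrix_matrix_mult_def matrix_vector_mult_def transpose_def
      sum_distrib_left sum_distrib_right mult_ac)

text \<open>Cauchy-Schwarz in one direction, the test vector \<open>u\<close> itself in the
  other.\<close>

lemma positive_definite_one_minus_outer: "positive_definite (mat 1 - outer u) \<longleftrightarrow> norm u < 1"
proof -
  have q: "v \<bullet> ((mat 1 - outer u) *v v) = (norm v)\<^sup>2 - (u \<bullet> v)\<^sup>2" for v
    by (simp add: matrix_vector_mult_diff_rdistrib inner_diff_right quadratic_form_outer power2_norm_eq_inner)
  show ?thesis
  proof
    assume pd: "positive_definite (mat 1 - outer u)"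
    show "norm u < 1"
    proof (cases "u = 0")
      case False
      then have "0 < (norm u)\<^sup>2 - (u \<bullet> u)\<^sup>2" using pd unfolding positive_definite_def q by blast
      then have "(norm u)\<^sup>2 * (norm u)\<^sup>2 < (norm u)\<^sup>2 * 1"
        unfolding power2_norm_eq_inner[symmetric] power2_eq_square[of "(norm u)\<^sup>2"] by simp
      then have "(norm u)\<^sup>2 < 1" using False by (subst (asm) mult_less_cancel_left_pos) auto
      then show ?thesis by (simp add: power_less_one_iff)
    qed simp
  next
    assume u: "norm u < 1"
    have "(u \<bullet> v)\<^sup>2 < (norm v)\<^sup>2" if "v \<noteq> 0" for v
    proof -
      have "\<bar>u \<bullet> v\<bar> \<le> norm u * norm v" by (rule Cauchy_Schwarz_ineq2)
      also have "\<dots> < norm v" using u that by simp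
      finally show ?thesis using power_strict_mono[of "\<bar>u \<bullet> v\<bar>" "norm v" 2] by simp
    qed
    then show "positive_definite (mat 1 - outer u)" unfolding positive_definite_def q
      by (simp add: transpose_minus transpose_outer)
  qed
qed

text \<open>An orthogonal map taking a multiple of a coordinate vector to \<open>u\<close> makes the
  matrix diagonal.\<close>

lemma det_one_minus_outer: "det (mat 1 - outer u) = 1 - (norm u)\<^sup>2" for u :: "real ^ 'm"
proof -
  obtain a :: 'm where True by simp
  obtain U where U: "orthogonal_transformation U" "U (axis a (norm u)) = u"
    using orthogonal_transformation_exists[of "axis a (norm u)" u] by (auto simp: norm_eq_sqrt_inner inner_axis_axis)
  define V where "V = matrix U"
  have V: "orthogonal_matrix V" "V *v axis a (norm u) = u"
    using U orthogonal_transformation_matrix[of U] by (auto simp: V_def matrix_works orthogonal_transformation_linear)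
  then have VV: "V ** transpose V = mat 1" by (simp add: orthogonal_matrix_def)
  define D where "D = mat 1 - outer (axis a (norm u))"
  have "V ** D ** transpose V = mat 1 - outer u"
    unfolding D_def by (simp add: matrix_diff_ldistrib matrix_diff_rdistrib VV outer_conj V(2))
  moreover have "det V * det V = 1" using det_orthogonal_matrix[OF V(1)] by auto
  ultimately have "det (mat 1 - outer u) = det D" by (metis det_mul det_transpose mult.commute mult.left_commute mult.right_neutral)
  also have "D = diagm (\<lambda>i. if i = a then 1 - (norm u)\<^sup>2 else 1)"
    by (auto simp: D_def diagm_def outer_def vec_eq_iff axis_def mat_def power2_eq_square)
  also have "det \<dots> = 1 - (norm u)\<^sup>2" by (simp add: det_diagm)
  finally show ?thesis .
qed

lemma positive_definite_conj:
  fixes Q :: "real ^ 'm ^ 'm"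
  assumes Q: "det Q \<noteq> 0"
  shows "positive_definite (transpose Q ** C ** Q) \<longleftrightarrow> positive_definite C"
proof -
  have one: "positive_definite (transpose P ** C ** P)" if P: "det P \<noteq> 0" and C: "positive_definite C" for P C :: "real ^ 'm ^ 'm"
  proof -
    have "P *v v \<noteq> 0" if "v \<noteq> 0" for v
    proof -
      obtain P' where "P' ** P = mat 1" using P invertible_det_nz[of P] invertible_def by blast
      then have "P' *v (P *v v) = v" by (simp add: matrix_vector_mul_assoc)
      then show ?thesis using that by auto
    qed
    then show ?thesis using C unfolding positive_definite_def quadratic_form_conj
      by (simp add: matrix_transpose_mul matrix_mul_assoc)
  qed
  obtain R where R: "R ** Q = mat 1" "Q ** R = mat 1" using Q invertible_det_nz[of Q] invertible_def by blast
  have "det R \<noteq> 0" using R(1) by (metis det_I det_mul mult_eq_0_iff zero_neq_one)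
  moreover have "transpose R ** (transpose Q ** C ** Q) ** R = C"
  proof -
    have "transpose R ** (transpose Q ** C ** Q) ** R = transpose (Q ** R) ** C ** (Q ** R)"
      by (simp add: matrix_transpose_mul matrix_mul_assoc)
    then show ?thesis by (simp add: R)
  qed
  ultimately show ?thesis using one[OF Q, of C] one[of R "transpose Q ** C ** Q"] by auto
qed

lemma positive_definite_borel [measurable]: "{A :: real ^ 'm ^ 'm. positive_definite A} \<in> sets borel"
proof -
  have "linear (\<lambda>A :: real ^ 'm ^ 'm. v \<bullet> (A *v v))" for v
    by (rule linearI) (simp_all add: matrix_vector_mult_add_rdistrib inner_right_distrib scaleR_matrix_vector_assoc[symmetric])
  then have c: "continuous_on UNIV (\<lambda>A :: real ^ 'm ^ 'm. v \<bullet> (A *v v))" for v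
    by (intro linear_continuous_on) (simp add: linear_conv_bounded_linear)
  have "continuous_on UNIV (transpose :: real ^ 'm ^ 'm \<Rightarrow> _)"
    using linear_transpose by (intro linear_continuous_on) (simp add: linear_conv_bounded_linear)
  then have "closed {A :: real ^ 'm ^ 'm. psd A}" unfolding psd_def
    by (intro closed_Collect_conj closed_Collect_eq closed_Collect_all closed_Collect_le c continuous_on_id continuous_on_const)
  moreover have "{A :: real ^ 'm ^ 'm. det A \<noteq> 0} \<in> sets borel"
    using pg_measurable[OF pg_det[OF pg_entry]] by measurable
  moreover have "{A :: real ^ 'm ^ 'm. positive_definite A} = {A. psd A} \<inter> {A. det A \<noteq> 0}"
    by (auto simp: positive_definite_iff)
  ultimately show ?thesis by (simp add: borel_closed)
qed

text \<open>The triangular decomposition is applied to a matrix whose first rows are a basis of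
  \<open>S\<close> and whose other rows are zero: in the coordinates given by \<open>H\<close> the
  basis vectors have no components from position \<open>dim S\<close> on, and the dimensions
  agree.\<close>

lemma subspace_coordinates:
  fixes S :: "(real ^ 'm) set"
  assumes S: "subspace S"
  obtains H :: "real ^ 'm ^ 'm" where "orthogonal_matrix H" "S = {x. \<forall>j. dim S \<le> rk j \<longrightarrow> (H *v x) $ j = 0}"
proof -
  define r where "r = dim S"
  obtain B where B: "B \<subseteq> S" "independent B" "S \<subseteq> span B" "card B = r" using basis_exists[of S] r_def by metis
  have fB: "finite B" using B(2) by (rule independent_imp_finite)
  have rm: "r \<le> CARD('m)" unfolding r_def using dim_subset_UNIV[of S] by simp
  obtain f where f: "bij_betw f {..<r} B" using ex_bij_betw_nat_finite[OF fB] B(4) by (auto simp: atLeast0LessThan)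
  define L :: "real ^ 'm ^ 'm" where "L = (\<chi> i. if rk i < r then f (rk i) else 0)"
  obtain T H where TH: "lower_triangular T" "orthogonal_matrix H" "L = T ** H" using lower_orthogonal_decomposition by blast
  define V where "V = {x. \<forall>j. r \<le> rk j \<longrightarrow> (H *v x) $ j = 0}"
  have sV: "subspace V" unfolding V_def by (rule subspaceI) (auto simp: matrix_vector_right_distrib matrix_vector_mult_scaleR)
  have "T = L ** transpose H" using TH(2,3) by (simp add: orthogonal_matrix_def matrix_mul_assoc[symmetric])
  then have T: "T $ i $ j = (H *v (L $ i)) $ j" for i j
    by (simp add: matrix_matrix_mult_def matrix_vector_mult_def transpose_def mult.commute)
  have "f k \<in> V" if k: "k < r" for k
  proof -
    have "(H *v f k) $ j = 0" if j: "r \<le> rk j" for j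
    proof -
      have "T $ ix k $ j = 0" using TH(1) j k rm by (simp add: lower_triangular_def)
      then show ?thesis using k rm by (simp add: T L_def)
    qed
    then show ?thesis by (simp add: V_def)
  qed
  then have "B \<subseteq> V" using f by (auto simp: bij_betw_def)
  then have SV: "S \<subseteq> V" using B(3) span_minimal[OF _ sV] by blast
  have "V \<subseteq> span ((\<lambda>i. row i H) ` seg r)"
  proof
    fix x assume x: "x \<in> V"
    have "x = transpose H *v (H *v x)" using orthogonal_matrix_ex_vec(2)[OF TH(2)] by simp
    also have "\<dots> = (\<Sum>j\<in>UNIV. (H *v x) $ j *\<^sub>R row j H)"
    proof -
      have "transpose H *v y = (\<Sum>j\<in>UNIV. y $ j *\<^sub>R row j H)" for y
        by (simp add: vec_eq_iff matrix_vector_mult_def transpose_def row_def mult.commute)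
      then show ?thesis .
    qed
    also have "\<dots> = (\<Sum>j\<in>seg r. (H *v x) $ j *\<^sub>R row j H)"
      by (rule sum.mono_neutral_right) (use x in \<open>auto simp: V_def seg_def\<close>)
    also have "\<dots> \<in> span ((\<lambda>i. row i H) ` seg r)" by (intro span_sum span_scale span_base) auto
    finally show "x \<in> span ((\<lambda>i. row i H) ` seg r)" .
  qed
  then have "dim V \<le> card ((\<lambda>i. row i H) ` seg r)" by (rule dim_le_card) auto
  also have "\<dots> \<le> r" using card_image_le[of "seg r :: 'm set" "\<lambda>i. row i H"] card_seg[OF rm] by simp
  finally have "S = V" using subspace_dim_equal[OF S sV SV] by (simp add: r_def)
  then show ?thesis using TH(2) that unfolding V_def r_def by blast
qed

lemma infdist_coordinates:
  fixes H :: "real ^ 'm ^ 'm"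
  assumes H: "orthogonal_matrix H"
  shows "(infdist x {x. \<forall>j\<in>A. (H *v x) $ j = 0})\<^sup>2 = rho A (H *v x)"
proof -
  let ?S = "{x. \<forall>j\<in>A. (H *v x) $ j = 0}"
  define s where "s = transpose H *v (\<chi> j. if j \<in> A then 0 else (H *v x) $ j)"
  have Hs: "H *v s = (\<chi> j. if j \<in> A then 0 else (H *v x) $ j)" unfolding s_def by (rule orthogonal_matrix_ex_vec(1)[OF H])
  have d: "(dist x w)\<^sup>2 = rho A (H *v x - H *v w) + rho (- A) (H *v x - H *v w)" for w
    unfolding dist_norm norm_orthogonal_vec[OF H, of "x - w", symmetric] matrix_vector_mult_diff_distrib by (rule norm_rho)
  have dS: "(dist x w)\<^sup>2 \<ge> rho A (H *v x)" if "w \<in> ?S" for w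
  proof -
    have "rho A (H *v x - H *v w) = rho A (H *v x)" using that by (auto simp: rho_def intro!: sum.cong)
    then show ?thesis unfolding d by simp
  qed
  have s: "s \<in> ?S" by (simp add: Hs)
  have "rho A (H *v x - H *v s) = rho A (H *v x)" "rho (- A) (H *v x - H *v s) = 0"
    unfolding Hs rho_def by (auto intro!: sum.cong)
  then have "dist x s = sqrt (rho A (H *v x))" using d[of s] by (metis add.right_neutral real_sqrt_abs abs_of_nonneg zero_le_dist)
  then have "infdist x ?S \<le> sqrt (rho A (H *v x))" using infdist_le[OF s, of x] by simp
  moreover have "infdist x ?S \<ge> sqrt (rho A (H *v x))"
  proof -
    have "?S \<noteq> {}" using s by blast
    then show ?thesis unfolding infdist_notempty[OF \<open>?S \<noteq> {}\<close>]
      by (rule cINF_greatest) (use dS real_sqrt_le_iff in \<open>fastforce intro: real_le_lsqrt\<close>)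
  qed
  ultimately show ?thesis by (simp add: antisym)
qed

text \<open>The value of \<open>nn_integral_ball_rho\<close> for \<open>m - r\<close> distinguished
  coordinates: the factor that a row leaves behind when it is integrated over the complement of the
  span of \<open>r\<close> earlier ones and that span.\<close>

definition vol_rho :: "nat \<Rightarrow> nat \<Rightarrow> nat \<Rightarrow> nat \<Rightarrow> real" where
  "vol_rho m r j q = sqrt pi ^ m * pochhammer (real (m - r) / 2) q * Gamma (real j / 2 + 1) /
     Gamma (real j / 2 + 1 + real m / 2 + real q)"

lemma rho_eq_0_iff: "rho A x = 0 \<longleftrightarrow> (\<forall>j\<in>A. x $ j = 0)" for A :: "'m::finite set"
  unfolding rho_def by (subst sum_nonneg_eq_0_iff) auto

text \<open>The dependence on the next row \<open>y\<close> when \<open>M\<close> is the residual of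
  the earlier rows and \<open>S\<close> their span. The points of \<open>S\<close> are excluded to
  match the nonvanishing minor required in \<open>stage\<close>.\<close>

definition rank_one_weight :: "real ^ 'm ^ 'm \<Rightarrow> (real ^ 'm) set \<Rightarrow> nat \<Rightarrow> nat \<Rightarrow> real ^ 'm \<Rightarrow> ennreal" where
  "rank_one_weight M S j q y = (if positive_definite (M - outer y) \<and> y \<notin> S
     then ennreal (sqrt (det (M - outer y)) ^ j * (infdist y S)\<^sup>2 ^ q) else 0)"

lemma rank_one_weight_measurable:
  assumes S: "subspace S"
  shows "rank_one_weight M S j q \<in> borel_measurable borel"
proof -
  have om: "(\<lambda>y. M - outer y) \<in> borel_measurable borel"
  proof (rule borel_measurable_continuous_onI)
    show "continuous_on UNIV (\<lambda>y. M - outer y)" unfolding outer_def by (intro continuous_intros)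
  qed
  have [measurable]: "Measurable.pred borel (\<lambda>y. positive_definite (M - outer y))"
    using measurable_sets[OF om positive_definite_borel] by (simp add: vimage_def pred_def)
  have [measurable]: "Measurable.pred borel (\<lambda>y. y \<notin> S)"
    using borel_closed[OF closed_subspace[OF S]] by (simp add: pred_def Collect_neg_eq)
  have "(\<lambda>y. sqrt (det (M - outer y)) ^ j * (infdist y S)\<^sup>2 ^ q) \<in> borel_measurable borel"
    using measurable_compose[OF om pg_measurable[OF pg_det[OF pg_entry]]]
      borel_measurable_continuous_onI[OF continuous_on_infdist[OF continuous_on_id, of UNIV S]] by measurable
  then show ?thesis unfolding rank_one_weight_def by measurable
qed

text \<open>The substitution \<open>y = Q u\<close>, \<open>Q\<^sup>2 = M\<close>, preserves the distance to \<open>S\<close>, since \<open>Q\<close> fixes the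
  orthogonal complement of \<open>S\<close>.\<close>

lemma nn_integral_rank_one_update:
  fixes M :: "real ^ 'm ^ 'm"
  assumes M: "positive_definite M" and S: "subspace S" "dim S < CARD('m)"
    and id: "\<And>v. (\<And>w. w \<in> S \<Longrightarrow> v \<bullet> w = 0) \<Longrightarrow> M *v v = v"
  shows "(\<integral>\<^sup>+y. rank_one_weight M S j q y \<partial>lborel)
    = ennreal (sqrt (det M) ^ Suc j * vol_rho CARD('m) (dim S) j q)"
proof -
  obtain Q where Q: "transpose Q = Q" "Q ** Q = M" "det Q = sqrt (det M)" "\<And>v. M *v v = v \<Longrightarrow> Q *v v = v"
    and cv: "\<And>g. g \<in> borel_measurable borel \<Longrightarrow> (\<integral>\<^sup>+y. g y \<partial>lborel) = ennreal (det Q) * (\<integral>\<^sup>+x. g (Q *v x) \<partial>lborel)"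
    using positive_definite_sqrt[OF M] by metis
  obtain H :: "real ^ 'm ^ 'm" where H: "orthogonal_matrix H" "S = {x. \<forall>j. dim S \<le> rk j \<longrightarrow> (H *v x) $ j = 0}"
    using subspace_coordinates[OF S(1)] by blast
  define A where "A = {j :: 'm. dim S \<le> rk j}"
  have SA: "S = {x. \<forall>j\<in>A. (H *v x) $ j = 0}" unfolding A_def using H(2) by blast
  have "A = - seg (dim S)" by (auto simp: A_def seg_def)
  then have cA: "card A = CARD('m) - dim S" using S(2) by (simp add: Compl_eq_Diff_UNIV card_Diff_subset card_seg)
  have "ix (dim S) \<in> A" using S(2) by (simp add: A_def)
  then have A: "A \<noteq> {}" by blast
  have detM: "det M > 0" by (rule positive_definite_det[OF M])
  have dQ: "det Q > 0" "det Q * det Q = det M" using detM by (simp_all add: Q(3))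
  define h where "h u = (if rho A u > 0 \<and> norm u < 1 then ennreal (sqrt (1 - (norm u)\<^sup>2) ^ j * rho A u ^ q) else 0)" for u
  have inS: "y \<in> S \<longleftrightarrow> rho A (H *v y) = 0" for y unfolding SA rho_eq_0_iff by simp
  have inf: "(infdist y S)\<^sup>2 = rho A (H *v y)" for y unfolding SA by (rule infdist_coordinates[OF H(1)])
  have HQ: "rho A (H *v (Q *v u)) = rho A (H *v u)" for u
    unfolding rho_def
  proof (rule sum.cong[OF refl])
    fix j assume j: "j \<in> A"
    have Hj: "(H *v x) $ j = row j H \<bullet> x" for x by (simp add: matrix_vector_mult_def row_def inner_vec_def)
    have "M *v row j H = row j H"
    proof (rule id)
      fix w assume "w \<in> S"
      then have "(H *v w) $ j = 0" using j by (auto simp: SA)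
      then show "row j H \<bullet> w = 0" by (simp add: Hj)
    qed
    then have "Q *v row j H = row j H" by (rule Q(4))
    moreover have "row j H \<bullet> (Q *v u) = (transpose Q *v row j H) \<bullet> u" by (rule inner_matrix_vector)
    ultimately show "((H *v (Q *v u)) $ j)\<^sup>2 = ((H *v u) $ j)\<^sup>2" by (simp only: Hj Q(1))
  qed
  \<comment> \<open>Factoring out \<open>Q\<close> turns definiteness of the updated residual into
    \<open>norm u < 1\<close> and its determinant into
    \<open>det M * (1 - (norm u)\<^sup>2)\<close>; the Jacobian \<open>sqrt (det M)\<close> raises
    the exponent from \<open>j\<close> to \<open>Suc j\<close>.\<close>
  have MQ: "M - outer (Q *v u) = transpose Q ** (mat 1 - outer u) ** Q" for u
    using outer_conj[of Q u] by (simp add: Q(1,2) matrix_diff_ldistrib matrix_diff_rdistrib)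
  have pd: "positive_definite (M - outer (Q *v u)) \<longleftrightarrow> norm (H *v u) < 1" for u
    unfolding MQ norm_orthogonal_vec[OF H(1)] using dQ by (simp add: positive_definite_conj positive_definite_one_minus_outer)
  have de: "sqrt (det (M - outer (Q *v u))) = sqrt (det M) * sqrt (1 - (norm (H *v u))\<^sup>2)" for u
    unfolding MQ norm_orthogonal_vec[OF H(1)] using dQ(2)
    by (simp add: det_mul det_transpose det_one_minus_outer real_sqrt_mult[symmetric] mult_ac)
  have gQ: "rank_one_weight M S j q (Q *v u) = ennreal (sqrt (det M) ^ j) * h (H *v u)" for u
  proof (cases "rho A (H *v u) > 0 \<and> norm (H *v u) < 1")
    case True
    have "0 \<le> sqrt (det M) ^ j" using detM by simp
    then show ?thesis using True unfolding rank_one_weight_def h_def pd de inS inf HQ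
      by (simp add: ennreal_mult'[symmetric] power_mult_distrib mult_ac)
  next
    case False
    then have "\<not> (norm (H *v u) < 1 \<and> rho A (H *v u) \<noteq> 0)"
      using rho_nonneg[of A "H *v u"] by linarith
    then show ?thesis using False unfolding rank_one_weight_def h_def pd inS HQ by auto
  qed
  have lo: "linear (\<lambda>y. H *v y)" by (rule matrix_vector_mul_linear)
  note gm = rank_one_weight_measurable[OF S(1), of M j q]
  have hm: "h \<in> borel_measurable borel" unfolding h_def by measurable
  have "(\<integral>\<^sup>+y. rank_one_weight M S j q y \<partial>lborel) = ennreal (det Q) * (\<integral>\<^sup>+u. ennreal (sqrt (det M) ^ j) * h (H *v u) \<partial>lborel)"
    unfolding cv[OF gm] gQ ..
  also have "(\<integral>\<^sup>+u. ennreal (sqrt (det M) ^ j) * h (H *v u) \<partial>lborel) = ennreal (sqrt (det M) ^ j) * (\<integral>\<^sup>+u. h (H *v u) \<partial>lborel)"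
    by (rule nn_integral_cmult) (use measurable_compose[OF linear_borel_measurable[OF lo] hm] in simp)
  also have "(\<integral>\<^sup>+u. h (H *v u) \<partial>lborel) = ennreal (vol_rho CARD('m) (dim S) j q)"
    unfolding nn_integral_orthogonal[OF H(1) hm] unfolding h_def vol_rho_def nn_integral_ball_rho[OF A] cA ..
  finally show ?thesis
    using dQ(1) detM by (simp add: Q(3) ennreal_mult''[symmetric] ennreal_mult'[symmetric] mult.assoc[symmetric])
qed

section \<open>Integrating out the rows of a contraction\<close>

definition residual :: "'n::finite set \<Rightarrow> ('n \<Rightarrow> real ^ 'm) \<Rightarrow> real ^ 'm ^ 'm" where
  "residual I z = mat 1 - (\<Sum>i\<in>I. outer (z i))"

lemma residual_insert: "i \<notin> I \<Longrightarrow> residual (insert i I) z = residual I z - outer (z i)"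
  by (simp add: residual_def)

lemma residual_cong: "(\<And>i. i \<in> I \<Longrightarrow> z i = z' i) \<Longrightarrow> residual I z = residual I z'"
  by (simp add: residual_def)

lemma transpose_sum: "transpose (\<Sum>i\<in>I. A i) = (\<Sum>i\<in>I. transpose (A i))"
  by (simp add: transpose_def vec_eq_iff)

lemma transpose_residual: "transpose (residual I z) = residual I z"
  by (simp add: residual_def transpose_minus transpose_sum transpose_outer)

lemma residual_mult_vec: "residual I z *v v = v - (\<Sum>i\<in>I. (z i \<bullet> v) *\<^sub>R z i)"
proof -
  have "outer x *v v = (x \<bullet> v) *\<^sub>R x" for x
    by (simp add: vec_eq_iff outer_def matrix_vector_mult_def inner_vec_def sum_distrib_left mult_ac)
  moreover have "(\<Sum>i\<in>I. outer (z i)) *v v = (\<Sum>i\<in>I. outer (z i) *v v)"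
    by (induction I rule: infinite_finite_induct) (auto simp: matrix_vector_mult_add_rdistrib)
  ultimately show ?thesis by (simp add: residual_def matrix_vector_mult_diff_rdistrib)
qed

text \<open>Adding back a rank-one term preserves definiteness, so the condition at the last row
  implies those at all earlier stages.\<close>

lemma positive_definite_minus_outer:
  assumes "positive_definite (M - outer y)" "transpose M = M"
  shows "positive_definite M"
  unfolding positive_definite_def
proof (intro conjI allI impI)
  fix v :: "real ^ 'a" assume "v \<noteq> 0"
  then have "v \<bullet> ((M - outer y) *v v) > 0" using assms unfolding positive_definite_def by blast
  also have "v \<bullet> ((M - outer y) *v v) = v \<bullet> (M *v v) - (y \<bullet> v)\<^sup>2"
    by (simp add: matrix_vector_mult_diff_rdistrib inner_diff_right quadratic_form_outer)
  finally show "v \<bullet> (M *v v) > 0" using zero_le_power2[of "y \<bullet> v"] by linarith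
qed (rule assms)

lemma pm_gramm_cong: "(\<And>i. i \<in> I \<Longrightarrow> z i = z' i) \<Longrightarrow> pm I (gramm z) = pm I (gramm z')"
proof -
  assume "\<And>i. i \<in> I \<Longrightarrow> z i = z' i"
  then have "trunc I (gramm z) = trunc I (gramm z')" by (simp add: trunc_def gramm_def vec_eq_iff)
  then show ?thesis by (simp add: pm_def)
qed

lemma pm_gramm_seg_Suc:
  fixes z :: "'n::finite \<Rightarrow> 'v::euclidean_space"
  assumes "r < CARD('n)"
  shows "pm (seg (Suc r)) (gramm z) = (infdist (z (ix r)) (span (z ` seg r)))\<^sup>2 * pm (seg r) (gramm z)"
  using assms by (simp add: seg_Suc pm_gramm_insert ix_notin_seg)

lemma dim_span_seg:
  fixes z :: "'n::finite \<Rightarrow> 'v::euclidean_space"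
  assumes "pm (seg r) (gramm z) \<noteq> 0" "r \<le> CARD('n)"
  shows "dim (span (z ` seg r)) = r"
  using assms
proof (induction r)
  case (Suc r)
  then have r: "r < CARD('n)" by simp
  have n: "infdist (z (ix r)) (span (z ` seg r)) \<noteq> 0" "pm (seg r) (gramm z) \<noteq> 0"
    using Suc.prems pm_gramm_seg_Suc[OF r, of z] by auto
  then have "z (ix r) \<notin> span (z ` seg r)" by auto
  then show ?case using Suc.IH n r by (simp add: seg_Suc dim_insert)
qed simp

lemma residual_measurable: "I \<subseteq> J \<Longrightarrow> residual I \<in> borel_measurable (\<Pi>\<^sub>M i\<in>J. lborel)"
proof -
  assume IJ: "I \<subseteq> J"
  have c: "continuous_on UNIV (outer :: real ^ 'm \<Rightarrow> _)" unfolding outer_def by (intro continuous_intros)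
  have "(\<lambda>z. outer (z i)) \<in> borel_measurable (\<Pi>\<^sub>M i\<in>J. lborel)" if "i \<in> I" for i
  proof -
    have "(\<lambda>z. z i) \<in> (\<Pi>\<^sub>M i\<in>J. lborel) \<rightarrow>\<^sub>M lborel" using that IJ by (intro measurable_component_singleton) auto
    from measurable_compose[OF this] borel_measurable_continuous_onI[OF c] show ?thesis by simp
  qed
  then show ?thesis unfolding residual_def[abs_def] by measurable
qed

lemma pm_gramm_measurable:
  assumes IJ: "I \<subseteq> J"
  shows "(\<lambda>z :: 'n::finite \<Rightarrow> 'v::euclidean_space. pm I (gramm z)) \<in> borel_measurable (\<Pi>\<^sub>M i\<in>J. lborel)"
proof -
  have [measurable]: "(\<lambda>z :: 'n \<Rightarrow> 'v. trunc I (gramm z) $ i $ j) \<in> borel_measurable (\<Pi>\<^sub>M i\<in>J. lborel)" for i j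
  proof (cases "i \<in> I \<and> j \<in> I")
    case True
    have "(\<lambda>z :: 'n \<Rightarrow> 'v. z k) \<in> borel_measurable (\<Pi>\<^sub>M i\<in>J. lborel)" if "k \<in> I" for k
      using measurable_component_singleton[of k J "\<lambda>_. lborel :: 'v measure"] that IJ by auto
    then show ?thesis using True by (simp add: trunc_def gramm_def borel_measurable_inner)
  qed (auto simp: trunc_def)
  show ?thesis unfolding pm_def det_def by measurable
qed

text \<open>The integrand that is left, up to a constant, when the rows from \<open>r\<close> on have been integrated out.\<close>

definition stage :: "(nat \<Rightarrow> nat) \<Rightarrow> nat \<Rightarrow> ('n::finite \<Rightarrow> real ^ 'm) \<Rightarrow> ennreal" where
  "stage \<kappa> r z = (if positive_definite (residual (seg r) z) \<and> pm (seg r) (gramm z) \<noteq> 0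
     then ennreal (sqrt (det (residual (seg r) z)) ^ (CARD('n) - r) *
       (\<Prod>i<r. (pm (seg (Suc i)) (gramm z) / pm (seg i) (gramm z)) ^ \<kappa> i)) else 0)"

lemma seg_mono: "i \<le> j \<Longrightarrow> seg i \<subseteq> seg j" by (auto simp: seg_def)

lemma stage_measurable:
  assumes "seg r \<subseteq> J"
  shows "stage \<kappa> r \<in> borel_measurable (\<Pi>\<^sub>M i\<in>(J :: 'n::finite set). (lborel :: (real ^ 'm) measure))"
proof -
  let ?P = "\<Pi>\<^sub>M i\<in>(J :: 'n set). (lborel :: (real ^ 'm) measure)"
  have [measurable]: "(\<lambda>z :: 'n \<Rightarrow> real ^ 'm. pm (seg k) (gramm z)) \<in> borel_measurable ?P" if "k \<le> r" for k
    by (rule pm_gramm_measurable) (use that assms seg_mono in blast)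
  have R: "residual (seg r) \<in> borel_measurable ?P" by (rule residual_measurable[OF assms])
  have [measurable]: "(\<lambda>z. det (residual (seg r) z)) \<in> borel_measurable ?P"
    using measurable_compose[OF R pg_measurable[OF pg_det[OF pg_entry]]] .
  have [measurable]: "Measurable.pred ?P (\<lambda>z. positive_definite (residual (seg r) z))"
    using measurable_sets[OF R positive_definite_borel] by (simp add: vimage_def pred_def Int_def conj_commute)
  have [measurable]: "(\<lambda>z :: 'n \<Rightarrow> real ^ 'm. \<Prod>i<r. (pm (seg (Suc i)) (gramm z) / pm (seg i) (gramm z)) ^ \<kappa> i) \<in> borel_measurable ?P"
    by (intro borel_measurable_prod borel_measurable_power borel_measurable_divide) auto
  have [measurable]: "(\<lambda>z :: 'n \<Rightarrow> real ^ 'm. pm (seg r) (gramm z)) \<in> borel_measurable ?P" by simp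
  show ?thesis unfolding stage_def by measurable
qed

text \<open>With the earlier rows fixed, the new row \<open>y\<close> enters only through the
  residual minus \<open>outer y\<close> and through its squared distance to their span, which is the
  quotient of consecutive minors. So the integrand is a constant times
  \<open>rank_one_weight\<close>, and \<open>nn_integral_rank_one_update\<close> raises the exponent
  \<open>CARD('n) - Suc r\<close> of the root of the determinant to
  \<open>CARD('n) - r\<close>.\<close>

lemma stage_integral_step:
  fixes x :: "'n::finite \<Rightarrow> real ^ 'm"
  assumes nm: "CARD('n) \<le> CARD('m)" and r: "r < CARD('n)"
  shows "(\<integral>\<^sup>+y. stage \<kappa> (Suc r) (x(ix r := y)) \<partial>lborel)
    = stage \<kappa> r x * ennreal (vol_rho CARD('m) r (CARD('n) - Suc r) (\<kappa> r))"
proof -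
  let ?i = "ix r :: 'n" and ?S = "span (x ` seg r)" and ?M = "residual (seg r) x" and ?p = "\<lambda>k. pm (seg k) (gramm x)"
  define c where "c = (\<Prod>i<r. (?p (Suc i) / ?p i) ^ \<kappa> i)"
  have c0: "0 \<le> c" unfolding c_def using r by (intro prod_nonneg zero_le_power ballI divide_nonneg_nonneg pm_gramm_nonneg) auto
  have same: "j \<in> seg r \<Longrightarrow> (x(?i := y)) j = x j" for j y using ix_notin_seg[OF r] by auto
  have R: "residual (seg (Suc r)) (x(?i := y)) = ?M - outer y" for y
    using residual_cong[of "seg r" "x(?i := y)" x] same by (simp add: seg_Suc[OF r] residual_insert ix_notin_seg[OF r])
  have p: "pm (seg k) (gramm (x(?i := y))) = ?p k" if "k \<le> r" for k y
    by (rule pm_gramm_cong) (use that seg_mono same in blast)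
  have im: "x(?i := y) ` seg r = x ` seg r" for y using same by (intro image_cong) auto
  have ps: "pm (seg (Suc r)) (gramm (x(?i := y))) = (infdist y ?S)\<^sup>2 * ?p r" for y
    unfolding pm_gramm_seg_Suc[OF r] im p[OF order_refl] by simp
  have inf0: "infdist y ?S = 0 \<longleftrightarrow> y \<in> ?S" for y
  proof -
    have "?S \<noteq> {}" using span_zero[of "x ` seg r"] by (metis empty_iff)
    then show ?thesis by (rule in_closed_iff_infdist_zero[symmetric, OF closed_span])
  qed
  have st: "stage \<kappa> (Suc r) (x(?i := y)) = (if positive_definite ?M \<and> ?p r \<noteq> 0 then ennreal c else 0) *
     rank_one_weight ?M ?S (CARD('n) - Suc r) (\<kappa> r) y" for y
  proof (cases "positive_definite (?M - outer y) \<and> y \<notin> ?S \<and> ?p r \<noteq> 0")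
    case True
    then have pd: "positive_definite ?M" using positive_definite_minus_outer transpose_residual by blast
    have P: "(\<Prod>i<Suc r. (pm (seg (Suc i)) (gramm (x(?i := y))) / pm (seg i) (gramm (x(?i := y)))) ^ \<kappa> i) = c * (infdist y ?S)\<^sup>2 ^ \<kappa> r"
    proof -
      have "(\<Prod>i<r. (pm (seg (Suc i)) (gramm (x(?i := y))) / pm (seg i) (gramm (x(?i := y)))) ^ \<kappa> i) = c"
        unfolding c_def by (intro prod.cong refl) (simp add: p)
      then show ?thesis using True by (simp add: ps p)
    qed
    have "(infdist y ?S)\<^sup>2 * ?p r \<noteq> 0" using True inf0 by simp
    then have "stage \<kappa> (Suc r) (x(?i := y)) = ennreal (sqrt (det (?M - outer y)) ^ (CARD('n) - Suc r) * (c * (infdist y ?S)\<^sup>2 ^ \<kappa> r))"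
      unfolding stage_def P R ps using True by (intro if_P conjI) auto
    also have "\<dots> = ennreal c * ennreal (sqrt (det (?M - outer y)) ^ (CARD('n) - Suc r) * (infdist y ?S)\<^sup>2 ^ \<kappa> r)"
      unfolding ennreal_mult'[OF c0, symmetric] by (rule arg_cong[where f = ennreal]) (rule mult.left_commute)
    finally show ?thesis using True pd by (simp add: rank_one_weight_def)
  next
    case False
    then show ?thesis by (auto simp add: stage_def rank_one_weight_def R ps inf0 simp del: prod.lessThan_Suc)
  qed
  show ?thesis
  proof (cases "positive_definite ?M \<and> ?p r \<noteq> 0")
    case True
    have d: "dim ?S = r" by (rule dim_span_seg) (use True r in auto)
    \<comment> \<open>The residual differs from the identity by the outer products of the earlier
      rows only, so it fixes their orthogonal complement.\<close>
    have id: "?M *v v = v" if "\<And>w. w \<in> ?S \<Longrightarrow> v \<bullet> w = 0" for v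
    proof -
      have "x i \<bullet> v = 0" if "i \<in> seg r" for i
        using \<open>\<And>w. w \<in> ?S \<Longrightarrow> v \<bullet> w = 0\<close>[of "x i"] that by (simp add: span_base inner_commute)
      then show ?thesis by (simp add: residual_mult_vec)
    qed
    have "dim ?S < CARD('m)" using d r nm by simp
    then have I: "(\<integral>\<^sup>+y. rank_one_weight ?M ?S (CARD('n) - Suc r) (\<kappa> r) y \<partial>lborel)
      = ennreal (sqrt (det ?M) ^ Suc (CARD('n) - Suc r) * vol_rho CARD('m) r (CARD('n) - Suc r) (\<kappa> r))"
      using nn_integral_rank_one_update[where S = ?S and M = ?M] True id unfolding d by auto
    have "(\<integral>\<^sup>+y. stage \<kappa> (Suc r) (x(?i := y)) \<partial>lborel) = (\<integral>\<^sup>+y. ennreal c * rank_one_weight ?M ?S (CARD('n) - Suc r) (\<kappa> r) y \<partial>lborel)"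
      unfolding st using True by simp
    also have "\<dots> = ennreal c * ennreal (sqrt (det ?M) ^ Suc (CARD('n) - Suc r) * vol_rho CARD('m) r (CARD('n) - Suc r) (\<kappa> r))"
      unfolding I[symmetric] by (rule nn_integral_cmult) (simp add: rank_one_weight_measurable)
    finally have "(\<integral>\<^sup>+y. stage \<kappa> (Suc r) (x(?i := y)) \<partial>lborel)
      = ennreal c * ennreal (sqrt (det ?M) ^ Suc (CARD('n) - Suc r) * vol_rho CARD('m) r (CARD('n) - Suc r) (\<kappa> r))" .
    moreover note c0
    moreover have "det ?M > 0" using True positive_definite_det by blast
    ultimately show ?thesis using True r
      by (simp add: stage_def c_def[symmetric] Suc_diff_Suc ennreal_mult'[symmetric] ennreal_mult''[symmetric] mult_ac del: power_Suc)
  next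
    case False
    then have "stage \<kappa> r x = 0" "(if positive_definite ?M \<and> ?p r \<noteq> 0 then ennreal c else 0) = 0" by (auto simp: stage_def)
    then show ?thesis unfolding st by simp
  qed
qed

lemma vol_rho_nonneg: "r < m \<Longrightarrow> vol_rho m r j q \<ge> 0"
  unfolding vol_rho_def
  by (intro divide_nonneg_nonneg mult_nonneg_nonneg pochhammer_nonneg less_imp_le[OF Gamma_real_pos] add_pos_nonneg add_nonneg_pos) auto

lemma stage_integral:
  assumes nm: "CARD('n::finite) \<le> CARD('m::finite)" and r: "r \<le> CARD('n)"
  shows "(\<integral>\<^sup>+z. stage \<kappa> r z \<partial>(\<Pi>\<^sub>M i\<in>(seg r :: 'n set). (lborel :: (real ^ 'm) measure)))
    = ennreal (\<Prod>i<r. vol_rho CARD('m) i (CARD('n) - Suc i) (\<kappa> i))"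
  using r
proof (induction r)
  case 0
  interpret product_sigma_finite "\<lambda>_::'n. lborel :: (real ^ 'm) measure" by standard
  \<comment> \<open>In this form the identity is covered by the lemmas on rank-one
    perturbations.\<close>
  have "residual {} z = mat 1 - outer 0" for z :: "'n \<Rightarrow> real ^ 'm" by (simp add: residual_def outer_def vec_eq_iff)
  then have "positive_definite (residual {} z)" "det (residual {} z) = 1" for z :: "'n \<Rightarrow> real ^ 'm"
    by (simp_all add: positive_definite_one_minus_outer det_one_minus_outer)
  then have "stage \<kappa> 0 z = 1" for z :: "'n \<Rightarrow> real ^ 'm" by (simp add: stage_def)
  then show ?case by (simp add: PiM_empty nn_integral_count_space_finite)
next
  case (Suc r)
  interpret product_sigma_finite "\<lambda>_::'n. lborel :: (real ^ 'm) measure" by standard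
  have r: "r < CARD('n)" using Suc.prems by simp
  let ?v = "\<lambda>i. vol_rho CARD('m) i (CARD('n) - Suc i) (\<kappa> i)"
  have v: "?v r \<ge> 0" using r nm by (intro vol_rho_nonneg) simp
  have "(\<integral>\<^sup>+z. stage \<kappa> (Suc r) z \<partial>(\<Pi>\<^sub>M i\<in>(seg (Suc r) :: 'n set). (lborel :: (real ^ 'm) measure)))
    = (\<integral>\<^sup>+x. (\<integral>\<^sup>+y. stage \<kappa> (Suc r) (x(ix r := y)) \<partial>lborel) \<partial>(\<Pi>\<^sub>M i\<in>(seg r :: 'n set). (lborel :: (real ^ 'm) measure)))"
    using stage_measurable[of "Suc r" "seg (Suc r) :: 'n set" \<kappa>] unfolding seg_Suc[OF r]
    by (intro product_nn_integral_insert) (auto simp: ix_notin_seg[OF r])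
  also have "\<dots> = (\<integral>\<^sup>+x. stage \<kappa> r x \<partial>(\<Pi>\<^sub>M i\<in>(seg r :: 'n set). (lborel :: (real ^ 'm) measure))) * ennreal (?v r)"
    unfolding stage_integral_step[OF nm r] by (rule nn_integral_multc) (rule stage_measurable, simp)
  finally show ?case using Suc.IH r v by (simp add: ennreal_mult''[symmetric])
qed

text \<open>A row lies in the span of the previous rows on a null set only.\<close>

lemma AE_pm_gramm_nonzero:
  assumes nm: "CARD('n::finite) \<le> CARD('m::finite)" and r: "r \<le> CARD('n)"
  shows "AE z in (\<Pi>\<^sub>M i\<in>(UNIV :: 'n set). (lborel :: (real ^ 'm) measure)). pm (seg r) (gramm z) \<noteq> 0"
  using r
proof (induction r)
  case (Suc r)
  interpret product_sigma_finite "\<lambda>_::'n. lborel :: (real ^ 'm) measure" by standard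
  have r: "r < CARD('n)" using Suc.prems by simp
  let ?i = "ix r :: 'n" and ?P = "\<lambda>I. \<Pi>\<^sub>M i\<in>(I :: 'n set). (lborel :: (real ^ 'm) measure)"
  define g where "g z = (if pm (seg r) (gramm z) \<noteq> 0 \<and> pm (seg (Suc r)) (gramm z) = 0 then 1 else 0 :: ennreal)"
    for z :: "'n \<Rightarrow> real ^ 'm"
  have [measurable]: "(\<lambda>z :: 'n \<Rightarrow> real ^ 'm. pm (seg k) (gramm z)) \<in> borel_measurable (?P UNIV)" for k
    by (rule pm_gramm_measurable) simp
  have gm: "g \<in> borel_measurable (?P UNIV)" unfolding g_def by measurable
  have U: "UNIV = insert ?i (UNIV - {?i})" by blast
  have "(\<integral>\<^sup>+z. g z \<partial>?P UNIV) = (\<integral>\<^sup>+x. (\<integral>\<^sup>+y. g (x(?i := y)) \<partial>lborel) \<partial>?P (UNIV - {?i}))"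
    using gm by (subst U, intro product_nn_integral_insert) (simp_all add: U[symmetric])
  also have "\<dots> = 0"
  proof -
    have "(\<integral>\<^sup>+y. g (x(?i := y)) \<partial>lborel) = 0" for x :: "'n \<Rightarrow> real ^ 'm"
    proof (cases "pm (seg r) (gramm x) = 0")
      case True
      have "pm (seg r) (gramm (x(?i := y))) = pm (seg r) (gramm x)" for y
        by (rule pm_gramm_cong) (use ix_notin_seg[OF r] in auto)
      then show ?thesis using True by (simp add: g_def)
    next
      case False
      let ?S = "span (x ` seg r)"
      have "dim ?S = r" by (rule dim_span_seg) (use False r in auto)
      then have "negligible ?S" using r nm by (intro negligible_lowdim) simp
      then have S0: "emeasure lborel ?S = 0"
        using negligible_iff_emeasure0[of ?S] closed_span[of "x ` seg r"] by (simp add: borel_closed)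
      have "g (x(?i := y)) = indicator ?S y" for y
      proof -
        have same: "j \<in> seg r \<Longrightarrow> (x(?i := y)) j = x j" for j using ix_notin_seg[OF r] by auto
        have im: "x(?i := y) ` seg r = x ` seg r" using same by (intro image_cong) auto
        have p: "pm (seg r) (gramm (x(?i := y))) = pm (seg r) (gramm x)" by (rule pm_gramm_cong) (rule same)
        have "?S \<noteq> {}" using span_zero[of "x ` seg r"] by (metis empty_iff)
        then have "infdist y ?S = 0 \<longleftrightarrow> y \<in> ?S" by (rule in_closed_iff_infdist_zero[symmetric, OF closed_span])
        then show ?thesis using False unfolding g_def pm_gramm_seg_Suc[OF r] im p by (simp add: indicator_def)
      qed
      then show ?thesis using S0 by (simp add: borel_closed)
    qed
    then show ?thesis by simp
  qed
  finally have "AE z in ?P UNIV. g z = 0" using gm by (simp add: nn_integral_0_iff_AE)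
  moreover have "AE z in ?P UNIV. pm (seg r) (gramm z) \<noteq> 0" using Suc by simp
  ultimately show ?case by eventually_elim (auto simp: g_def split: if_splits)
qed simp

section \<open>Lebesgue measure restricted to the strict contractions\<close>

definition contractions :: "(real ^ 'm ^ 'n) set" where
  "contractions = {Z. positive_definite (mat 1 - transpose Z ** Z)}"

lemma residual_rows: "residual UNIV (($) Z) = mat 1 - transpose Z ** Z"
  by (simp add: residual_def vec_eq_iff outer_def matrix_matrix_mult_def transpose_def)

lemma contractions_borel [measurable]: "(contractions :: (real ^ 'm ^ 'n) set) \<in> sets borel"
proof -
  have "continuous_on UNIV (\<lambda>Z :: real ^ 'm ^ 'n. mat 1 - transpose Z ** Z)"
    unfolding matrix_matrix_mult_def transpose_def by (intro continuous_intros)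
  then show ?thesis using measurable_sets[OF borel_measurable_continuous_onI positive_definite_borel]
    by (simp add: contractions_def vimage_def)
qed

text \<open>Multiplicative summation by parts; in use the last factor is 1, since a partition with
  at most \<open>N\<close> parts has \<open>a N = 0\<close>.\<close>

lemma prod_ratio_powers:
  fixes p :: "nat \<Rightarrow> real" and a :: "nat \<Rightarrow> nat"
  assumes "antimono a" "p 0 = 1" "\<And>i. i \<le> N \<Longrightarrow> p i \<noteq> 0"
  shows "(\<Prod>r<N. p (Suc r) ^ (a r - a (Suc r))) * p N ^ a N = (\<Prod>i<N. (p (Suc i) / p i) ^ a i)"
  using assms(3)
proof (induction N)
  case (Suc N)
  have "a (Suc N) \<le> a N" using assms(1) by (simp add: antimono_def)
  then have "p (Suc N) ^ (a N - a (Suc N)) * p (Suc N) ^ a (Suc N) = p (Suc N) ^ a N" by (simp add: power_add[symmetric])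
  then have "(\<Prod>r<Suc N. p (Suc r) ^ (a r - a (Suc r))) * p (Suc N) ^ a (Suc N)
    = ((\<Prod>r<N. p (Suc r) ^ (a r - a (Suc r))) * p N ^ a N) * (p (Suc N) / p N) ^ a N"
    using Suc.prems[of N] by (simp add: power_divide mult.assoc)
  then show ?case using Suc by simp
qed (simp add: assms(2))

text \<open>Off a null set all leading minors are nonzero, and there the power function is the
  product of the quotients in \<open>stage\<close>; at \<open>r = CARD('n)\<close> the determinant
  has exponent \<open>0\<close> and only the indicator of the contractions remains beside
  it.\<close>

theorem contractions_dlt:
  assumes nm: "CARD('n::finite) \<le> CARD('m::finite)" and \<kappa>: "\<kappa> \<in> parts CARD('n) k"
  shows "(\<integral>\<^sup>+Z. ennreal (dlt (lookup \<kappa>) (Z ** transpose Z)) * indicator contractions Z \<partial>(lborel :: (real ^ 'm ^ 'n) measure))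
    = ennreal (\<Prod>i<CARD('n). vol_rho CARD('m) i (CARD('n) - Suc i) (lookup \<kappa> i))"
proof -
  let ?P = "\<Pi>\<^sub>M i\<in>(UNIV :: 'n set). (lborel :: (real ^ 'm) measure)" and ?n = "CARD('n)"
  let ?f = "\<lambda>Z :: real ^ 'm ^ 'n. ennreal (dlt (lookup \<kappa>) (Z ** transpose Z)) * indicator contractions Z"
  have [measurable]: "(\<lambda>Z :: real ^ 'm ^ 'n. dlt (lookup \<kappa>) (Z ** transpose Z)) \<in> borel_measurable borel"
    by (intro pg_measurable pg_dlt pg_matrix_mult pg_transpose pg_entry)
  have "(\<integral>\<^sup>+Z. ?f Z \<partial>lborel) = (\<integral>\<^sup>+z. ?f (\<chi> i. z i) \<partial>?P)" by (rule nn_integral_lborel_vec) measurable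
  also have "\<dots> = (\<integral>\<^sup>+z. stage (lookup \<kappa>) ?n z \<partial>?P)"
  proof (rule nn_integral_cong_AE)
    have "AE z in ?P. \<forall>r\<in>{..?n}. pm (seg r) (gramm z) \<noteq> 0"
      by (rule AE_finite_allI) (auto intro: AE_pm_gramm_nonzero[OF nm])
    then show "AE z in ?P. ?f (\<chi> i. z i) = stage (lookup \<kappa>) ?n z"
    proof (rule AE_mp, intro AE_I2 impI)
      fix z :: "'n \<Rightarrow> real ^ 'm" assume nz: "\<forall>r\<in>{..?n}. pm (seg r) (gramm z) \<noteq> 0"
      define Z where "Z = (\<chi> i. z i)"
      have z: "z = ($) Z" by (auto simp: Z_def)
      have "antimono (lookup \<kappa>)" using \<kappa> by (simp add: parts_def)
      then have "dlt (lookup \<kappa>) (gramm z) = (\<Prod>i<?n. (pm (seg (Suc i)) (gramm z) / pm (seg i) (gramm z)) ^ lookup \<kappa> i)"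
        using prod_ratio_powers[of "lookup \<kappa>" "\<lambda>r. pm (seg r) (gramm z)" ?n] nz parts_zero_beyond[OF \<kappa>, of ?n]
        by (simp add: dlt_def)
      moreover have "Z ** transpose Z = gramm z" unfolding z by (rule gramm_rows)
      moreover have "residual UNIV z = mat 1 - transpose Z ** Z" unfolding z by (rule residual_rows)
      moreover have "pm UNIV (gramm z) \<noteq> 0" using bspec[OF nz, of ?n] by (simp add: seg_card)
      ultimately have "?f Z = stage (lookup \<kappa>) ?n z"
        by (auto simp: stage_def seg_card contractions_def indicator_def)
      then show "?f (\<chi> i. z i) = stage (lookup \<kappa>) ?n z" by (simp add: Z_def)
    qed
  qed
  also have "\<dots> = ennreal (\<Prod>i<?n. vol_rho CARD('m) i (?n - Suc i) (lookup \<kappa> i))"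
    using stage_integral[OF nm order_refl, of "lookup \<kappa>"] by (simp add: seg_card)
  finally show ?thesis .
qed

text \<open>Not normalised to a probability measure: its total mass is the \<open>k = 0\<close> term
  of the series in the end.\<close>

definition conM :: "(real ^ 'm ^ 'n) measure" where
  "conM = density lborel (indicator contractions)"

lemma sets_conM [simp, measurable_cong]: "sets conM = sets borel"
  and space_conM [simp]: "space conM = UNIV"
  by (simp_all add: conM_def space_density)

text \<open>Testing the definite matrix on coordinate vectors shows that every column has norm at
  most 1. Only boundedness is used later, so the bound is crude.\<close>

lemma contractions_norm: "Z \<in> contractions \<Longrightarrow> norm Z \<le> CARD('m)" for Z :: "real ^ 'm ^ 'n"
proof (rule power2_le_imp_le)
  assume Z: "Z \<in> contractions"
  have "(norm (column j Z))\<^sup>2 \<le> 1" for j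
  proof -
    have "axis j 1 \<noteq> (0 :: real ^ 'm)" by (simp add: axis_eq_0_iff)
    then have "0 < axis j 1 \<bullet> ((mat 1 - transpose Z ** Z) *v axis j 1)"
      using Z unfolding contractions_def positive_definite_def by blast
    also have "\<dots> = 1 - axis j 1 \<bullet> (transpose Z *v (Z *v axis j 1))"
      by (simp add: matrix_vector_mult_diff_rdistrib inner_diff_right inner_axis_axis matrix_vector_mul_assoc)
    also have "axis j 1 \<bullet> (transpose Z *v (Z *v axis j 1)) = (Z *v axis j 1) \<bullet> (Z *v axis j 1)"
      by (subst inner_matrix_vector) simp
    finally show ?thesis by (simp add: matrix_vector_mult_basis power2_norm_eq_inner)
  qed
  then have "(norm Z)\<^sup>2 \<le> (\<Sum>j\<in>(UNIV :: 'm set). 1)"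
    unfolding norm_sq_matrix norm_sq_column by (subst sum.swap) (intro sum_mono, auto)
  also have "\<dots> \<le> (real CARD('m))\<^sup>2" by (simp add: power2_eq_square)
  finally show "(norm Z)\<^sup>2 \<le> (real CARD('m))\<^sup>2" .
qed simp

lemma AE_conM: "AE Z in (conM :: (real ^ 'm ^ 'n) measure). Z \<in> contractions"
  unfolding conM_def by (subst AE_density) (auto simp: indicator_def)

lemma finite_conM: "finite_measure (conM :: (real ^ 'm ^ 'n) measure)"
proof
  have "emeasure (conM :: (real ^ 'm ^ 'n) measure) UNIV = emeasure lborel (contractions :: (real ^ 'm ^ 'n) set)"
    by (simp add: conM_def emeasure_density)
  also have "\<dots> < \<infinity>"
    by (rule emeasure_bounded_finite) (auto simp: bounded_iff dest: contractions_norm)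
  finally show "emeasure (conM :: (real ^ 'm ^ 'n) measure) (space conM) \<noteq> \<infinity>" by simp
qed

lemma has_moments_conM: "has_moments (conM :: (real ^ 'm ^ 'n) measure)"
  unfolding has_moments_def
proof (intro conjI allI)
  interpret finite_measure "conM :: (real ^ 'm ^ 'n) measure" by (rule finite_conM)
  fix p
  show "integrable conM (\<lambda>Z :: real ^ 'm ^ 'n. (1 + norm Z) ^ p)"
  proof (rule integrable_const_bound[where B = "(1 + real CARD('m)) ^ p"])
    show "AE Z in conM. norm ((1 + norm (Z :: real ^ 'm ^ 'n)) ^ p) \<le> (1 + real CARD('m)) ^ p"
      using AE_conM by eventually_elim (auto intro!: power_mono dest: contractions_norm)
  qed measurable
qed (auto intro: finite_conM)

lemma conM_isometry:
  fixes f :: "real ^ 'm ^ 'n \<Rightarrow> real ^ 'm ^ 'n"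
  assumes lin: "linear f" and iso: "\<And>Z. norm (f Z) = norm Z" and inv: "\<And>Z. f Z \<in> contractions \<longleftrightarrow> Z \<in> contractions"
  shows "distr conM borel f = conM"
proof -
  have [measurable]: "f \<in> borel_measurable borel" by (rule linear_borel_measurable[OF lin])
  have "indicator contractions (f Z) = (indicator contractions Z :: ennreal)" for Z by (simp add: indicator_def inv)
  then have "distr conM borel f = distr (density lborel (\<lambda>Z. indicator contractions (f Z))) borel f" by (simp add: conM_def)
  also have "\<dots> = density (distr lborel borel f) (indicator contractions)"
    by (rule density_distr[symmetric]) auto
  finally show ?thesis by (simp add: lborel_isometry[OF lin iso] conM_def)
qed

lemma conM_left: "orthogonal_matrix U \<Longrightarrow> distr conM borel (\<lambda>Z :: real ^ 'm ^ 'n. U ** Z) = conM"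
proof (rule conM_isometry)
  assume U: "orthogonal_matrix U"
  have "transpose (U ** Z) ** (U ** Z) = transpose Z ** (transpose U ** U) ** Z" for Z :: "real ^ 'm ^ 'n"
    by (simp add: matrix_transpose_mul matrix_mul_assoc)
  then have "transpose (U ** Z) ** (U ** Z) = transpose Z ** Z" for Z :: "real ^ 'm ^ 'n"
    using U by (simp add: orthogonal_matrix_def)
  then show "U ** Z \<in> contractions \<longleftrightarrow> Z \<in> contractions" for Z :: "real ^ 'm ^ 'n" by (simp add: contractions_def)
qed (auto simp: linear_left_mult norm_orthogonal_left)

lemma conM_right: "orthogonal_matrix U \<Longrightarrow> distr conM borel (\<lambda>Z :: real ^ 'm ^ 'n. Z ** U) = conM"
proof (rule conM_isometry)
  assume U: "orthogonal_matrix U"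
  have "mat 1 - transpose (Z ** U) ** (Z ** U) = transpose U ** (mat 1 - transpose Z ** Z) ** U" for Z :: "real ^ 'm ^ 'n"
    using U by (simp add: matrix_transpose_mul matrix_mul_assoc matrix_diff_ldistrib matrix_diff_rdistrib orthogonal_matrix_def)
  moreover have "det U \<noteq> 0" using det_orthogonal_matrix[OF U] by auto
  ultimately show "Z ** U \<in> contractions \<longleftrightarrow> Z \<in> contractions" for Z :: "real ^ 'm ^ 'n"
    by (simp add: contractions_def positive_definite_conj)
qed (auto simp: linear_right_mult norm_orthogonal_right)

lemma integral_conM_dlt:
  assumes nm: "CARD('n::finite) \<le> CARD('m::finite)" and \<kappa>: "\<kappa> \<in> parts CARD('n) k"
  shows "(\<integral>Z. dlt (lookup \<kappa>) (Z ** transpose Z) \<partial>(conM :: (real ^ 'm ^ 'n) measure))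
    = (\<Prod>i<CARD('n). vol_rho CARD('m) i (CARD('n) - Suc i) (lookup \<kappa> i))"
proof -
  have [measurable]: "(\<lambda>Z :: real ^ 'm ^ 'n. dlt (lookup \<kappa>) (Z ** transpose Z)) \<in> borel_measurable borel"
    by (intro pg_measurable pg_dlt pg_matrix_mult pg_transpose pg_entry)
  have "(\<integral>\<^sup>+Z. ennreal (dlt (lookup \<kappa>) (Z ** transpose Z)) \<partial>(conM :: (real ^ 'm ^ 'n) measure))
    = (\<integral>\<^sup>+Z. ennreal (dlt (lookup \<kappa>) (Z ** transpose Z)) * indicator contractions Z \<partial>(lborel :: (real ^ 'm ^ 'n) measure))"
    unfolding conM_def by (subst nn_integral_density) (auto simp: mult.commute)
  also note contractions_dlt[OF nm \<kappa>]
  finally have "(\<integral>Z. dlt (lookup \<kappa>) (Z ** transpose Z) \<partial>(conM :: (real ^ 'm ^ 'n) measure))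
      = enn2real (ennreal (\<Prod>i<CARD('n). vol_rho CARD('m) i (CARD('n) - Suc i) (lookup \<kappa> i)))"
    by (subst integral_eq_nn_integral) (simp_all, simp add: gramm_rows dlt_gramm_nonneg)
  also have "\<dots> = (\<Prod>i<CARD('n). vol_rho CARD('m) i (CARD('n) - Suc i) (lookup \<kappa> i))"
    using nm by (intro enn2real_ennreal prod_nonneg ballI vol_rho_nonneg) auto
  finally show ?thesis .
qed

text \<open>Left invariance expands the power of the trace with the identity as outer factor, whence
  the value of \<open>sph\<close> at 1 for \<open>'n\<close>. Right invariance, through
  \<open>dlt_mean_proportional_rect\<close>, then extracts the dependence on \<open>a\<close>,
  normalised by the value at 1 for \<open>'m\<close>.\<close>

theorem integral_conM_trace_power:
  assumes nm: "CARD('n::finite) \<le> CARD('m::finite)" and a: "\<And>i. a i \<ge> 0"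
  shows "(\<integral>Z. trace (Z ** dg a ** transpose Z) ^ k \<partial>(conM :: (real ^ 'm ^ 'n) measure))
    = (\<Sum>\<kappa>\<in>parts CARD('n) k. gam TYPE('n) \<kappa> * sph TYPE('n) \<kappa> (\<lambda>_. 1) *
        (\<Prod>i<CARD('n). vol_rho CARD('m) i (CARD('n) - Suc i) (lookup \<kappa> i)) * sph TYPE('m) \<kappa> a / sph TYPE('m) \<kappa> (\<lambda>_. 1))"
proof -
  let ?\<mu> = "conM :: (real ^ 'm ^ 'n) measure"
  have "(\<integral>Z. trace (diagm (\<lambda>i. sqrt 1) ** (Z ** dg a ** transpose Z) ** diagm (\<lambda>i. sqrt 1)) ^ k \<partial>?\<mu>)
    = (\<Sum>\<kappa>\<in>parts CARD('n) k. gam TYPE('n) \<kappa> * vh (lookup \<kappa>) (diagm (\<lambda>i::'n. 1)) * (\<integral>Z. dlt (lookup \<kappa>) (Z ** dg a ** transpose Z) \<partial>?\<mu>))"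
    using has_moments_conM conM_left trace_power_gam by (rule expansion_mean[where q = lookup]) auto
  then have "(\<integral>Z. trace (Z ** dg a ** transpose Z) ^ k \<partial>?\<mu>)
    = (\<Sum>\<kappa>\<in>parts CARD('n) k. gam TYPE('n) \<kappa> * sph TYPE('n) \<kappa> (\<lambda>_. 1) * (\<integral>Z. dlt (lookup \<kappa>) (Z ** dg a ** transpose Z) \<partial>?\<mu>))"
    by (simp add: sph_def mat_eq_diagm[symmetric])
  also have "\<dots> = (\<Sum>\<kappa>\<in>parts CARD('n) k. gam TYPE('n) \<kappa> * sph TYPE('n) \<kappa> (\<lambda>_. 1) *
        (\<Prod>i<CARD('n). vol_rho CARD('m) i (CARD('n) - Suc i) (lookup \<kappa> i)) * sph TYPE('m) \<kappa> a / sph TYPE('m) \<kappa> (\<lambda>_. 1))"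
  proof (rule sum.cong[OF refl])
    fix \<kappa> assume \<kappa>: "\<kappa> \<in> parts CARD('n) k"
    have "(\<integral>Z. dlt (lookup \<kappa>) (Z ** dg a ** transpose Z) \<partial>?\<mu>) * sph TYPE('m) \<kappa> (\<lambda>_. 1)
      = (\<integral>Z. dlt (lookup \<kappa>) (Z ** transpose Z) \<partial>?\<mu>) * sph TYPE('m) \<kappa> a"
      using nm has_moments_conM conM_right \<kappa> a by (rule dlt_mean_proportional_rect)
    then show "gam TYPE('n) \<kappa> * sph TYPE('n) \<kappa> (\<lambda>_. 1) * (\<integral>Z. dlt (lookup \<kappa>) (Z ** dg a ** transpose Z) \<partial>?\<mu>)
      = gam TYPE('n) \<kappa> * sph TYPE('n) \<kappa> (\<lambda>_. 1) *
        (\<Prod>i<CARD('n). vol_rho CARD('m) i (CARD('n) - Suc i) (lookup \<kappa> i)) * sph TYPE('m) \<kappa> a / sph TYPE('m) \<kappa> (\<lambda>_. 1)"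
      using sph_one_pos[of \<kappa>, where 'm = 'm] unfolding integral_conM_dlt[OF nm \<kappa>] by (simp add: field_simps)
  qed
  finally show ?thesis .
qed

text \<open>Row \<open>i\<close> has \<open>j = n - 1 - i\<close>, so \<open>j / 2 + 1\<close> is
  \<open>(n + 1) / 2 - i / 2\<close>, and its Pochhammer symbol starts at
  \<open>(m - i) / 2\<close>. These are the factors of the multivariate objects; the powers of
  \<open>pi\<close> in the multivariate gamma functions cancel in the quotient, and
  \<open>sqrt pi ^ m\<close> from every row remains.\<close>

lemma prod_vol_rho:
  assumes nm: "n \<le> m" and \<kappa>: "\<kappa> \<in> parts n k"
  shows "(\<Prod>i<n. vol_rho m i (n - Suc i) (lookup \<kappa> i))
    = pi powr (real n * real m / 2) * multivariate_Gamma n ((real n + 1) / 2) / multivariate_Gamma n ((real n + real m + 1) / 2) *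
      (gen_pochhammer (real m / 2) \<kappa> / gen_pochhammer ((real n + real m + 1) / 2) \<kappa>)"
proof -
  define c where "c = (real n + real m + 1) / 2"
  have keys: "keys \<kappa> \<subseteq> {..<n}" using \<kappa> by (simp add: parts_def Mon_def)
  have gp: "gen_pochhammer a \<kappa> = (\<Prod>i<n. pochhammer (a - real i / 2) (lookup \<kappa> i))" for a
    unfolding gen_pochhammer_def by (rule prod.mono_neutral_left) (use keys in \<open>auto simp: in_keys_iff\<close>)
  have mg: "multivariate_Gamma n b = pi powr (real n * (real n - 1) / 4) * (\<Prod>i<n. Gamma (b - real i / 2))" for b :: real
  proof -
    have "(\<Prod>i=1..n. Gamma (b - (real i - 1) / 2)) = (\<Prod>i<n. Gamma (b - real i / 2))"
      by (rule prod.reindex_bij_witness[of _ Suc "\<lambda>i. i - 1"]) (auto simp: of_nat_diff)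
    then show ?thesis by (simp add: multivariate_Gamma_def)
  qed
  have v: "vol_rho m i (n - Suc i) q = sqrt pi ^ m * (Gamma ((real n + 1) / 2 - real i / 2) / Gamma (c - real i / 2)) *
      (pochhammer (real m / 2 - real i / 2) q / pochhammer (c - real i / 2) q)" if "i < n" for i q
  proof -
    have e1: "real (m - i) / 2 = real m / 2 - real i / 2" using that nm by (simp add: of_nat_diff diff_divide_distrib)
    have e2: "real (n - Suc i) / 2 + 1 = (real n + 1) / 2 - real i / 2" using that by (simp add: of_nat_diff field_simps)
    have e3: "(real n + 1) / 2 - real i / 2 + real m / 2 = c - real i / 2" by (simp add: c_def field_simps)
    have "c - real i / 2 > 0" using that by (simp add: c_def field_simps)
    then have "pochhammer (c - real i / 2) q = Gamma (c - real i / 2 + real q) / Gamma (c - real i / 2)"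
      by (intro pochhammer_Gamma) (auto elim!: nonpos_Ints_cases)
    moreover have "Gamma (c - real i / 2) > 0" using \<open>c - real i / 2 > 0\<close> by (rule Gamma_real_pos)
    ultimately have "Gamma (c - real i / 2 + real q) = Gamma (c - real i / 2) * pochhammer (c - real i / 2) q" by simp
    then show ?thesis unfolding vol_rho_def e1 e2 e3 by simp
  qed
  have "(\<Prod>i<n. vol_rho m i (n - Suc i) (lookup \<kappa> i)) = (sqrt pi ^ m) ^ n *
    ((\<Prod>i<n. Gamma ((real n + 1) / 2 - real i / 2)) / (\<Prod>i<n. Gamma (c - real i / 2))) *
    (gen_pochhammer (real m / 2) \<kappa> / gen_pochhammer c \<kappa>)"
    unfolding gp by (simp add: v prod.distrib prod_dividef)
  also have "(sqrt pi ^ m) ^ n = pi powr (real n * real m / 2)"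
    by (simp add: powr_half_sqrt[symmetric] powr_powr powr_realpow[symmetric] power_mult[symmetric] mult.commute)
  finally show ?thesis unfolding mg c_def[symmetric] by simp
qed

section \<open>Zonal polynomials of symmetric matrices\<close>

lemma proots_linear_product: "proots (\<Prod>x\<leftarrow>xs. [:- x, 1:]) = mset xs" for xs :: "real list"
proof (induction xs)
  case (Cons x xs)
  have "(\<Prod>x\<leftarrow>xs. [:- x, 1:]) \<noteq> 0" by (auto simp: prod_list_zero_iff)
  then show ?case using Cons by (simp add: proots_mult del: mult_pCons_left)
qed simp

text \<open>Equality of the products for all \<open>t\<close> is equality of polynomials, whose
  roots with multiplicity form the same multiset; sorting makes the list unique.\<close>

lemma eigenvalues_eq:
  fixes A :: "real ^ 'm ^ 'm"
  assumes U: "orthogonal_matrix U" "A = transpose U ** diagm d ** U"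
  shows "eigenvalues A = rev (sort (map (\<lambda>l. d (ix l)) [0..<CARD('m)]))"
proof -
  let ?ds = "map (\<lambda>l. d (ix l)) [0..<CARD('m)]"
  have det: "det (mat t - A) = (\<Prod>x\<leftarrow>?ds. t - x)" for t
  proof -
    have UU: "transpose U ** U = mat 1" using U(1) by (simp add: orthogonal_matrix_def)
    have "mat t - A = transpose U ** (diagm (\<lambda>_. t) - diagm d) ** U"
    proof -
      have "diagm (\<lambda>_. t) = t *\<^sub>R (mat 1 :: real ^ 'm ^ 'm)" by (simp add: diagm_def mat_def vec_eq_iff)
      then have "transpose U ** diagm (\<lambda>_. t) ** U = t *\<^sub>R (transpose U ** U)" by (simp add: scalar_matrix_assoc matrix_scalar_ac)
      also have "\<dots> = mat t" unfolding UU by (simp add: mat_def vec_eq_iff)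
      finally show ?thesis by (simp add: U(2) matrix_diff_ldistrib matrix_diff_rdistrib)
    qed
    moreover have "diagm (\<lambda>_. t) - diagm d = diagm (\<lambda>i. t - d i)" by (simp add: diagm_def vec_eq_iff)
    moreover have "det U * det U = 1" using det_orthogonal_matrix[OF U(1)] by auto
    ultimately have "det (mat t - A) = (\<Prod>i\<in>UNIV. t - d i)"
      by (simp add: det_mul det_diagm mult.assoc mult.left_commute)
    also have "\<dots> = (\<Prod>l<CARD('m). t - d (ix l))" by (rule prod_ix)
    also have "\<dots> = (\<Prod>x\<leftarrow>?ds. t - x)"
      by (simp add: prod.list_conv_set_nth atLeast0LessThan)
    finally show ?thesis .
  qed
  have same: "(\<Prod>x\<leftarrow>xs. t - x) = (\<Prod>x\<leftarrow>ys. t - x)" if "mset xs = mset ys" for xs ys :: "real list" and t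
    using that by (metis mset_map prod_mset_prod_list)
  show ?thesis unfolding eigenvalues_def
  proof (rule the_equality)
    have "sorted (sort ?ds)" by simp
    then show "sorted_wrt (\<ge>) (rev (sort ?ds)) \<and> length (rev (sort ?ds)) = CARD('m) \<and>
        (\<forall>t. det (mat t - A) = (\<Prod>x\<leftarrow>rev (sort ?ds). t - x))"
      using same[of "rev (sort ?ds)" ?ds] by (simp add: det sorted_wrt_rev)
  next
    fix xs assume xs: "sorted_wrt (\<ge>) xs \<and> length xs = CARD('m) \<and> (\<forall>t. det (mat t - A) = (\<Prod>x\<leftarrow>xs. t - x))"
    have p: "poly (\<Prod>x\<leftarrow>zs. [:- x, 1:]) t = (\<Prod>x\<leftarrow>zs. t - x)" for zs and t :: real
      by (induction zs) (auto simp: left_diff_distrib)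
    have "(\<Prod>x\<leftarrow>xs. [:- x, 1:]) = (\<Prod>x\<leftarrow>?ds. [:- x, 1:])"
      unfolding poly_eq_poly_eq_iff[symmetric] fun_eq_iff p using xs det by metis
    then have "mset xs = mset ?ds" by (metis proots_linear_product)
    moreover have "sorted (rev xs)" using xs by (simp add: sorted_wrt_rev)
    ultimately have "sort ?ds = rev xs" by (intro properties_for_sort) auto
    then show "xs = rev (sort ?ds)" by simp
  qed
qed

lemma sph_cong: "(\<And>i. i < CARD('m) \<Longrightarrow> x i = y i) \<Longrightarrow> sph TYPE('m::finite) \<kappa> x = sph TYPE('m) \<kappa> y"
  by (simp add: sph_def)

text \<open>The sorted eigenvalues are a rearrangement of \<open>d\<close>, and \<open>sph\<close>
  is symmetric.\<close>

theorem zonal_symmetric: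
  fixes A :: "real ^ 'm ^ 'm"
  assumes U: "orthogonal_matrix U" "A = transpose U ** diagm d ** U" and \<kappa>: "\<kappa> \<in> parts CARD('m) k"
  shows "zonal \<kappa> A = gam TYPE('m) \<kappa> * sph TYPE('m) \<kappa> (\<lambda>l. d (ix l))"
proof -
  let ?ds = "map (\<lambda>l. d (ix l)) [0..<CARD('m)]"
  have "mset (eigenvalues A) = mset ?ds" by (simp add: eigenvalues_eq[OF U])
  then obtain \<pi> where \<pi>: "\<pi> permutes {..<length ?ds}" "permute_list \<pi> ?ds = eigenvalues A"
    by (rule mset_eq_permutation)
  have pm: "\<pi> permutes {..<CARD('m)}" using \<pi>(1) by simp
  have "sph TYPE('m) \<kappa> (\<lambda>i. eigenvalues A ! i) = sph TYPE('m) \<kappa> ((\<lambda>l. d (ix l)) \<circ> \<pi>)"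
  proof (rule sph_cong)
    fix i assume i: "i < CARD('m)"
    then have "\<pi> i < CARD('m)" using permutes_in_image[OF pm, of i] by simp
    then show "eigenvalues A ! i = ((\<lambda>l. d (ix l)) \<circ> \<pi>) i"
      using i permute_list_nth[OF \<pi>(1), of i] by (simp add: \<pi>(2)[symmetric])
  qed
  also have "\<dots> = sph TYPE('m) \<kappa> (\<lambda>l. d (ix l))" by (rule sph_permute[OF pm])
  finally show ?thesis by (simp add: zonal_def zonal_poly_eval[OF \<kappa>])
qed

text \<open>Homogeneity of degree \<open>k\<close>. It carries the sign of the argument of the
  hypergeometric function, since the integral formulas hold for nonnegative arguments.\<close>

lemma sph_minus:
  assumes "\<kappa> \<in> parts CARD('m::finite) k"
  shows "sph TYPE('m) \<kappa> (\<lambda>i. - x i) = (- 1) ^ k * sph TYPE('m) \<kappa> x"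
proof -
  have "mono_eval \<alpha> (\<lambda>i. - x i) = (- 1) ^ k * mono_eval \<alpha> x" if \<alpha>: "\<alpha> \<in> Mon CARD('m) k" for \<alpha>
  proof -
    have k: "keys \<alpha> \<subseteq> {..<CARD('m)}" "(\<Sum>i<CARD('m). lookup \<alpha> i) = k" using \<alpha> by (simp_all add: Mon_def psum_def)
    have "mono_eval \<alpha> (\<lambda>i. - x i) = (\<Prod>i<CARD('m). (- 1) ^ lookup \<alpha> i * x i ^ lookup \<alpha> i)"
      unfolding mono_eval_lessThan[OF k(1)] by (intro prod.cong refl) (rule power_minus)
    also have "\<dots> = (- 1) ^ (\<Sum>i<CARD('m). lookup \<alpha> i) * mono_eval \<alpha> x"
      unfolding mono_eval_lessThan[OF k(1)] by (simp add: prod.distrib power_sum)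
    finally show ?thesis by (simp only: k(2))
  qed
  then show ?thesis unfolding sphc(3)[OF assms] sum_distrib_left by (intro sum.cong) auto
qed

section \<open>The largest eigenvalue\<close>

text \<open>Contractions are bounded, so the trace is bounded by a constant \<open>K\<close>, and
  the exponential series of \<open>K\<close> dominates the termwise integrals.\<close>

lemma integral_conM_exp:
  fixes B :: "real ^ 'm ^ 'm"
  shows "(\<lambda>k. (- 1) ^ k / fact k * (\<integral>Z. trace (Z ** B ** transpose Z) ^ k \<partial>(conM :: (real ^ 'm ^ 'n) measure)))
    sums (\<integral>Z. exp (- trace (Z ** B ** transpose Z)) \<partial>(conM :: (real ^ 'm ^ 'n) measure))"
proof -
  let ?\<mu> = "conM :: (real ^ 'm ^ 'n) measure" and ?t = "\<lambda>Z :: real ^ 'm ^ 'n. trace (Z ** B ** transpose Z)"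
  interpret finite_measure ?\<mu> by (rule finite_conM)
  have pt: "pg ?t" by (intro pg_trace pg_matrix_mult pg_transpose pg_entry pg_const)
  have pk: "pg (\<lambda>Z. (- 1) ^ k / fact k * ?t Z ^ k)" for k by (intro pg_mult pg_const pg_power pt)
  obtain C p where C: "C \<ge> 0" "\<And>Z. \<bar>?t Z\<bar> \<le> C * (1 + norm Z) ^ p" using pgE[OF pt] by metis
  define K where "K = C * (1 + real CARD('m)) ^ p"
  have K: "AE Z in ?\<mu>. \<bar>?t Z\<bar> \<le> K"
    using AE_conM
  proof eventually_elim
    fix Z :: "real ^ 'm ^ 'n" assume "Z \<in> contractions"
    then have "(1 + norm Z) ^ p \<le> (1 + real CARD('m)) ^ p" by (intro power_mono) (auto dest: contractions_norm)
    then show "\<bar>?t Z\<bar> \<le> K" using C(2)[of Z] C(1) unfolding K_def by (meson mult_left_mono order_trans)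
  qed
  have b: "(\<integral>Z. norm ((- 1) ^ k / fact k * ?t Z ^ k) \<partial>?\<mu>) \<le> measure ?\<mu> UNIV * (K ^ k / fact k)" for k
  proof -
    have "(\<integral>Z. norm ((- 1) ^ k / fact k * ?t Z ^ k) \<partial>?\<mu>) \<le> (\<integral>Z. K ^ k / fact k \<partial>?\<mu>)"
    proof (rule integral_mono_AE)
      show "integrable ?\<mu> (\<lambda>Z. norm ((- 1) ^ k / fact k * ?t Z ^ k))"
        by (intro integrable_norm integrable_pg[OF has_moments_conM pk])
      show "AE Z in ?\<mu>. norm ((- 1) ^ k / fact k * ?t Z ^ k) \<le> K ^ k / fact k"
        using K by eventually_elim (simp add: abs_mult power_abs divide_right_mono power_mono)
    qed simp
    then show ?thesis by simp
  qed
  have ex: "exp (- ?t Z) = suminf (\<lambda>k. (- 1) ^ k / fact k * ?t Z ^ k)" for Z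
  proof -
    have "(\<lambda>k. (- ?t Z) ^ k /\<^sub>R fact k) = (\<lambda>k. (- 1) ^ k / fact k * ?t Z ^ k)"
      by (auto simp: power_minus[of "?t Z"] divide_inverse mult_ac)
    then show ?thesis by (simp add: exp_def)
  qed
  have "(\<lambda>k. \<integral>Z. (- 1) ^ k / fact k * ?t Z ^ k \<partial>?\<mu>) sums (\<integral>Z. exp (- ?t Z) \<partial>?\<mu>)"
    unfolding ex
  proof (rule sums_integral)
    show "integrable ?\<mu> (\<lambda>Z. (- 1) ^ k / fact k * ?t Z ^ k)" for k by (rule integrable_pg[OF has_moments_conM pk])
    show "AE Z in ?\<mu>. summable (\<lambda>k. norm ((- 1) ^ k / fact k * ?t Z ^ k))"
    proof (rule AE_I2)
      fix Z
      have "(\<lambda>k. norm ((- 1) ^ k / fact k * ?t Z ^ k)) = (\<lambda>k. \<bar>?t Z\<bar> ^ k /\<^sub>R fact k)"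
        by (auto simp: abs_mult power_abs divide_inverse mult_ac)
      then show "summable (\<lambda>k. norm ((- 1) ^ k / fact k * ?t Z ^ k))" by (simp only: summable_exp_generic)
    qed
    show "summable (\<lambda>k. \<integral>Z. norm ((- 1) ^ k / fact k * ?t Z ^ k) \<partial>?\<mu>)"
    proof (rule summable_comparison_test')
      have "summable (\<lambda>k. K ^ k /\<^sub>R fact k)" by (rule summable_exp_generic)
      then have "summable (\<lambda>k. K ^ k / fact k)" by (simp add: divide_inverse mult.commute)
      then show "summable (\<lambda>k. measure ?\<mu> UNIV * (K ^ k / fact k))" by (rule summable_mult)
      show "norm (\<integral>Z. norm ((- 1) ^ k / fact k * ?t Z ^ k) \<partial>?\<mu>) \<le> measure ?\<mu> UNIV * (K ^ k / fact k)" if "k \<ge> 0" for k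
      proof -
        have "(\<integral>Z. norm ((- 1) ^ k / fact k * ?t Z ^ k) \<partial>?\<mu>) \<ge> 0" by (rule Bochner_Integration.integral_nonneg) simp
        then show ?thesis using b[of k] by simp
      qed
    qed
  qed
  then show ?thesis by simp
qed

text \<open>The set under \<open>Max\<close> is the range of the diagonal \<open>d\<close>, finite
  and nonempty, and definiteness of \<open>mat x - A\<close> says that all \<open>d i\<close> lie
  below \<open>x\<close>.\<close>

lemma largest_eigenvalue_less_iff:
  fixes A :: "real ^ 'm ^ 'm"
  assumes "transpose A = A"
  shows "largest_eigenvalue A < x \<longleftrightarrow> positive_definite (mat x - A)"
proof -
  obtain U d where U: "orthogonal_matrix U" "A = transpose U ** diagm d ** U"
    using symmetric_diagonalization[OF assms] by blast
  have UU: "transpose U ** U = mat 1" "U ** transpose U = mat 1" using U(1) by (simp_all add: orthogonal_matrix_def)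
  have ev: "A *v v = l *\<^sub>R v \<longleftrightarrow> diagm d *v (U *v v) = l *\<^sub>R (U *v v)" for v l
  proof
    assume "A *v v = l *\<^sub>R v"
    then have "U *v (A *v v) = l *\<^sub>R (U *v v)" by (simp add: matrix_vector_mult_scaleR)
    moreover have "U *v (A *v v) = diagm d *v (U *v v)"
      unfolding U(2) by (simp only: matrix_vector_mul_assoc matrix_mul_assoc UU matrix_mul_lid)
    ultimately show "diagm d *v (U *v v) = l *\<^sub>R (U *v v)" by simp
  next
    assume "diagm d *v (U *v v) = l *\<^sub>R (U *v v)"
    then have "transpose U *v (diagm d *v (U *v v)) = l *\<^sub>R (transpose U *v (U *v v))" by (simp only: matrix_vector_mult_scaleR)
    then show "A *v v = l *\<^sub>R v" unfolding orthogonal_matrix_ex_vec(2)[OF U(1)] U(2) by (simp only: matrix_vector_mul_assoc matrix_mul_assoc)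
  qed
  have E: "{l. \<exists>v. v \<noteq> 0 \<and> A *v v = l *\<^sub>R v} = range d"
  proof (intro equalityI subsetI)
    fix l assume "l \<in> {l. \<exists>v. v \<noteq> 0 \<and> A *v v = l *\<^sub>R v}"
    then obtain v where v: "v \<noteq> 0" "diagm d *v (U *v v) = l *\<^sub>R (U *v v)" using ev by blast
    have "U *v v \<noteq> 0" using v(1) orthogonal_matrix_ex_vec(2)[OF U(1), of v] by auto
    then obtain i where "(U *v v) $ i \<noteq> 0" by (auto simp: vec_eq_iff)
    moreover have "d i * (U *v v) $ i = l * (U *v v) $ i" using v(2) by (simp add: vec_eq_iff diagm_mult_vec)
    ultimately show "l \<in> range d" by (metis mult_right_cancel rangeI)
  next
    fix l assume "l \<in> range d"
    then obtain i where l: "l = d i" by blast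
    define v where "v = transpose U *v axis i 1"
    have Uv: "U *v v = axis i 1" unfolding v_def by (rule orthogonal_matrix_ex_vec(1)[OF U(1)])
    then have "v \<noteq> 0" by (auto simp: axis_eq_0_iff)
    moreover have "A *v v = l *\<^sub>R v" unfolding ev Uv l by (simp add: vec_eq_iff diagm_mult_vec axis_def)
    ultimately show "l \<in> {l. \<exists>v. v \<noteq> 0 \<and> A *v v = l *\<^sub>R v}" by blast
  qed
  have "mat x - A = transpose U ** (mat x - diagm d) ** U"
  proof -
    have "mat x = x *\<^sub>R (mat 1 :: real ^ 'm ^ 'm)" by (simp add: mat_def vec_eq_iff)
    moreover have "transpose U ** (x *\<^sub>R mat 1) ** U = x *\<^sub>R (transpose U ** U)" by (simp add: scalar_matrix_assoc matrix_scalar_ac)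
    ultimately have "transpose U ** mat x ** U = mat x" by (simp add: UU)
    then show ?thesis by (simp add: U(2) matrix_diff_ldistrib matrix_diff_rdistrib)
  qed
  moreover have "mat x - diagm d = diagm (\<lambda>i. x - d i)" by (auto simp: mat_def diagm_def vec_eq_iff)
  moreover have "det U \<noteq> 0" using det_orthogonal_matrix[OF U(1)] by auto
  ultimately have "positive_definite (mat x - A) \<longleftrightarrow> positive_definite (diagm (\<lambda>i. x - d i))"
    by (simp add: positive_definite_conj)
  also have "\<dots> \<longleftrightarrow> (\<forall>i. d i < x)"
  proof
    assume pd: "positive_definite (diagm (\<lambda>i. x - d i))"
    show "\<forall>i. d i < x"
    proof
      fix i :: 'm
      have "axis i 1 \<noteq> (0 :: real ^ 'm)" by (simp add: axis_eq_0_iff)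
      then have "0 < axis i 1 \<bullet> (diagm (\<lambda>i. x - d i) *v axis i 1)" using pd unfolding positive_definite_def by blast
      then show "d i < x" by (simp add: inner_axis' diagm_mult_vec)
    qed
  next
    assume d: "\<forall>i. d i < x"
    then have "psd (diagm (\<lambda>i. x - d i))" by (intro psd_diagm) (simp add: less_imp_le)
    moreover have "det (diagm (\<lambda>i. x - d i)) \<noteq> 0" using d by (auto simp: det_diagm prod_zero_iff)
    ultimately show "positive_definite (diagm (\<lambda>i. x - d i))" by (simp add: positive_definite_iff)
  qed
  finally show ?thesis unfolding largest_eigenvalue_def E by simp
qed

lemma scaled_contraction_iff:
  fixes Z :: "real ^ 'm ^ 'n"
  assumes x: "x > 0"
  shows "largest_eigenvalue (transpose (sqrt x *\<^sub>R Z) ** (sqrt x *\<^sub>R Z)) < x \<longleftrightarrow> Z \<in> contractions"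
proof -
  have e: "mat x - transpose (sqrt x *\<^sub>R Z) ** (sqrt x *\<^sub>R Z) = x *\<^sub>R (mat 1 - transpose Z ** Z)"
  proof -
    have "transpose (sqrt x *\<^sub>R Z) ** (sqrt x *\<^sub>R Z) = x *\<^sub>R (transpose Z ** Z)"
    proof -
      have "(\<Sum>k\<in>UNIV. (sqrt x * Z $ k $ i) * (sqrt x * Z $ k $ j)) = x * (\<Sum>k\<in>UNIV. Z $ k $ i * Z $ k $ j)" for i j
        unfolding sum_distrib_left
      proof (intro sum.cong refl)
        fix k
        have "sqrt x * sqrt x = x" using x by simp
        then show "(sqrt x * Z $ k $ i) * (sqrt x * Z $ k $ j) = x * (Z $ k $ i * Z $ k $ j)"
          using mult.assoc[of "sqrt x" "sqrt x" "Z $ k $ i * Z $ k $ j"] by (simp only: mult_ac)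
      qed
      then show ?thesis by (simp add: vec_eq_iff matrix_matrix_mult_def transpose_def)
    qed
    moreover have "mat x = x *\<^sub>R (mat 1 :: real ^ 'm ^ 'm)" by (simp add: mat_def vec_eq_iff)
    ultimately show ?thesis by (simp add: scaleR_diff_right)
  qed
  have "positive_definite (x *\<^sub>R (mat 1 - transpose Z ** Z)) \<longleftrightarrow> positive_definite (mat 1 - transpose Z ** Z)"
  proof -
    have "transpose (x *\<^sub>R C) = x *\<^sub>R transpose C" for C :: "real ^ 'm ^ 'm" by (simp add: transpose_def vec_eq_iff)
    then show ?thesis using x unfolding positive_definite_def
      by (simp add: scaleR_matrix_vector_assoc[symmetric] zero_less_mult_iff)
  qed
  then show ?thesis
    by (subst largest_eigenvalue_less_iff) (simp_all add: matrix_transpose_mul e contractions_def)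
qed

section \<open>From the law of the columns to an integral over contractions\<close>

lemma trace_sandwich_rows: "trace (Z ** B ** transpose Z) = (\<Sum>j\<in>UNIV. (Z $ j) \<bullet> (B *v (Z $ j)))" for Z :: "real ^ 'm ^ 'n"
proof -
  have "(Z ** B ** transpose Z) $ j $ j = (Z $ j) \<bullet> (B *v (Z $ j))" for j
  proof -
    have "(Z ** B ** transpose Z) $ j $ j = (\<Sum>k\<in>UNIV. (\<Sum>i\<in>UNIV. Z $ j $ i * B $ i $ k) * Z $ j $ k)"
      by (simp add: matrix_matrix_mult_def transpose_def)
    also have "\<dots> = (\<Sum>i\<in>UNIV. \<Sum>k\<in>UNIV. Z $ j $ i * (B $ i $ k * Z $ j $ k))"
      unfolding sum_distrib_right by (subst sum.swap) (simp only: mult.assoc)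
    finally show ?thesis by (simp add: inner_vec_def matrix_vector_mult_def sum_distrib_left)
  qed
  then show ?thesis by (simp add: trace_def)
qed

text \<open>The columns of \<open>X\<close> are the rows of its transpose, and matrices are vectors
  of rows; so independence of the columns makes the law of the transpose a product measure with the
  product of the densities.\<close>

theorem column_law:
  fixes X :: "'a \<Rightarrow> real ^ 'n ^ 'm" and f :: "real ^ 'm \<Rightarrow> ennreal"
  assumes M: "prob_space M"
    and ind: "prob_space.indep_vars M (\<lambda>_. borel) (\<lambda>j \<omega>. column j (X \<omega>)) UNIV"
    and dist: "\<And>j. distributed M lborel (\<lambda>\<omega>. column j (X \<omega>)) f"
    and E: "E \<in> sets borel"
  shows "emeasure M {\<omega> \<in> space M. transpose (X \<omega>) \<in> E} = (\<integral>\<^sup>+Z. (\<Prod>j\<in>UNIV. f (Z $ j)) * indicator E Z \<partial>lborel)"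
proof -
  interpret prob_space M by fact
  let ?P = "\<Pi>\<^sub>M j\<in>(UNIV :: 'n set). (lborel :: (real ^ 'm) measure)" and ?B = "\<Pi>\<^sub>M j\<in>(UNIV :: 'n set). (borel :: (real ^ 'm) measure)"
  let ?X = "\<lambda>\<omega> j. column j (X \<omega>)"
  have fm [measurable]: "f \<in> borel_measurable borel" using distributed_borel_measurable[OF dist] by simp
  have cm: "(\<lambda>\<omega>. column j (X \<omega>)) \<in> borel_measurable M" for j using distributed_measurable[OF dist] by simp
  have cd: "distr M borel (\<lambda>\<omega>. column j (X \<omega>)) = density lborel f" for j
    using distributed_distr_eq_density[OF dist, of j] by (simp add: distr_cong[OF refl sets_lborel refl])
  have s: "sets ?P = sets ?B" by (intro sets_PiM_cong) auto
  have vm: "(\<lambda>z. \<chi> j. z j) \<in> ?B \<rightarrow>\<^sub>M (borel :: (real ^ 'm ^ 'n) measure)"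
    using vec_lambda_measurable[where 'm = 'n and 'v = "real ^ 'm"] by (simp only: measurable_cong_sets[OF s refl])
  have Xm: "?X \<in> M \<rightarrow>\<^sub>M ?B"
    by (rule measurable_PiM_single') (use cm in auto)
  have sf: "sigma_finite_measure (density lborel f)"
    unfolding cd[of undefined, symmetric] by (intro prob_space_imp_sigma_finite prob_space_distr cm)
  have "distr M ?B (\<lambda>\<omega>. \<lambda>j\<in>UNIV. column j (X \<omega>)) = (\<Pi>\<^sub>M j\<in>UNIV. distr M borel (\<lambda>\<omega>. column j (X \<omega>)))"
    using ind by (subst (asm) indep_vars_iff_distr_eq_PiM) (auto intro: cm)
  then have law: "distr M ?B ?X = density ?P (\<lambda>z. \<Prod>j\<in>UNIV. f (z j))"
    unfolding cd by (subst (asm) PiM_density) (auto simp: sf restrict_def intro: lborel.sigma_finite_measure_axioms)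
  define F where "F = {z \<in> space ?B. (\<chi> j. z j) \<in> E}"
  have F: "F \<in> sets ?B" using measurable_sets[OF vm E] by (simp add: F_def vimage_def Int_def conj_commute)
  have "{\<omega> \<in> space M. transpose (X \<omega>) \<in> E} = ?X -` F \<inter> space M"
  proof -
    have "(\<chi> j. column j (X \<omega>)) = transpose (X \<omega>)" for \<omega> by (simp add: column_def transpose_def vec_eq_iff)
    then show ?thesis by (auto simp: F_def space_PiM)
  qed
  then have "emeasure M {\<omega> \<in> space M. transpose (X \<omega>) \<in> E} = emeasure (distr M ?B ?X) F"
    by (simp add: emeasure_distr[OF Xm F])
  also have "\<dots> = (\<integral>\<^sup>+z. (\<Prod>j\<in>UNIV. f (z j)) * indicator F z \<partial>?P)"
    unfolding law by (rule emeasure_density) (use F s in auto)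
  also have "\<dots> = (\<integral>\<^sup>+z. (\<lambda>Z. (\<Prod>j\<in>UNIV. f (Z $ j)) * indicator E Z) (\<chi> j. z j) \<partial>?P)"
    by (intro nn_integral_cong) (auto simp: F_def indicator_def space_PiM)
  also have "\<dots> = (\<integral>\<^sup>+Z. (\<Prod>j\<in>UNIV. f (Z $ j)) * indicator E Z \<partial>lborel)"
  proof (rule nn_integral_lborel_vec[symmetric])
    have [measurable]: "(\<lambda>Z :: real ^ 'm ^ 'n. Z $ j) \<in> borel_measurable borel" for j
      by (intro borel_measurable_continuous_onI continuous_intros)
    note E [measurable]
    show "(\<lambda>Z. (\<Prod>j\<in>UNIV. f (Z $ j)) * indicator E Z) \<in> borel_measurable borel" by measurable
  qed
  finally show ?thesis .
qed

lemma nn_integral_scaleR: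
  fixes g :: "'a::euclidean_space \<Rightarrow> ennreal"
  assumes c: "c > 0" and g [measurable]: "g \<in> borel_measurable borel"
  shows "(\<integral>\<^sup>+y. g y \<partial>lborel) = ennreal (c ^ DIM('a)) * (\<integral>\<^sup>+y. g (c *\<^sub>R y) \<partial>lborel)"
proof -
  have "(\<integral>\<^sup>+y. g y \<partial>lborel) = (\<integral>\<^sup>+y. g y \<partial>density (distr lborel borel (\<lambda>y. 0 + c *\<^sub>R y)) (\<lambda>_. \<bar>c\<bar> ^ DIM('a)))"
    using c by (subst lborel_affine[of c 0]) auto
  then show ?thesis using c by (simp add: nn_integral_density nn_integral_distr nn_integral_cmult)
qed

lemma matrix_inv_diagonalization:
  fixes U :: "real ^ 'm ^ 'm"
  assumes U: "orthogonal_matrix U" and d: "\<And>i. d i \<noteq> 0"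
  shows "matrix_inv (transpose U ** diagm d ** U) = transpose U ** diagm (\<lambda>i. 1 / d i) ** U"
proof -
  have UU: "transpose U ** U = mat 1" "U ** transpose U = mat 1" using U by (simp_all add: orthogonal_matrix_def)
  have *: "(transpose U ** diagm e ** U) ** (transpose U ** diagm e' ** U) = mat 1" if "\<And>i. e i * e' i = 1" for e e' :: "'m \<Rightarrow> real"
  proof -
    have "(transpose U ** diagm e ** U) ** (transpose U ** diagm e' ** U) = transpose U ** diagm e ** (U ** transpose U) ** diagm e' ** U"
      by (simp only: matrix_mul_assoc)
    also have "\<dots> = transpose U ** (diagm e ** diagm e') ** U" by (simp only: UU matrix_mul_rid matrix_mul_assoc)
    finally show ?thesis by (simp add: diagm_mult that mat_eq_diagm[symmetric] UU)
  qed
  let ?A = "transpose U ** diagm d ** U" and ?B = "transpose U ** diagm (\<lambda>i. 1 / d i) ** U"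
  have AB: "?A ** ?B = mat 1" "?B ** ?A = mat 1" using d by (auto intro!: *)
  then have "\<exists>C. ?A ** C = mat 1 \<and> C ** ?A = mat 1" by blast
  from someI_ex[OF this] have "matrix_inv ?A ** ?A = mat 1" unfolding matrix_inv_def by blast
  then have "matrix_inv ?A ** (?A ** ?B) = ?B" by (simp add: matrix_mul_assoc)
  then show ?thesis by (simp add: AB)
qed

theorem theorem2:
  fixes M :: "'a measure"
    and \<Sigma> :: "real ^ 'm ^ 'm"
    and W :: "'a \<Rightarrow> real ^ 'm ^ 'm"
    and x :: real
  assumes "CARD('n::finite) < CARD('m)"
    and "positive_definite \<Sigma>"
    and "prob_space M"
    and "wishart M TYPE('n) \<Sigma> W"
    and "x > 0"
  shows "measure M {\<omega> \<in> space M. largest_eigenvalue (W \<omega>) < x} =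
    multivariate_Gamma CARD('n) ((real CARD('n) + 1) / 2) *
      (x / 2) powr (real CARD('n) * real CARD('m) / 2) /
    (multivariate_Gamma CARD('n) ((real CARD('n) + real CARD('m) + 1) / 2) *
      det \<Sigma> powr (real CARD('n) / 2)) *
    hypergeom_1F1 (real CARD('m) / 2) ((real CARD('n) + real CARD('m) + 1) / 2)
      (- (x / 2) *\<^sub>R matrix_inv \<Sigma>) (mat 1 :: real ^ 'n ^ 'n)"
proof -
  let ?n = "CARD('n)" and ?m = "CARD('m)" and ?\<mu> = "conM :: (real ^ 'm ^ 'n) measure"
  define c where "c = (real ?n + real ?m + 1) / 2"
  define V where "V = multivariate_Gamma ?n ((real ?n + 1) / 2) / multivariate_Gamma ?n c"
  define B where "B = matrix_inv \<Sigma>"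
  have x: "x > 0" and nm: "?n \<le> ?m" using assms by simp_all
  obtain X :: "'a \<Rightarrow> real ^ 'n ^ 'm" where X: "prob_space.indep_vars M (\<lambda>_. borel) (\<lambda>j \<omega>. column j (X \<omega>)) UNIV"
      "\<And>j. distributed M lborel (\<lambda>\<omega>. column j (X \<omega>)) (\<lambda>v. ennreal (mvn_density 0 \<Sigma> v))"
      "\<And>\<omega>. \<omega> \<in> space M \<Longrightarrow> W \<omega> = X \<omega> ** transpose (X \<omega>)"
    using \<open>wishart M TYPE('n) \<Sigma> W\<close> unfolding wishart_def by blast
  obtain U d where U: "orthogonal_matrix U" "\<Sigma> = transpose U ** diagm d ** U" "\<And>i. d i > 0"
    using positive_definite_diagonalization[OF \<open>positive_definite \<Sigma>\<close>] by blast
  \<comment> \<open>The eigenvalues of \<open>(x / 2) *\<^sub>R B\<close>. They are nonnegative, as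
    \<open>integral_conM_trace_power\<close> requires; the minus sign is restored termwise.\<close>
  define a where "a l = x / 2 / d (ix l)" for l
  have a: "a l \<ge> 0" for l using x U(3)[of "ix l"] by (simp add: a_def)
  have "d i \<noteq> 0" for i using U(3)[of i] by simp
  then have Bd: "B = transpose U ** diagm (\<lambda>i. 1 / d i) ** U" unfolding B_def U(2) by (rule matrix_inv_diagonalization[OF U(1)])
  have scale_B: "s *\<^sub>R B = transpose U ** diagm (\<lambda>i. s / d i) ** U" for s
  proof -
    have "diagm (\<lambda>i. s / d i) = s *\<^sub>R diagm (\<lambda>i. 1 / d i)" by (simp add: diagm_def vec_eq_iff)
    then show ?thesis by (simp add: Bd scalar_matrix_assoc matrix_scalar_ac)
  qed
  have det: "det \<Sigma> > 0" by (rule positive_definite_det) fact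

  \<comment> \<open>The event in terms of \<open>Z = transpose (X \<omega>)\<close>, for which
    \<open>transpose Z ** Z\<close> is \<open>W \<omega>\<close>.\<close>
  define E where "E = {Z :: real ^ 'm ^ 'n. largest_eigenvalue (transpose Z ** Z) < x}"
  have [measurable]: "E \<in> sets borel"
  proof -
    have "continuous_on UNIV (\<lambda>Z :: real ^ 'm ^ 'n. mat x - transpose Z ** Z)"
      unfolding matrix_matrix_mult_def transpose_def by (intro continuous_intros)
    moreover have "E = {Z. positive_definite (mat x - transpose Z ** Z)}"
      unfolding E_def by (subst largest_eigenvalue_less_iff) (simp_all only: matrix_transpose_mul transpose_transpose)
    ultimately show ?thesis using measurable_sets[OF borel_measurable_continuous_onI positive_definite_borel]
      by (simp add: vimage_def)
  qed
  define c0 where "c0 = (1 / sqrt ((2 * pi) ^ ?m * det \<Sigma>)) ^ ?n"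
  have c0: "c0 \<ge> 0" using det by (simp add: c0_def)
  have dens: "(\<Prod>j\<in>UNIV. ennreal (mvn_density 0 \<Sigma> (Z $ j))) = ennreal (c0 * exp (- trace (Z ** B ** transpose Z) / 2))" for Z :: "real ^ 'm ^ 'n"
  proof -
    have "(\<Prod>j\<in>UNIV. mvn_density 0 \<Sigma> (Z $ j)) = c0 * (\<Prod>j\<in>UNIV. exp (- ((Z $ j) \<bullet> (B *v (Z $ j))) / 2))"
      by (simp add: mvn_density_def B_def c0_def prod_dividef power_one_over)
    also have "(\<Prod>j\<in>UNIV. exp (- ((Z $ j) \<bullet> (B *v (Z $ j))) / 2)) = exp (- trace (Z ** B ** transpose Z) / 2)"
      unfolding trace_sandwich_rows by (simp add: exp_sum[symmetric] sum_negf sum_divide_distrib)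
    finally show ?thesis using det by (subst prod_ennreal) (auto simp: mvn_density_def)
  qed
  have tm [measurable]: "(\<lambda>Z :: real ^ 'm ^ 'n. trace (Z ** C ** transpose Z)) \<in> borel_measurable borel" for C
    by (intro pg_measurable pg_trace pg_matrix_mult pg_transpose pg_entry pg_const)
  define J where "J = (\<integral>Z. exp (- trace (Z ** ((x / 2) *\<^sub>R B) ** transpose Z)) \<partial>?\<mu>)"
  have "{\<omega> \<in> space M. largest_eigenvalue (W \<omega>) < x} = {\<omega> \<in> space M. transpose (X \<omega>) \<in> E}"
    by (auto simp: E_def X(3))
  then have "emeasure M {\<omega> \<in> space M. largest_eigenvalue (W \<omega>) < x}
    = (\<integral>\<^sup>+Z. (\<Prod>j\<in>UNIV. ennreal (mvn_density 0 \<Sigma> (Z $ j))) * indicator E Z \<partial>(lborel :: (real ^ 'm ^ 'n) measure))"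
    using column_law[OF \<open>prob_space M\<close> X(1,2), of E] by simp
  also have "\<dots> = (\<integral>\<^sup>+Z. ennreal (c0 * exp (- trace (Z ** B ** transpose Z) / 2)) * indicator E Z \<partial>(lborel :: (real ^ 'm ^ 'n) measure))"
    unfolding dens ..
  \<comment> \<open>The scaling by \<open>sqrt x\<close> turns the event into the set of
    contractions; its Jacobian is \<open>x\<close> to the power \<open>n m / 2\<close>.\<close>
  also have "\<dots> = ennreal (sqrt x ^ (?n * ?m)) *
      (\<integral>\<^sup>+Z. ennreal (c0 * exp (- trace ((sqrt x *\<^sub>R Z) ** B ** transpose (sqrt x *\<^sub>R Z)) / 2)) * indicator E (sqrt x *\<^sub>R Z) \<partial>(lborel :: (real ^ 'm ^ 'n) measure))"
    using x by (subst nn_integral_scaleR[of "sqrt x"]) auto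
  also have "(\<lambda>Z :: real ^ 'm ^ 'n. ennreal (c0 * exp (- trace ((sqrt x *\<^sub>R Z) ** B ** transpose (sqrt x *\<^sub>R Z)) / 2)) * indicator E (sqrt x *\<^sub>R Z))
      = (\<lambda>Z. ennreal c0 * (indicator contractions Z * ennreal (exp (- trace (Z ** ((x / 2) *\<^sub>R B) ** transpose Z)))))"
  proof
    fix Z :: "real ^ 'm ^ 'n"
    have "trace ((sqrt x *\<^sub>R Z) ** B ** transpose (sqrt x *\<^sub>R Z)) = x * trace (Z ** B ** transpose Z)"
      unfolding trace_sandwich_rows sum_distrib_left
    proof (intro sum.cong refl)
      fix j
      have "(sqrt x *\<^sub>R Z) $ j \<bullet> (B *v (sqrt x *\<^sub>R Z) $ j) = (sqrt x * sqrt x) * (Z $ j \<bullet> (B *v Z $ j))"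
        by (simp only: vector_scaleR_component matrix_vector_mult_scaleR inner_scaleR_left inner_scaleR_right mult.assoc)
      then show "(sqrt x *\<^sub>R Z) $ j \<bullet> (B *v (sqrt x *\<^sub>R Z) $ j) = x * (Z $ j \<bullet> (B *v Z $ j))" using x by simp
    qed
    moreover have "trace (Z ** ((x / 2) *\<^sub>R B) ** transpose Z) = x / 2 * trace (Z ** B ** transpose Z)"
      unfolding trace_sandwich_rows sum_distrib_left by (simp add: scaleR_matrix_vector_assoc[symmetric])
    ultimately have e: "- trace ((sqrt x *\<^sub>R Z) ** B ** transpose (sqrt x *\<^sub>R Z)) / 2 = - trace (Z ** ((x / 2) *\<^sub>R B) ** transpose Z)"
      by simp
    have "indicator E (sqrt x *\<^sub>R Z) = (indicator contractions Z :: ennreal)"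
      using scaled_contraction_iff[OF x, of Z] by (simp add: E_def indicator_def)
    then show "ennreal (c0 * exp (- trace ((sqrt x *\<^sub>R Z) ** B ** transpose (sqrt x *\<^sub>R Z)) / 2)) * indicator E (sqrt x *\<^sub>R Z)
        = ennreal c0 * (indicator contractions Z * ennreal (exp (- trace (Z ** ((x / 2) *\<^sub>R B) ** transpose Z))))"
      unfolding e using c0 by (simp add: ennreal_mult' mult_ac)
  qed
  also have "(\<integral>\<^sup>+Z. ennreal c0 * (indicator contractions Z * ennreal (exp (- trace (Z ** ((x / 2) *\<^sub>R B) ** transpose Z)))) \<partial>(lborel :: (real ^ 'm ^ 'n) measure))
      = ennreal c0 * (\<integral>\<^sup>+Z. ennreal (exp (- trace (Z ** ((x / 2) *\<^sub>R B) ** transpose Z))) \<partial>?\<mu>)"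
    unfolding conM_def by (subst nn_integral_cmult, measurable) (subst nn_integral_density, auto)
  finally have em: "emeasure M {\<omega> \<in> space M. largest_eigenvalue (W \<omega>) < x} = ennreal (sqrt x ^ (?n * ?m)) *
      (ennreal c0 * (\<integral>\<^sup>+Z. ennreal (exp (- trace (Z ** ((x / 2) *\<^sub>R B) ** transpose Z))) \<partial>?\<mu>))" .
  have "J = enn2real (\<integral>\<^sup>+Z. ennreal (exp (- trace (Z ** ((x / 2) *\<^sub>R B) ** transpose Z))) \<partial>?\<mu>)"
    unfolding J_def by (rule integral_eq_nn_integral) auto
  then have P: "measure M {\<omega> \<in> space M. largest_eigenvalue (W \<omega>) < x} = sqrt x ^ (?n * ?m) * (c0 * J)"
    unfolding measure_def em using x c0 by (simp add: enn2real_mult)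
  have JV: "J = V * pi powr (real ?n * real ?m / 2) * hypergeom_1F1 (real ?m / 2) c (- (x / 2) *\<^sub>R B) (mat 1 :: real ^ 'n ^ 'n)"
  proof -
    have aB: "(x / 2) *\<^sub>R B = transpose U ** dg a ** U" unfolding scale_B by (simp add: a_def)
    have s\<mu>: "(\<lambda>Z :: real ^ 'm ^ 'n. Z ** transpose U) \<in> ?\<mu> \<rightarrow>\<^sub>M borel"
      using linear_borel_measurable[OF linear_right_mult] by (simp add: measurable_cong_sets[OF sets_conM refl])
    \<comment> \<open>Right invariance of \<open>conM\<close> removes the orthogonal factor of
      \<open>B\<close> and leaves the diagonal case.\<close>
    have "J = (\<integral>Z. exp (- trace ((Z ** transpose U) ** dg a ** transpose (Z ** transpose U))) \<partial>?\<mu>)"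
      unfolding J_def aB by (simp add: matrix_transpose_mul matrix_mul_assoc)
    also have "\<dots> = (\<integral>Z. exp (- trace (Z ** dg a ** transpose Z)) \<partial>distr ?\<mu> borel (\<lambda>Z. Z ** transpose U))"
      by (rule integral_distr[symmetric, OF s\<mu>]) measurable
    also have "distr ?\<mu> borel (\<lambda>Z. Z ** transpose U) = ?\<mu>" using U(1) by (intro conM_right) simp
    finally have J: "J = (\<integral>Z. exp (- trace (Z ** dg a ** transpose Z)) \<partial>?\<mu>)" .
    define h where "h k = (\<Sum>\<kappa>\<in>partitions ?n k. gen_pochhammer (real ?m / 2) \<kappa> / gen_pochhammer c \<kappa> *
        (zonal \<kappa> (- (x / 2) *\<^sub>R B) * zonal \<kappa> (mat 1 :: real ^ 'n ^ 'n) / (fact k * zonal \<kappa> (mat 1 :: real ^ 'm ^ 'm))))" for k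
    \<comment> \<open>The constants \<open>gam\<close> for \<open>'m\<close> cancel between the
      zonal polynomials of the argument and of the identity, while the one for \<open>'n\<close>
      belongs to the zonal polynomial of the identity of that size.\<close>
    have summand: "(- 1) ^ k / fact k * (\<integral>Z. trace (Z ** dg a ** transpose Z) ^ k \<partial>?\<mu>) = V * pi powr (real ?n * real ?m / 2) * h k" for k
      unfolding integral_conM_trace_power[where a = a, OF nm a] h_def partitions_eq_parts sum_distrib_left
    proof (rule sum.cong[OF refl])
      fix \<kappa> assume \<kappa>: "\<kappa> \<in> parts ?n k"
      have \<kappa>m: "\<kappa> \<in> parts ?m k" using parts_mono[OF nm \<kappa>] .
      have "zonal \<kappa> (- (x / 2) *\<^sub>R B) = gam TYPE('m) \<kappa> * sph TYPE('m) \<kappa> (\<lambda>l. - (x / 2) / d (ix l))"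
        by (rule zonal_symmetric[OF U(1) scale_B \<kappa>m])
      also have "(\<lambda>l. - (x / 2) / d (ix l)) = (\<lambda>l. - a l)" by (simp add: a_def)
      finally have z: "zonal \<kappa> (- (x / 2) *\<^sub>R B) = gam TYPE('m) \<kappa> * ((- 1) ^ k * sph TYPE('m) \<kappa> a)"
        unfolding sph_minus[OF \<kappa>m] .
      have z1: "zonal \<kappa> (mat 1 :: real ^ 'm ^ 'm) = gam TYPE('m) \<kappa> * sph TYPE('m) \<kappa> (\<lambda>_. 1)"
        by (rule zonal_symmetric[OF orthogonal_matrix_id _ \<kappa>m]) (simp add: mat_eq_diagm[symmetric])
      have z2: "zonal \<kappa> (mat 1 :: real ^ 'n ^ 'n) = gam TYPE('n) \<kappa> * sph TYPE('n) \<kappa> (\<lambda>_. 1)"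
        by (rule zonal_symmetric[OF orthogonal_matrix_id _ \<kappa>]) (simp add: mat_eq_diagm[symmetric])
      have p: "(\<Prod>i<?n. vol_rho ?m i (?n - Suc i) (lookup \<kappa> i))
        = V * pi powr (real ?n * real ?m / 2) * (gen_pochhammer (real ?m / 2) \<kappa> / gen_pochhammer c \<kappa>)"
        unfolding prod_vol_rho[OF nm \<kappa>] V_def c_def by simp
      show "(- 1) ^ k / fact k * (gam TYPE('n) \<kappa> * sph TYPE('n) \<kappa> (\<lambda>_. 1) *
          (\<Prod>i<?n. vol_rho ?m i (?n - Suc i) (lookup \<kappa> i)) * sph TYPE('m) \<kappa> a / sph TYPE('m) \<kappa> (\<lambda>_. 1))
        = V * pi powr (real ?n * real ?m / 2) * (gen_pochhammer (real ?m / 2) \<kappa> / gen_pochhammer c \<kappa> *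
          (zonal \<kappa> (- (x / 2) *\<^sub>R B) * zonal \<kappa> (mat 1 :: real ^ 'n ^ 'n) / (fact k * zonal \<kappa> (mat 1 :: real ^ 'm ^ 'm))))"
        unfolding z z1 z2 p using gam_nonzero[OF \<kappa>m] by (simp add: mult_ac)
    qed
    have sums: "(\<lambda>k. V * pi powr (real ?n * real ?m / 2) * h k) sums J"
      unfolding J summand[symmetric] by (rule integral_conM_exp)
    \<comment> \<open>Dividing by this constant yields the convergence of the hypergeometric series
      from that of the termwise integrals.\<close>
    have nz: "V * pi powr (real ?n * real ?m / 2) \<noteq> 0"
    proof -
      have "multivariate_Gamma ?n b > 0" if "b > (real ?n - 1) / 2" for b :: real
        unfolding multivariate_Gamma_def using that
        by (auto intro!: mult_pos_pos prod_pos Gamma_real_pos simp: field_simps)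
      from this[of "(real ?n + 1) / 2"] this[of c] show ?thesis by (simp add: V_def c_def)
    qed
    have "h sums (J / (V * pi powr (real ?n * real ?m / 2)))"
      using sums_divide[OF sums, of "V * pi powr (real ?n * real ?m / 2)"] nz by simp
    then have "hypergeom_1F1 (real ?m / 2) c (- (x / 2) *\<^sub>R B) (mat 1 :: real ^ 'n ^ 'n) = J / (V * pi powr (real ?n * real ?m / 2))"
      unfolding hypergeom_1F1_def h_def[symmetric] by (rule sums_unique[symmetric])
    then show ?thesis using nz by simp
  qed
  \<comment> \<open>The densities contribute \<open>2 * pi\<close> to the power
    \<open>- n m / 2\<close> and the rows of the contraction \<open>pi\<close> to the power
    \<open>n m / 2\<close>; what remains is the \<open>2\<close> in \<open>x / 2\<close>.\<close>
  have const: "sqrt x ^ (?n * ?m) * c0 * pi powr (real ?n * real ?m / 2) = (x / 2) powr (real ?n * real ?m / 2) / det \<Sigma> powr (real ?n / 2)"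
  proof -
    define e where "e = real ?n * real ?m / 2"
    have sq: "sqrt t ^ k = t powr (real k / 2)" if "t > 0" for t k
      using that by (simp add: powr_half_sqrt[symmetric] powr_powr powr_realpow[symmetric])
    have x1: "sqrt x ^ (?n * ?m) = x powr e" using sq[OF x, of "?n * ?m"] by (simp add: e_def)
    have "sqrt ((2 * pi) ^ ?m * det \<Sigma>) ^ ?n = ((2 * pi) ^ ?m * det \<Sigma>) powr (real ?n / 2)"
      using det by (intro sq) simp
    also have "\<dots> = ((2 * pi) ^ ?m) powr (real ?n / 2) * det \<Sigma> powr (real ?n / 2)"
      by (rule powr_mult)
    also have "((2 * pi) ^ ?m) powr (real ?n / 2) = (2 * pi) powr e"
      
    proof -
      have "(2 * pi) ^ ?m = (2 * pi) powr real ?m" by (rule powr_realpow[symmetric]) simp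
      then show ?thesis by (simp only: powr_powr e_def mult.commute times_divide_eq_right)
    qed
    also have "(2 * pi) powr e = 2 powr e * pi powr e" by (rule powr_mult)
    finally have "c0 = 1 / (2 powr e * pi powr e * det \<Sigma> powr (real ?n / 2))"
      by (simp add: c0_def power_one_over)
    moreover have "(x / 2) powr e = x powr e / 2 powr e" by (rule powr_divide)
    ultimately show ?thesis unfolding x1 e_def[symmetric] by simp
  qed
  have "measure M {\<omega> \<in> space M. largest_eigenvalue (W \<omega>) < x} = (sqrt x ^ (?n * ?m) * c0 * pi powr (real ?n * real ?m / 2)) *
      (V * hypergeom_1F1 (real ?m / 2) c (- (x / 2) *\<^sub>R B) (mat 1 :: real ^ 'n ^ 'n))"
    unfolding P JV by (simp only: mult_ac)
  then show ?thesis unfolding const V_def c_def B_def by (simp add: mult_ac)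
qed

end
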